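(* The equation $i\psi_t=-\psi_{xx}+\delta(x)|\psi|^2\psi$ on $\mathbb R\times\mathbb R$ (where $\delta$ is the Dirac mass at $x=0$) is globally well-posed in $L^2(\mathbb R)$. Moreover, there is an absolute constant $C>0$ such that every global solution $\psi$ satisfies $$\int_{\mathbb R}|\psi(t,0)|^4\,dt\le C\,\|\psi(0)\|_{L^2}^4,$$ and every solution scatters: there exist $\psi_+,\psi_-\in L^2(\mathbb R)$ such that $$\|\psi(t)-e^{it\partial_x^2}\psi_\pm\|_{L^2(\mathbb R)}\to0\quad\text{as }t\to\pm\infty .$$
   Context: $e^{it\partial_x^2}$ is the free Schrödinger group on $\mathbb R$, i.e. the Fourier multiplier $e^{-it\xi^2}$. $C_x$ denotes the bounded continuous functions $\mathbb R\to\mathbb C$ with the sup norm. For an interval $I\subseteq\mathbb R$, $C_IL^2_x$ denotes bounded continuous functions $I\to L^2(\mathbb R)$ with the sup norm, $L^4_IC_x=L^4(I;C_x)$, and $L^4_{I,\mathrm{loc}}C_x$ denotes functions in $L^4_JC_x$ for every compact subinterval $J\subseteq I$. Solution: $\psi\in C_IL^2_x\cap L^4_{I,\mathrm{loc}}C_x$ is a solution of the equation on $I$ if for some $t_0\in I$ and all $t\in I$, $$\psi(t)=e^{i(t-t_0)\partial_x^2}\psi(t_0)-i\int_{t_0}^te^{i(t-s)\partial_x^2}\bigl[|\psi(s,0)|^2\psi(s,0)\,\delta\bigr]\,ds .$$ Integrals of the form $\int e^{-is\partial_x^2}f(s)\,ds$ with $f$ measure-valued are understood as elements of $L^2(\mathbb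 R)$ by duality: their pairing with $\varphi\in L^2(\mathbb R)$ is $\int\bigl[\int_{\mathbb R}\overline{(e^{is\partial_x^2}\varphi)(x)}\,df(s)(x)\bigr]ds$, using that $e^{is\partial_x^2}\varphi$ is, for a.e. $s$, a continuous function. Since $\psi(t)\in C_x$ for a.e. $t$, the value $\psi(t,0)$ is meaningful for a.e. $t$. Globally well-posed in $L^2(\mathbb R)$ means: for each $\psi_0\in L^2(\mathbb R)$ there is a solution on $I=\mathbb R$ with $\psi(0)=\psi_0$; it is unique; and if $\psi_{n,0}\to\psi_0$ in $L^2(\mathbb R)$, then the corresponding solutions converge to $\psi$ in $C_{[-T,T]}L^2_x\cap L^4_{[-T,T]}C_x$ for every $T<\infty$. *)

theory Defs
  imports "HOL-Probability.Probability"
begin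

section \<open>The Hilbert space of square-integrable functions on the line\<close>

definition square_integrable :: "(real \<Rightarrow> complex) \<Rightarrow> bool" where
  "square_integrable f \<longleftrightarrow>
     f \<in> borel_measurable lborel \<and> integrable lborel (\<lambda>x. (cmod (f x))\<^sup>2)"

definition l2_eq :: "(real \<Rightarrow> complex) \<Rightarrow> (real \<Rightarrow> complex) \<Rightarrow> bool" where
  "l2_eq f g \<longleftrightarrow> square_integrable f \<and> square_integrable g \<and> (AE x in lborel. f x = g x)"

lemma square_integrable_zero: "square_integrable (\<lambda>_. 0)"
  by (simp add: square_integrable_def)

lemma square_integrable_scale:
  assumes "square_integrable f"
  shows "square_integrable (\<lambda>x. c * f x)"
  using assms by (auto simp: square_integrable_def norm_mult power_mult_distrib)

lemma square_integrable_add: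
  assumes f: "square_integrable f" and g: "square_integrable g"
  shows "square_integrable (\<lambda>x. f x + g x)"
proof -
  have bound: "(cmod (a + b))\<^sup>2 \<le> 2 * (cmod a)\<^sup>2 + 2 * (cmod b)\<^sup>2" for a b :: complex
  proof -
    have "(cmod (a + b))\<^sup>2 \<le> (cmod a + cmod b)\<^sup>2"
      by (intro power_mono norm_triangle_ineq) auto
    also have "\<dots> \<le> 2 * (cmod a)\<^sup>2 + 2 * (cmod b)\<^sup>2"
      using sum_squares_bound[of "cmod a" "cmod b"] by (simp add: power2_sum)
    finally show ?thesis .
  qed
  have "integrable lborel (\<lambda>x. (cmod (f x + g x))\<^sup>2)"
    by (rule Bochner_Integration.integrable_bound
          [of _ "\<lambda>x. 2 * (cmod (f x))\<^sup>2 + 2 * (cmod (g x))\<^sup>2"])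
       (use f g in \<open>auto simp: square_integrable_def intro: order_trans[OF bound]\<close>)
  then show ?thesis
    using f g by (auto simp: square_integrable_def)
qed

lemma integrable_mult_cnj:
  assumes f: "square_integrable f" and g: "square_integrable g"
  shows "integrable lborel (\<lambda>x. f x * cnj (g x))"
proof (rule Bochner_Integration.integrable_bound[of _ "\<lambda>x. (cmod (f x))\<^sup>2 + (cmod (g x))\<^sup>2"])
  have meas: "f \<in> borel_measurable borel" "g \<in> borel_measurable borel"
    using f g by (auto simp: square_integrable_def)
  have [measurable]: "cnj \<in> borel_measurable borel"
    by (intro borel_measurable_continuous_onI continuous_intros)
  show "(\<lambda>x. f x * cnj (g x)) \<in> borel_measurable lborel"
    using meas by measurable
  have "cmod a * cmod b \<le> (cmod a)\<^sup>2 + (cmod b)\<^sup>2" for a b :: complex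
  proof -
    have "0 \<le> cmod a * cmod b"
      by simp
    then show ?thesis
      using sum_squares_bound[of "cmod a" "cmod b"] by linarith
  qed
  then show "AE x in lborel. norm (f x * cnj (g x)) \<le> norm ((cmod (f x))\<^sup>2 + (cmod (g x))\<^sup>2)"
    by (simp add: norm_mult)
qed (use f g in \<open>auto simp: square_integrable_def\<close>)

quotient_type l2 = "real \<Rightarrow> complex" / partial: l2_eq
proof (rule part_equivpI)
  show "\<exists>f. l2_eq f f"
    using square_integrable_zero by (auto simp: l2_eq_def)
  show "symp l2_eq"
    by (auto simp: symp_def l2_eq_def elim: eventually_mono)
  show "transp l2_eq"
    by (auto simp: transp_def l2_eq_def)
qed

text \<open>Antilinear in the second argument.\<close>

lift_definition l2_cinner :: "l2 \<Rightarrow> l2 \<Rightarrow> complex" is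
  "\<lambda>f g. LINT x|lborel. f x * cnj (g x)"
proof -
  fix f f' g g' assume "l2_eq f f'" "l2_eq g g'"
  then show "(LINT x|lborel. f x * cnj (g x)) = (LINT x|lborel. f' x * cnj (g' x))"
    by (intro integral_cong_AE) (auto simp: l2_eq_def dest: integrable_mult_cnj)
qed

lift_definition l2_scaleC :: "complex \<Rightarrow> l2 \<Rightarrow> l2" is "\<lambda>c f x. c * f x"
  by (auto simp: l2_eq_def square_integrable_scale)

instantiation l2 :: real_inner
begin

lift_definition zero_l2 :: l2 is "\<lambda>_. 0"
  by (simp add: l2_eq_def square_integrable_zero)

lift_definition plus_l2 :: "l2 \<Rightarrow> l2 \<Rightarrow> l2" is "\<lambda>f g x. f x + g x"
  by (auto simp: l2_eq_def square_integrable_add)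

definition uminus_l2 :: "l2 \<Rightarrow> l2" where
  "uminus_l2 f = l2_scaleC (-1) f"

definition minus_l2 :: "l2 \<Rightarrow> l2 \<Rightarrow> l2" where
  "minus_l2 f g = f + - g"

definition scaleR_l2 :: "real \<Rightarrow> l2 \<Rightarrow> l2" where
  "scaleR_l2 r f = l2_scaleC (complex_of_real r) f"

definition inner_l2 :: "l2 \<Rightarrow> l2 \<Rightarrow> real" where
  "inner_l2 f g = Re (l2_cinner f g)"

lift_definition norm_l2 :: "l2 \<Rightarrow> real" is "\<lambda>f. sqrt (LINT x|lborel. (cmod (f x))\<^sup>2)"
proof -
  fix f g assume "l2_eq f g"
  then have "(LINT x|lborel. (cmod (f x))\<^sup>2) = (LINT x|lborel. (cmod (g x))\<^sup>2)"
    by (intro integral_cong_AE) (auto simp: l2_eq_def square_integrable_def)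
  then show "sqrt (LINT x|lborel. (cmod (f x))\<^sup>2) = sqrt (LINT x|lborel. (cmod (g x))\<^sup>2)"
    by simp
qed

definition sgn_l2 :: "l2 \<Rightarrow> l2" where
  "sgn_l2 f = scaleR (inverse (norm f)) f"

definition dist_l2 :: "l2 \<Rightarrow> l2 \<Rightarrow> real" where
  "dist_l2 f g = norm (f - g)"

definition uniformity_l2 :: "(l2 \<times> l2) filter" where
  "uniformity_l2 = (INF e\<in>{0<..}. principal {(f, g). dist f g < e})"

definition open_l2 :: "l2 set \<Rightarrow> bool" where
  "open_l2 U \<longleftrightarrow> (\<forall>f\<in>U. \<forall>\<^sub>F (f', g) in uniformity. f' = f \<longrightarrow> g \<in> U)"

instance
proof
  fix f g h :: l2 and r s :: real
  note l2_defs = l2_eq_def square_integrable_add square_integrable_zero square_integrable_scale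
  show "f + g + h = f + (g + h)"
    by transfer (auto simp: l2_defs distrib_left distrib_right add.assoc mult.assoc)
  show "f + g = g + f"
    by transfer (auto simp: l2_defs add.commute)
  show "0 + f = f"
    by transfer (auto simp: l2_defs)
  show "- f + f = 0"
    unfolding uminus_l2_def by transfer (auto simp: l2_defs)
  show "f - g = f + - g"
    by (rule minus_l2_def)
  show "r *\<^sub>R (f + g) = r *\<^sub>R f + r *\<^sub>R g"
    unfolding scaleR_l2_def by transfer (auto simp: l2_defs distrib_left distrib_right add.assoc mult.assoc)
  show "(r + s) *\<^sub>R f = r *\<^sub>R f + s *\<^sub>R f"
    unfolding scaleR_l2_def by transfer (auto simp: l2_defs distrib_left distrib_right add.assoc mult.assoc)
  show "r *\<^sub>R s *\<^sub>R f = (r * s) *\<^sub>R f"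
    unfolding scaleR_l2_def by transfer (auto simp: l2_defs distrib_left distrib_right add.assoc mult.assoc)
  show "1 *\<^sub>R f = f"
    unfolding scaleR_l2_def by transfer (auto simp: l2_defs)
  show "dist f g = norm (f - g)"
    by (rule dist_l2_def)
  show "sgn f = scaleR (inverse (norm f)) f"
    by (rule sgn_l2_def)
  show "uniformity = (INF e\<in>{0<..}. principal {(f :: l2, g). dist f g < e})"
    by (rule uniformity_l2_def)
  show "open U \<longleftrightarrow> (\<forall>f\<in>U. \<forall>\<^sub>F (f', g) in uniformity. f' = f \<longrightarrow> g \<in> U)" for U :: "l2 set"
    by (rule open_l2_def)
  have cinner_commute: "l2_cinner f g = cnj (l2_cinner g f)"
    by transfer (simp add: Bochner_Integration.integral_cnj[symmetric] mult.commute
        del: Bochner_Integration.integral_cnj)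
  then show "inner f g = inner g f"
    by (simp add: inner_l2_def)
  have "l2_cinner (f + g) h = l2_cinner f h + l2_cinner g h"
  proof transfer
    fix f g h assume "l2_eq f f" "l2_eq g g" "l2_eq h h"
    then show "(LINT x|lborel. (f x + g x) * cnj (h x)) =
        (LINT x|lborel. f x * cnj (h x)) + (LINT x|lborel. g x * cnj (h x))"
      by (simp add: l2_eq_def distrib_right integrable_mult_cnj)
  qed
  then show "inner (f + g) h = inner f h + inner g h"
    by (simp add: inner_l2_def)
  have "l2_cinner (l2_scaleC c f) g = c * l2_cinner f g" for c
    by transfer (simp add: mult.assoc)
  then show "inner (r *\<^sub>R f) g = r * inner f g"
    by (simp add: inner_l2_def scaleR_l2_def)
  have self: "inner f f = (norm f)\<^sup>2 \<and> 0 \<le> norm f" for f :: l2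
    unfolding inner_l2_def
  proof transfer
    fix f :: "real \<Rightarrow> complex"
    have "(LINT x|lborel. f x * cnj (f x)) = complex_of_real (LINT x|lborel. (cmod (f x))\<^sup>2)"
      unfolding integral_complex_of_real[symmetric]
      by (intro Bochner_Integration.integral_cong) (simp_all only: complex_norm_square)
    then show "Re (LINT x|lborel. f x * cnj (f x)) = (sqrt (LINT x|lborel. (cmod (f x))\<^sup>2))\<^sup>2 \<and>
        0 \<le> sqrt (LINT x|lborel. (cmod (f x))\<^sup>2)"
      by simp
  qed
  show "0 \<le> inner f f"
    by (simp add: self)
  show "norm f = sqrt (inner f f)"
    by (simp add: self)
  have "norm f = 0 \<longleftrightarrow> f = 0"
  proof transfer
    fix f assume "l2_eq f f"
    then show "sqrt (LINT x|lborel. (cmod (f x))\<^sup>2) = 0 \<longleftrightarrow> l2_eq f (\<lambda>_. 0)"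
      using integral_nonneg_eq_0_iff_AE[of lborel "\<lambda>x. (cmod (f x))\<^sup>2"]
      by (auto simp: l2_eq_def square_integrable_def)
  qed
  then show "inner f f = 0 \<longleftrightarrow> f = 0"
    by (simp add: self)
qed

end


section \<open>Fourier transform and free Schroedinger group\<close>

text \<open>The $L^2$ Fourier transform is the limit in the mean of the truncated integrals
  $(2\pi)^{-1/2} \int_{-n}^n e^{-ix\xi} f(x)\,dx$. Only the factor $e^{-ix\xi}$ matters below;
  the constant makes the transform unitary and cancels in a Fourier multiplier.\<close>

definition fourier :: "l2 \<Rightarrow> l2" where
  "fourier f = lim (\<lambda>n::nat. abs_l2 (\<lambda>\<xi>. complex_of_real (1 / sqrt (2 * pi)) *
     (LINT x:{- real n..real n}|lborel. cis (- (x * \<xi>)) * rep_l2 f x)))"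

definition fourier_multiplier :: "(real \<Rightarrow> complex) \<Rightarrow> l2 \<Rightarrow> l2" where
  "fourier_multiplier m f = inv fourier (abs_l2 (\<lambda>\<xi>. m \<xi> * rep_l2 (fourier f) \<xi>))"

definition schroedinger :: "real \<Rightarrow> l2 \<Rightarrow> l2" where
  "schroedinger t = fourier_multiplier (\<lambda>\<xi>. cis (- (t * \<xi>\<^sup>2)))"


section \<open>Function spaces in space-time\<close>

definition represents :: "(real \<Rightarrow>\<^sub>C complex) \<Rightarrow> l2 \<Rightarrow> bool" where
  "represents u f \<longleftrightarrow> (AE x in lborel. rep_l2 f x = apply_bcontfun u x)"

definition in_Cx :: "l2 \<Rightarrow> bool" where
  "in_Cx f \<longleftrightarrow> (\<exists>u. represents u f)"

lemma represents_unique: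
  assumes "represents u f" and "represents v f"
  shows "u = v"
proof (rule bcontfun_eqI)
  let ?S = "{x. apply_bcontfun u x \<noteq> apply_bcontfun v x}"
  have "AE x in lborel. x \<notin> ?S"
    using assms unfolding represents_def by eventually_elim simp
  moreover have "open ?S"
    by (intro open_Collect_neq continuous_on_apply_bcontfun)
  ultimately have "?S \<in> null_sets lborel"
    by (subst AE_iff_null_sets) auto
  then have "negligible ?S"
    by (simp add: negligible_iff_null_sets null_sets_completionI)
  then show "apply_bcontfun u x = apply_bcontfun v x" for x
    using open_not_negligible[OF \<open>open ?S\<close>] by blast
qed

text \<open>The value is arbitrary if \<^term>\<open>f\<close> has no bounded continuous representative. This is
  harmless below, where it can happen only on a null set of times.\<close>

definition Cx_rep :: "l2 \<Rightarrow> (real \<Rightarrow>\<^sub>C complex)" where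
  "Cx_rep f = (THE u. represents u f)"

text \<open>Measurability in the sense of Bochner, for a possibly nonseparable target space.\<close>

definition strongly_measurable :: "'a measure \<Rightarrow> ('a \<Rightarrow> 'b::metric_space) \<Rightarrow> bool" where
  "strongly_measurable M u \<longleftrightarrow>
     (\<exists>s :: nat \<Rightarrow> 'a \<Rightarrow> 'b. (\<forall>n. simple_function M (s n)) \<and>
        (AE t in M. (\<lambda>n. s n t) \<longlonglongrightarrow> u t))"

definition in_CL2 :: "real set \<Rightarrow> (real \<Rightarrow> l2) \<Rightarrow> bool" where
  "in_CL2 I \<psi> \<longleftrightarrow> continuous_on I \<psi> \<and> bounded (\<psi> ` I)"

definition CL2_norm :: "real set \<Rightarrow> (real \<Rightarrow> l2) \<Rightarrow> real" where
  "CL2_norm I \<psi> = (SUP t\<in>I. norm (\<psi> t))"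

definition in_L4Cx :: "real set \<Rightarrow> (real \<Rightarrow> l2) \<Rightarrow> bool" where
  "in_L4Cx J \<psi> \<longleftrightarrow>
     (AE t in lebesgue_on J. in_Cx (\<psi> t)) \<and>
     strongly_measurable (lebesgue_on J) (\<lambda>t. Cx_rep (\<psi> t)) \<and>
     integrable (lebesgue_on J) (\<lambda>t. norm (Cx_rep (\<psi> t)) ^ 4)"

definition L4Cx_norm :: "real set \<Rightarrow> (real \<Rightarrow> l2) \<Rightarrow> real" where
  "L4Cx_norm J \<psi> = root 4 (LINT t|lebesgue_on J. norm (Cx_rep (\<psi> t)) ^ 4)"

definition in_L4Cx_loc :: "real set \<Rightarrow> (real \<Rightarrow> l2) \<Rightarrow> bool" where
  "in_L4Cx_loc I \<psi> \<longleftrightarrow> (\<forall>a b. {a..b} \<subseteq> I \<longrightarrow> in_L4Cx {a..b} \<psi>)"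


section \<open>The equation with concentrated nonlinearity\<close>

definition dirac :: "real measure" where
  "dirac = return borel 0"

text \<open>\<open>F\<close> is the integral $\int_a^b e^{-is\partial_x^2} f(s)\,ds$ (oriented, so $a > b$ is allowed)
  of the measure-valued function $f(s) = c(s)\,\mu$, defined by duality. The continuous
  representative of $e^{is\partial_x^2}\varphi$ is bounded for almost every $s$ by the
  Strichartz estimate, so \<^const>\<open>Cx_rep\<close> gives its values.\<close>

definition has_schroedinger_integral ::
    "real measure \<Rightarrow> (real \<Rightarrow> complex) \<Rightarrow> real \<Rightarrow> real \<Rightarrow> l2 \<Rightarrow> bool" where
  "has_schroedinger_integral \<mu> c a b F \<longleftrightarrow>
     (\<forall>\<phi>. let p = (\<lambda>s. c s * (LINT x|\<mu>. cnj (apply_bcontfun (Cx_rep (schroedinger s \<phi>)) x))) in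
        interval_lebesgue_integrable lebesgue (ereal a) (ereal b) p \<and>
        l2_cinner F \<phi> = interval_lebesgue_integral lebesgue (ereal a) (ereal b) p)"

text \<open>In the Duhamel term, $e^{i(t-s)\partial_x^2} = e^{it\partial_x^2} e^{-is\partial_x^2}$.\<close>

definition solution :: "real set \<Rightarrow> (real \<Rightarrow> l2) \<Rightarrow> bool" where
  "solution I \<psi> \<longleftrightarrow>
     in_CL2 I \<psi> \<and> in_L4Cx_loc I \<psi> \<and>
     (\<exists>t\<^sub>0\<in>I. \<forall>t\<in>I. \<exists>F.
        has_schroedinger_integral dirac
          (\<lambda>s. let z = apply_bcontfun (Cx_rep (\<psi> s)) 0 in complex_of_real ((cmod z)\<^sup>2) * z)
          t\<^sub>0 t F \<and>
        \<psi> t = schroedinger (t - t\<^sub>0) (\<psi> t\<^sub>0) - l2_scaleC \<i> (schroedinger t F))"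

definition globally_well_posed :: bool where
  "globally_well_posed \<longleftrightarrow>
     (\<forall>\<psi>\<^sub>0. \<exists>!\<psi>. solution UNIV \<psi> \<and> \<psi> 0 = \<psi>\<^sub>0) \<and>
     (\<forall>(\<psi>s :: nat \<Rightarrow> real \<Rightarrow> l2) \<psi>.
        (\<forall>n. solution UNIV (\<psi>s n)) \<longrightarrow> solution UNIV \<psi> \<longrightarrow> (\<lambda>n. \<psi>s n 0) \<longlonglongrightarrow> \<psi> 0 \<longrightarrow>
        (\<forall>T>0. (\<lambda>n. CL2_norm {-T..T} (\<lambda>t. \<psi>s n t - \<psi> t)) \<longlonglongrightarrow> 0 \<and>
               (\<lambda>n. L4Cx_norm {-T..T} (\<lambda>t. \<psi>s n t - \<psi> t)) \<longlonglongrightarrow> 0))"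

end

theory Submission
  imports Defs "HOL-Complex_Analysis.Complex_Analysis" "HOL-Real_Asymp.Real_Asymp"
begin

text \<open>
  Let $z(t) = \psi(t,0)$. Evaluated at the origin, Duhamel's formula closes up to a scalar
  equation,
  $$ z(t) + i \int_0^t \kappa(t-s)\, |z(s)|^2 z(s)\, ds = f(t), \qquad
     f(t) = (e^{it\partial_x^2}\psi_0)(0), \quad \kappa(\tau) = (4\pi i\tau)^{-1/2}, $$
  and $z$ determines $\psi$ through $\psi(t) = e^{it\partial_x^2}(\psi_0 - i F(t))$ with
  $F(t) = \int_0^t e^{-is\partial_x^2}[|z|^2 z\,\delta]\,ds$. So the theorem is a statement about this
  Volterra equation in $L^4(\mathbb R)$ (\<open>solution_imp_trace_solution\<close>,
  \<open>trace_solution_imp_solution\<close>).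

  The linear estimates rest on the decay $|\kappa(\tau)| \le |\tau|^{-1/2}$, which holds uniformly
  for the evolved Gaussian kernels at all points of space. By the Hardy--Littlewood--Sobolev
  inequality, convolution with $|\tau|^{-1/2}$ maps $L^{4/3}$ to $L^4$ (\<open>riesz_L4\<close>). The $TT^*$
  argument, applied with a point and a regularisation chosen freely at each time, gives the maximal
  Strichartz estimate $\int \sup_x |e^{it\partial_x^2}\varphi|^4\,dt \le K^4 \|\varphi\|^4$
  (\<open>maximal_strichartz\<close>), and by duality $\|F(t)\| \le K \|c\|_{L^{4/3}}$ for the source
  $c = |z|^2 z$ (\<open>norm_source_le\<close>). Thus $f \in L^4$, and $c \in L^{4/3}$ as soon as $z \in L^4$.

  The nonlinear input is a sign. With $(Vc)(t) = \int_{-\infty}^t \kappa(t-s) c(s)\,ds$, twice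
  $\mathrm{Re} \int \bar c \, i V c$ is the quadratic form of a Hermitian kernel, namely the square
  of the $L^2$ norm of $\int e^{-is\partial_x^2}[c\,\delta]\,ds$, hence nonnegative
  (\<open>volt_positive\<close>). Together with the monotonicity of $z \mapsto |z|^2 z$ this yields,
  for two solutions with data $f$ and $g$,
  $$ \int (|z|^2 + |w|^2)\,|z-w|^2 \le 9 \int (|z|^2 + |w|^2)\,|f-g|^2 $$
  (\<open>volterra_stability\<close>). With $w = g = 0$ it is the bound of $\|z\|_{L^4}$ by
  $\|f\|_{L^4}$, independent of the length of the time interval; with $f = g$ it is uniqueness; and
  in general it gives continuous dependence on the data. Existence on a short interval is a
  contraction argument (\<open>small_data_fixpoint\<close>), and the uniform bound lets local solutions be
  continued for ever (\<open>volterra_global\<close>). Negative times are reduced to positive ones because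
  $t \mapsto \overline{z(-t)}$ solves the same equation. Scattering holds because the tails of
  $z \in L^4(\mathbb R)$ tend to zero, so that $F(t)$ converges as $t \to \pm\infty$.

  Two foundations are established on the way. The Fourier transform on $L^2$ is given as a limit in
  the mean of truncated integrals; that it converges, and is unitary, is derived from the Gaussian
  integral with complex parameter. And a continuous representative of an $L^2$ function is obtained
  as the uniform limit of its Gaussian regularisations, which gives access to pointwise values, to
  measurability in time, and to suprema over space.
\<close>

section \<open>The Gaussian integral with complex parameter\<close>

lemma integrable_gaussian:
  fixes a :: real assumes "a > 0"
  shows "integrable lborel (\<lambda>x. exp (- a * x\<^sup>2))"
proof -
  define s where "s = sqrt (1 / (2 * a))"
  have s: "s > 0" "s\<^sup>2 = 1 / (2 * a)" using assms by (auto simp: s_def)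
  have "integrable lborel (\<lambda>x. sqrt (2 * pi * s\<^sup>2) * normal_density 0 s x)"
    by (intro integrable_mult_right integrable_normal_density s)
  also have "(\<lambda>x. sqrt (2 * pi * s\<^sup>2) * normal_density 0 s x) = (\<lambda>x. exp (- a * x\<^sup>2))"
    using s assms by (auto simp: normal_density_def s(2) fun_eq_iff)
  finally show ?thesis .
qed

text \<open>An entire odd primitive turns the Gaussian integral along any line into a difference of its
  limits at infinity.\<close>

lemma gaussian_primitive:
  obtains \<Phi> :: "complex \<Rightarrow> complex" where
    "\<And>w. (\<Phi> has_field_derivative exp (- w\<^sup>2)) (at w)"
    "\<And>w. \<Phi> (- w) = - \<Phi> w"
    "((\<lambda>r. \<Phi> (complex_of_real r)) \<longlongrightarrow> complex_of_real (sqrt pi / 2)) at_top"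
proof -
  have "(\<lambda>w::complex. exp (- w\<^sup>2)) holomorphic_on UNIV"
    by (intro holomorphic_intros)
  then have hol: "(\<lambda>w::complex. exp (- w\<^sup>2)) holomorphic_on UNIV" .
  obtain g :: "complex \<Rightarrow> complex" where g: "\<And>w. (g has_field_derivative exp (- w\<^sup>2)) (at w)"
    by (rule holomorphic_convex_primitive'[OF convex_UNIV open_UNIV hol], rule that) simp
  define \<Phi> where "\<Phi> w = (g w - g (- w)) / 2" for w
  have d: "(\<Phi> has_field_derivative exp (- w\<^sup>2)) (at w)" for w
    unfolding \<Phi>_def
    by (rule derivative_eq_intros g DERIV_chain2[OF g] refl | simp)+
  have odd: "\<Phi> (- w) = - \<Phi> w" for w
    by (simp add: \<Phi>_def field_simps)
  have dr: "((\<lambda>r. \<Phi> (complex_of_real r)) has_vector_derivative complex_of_real (exp (- x\<^sup>2))) (at x within S)" for x S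
  proof -
    have "((\<Phi> \<circ> of_real) has_vector_derivative 1 * exp (- (complex_of_real x)\<^sup>2)) (at x within S)"
      by (rule field_vector_diff_chain_within)
         (auto intro!: derivative_eq_intros DERIV_subset[OF d] has_vector_derivative_of_real)
    then show ?thesis by (simp add: o_def exp_of_real[symmetric])
  qed
  let ?g = "\<lambda>x::real. indicator {0..} x * exp (- x\<^sup>2)"
  have int: "integrable lborel ?g" "integral\<^sup>L lborel ?g = sqrt pi / 2"
    using gaussian_moment_0 by (auto simp: has_bochner_integral_iff)
  have lim: "((\<lambda>y. LINT x|lborel. indicator {..y} x *\<^sub>R ?g x) \<longlongrightarrow> sqrt pi / 2) at_top"
    using tendsto_integral_at_top[of lborel ?g] int by simp
  have "((\<lambda>r. \<Phi> (complex_of_real r)) \<longlongrightarrow> complex_of_real (sqrt pi / 2)) at_top"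
  proof (rule Lim_transform_eventually)
    show "((\<lambda>y. complex_of_real (LINT x|lborel. indicator {..y} x *\<^sub>R ?g x)) \<longlongrightarrow> complex_of_real (sqrt pi / 2)) at_top"
      by (intro tendsto_of_real lim)
    have *: "complex_of_real (LINT x|lborel. indicator {..y} x *\<^sub>R ?g x) = \<Phi> (of_real y)" if "y \<ge> 0" for y
    proof -
      have "(LBINT x. indicator {0..y} x *\<^sub>R complex_of_real (exp (- x\<^sup>2))) = \<Phi> (of_real y) - \<Phi> (of_real 0)"
        by (rule integral_FTC_Icc[OF that dr]) (auto intro!: continuous_intros)
      moreover have "\<Phi> 0 = 0" using odd[of 0] by simp
      moreover have "(\<lambda>x. indicator {0..y} x *\<^sub>R complex_of_real (exp (- x\<^sup>2))) = (\<lambda>x. complex_of_real (indicator {..y} x *\<^sub>R ?g x))"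
        by (auto simp: fun_eq_iff indicator_def)
      ultimately show ?thesis by (simp only: integral_complex_of_real) simp
    qed
    show "\<forall>\<^sub>F y in at_top. complex_of_real (LINT x|lborel. indicator {..y} x *\<^sub>R ?g x) = \<Phi> (of_real y)"
      using eventually_ge_at_top[of 0] by eventually_elim (rule *)
  qed
  then show ?thesis using that d odd by blast
qed

text \<open>The primitive has the same limit along a slanted, shifted ray as along the positive real axis,
  as long as the ray stays in the sector in which $e^{-w^2}$ decays: the vertical segments that
  join the two have length $O(R)$, and the integrand on them is exponentially small.\<close>

lemma gaussian_tail_limit:
  fixes \<Phi> :: "complex \<Rightarrow> complex" and s b :: complex
  assumes d: "\<And>w. (\<Phi> has_field_derivative exp (- w\<^sup>2)) (at w)"
    and l: "((\<lambda>r. \<Phi> (complex_of_real r)) \<longlongrightarrow> L) at_top"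
    and s: "Re s > 0" "\<bar>Im s\<bar> < Re s"
  shows "((\<lambda>R. \<Phi> (s * complex_of_real R - b)) \<longlongrightarrow> L) at_top"
proof -
  define \<delta> where "\<delta> = (Re s)\<^sup>2 - (Im s)\<^sup>2"
  have \<delta>: "\<delta> > 0" using s abs_le_square_iff[of "Re s" "Im s"] unfolding \<delta>_def
    by linarith
  define m where "m = 2 * Re s * Re b - 2 * Im s * Im b"
  define k where "k = (Im b)\<^sup>2 - (Re b)\<^sup>2"
  define A where "A = Re s"
  define B where "B = \<bar>Im b\<bar>"
  have dec: "((\<lambda>R. (A * R + B) * exp (- \<delta> * R\<^sup>2 + m * R + k)) \<longlongrightarrow> 0) at_top"
    using \<delta> by real_asymp
  have diff: "norm (\<Phi> (s * of_real R - b) - \<Phi> (of_real (Re (s * of_real R - b)))) \<le>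
      (A * R + B) * exp (- \<delta> * R\<^sup>2 + m * R + k)" if "R \<ge> 0" for R
  proof -
    define u where "u = Re (s * of_real R - b)"
    define v where "v = Im (s * of_real R - b)"
    have w: "s * of_real R - b = Complex u v" by (simp add: u_def v_def complex_eq_iff)
    have "norm (\<Phi> (Complex u v) - \<Phi> (of_real u)) \<le> exp (v\<^sup>2 - u\<^sup>2) * norm (Complex u v - of_real u)"
    proof (rule field_differentiable_bound[where S="closed_segment (of_real u) (Complex u v)"])
      fix z assume "z \<in> closed_segment (complex_of_real u) (Complex u v)"
      then obtain r where r: "0 \<le> r" "r \<le> 1" "z = (1 - r) *\<^sub>R of_real u + r *\<^sub>R Complex u v"
        by (auto simp: in_segment)
      have z: "Re z = u" "Im z = r * v" unfolding r(3) by (auto simp: algebra_simps)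
      show "(\<Phi> has_field_derivative exp (- z\<^sup>2)) (at z within closed_segment (of_real u) (Complex u v))"
        using d DERIV_subset by blast
      have "(r * v)\<^sup>2 \<le> 1 * v\<^sup>2" unfolding power_mult_distrib
        using r by (intro mult_right_mono) (auto simp: power_le_one)
      then show "norm (exp (- z\<^sup>2)) \<le> exp (v\<^sup>2 - u\<^sup>2)"
        by (simp add: z power2_eq_square)
    qed auto
    also have "norm (Complex u v - of_real u) = \<bar>v\<bar>"
      by (simp add: cmod_def)
    also have "exp (v\<^sup>2 - u\<^sup>2) * \<bar>v\<bar> = \<bar>v\<bar> * exp (- \<delta> * R\<^sup>2 + m * R + k)"
      by (simp add: u_def v_def \<delta>_def m_def k_def power2_eq_square algebra_simps)
    also have "\<dots> \<le> (A * R + B) * exp (- \<delta> * R\<^sup>2 + m * R + k)"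
    proof (intro mult_right_mono)
      have "\<bar>v\<bar> \<le> \<bar>Im s * R\<bar> + \<bar>Im b\<bar>" by (simp add: v_def)
      also have "\<bar>Im s * R\<bar> \<le> Re s * R" using s that by (simp add: abs_mult mult_right_mono)
      finally show "\<bar>v\<bar> \<le> A * R + B" by (simp add: A_def B_def)
    qed auto
    finally show ?thesis by (simp add: w)
  qed
  have "((\<lambda>R. \<Phi> (s * of_real R - b) - \<Phi> (of_real (Re (s * of_real R - b)))) \<longlongrightarrow> 0) at_top"
    by (rule Lim_null_comparison[OF _ dec], rule eventually_mono[OF eventually_ge_at_top[of 0]], rule diff)
  moreover have "((\<lambda>R. \<Phi> (of_real (Re (s * of_real R - b)))) \<longlongrightarrow> L) at_top"
  proof (rule filterlim_compose[OF l])
    show "filterlim (\<lambda>R. Re (s * complex_of_real R - b)) at_top at_top"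
      using s(1) by simp real_asymp
  qed
  ultimately show ?thesis
    using tendsto_add by fastforce
qed

text \<open>The Fourier transform of $\xi \mapsto e^{-z\xi^2}$, without normalisation. For $z = \varepsilon
  + it$ it is, up to $2\pi$, the kernel of $e^{(\varepsilon + it)\,\partial_x^2}$; the principal
  root is the branch that continues $\sqrt z$ from the positive axis.\<close>

definition gauss_kernel :: "complex \<Rightarrow> real \<Rightarrow> complex" where
  "gauss_kernel z x = complex_of_real (sqrt pi) / csqrt z * exp (- (complex_of_real x)\<^sup>2 / (4 * z))"

text \<open>The square root maps the right half plane into the sector of half-angle $\pi/4$, which is where
  $e^{-w^2}$ decays.\<close>

lemma csqrt_cone:
  assumes "Re z > 0"
  shows "Re (csqrt z) > 0" "\<bar>Im (csqrt z)\<bar> < Re (csqrt z)"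
proof -
  let ?s = "csqrt z"
  have "z = ?s\<^sup>2" by simp
  then have "Re z = (Re ?s)\<^sup>2 - (Im ?s)\<^sup>2" by (metis Re_power2)
  then have "\<bar>Im ?s\<bar> < \<bar>Re ?s\<bar>" using assms abs_le_square_iff[of "Re ?s" "Im ?s"] by linarith
  moreover have "Re ?s \<ge> 0" using csqrt_principal[of z] by auto
  ultimately show "Re ?s > 0" "\<bar>Im ?s\<bar> < Re ?s" by linarith+
qed

lemma gaussian_fourier:
  fixes z :: complex and x :: real
  assumes z: "Re z > 0"
  shows "integrable lborel (\<lambda>\<xi>. exp (\<i> * of_real (x * \<xi>) - z * (complex_of_real \<xi>)\<^sup>2))"
    and "(LINT \<xi>|lborel. exp (\<i> * of_real (x * \<xi>) - z * (complex_of_real \<xi>)\<^sup>2)) = gauss_kernel z x"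
proof -
  let ?f = "\<lambda>\<xi>. exp (\<i> * of_real (x * \<xi>) - z * (complex_of_real \<xi>)\<^sup>2)"
  have nf: "norm (?f \<xi>) = exp (- Re z * \<xi>\<^sup>2)" for \<xi>
    by (simp add: power2_eq_square)
  show int: "integrable lborel ?f"
  proof (rule Bochner_Integration.integrable_bound[OF integrable_gaussian[OF z]])
    show "?f \<in> borel_measurable lborel"
      by measurable
  qed (simp add: nf)
  obtain \<Phi> :: "complex \<Rightarrow> complex" where
    d: "\<And>w. (\<Phi> has_field_derivative exp (- w\<^sup>2)) (at w)"
    and odd: "\<And>w. \<Phi> (- w) = - \<Phi> w"
    and l: "((\<lambda>r. \<Phi> (complex_of_real r)) \<longlongrightarrow> complex_of_real (sqrt pi / 2)) at_top"
    by (rule gaussian_primitive, rule that)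
  define s where "s = csqrt z"
  have s: "Re s > 0" "\<bar>Im s\<bar> < Re s" "s\<^sup>2 = z" "s \<noteq> 0"
    using csqrt_cone[OF z] by (auto simp: s_def)
  \<comment> \<open>Completing the square: $i x\xi - s^2\xi^2 = b^2 - (s\xi - b)^2$.\<close>
  define b where "b = \<i> * of_real x / (2 * s)"
  have b2: "b\<^sup>2 = - (of_real x)\<^sup>2 / (4 * z)"
    by (simp add: b_def power_divide power_mult_distrib s)
  have sb: "2 * s * b = \<i> * of_real x" using s by (simp add: b_def)
  define F where "F \<xi> = exp (b\<^sup>2) / s * \<Phi> (s * complex_of_real \<xi> - b)" for \<xi>
  have dF: "(F has_vector_derivative ?f \<xi>) (at \<xi>)" for \<xi>
  proof -
    have "((\<lambda>w. exp (b\<^sup>2) / s * \<Phi> (s * w - b)) has_field_derivative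
        exp (b\<^sup>2) / s * (exp (- (s * of_real \<xi> - b)\<^sup>2) * s)) (at (of_real \<xi>))"
      by (rule derivative_eq_intros DERIV_chain2[OF d] refl | simp)+
    then have "(F has_vector_derivative (1 * (exp (b\<^sup>2) / s * (exp (- (s * of_real \<xi> - b)\<^sup>2) * s)))) (at \<xi>)"
      unfolding F_def
      by (intro field_vector_diff_chain_at[unfolded o_def, where f=of_real])
         (auto intro!: derivative_eq_intros has_vector_derivative_of_real)
    moreover have "exp (b\<^sup>2) / s * (exp (- (s * of_real \<xi> - b)\<^sup>2) * s) = ?f \<xi>"
    proof -
      have "exp (b\<^sup>2) / s * (exp (- (s * of_real \<xi> - b)\<^sup>2) * s) = exp (b\<^sup>2 - (s * of_real \<xi> - b)\<^sup>2)"
        using s by (simp add: exp_add[symmetric] exp_diff exp_minus field_simps)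
      also have "b\<^sup>2 - (s * of_real \<xi> - b)\<^sup>2 = (2 * s * b) * of_real \<xi> - s\<^sup>2 * (of_real \<xi>)\<^sup>2"
        by (simp add: power2_eq_square algebra_simps)
      finally show ?thesis unfolding sb s(3) by (simp add: mult.assoc)
    qed
    ultimately show ?thesis by simp
  qed
  have "(LBINT \<xi>=-\<infinity>..\<infinity>. ?f \<xi>) = exp (b\<^sup>2) / s * of_real (sqrt pi / 2) - exp (b\<^sup>2) / s * (- of_real (sqrt pi / 2))"
  proof (rule interval_integral_FTC_integrable[where F=F])
    show "((F \<circ> real_of_ereal) \<longlongrightarrow> exp (b\<^sup>2) / s * of_real (sqrt pi / 2)) (at_left \<infinity>)"
      unfolding ereal_tendsto_simps F_def[abs_def]
      by (intro tendsto_intros gaussian_tail_limit[OF d l s(1,2)])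
    have "((\<lambda>R. - \<Phi> (s * of_real R - (- b))) \<longlongrightarrow> - of_real (sqrt pi / 2)) at_top"
      by (intro tendsto_intros gaussian_tail_limit[OF d l s(1,2)])
    then have "((\<lambda>R. \<Phi> (s * of_real (- R) - b)) \<longlongrightarrow> - of_real (sqrt pi / 2)) at_top"
      by (simp add: odd[symmetric])
    then have "((\<lambda>R. \<Phi> (s * of_real R - b)) \<longlongrightarrow> - of_real (sqrt pi / 2)) at_bot"
      by (simp add: filterlim_at_bot_mirror)
    then show "((F \<circ> real_of_ereal) \<longlongrightarrow> exp (b\<^sup>2) / s * (- of_real (sqrt pi / 2))) (at_right (- \<infinity>))"
      unfolding ereal_tendsto_simps F_def[abs_def]
      by (intro tendsto_intros)
    show "set_integrable lborel (einterval (- \<infinity>) \<infinity>) ?f"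
      using int by (simp add: set_integrable_def)
  qed (rule dF | simp | intro continuous_intros)+
  then show "(LINT \<xi>|lborel. ?f \<xi>) = gauss_kernel z x"
    by (simp add: interval_lebesgue_integral_def set_lebesgue_integral_def gauss_kernel_def b2 s_def)
qed

text \<open>The modulus of the Gaussian factor is at most one, so only the dispersive decay remains,
  uniformly in the point of space.\<close>

lemma gauss_kernel_bound:
  assumes "Re z \<ge> 0" "z \<noteq> 0"
  shows "cmod (gauss_kernel z x) \<le> sqrt pi / sqrt (cmod z)"
proof -
  have "- (complex_of_real x)\<^sup>2 / (4 * z) = complex_of_real (- x\<^sup>2 / 4) * inverse z"
    using assms by (simp add: field_simps)
  then have "Re (- (complex_of_real x)\<^sup>2 / (4 * z)) = - x\<^sup>2 / 4 * Re (inverse z)"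
    by (simp only: mult_zero_left diff_0_right Re_complex_of_real Im_complex_of_real times_complex.sel)
  also have "\<dots> \<le> 0"
  proof -
    have "Re (inverse z) \<ge> 0" using assms by (simp add: complex_inverse)
    then show ?thesis by (intro mult_nonpos_nonneg) (auto simp: divide_nonpos_pos)
  qed
  finally have "Re (- (complex_of_real x)\<^sup>2 / (4 * z)) \<le> 0" .
  then have "cmod (exp (- (complex_of_real x)\<^sup>2 / (4 * z))) \<le> 1" by simp
  moreover have "cmod (csqrt z) = sqrt (cmod z)"
    by (metis norm_power power2_csqrt real_sqrt_abs abs_norm_cancel)
  ultimately show ?thesis
    by (simp add: gauss_kernel_def norm_mult norm_divide divide_right_mono mult_left_le)
qed

section \<open>Convolution with the inverse square root\<close>

lemma nn_integral_near:
  assumes "R > 0"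
  shows "(\<integral>\<^sup>+ y. ennreal (indicator {x - R..x + R} y / sqrt \<bar>x - y\<bar>) \<partial>lborel) \<le> ennreal (4 * sqrt R)"
proof -
  have half: "(\<integral>\<^sup>+ u. ennreal (indicator {0..R} u * u powr (-1/2)) \<partial>lborel) = ennreal (2 * sqrt R)"
  proof -
    have h: "((\<lambda>u. u powr (-1/2)) has_integral (R powr (-1/2 + 1) / (-1/2 + 1))) {0..R}"
      by (rule has_integral_powr_from_0) (use assms in auto)
    have "(\<integral>\<^sup>+ u. ennreal (indicator {0..R} u * u powr (-1/2)) \<partial>lborel) = ennreal (R powr (-1/2 + 1) / (-1/2 + 1))"
      by (rule nn_integral_has_integral_lebesgue[OF _ h]) auto
    moreover have "R powr (-1/2 + 1) / (-1/2 + 1) = 2 * sqrt R"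
      using assms by (simp add: powr_half_sqrt)
    ultimately show ?thesis by (simp add: mult.commute)
  qed
  have r: "(\<integral>\<^sup>+ y. ennreal (indicator {0..R} (y - x) * (y - x) powr (-1/2)) \<partial>lborel) = ennreal (2 * sqrt R)"
    using nn_integral_real_affine[of "\<lambda>u. ennreal (indicator {0..R} u * u powr (-1/2))" 1 "-x"] half by simp
  have l: "(\<integral>\<^sup>+ y. ennreal (indicator {0..R} (x - y) * (x - y) powr (-1/2)) \<partial>lborel) = ennreal (2 * sqrt R)"
    using nn_integral_real_affine[of "\<lambda>u. ennreal (indicator {0..R} u * u powr (-1/2))" "-1" x] half by simp
  have "(\<integral>\<^sup>+ y. ennreal (indicator {x - R..x + R} y / sqrt \<bar>x - y\<bar>) \<partial>lborel) \<le>
     (\<integral>\<^sup>+ y. ennreal (indicator {0..R} (y - x) * (y - x) powr (-1/2)) + ennreal (indicator {0..R} (x - y) * (x - y) powr (-1/2)) \<partial>lborel)"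
  proof (rule nn_integral_mono)
    fix y
    have "indicator {x - R..x + R} y / sqrt \<bar>x - y\<bar> \<le> indicator {0..R} (y - x) * (y - x) powr (-1/2) + indicator {0..R} (x - y) * (x - y) powr (-1/2)"
      by (cases "y \<ge> x"; cases "y = x") (auto simp: indicator_def powr_minus powr_half_sqrt divide_simps)
    then show "ennreal (indicator {x - R..x + R} y / sqrt \<bar>x - y\<bar>) \<le> ennreal (indicator {0..R} (y - x) * (y - x) powr (-1/2)) + ennreal (indicator {0..R} (x - y) * (x - y) powr (-1/2))"
      by (simp flip: ennreal_plus add: ennreal_leI)
  qed
  also have "\<dots> = ennreal (2 * sqrt R) + ennreal (2 * sqrt R)"
    by (subst nn_integral_add) (measurable, simp only: l r)
  also have "\<dots> = ennreal (4 * sqrt R)" using assms by (simp flip: ennreal_plus)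
  finally show ?thesis .
qed

lemma nn_integral_far:
  assumes "R > 0"
  shows "(\<integral>\<^sup>+ y. ennreal (indicator (- {x - R..x + R}) y / (x - y)\<^sup>2) \<partial>lborel) \<le> ennreal (2 / R)"
proof -
  have half: "(\<integral>\<^sup>+ u. ennreal (indicator {R..} u * u powr (-2)) \<partial>lborel) = ennreal (1 / R)"
  proof -
    have h: "((\<lambda>u. u powr (-2)) has_integral - (R powr (-2 + 1)) / (-2 + 1)) {R..}"
      by (rule has_integral_powr_to_inf) (use assms in auto)
    have "(\<integral>\<^sup>+ u. ennreal (indicator {R..} u * u powr (-2)) \<partial>lborel) = ennreal (- (R powr (-2 + 1)) / (-2 + 1))"
      by (rule nn_integral_has_integral_lebesgue[OF _ h]) auto
    moreover have "- (R powr (-2 + 1)) / (-2 + 1) = 1 / R"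
      using assms by (simp add: powr_minus divide_simps)
    ultimately show ?thesis by simp
  qed
  have r: "(\<integral>\<^sup>+ y. ennreal (indicator {R..} (y - x) * (y - x) powr (-2)) \<partial>lborel) = ennreal (1 / R)"
    using nn_integral_real_affine[of "\<lambda>u. ennreal (indicator {R..} u * u powr (-2))" 1 "-x"] half by simp
  have l: "(\<integral>\<^sup>+ y. ennreal (indicator {R..} (x - y) * (x - y) powr (-2)) \<partial>lborel) = ennreal (1 / R)"
    using nn_integral_real_affine[of "\<lambda>u. ennreal (indicator {R..} u * u powr (-2))" "-1" x] half by simp
  have "(\<integral>\<^sup>+ y. ennreal (indicator (- {x - R..x + R}) y / (x - y)\<^sup>2) \<partial>lborel) \<le>
     (\<integral>\<^sup>+ y. ennreal (indicator {R..} (y - x) * (y - x) powr (-2)) + ennreal (indicator {R..} (x - y) * (x - y) powr (-2)) \<partial>lborel)"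
  proof (rule nn_integral_mono)
    fix y
    have "(y - x) powr (-2) = 1 / (x - y)\<^sup>2" if "y > x" for y
      using that by (simp add: powr_minus powr_numeral divide_simps power2_commute)
    moreover have "(x - y) powr (-2) = 1 / (x - y)\<^sup>2" if "y < x" for y
      using that by (simp add: powr_minus powr_numeral divide_simps)
    ultimately have "indicator (- {x - R..x + R}) y / (x - y)\<^sup>2 \<le> indicator {R..} (y - x) * (y - x) powr (-2) + indicator {R..} (x - y) * (x - y) powr (-2)"
      using assms by (cases "y > x"; cases "y < x") (auto simp: indicator_def)
    then show "ennreal (indicator (- {x - R..x + R}) y / (x - y)\<^sup>2) \<le> ennreal (indicator {R..} (y - x) * (y - x) powr (-2)) + ennreal (indicator {R..} (x - y) * (x - y) powr (-2))"
      by (simp flip: ennreal_plus add: ennreal_leI)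
  qed
  also have "\<dots> = ennreal (1 / R) + ennreal (1 / R)"
    by (subst nn_integral_add) (measurable, simp only: l r)
  also have "\<dots> = ennreal (2 / R)" using assms by (simp flip: ennreal_plus)
  finally show ?thesis .
qed

text \<open>Young's inequality with exponents $4/3$ and $4$, by cases on which of $k$ and $\mu q$ is larger.\<close>

lemma young_3_4:
  fixes q k \<mu> :: real assumes "q \<ge> 0" "k \<ge> 0" "\<mu> > 0"
  shows "q ^ 3 * k \<le> \<mu> * q ^ 4 + k ^ 4 / \<mu> ^ 3"
proof (cases "k \<le> \<mu> * q")
  case True
  then have "q ^ 3 * k \<le> q ^ 3 * (\<mu> * q)" using assms by (intro mult_left_mono) auto
  also have "\<dots> = \<mu> * q ^ 4" by (simp add: power_numeral_reduce)
  also have "\<dots> \<le> \<mu> * q ^ 4 + k ^ 4 / \<mu> ^ 3" using assms by simp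
  finally show ?thesis .
next
  case False
  then have "q \<le> k / \<mu>" using assms by (simp add: field_simps)
  then have "q ^ 3 * k \<le> (k / \<mu>) ^ 3 * k" using assms by (intro mult_right_mono power_mono) auto
  also have "\<dots> = k ^ 4 / \<mu> ^ 3" by (simp add: power_numeral_reduce power_divide)
  also have "\<dots> \<le> \<mu> * q ^ 4 + k ^ 4 / \<mu> ^ 3" using assms by simp
  finally show ?thesis .
qed

text \<open>Near the singularity $q \le \mu$ is used, and away from it Young's inequality; both
  contributions are of order $\mu$ when the radius is $\mu^{-4}$.\<close>

lemma hls_inner:
  fixes q :: "real \<Rightarrow> real"
  assumes [measurable]: "q \<in> borel_measurable borel" and q: "\<And>y. q y \<ge> 0"
    and Q: "(\<integral>\<^sup>+ y. ennreal (q y ^ 4) \<partial>lborel) \<le> 1" and \<mu>: "\<mu> \<ge> 0"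
  shows "(\<integral>\<^sup>+ y. ennreal (indicator {y. q y \<le> \<mu>} y * q y ^ 3 / sqrt \<bar>x - y\<bar>) \<partial>lborel) \<le> ennreal (7 * \<mu>)"
proof (cases "\<mu> = 0")
  case True
  have "(\<integral>\<^sup>+ y. ennreal (indicator {y. q y \<le> \<mu>} y * q y ^ 3 / sqrt \<bar>x - y\<bar>) \<partial>lborel) = (\<integral>\<^sup>+ y. 0 \<partial>(lborel :: real measure))"
    by (intro nn_integral_cong) (use q True in \<open>auto simp: indicator_def dest: antisym\<close>)
  then show ?thesis by simp
next
  case False
  with \<mu> have \<mu>: "\<mu> > 0" by simp
  \<comment> \<open>The radius balances $\mu^3 R^{1/2}$ against $\mu^{-3} R^{-1}$.\<close>
  define R where "R = 1 / \<mu> ^ 4"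
  have R: "R > 0" using \<mu> by (simp add: R_def)
  have sR: "sqrt R = 1 / \<mu> ^ 2" using \<mu> unfolding R_def
    by (intro real_sqrt_unique) (auto simp: power_divide simp flip: power_mult)
  have "(\<integral>\<^sup>+ y. ennreal (indicator {y. q y \<le> \<mu>} y * q y ^ 3 / sqrt \<bar>x - y\<bar>) \<partial>lborel) \<le>
    (\<integral>\<^sup>+ y. ennreal (\<mu>^3) * ennreal (indicator {x - R..x + R} y / sqrt \<bar>x - y\<bar>) + (ennreal \<mu> * ennreal (q y ^ 4)
        + ennreal (1 / \<mu>^3) * ennreal (indicator (- {x - R..x + R}) y / (x - y)\<^sup>2)) \<partial>lborel)"
  proof (rule nn_integral_mono)
    fix y
    have "indicator {y. q y \<le> \<mu>} y * q y ^ 3 / sqrt \<bar>x - y\<bar> \<le> \<mu>^3 * (indicator {x - R..x + R} y / sqrt \<bar>x - y\<bar>) + (\<mu> * q y ^ 4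
        + 1 / \<mu>^3 * (indicator (- {x - R..x + R}) y / (x - y)\<^sup>2))"
    proof (cases "y \<in> {x - R..x + R}")
      case True
      have "indicator {y. q y \<le> \<mu>} y * q y ^ 3 / sqrt \<bar>x - y\<bar> \<le> \<mu>^3 * (1 / sqrt \<bar>x - y\<bar>)"
        using q \<mu> by (auto simp: indicator_def intro!: divide_right_mono power_mono)
      then show ?thesis using True \<mu> by (simp add: add_increasing2)
    next
      case False
      have "indicator {y. q y \<le> \<mu>} y * q y ^ 3 / sqrt \<bar>x - y\<bar> \<le> q y ^ 3 * (1 / sqrt \<bar>x - y\<bar>)"
        using q by (auto simp: indicator_def intro!: divide_right_mono)
      also have "\<dots> \<le> \<mu> * q y ^ 4 + (1 / sqrt \<bar>x - y\<bar>) ^ 4 / \<mu> ^ 3"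
        by (rule young_3_4) (use q \<mu> in auto)
      also have "(1 / sqrt \<bar>x - y\<bar>) ^ 4 = 1 / (x - y)\<^sup>2"
      proof -
        have "(sqrt \<bar>x - y\<bar>) ^ (2 * 2) = ((sqrt \<bar>x - y\<bar>)\<^sup>2)\<^sup>2" by (rule power_mult)
        then show ?thesis by (simp add: power_divide)
      qed
      finally show ?thesis using False by (simp add: field_simps)
    qed
    then show "ennreal (indicator {y. q y \<le> \<mu>} y * q y ^ 3 / sqrt \<bar>x - y\<bar>) \<le> ennreal (\<mu>^3) * ennreal (indicator {x - R..x + R} y / sqrt \<bar>x - y\<bar>) + (ennreal \<mu> * ennreal (q y ^ 4)
        + ennreal (1 / \<mu>^3) * ennreal (indicator (- {x - R..x + R}) y / (x - y)\<^sup>2))"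
      using \<mu> q by (simp flip: ennreal_plus ennreal_mult add: ennreal_leI)
  qed
  also have "\<dots> = ennreal (\<mu>^3) * (\<integral>\<^sup>+ y. ennreal (indicator {x - R..x + R} y / sqrt \<bar>x - y\<bar>) \<partial>lborel) +
      (ennreal \<mu> * (\<integral>\<^sup>+ y. ennreal (q y ^ 4) \<partial>lborel) + ennreal (1 / \<mu>^3) * (\<integral>\<^sup>+ y. ennreal (indicator (- {x - R..x + R}) y / (x - y)\<^sup>2) \<partial>lborel))"
    by (simp add: nn_integral_add nn_integral_cmult)
  also have "\<dots> \<le> ennreal (\<mu>^3) * ennreal (4 * sqrt R) + (ennreal \<mu> * 1 + ennreal (1 / \<mu>^3) * ennreal (2 / R))"
    by (intro add_mono mult_left_mono nn_integral_near nn_integral_far R Q) auto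
  also have "\<dots> = ennreal (\<mu>^3 * (4 * sqrt R) + (\<mu> + 1 / \<mu>^3 * (2 / R)))"
    using \<mu> R by (simp flip: ennreal_mult ennreal_plus)
  also have "\<mu>^3 * (4 * sqrt R) + (\<mu> + 1 / \<mu>^3 * (2 / R)) = 7 * \<mu>"
    using \<mu> unfolding sR unfolding R_def by (simp add: field_simps power_numeral_reduce)
  finally show ?thesis .
qed

text \<open>Split the square into the region where $q(y) \le p(x)$ and its mirror image. On the first, the
  inner integral is at most $7\,p(x)$, which leaves $7 \int p^4$.\<close>

lemma hls_normalized:
  fixes p q :: "real \<Rightarrow> real"
  assumes [measurable]: "p \<in> borel_measurable borel" "q \<in> borel_measurable borel"
    and p: "\<And>y. p y \<ge> 0" and q: "\<And>y. q y \<ge> 0"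
    and P: "(\<integral>\<^sup>+ y. ennreal (p y ^ 4) \<partial>lborel) \<le> 1" and Q: "(\<integral>\<^sup>+ y. ennreal (q y ^ 4) \<partial>lborel) \<le> 1"
  shows "(\<integral>\<^sup>+ x. \<integral>\<^sup>+ y. ennreal (p x ^ 3 * q y ^ 3 / sqrt \<bar>x - y\<bar>) \<partial>lborel \<partial>lborel) \<le> 14"
proof -
  let ?I = "\<lambda>p q x y. ennreal (p x ^ 3) * ennreal (indicator {y. q y \<le> p x} y * q y ^ 3 / sqrt \<bar>x - y\<bar>)"
  have main: "(\<integral>\<^sup>+ x. \<integral>\<^sup>+ y. ?I p q x y \<partial>lborel \<partial>lborel) \<le> 7"
    if [measurable]: "p \<in> borel_measurable borel" "q \<in> borel_measurable borel"
    and p: "\<And>y. p y \<ge> 0" and q: "\<And>y. q y \<ge> 0"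
    and P: "(\<integral>\<^sup>+ y. ennreal (p y ^ 4) \<partial>lborel) \<le> 1" and Q: "(\<integral>\<^sup>+ y. ennreal (q y ^ 4) \<partial>lborel) \<le> 1"
    for p q :: "real \<Rightarrow> real"
  proof -
    have "(\<integral>\<^sup>+ x. \<integral>\<^sup>+ y. ?I p q x y \<partial>lborel \<partial>lborel)
      = (\<integral>\<^sup>+ x. ennreal (p x ^ 3) * (\<integral>\<^sup>+ y. ennreal (indicator {y. q y \<le> p x} y * q y ^ 3 / sqrt \<bar>x - y\<bar>) \<partial>lborel) \<partial>lborel)"
      by (intro nn_integral_cong nn_integral_cmult) measurable
    also have "\<dots> \<le> (\<integral>\<^sup>+ x. ennreal (p x ^ 3) * ennreal (7 * p x) \<partial>lborel)"
      by (intro nn_integral_mono mult_left_mono hls_inner p q Q that) auto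
    also have "\<dots> = (\<integral>\<^sup>+ x. 7 * ennreal (p x ^ 4) \<partial>lborel)"
      by (intro nn_integral_cong) (simp add: p ennreal_mult[symmetric] ennreal_mult'[symmetric] power_numeral_reduce flip: ennreal_numeral)
    also have "\<dots> = 7 * (\<integral>\<^sup>+ x. ennreal (p x ^ 4) \<partial>lborel)" by (intro nn_integral_cmult) auto
    also have "\<dots> \<le> 7 * 1" by (intro mult_left_mono P) auto
    finally show ?thesis by simp
  qed
  have "(\<integral>\<^sup>+ x. \<integral>\<^sup>+ y. ennreal (p x ^ 3 * q y ^ 3 / sqrt \<bar>x - y\<bar>) \<partial>lborel \<partial>lborel) \<le>
    (\<integral>\<^sup>+ x. \<integral>\<^sup>+ y. ?I p q x y
       + ?I q p y x \<partial>lborel \<partial>lborel)"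
  proof (intro nn_integral_mono)
    fix x y
    have "p x ^ 3 * q y ^ 3 / sqrt \<bar>x - y\<bar> \<le> p x ^ 3 * (indicator {y. q y \<le> p x} y * q y ^ 3 / sqrt \<bar>x - y\<bar>)
       + q y ^ 3 * (indicator {x. p x \<le> q y} x * p x ^ 3 / sqrt \<bar>y - x\<bar>)"
      using p[of x] q[of y] by (auto simp: indicator_def abs_minus_commute mult.commute)
    then show "ennreal (p x ^ 3 * q y ^ 3 / sqrt \<bar>x - y\<bar>) \<le> ?I p q x y
       + ?I q p y x"
      using p q by (simp flip: ennreal_plus ennreal_mult add: ennreal_leI)
  qed
  also have "\<dots> = (\<integral>\<^sup>+ x. \<integral>\<^sup>+ y. ?I p q x y \<partial>lborel \<partial>lborel)
     + (\<integral>\<^sup>+ x. \<integral>\<^sup>+ y. ?I q p y x \<partial>lborel \<partial>lborel)"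
    by (subst nn_integral_add[symmetric]) (auto intro!: nn_integral_cong nn_integral_add)
  also have "(\<integral>\<^sup>+ x. \<integral>\<^sup>+ y. ?I q p y x \<partial>lborel \<partial>lborel)
    = (\<integral>\<^sup>+ y. \<integral>\<^sup>+ x. ?I q p y x \<partial>lborel \<partial>lborel)"
    by (rule lborel_pair.Fubini') measurable
  also have "(\<integral>\<^sup>+ x. \<integral>\<^sup>+ y. ?I p q x y \<partial>lborel \<partial>lborel) + \<dots> \<le> 7 + 7"
    by (intro add_mono main assms)
  finally show ?thesis by simp
qed

text \<open>The Hardy--Littlewood--Sobolev inequality for the kernel $|x-y|^{-1/2}$ and exponents $4/3$,
  written with cubes so that the two norms are fourth-power integrals.\<close>

lemma hls:
  fixes p q :: "real \<Rightarrow> real"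
  assumes [measurable]: "p \<in> borel_measurable borel" "q \<in> borel_measurable borel"
    and p: "\<And>y. p y \<ge> 0" and q: "\<And>y. q y \<ge> 0"
    and P: "(\<integral>\<^sup>+ y. ennreal (p y ^ 4) \<partial>lborel) \<le> ennreal P" and Q: "(\<integral>\<^sup>+ y. ennreal (q y ^ 4) \<partial>lborel) \<le> ennreal Q"
    and pos: "P \<ge> 0" "Q \<ge> 0"
  shows "(\<integral>\<^sup>+ x. \<integral>\<^sup>+ y. ennreal (p x ^ 3 * q y ^ 3 / sqrt \<bar>x - y\<bar>) \<partial>lborel \<partial>lborel) \<le> ennreal (14 * root 4 P ^ 3 * root 4 Q ^ 3)"
proof (cases "P = 0 \<or> Q = 0")
  case True
  have z: "AE x in lborel. p x = 0" if "(\<integral>\<^sup>+ y. ennreal (p y ^ 4) \<partial>lborel) = 0" "p \<in> borel_measurable borel" for p :: "real \<Rightarrow> real"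
  proof -
    have "AE x in lborel. ennreal (p x ^ 4) = 0"
      using that by (subst (asm) nn_integral_0_iff_AE) auto
    then show ?thesis
    proof eventually_elim
      case (elim x)
      then have "p x ^ 4 \<le> 0" by (simp add: ennreal_eq_0_iff)
      then show ?case by (metis even_numeral power_eq_0_iff zero_le_even_power order_antisym_conv)
    qed
  qed
  have "(\<integral>\<^sup>+ x. \<integral>\<^sup>+ y. ennreal (p x ^ 3 * q y ^ 3 / sqrt \<bar>x - y\<bar>) \<partial>lborel \<partial>lborel) = (\<integral>\<^sup>+ x. 0 \<partial>(lborel :: real measure))"
  proof (rule nn_integral_cong_AE)
    have "AE x in lborel. p x = 0 \<or> (AE y in lborel. q y = 0)"
      using True z[of p] z[of q] P Q by auto
    then show "AE x in lborel. (\<integral>\<^sup>+ y. ennreal (p x ^ 3 * q y ^ 3 / sqrt \<bar>x - y\<bar>) \<partial>lborel) = 0"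
    proof eventually_elim
      case (elim x)
      have "AE y in lborel. ennreal (p x ^ 3 * q y ^ 3 / sqrt \<bar>x - y\<bar>) = 0"
        using elim by auto
      then show ?case by (subst nn_integral_0_iff_AE) auto
    qed
  qed
  then show ?thesis by simp
next
  case False
  with pos have pos: "P > 0" "Q > 0" by auto
  define a where "a = root 4 P"
  define b where "b = root 4 Q"
  have ab: "a > 0" "b > 0" "a ^ 4 = P" "b ^ 4 = Q"
    using pos by (auto simp: a_def b_def)
  have norm1: "(\<integral>\<^sup>+ y. ennreal ((p y / a) ^ 4) \<partial>lborel) \<le> 1" if [measurable]: "p \<in> borel_measurable borel"
    and P: "(\<integral>\<^sup>+ y. ennreal (p y ^ 4) \<partial>lborel) \<le> ennreal (a ^ 4)" and a: "a > 0" for p :: "real \<Rightarrow> real" and a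
  proof -
    have "(\<integral>\<^sup>+ y. ennreal ((p y / a) ^ 4) \<partial>lborel) = (\<integral>\<^sup>+ y. ennreal (1 / a ^ 4) * ennreal (p y ^ 4) \<partial>lborel)"
      using a by (intro nn_integral_cong) (simp add: power_divide flip: ennreal_mult)
    also have "\<dots> = ennreal (1 / a ^ 4) * (\<integral>\<^sup>+ y. ennreal (p y ^ 4) \<partial>lborel)"
      by (intro nn_integral_cmult) measurable
    also have "\<dots> \<le> ennreal (1 / a ^ 4) * ennreal (a ^ 4)"
      by (intro mult_left_mono P) auto
    also have "\<dots> = 1" using a by (simp flip: ennreal_mult)
    finally show ?thesis .
  qed
  have "(\<integral>\<^sup>+ x. \<integral>\<^sup>+ y. ennreal (p x ^ 3 * q y ^ 3 / sqrt \<bar>x - y\<bar>) \<partial>lborel \<partial>lborel)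
     = (\<integral>\<^sup>+ x. \<integral>\<^sup>+ y. ennreal (a^3 * b^3) * ennreal ((p x / a) ^ 3 * (q y / b) ^ 3 / sqrt \<bar>x - y\<bar>) \<partial>lborel \<partial>lborel)"
    using ab p q by (intro nn_integral_cong) (simp add: power_divide flip: ennreal_mult)
  also have "\<dots> = ennreal (a^3 * b^3) * (\<integral>\<^sup>+ x. \<integral>\<^sup>+ y. ennreal ((p x / a) ^ 3 * (q y / b) ^ 3 / sqrt \<bar>x - y\<bar>) \<partial>lborel \<partial>lborel)"
    by (subst nn_integral_cmult[symmetric]) (auto intro!: nn_integral_cong nn_integral_cmult)
  also have "\<dots> \<le> ennreal (a^3 * b^3) * 14"
    using ab p q P Q by (intro mult_left_mono hls_normalized norm1) auto
  also have "\<dots> = ennreal (14 * a ^ 3 * b ^ 3)"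
    using ab by (simp add: ennreal_mult mult_ac)
  finally show ?thesis by (simp add: a_def b_def)
qed

text \<open>The Riesz potential of order $1/2$, with values in the extended reals so that it exists at every
  time.\<close>

definition riesz :: "(real \<Rightarrow> complex) \<Rightarrow> real \<Rightarrow> ennreal" where
  "riesz f t = (\<integral>\<^sup>+ s. ennreal (cmod (f s) / sqrt \<bar>t - s\<bar>) \<partial>lborel)"

lemma borel_measurable_riesz [measurable]:
  assumes [measurable]: "f \<in> borel_measurable borel"
  shows "riesz f \<in> borel_measurable borel"
  unfolding riesz_def by measurable

lemma cube_root_facts:
  fixes a :: real assumes "a \<ge> 0"
  shows "(a powr (1/3)) ^ 3 = a" "(a powr (1/3)) ^ 4 = a powr (4/3)"
  using assms by (auto simp: powr_realpow' powr_powr simp flip: powr_numeral)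

text \<open>Pair the potential with the cube of its own truncation $u$: the result bounds $\int u^4$ by a
  multiple of its own power $3/4$, which can be divided out. The truncation is what makes that
  power finite.\<close>

lemma riesz_L4:
  fixes f :: "real \<Rightarrow> complex"
  assumes [measurable]: "f \<in> borel_measurable borel"
    and A: "(\<integral>\<^sup>+ s. ennreal (cmod (f s) powr (4/3)) \<partial>lborel) \<le> ennreal A" "A \<ge> 0"
  shows "(\<integral>\<^sup>+ t. riesz f t ^ 4 \<partial>lborel) \<le> ennreal (14 ^ 4 * A ^ 3)"
proof -
  \<comment> \<open>Truncated in height and in time, so that its fourth power is integrable.\<close>
  define u where "u N t = enn2real (min (riesz f t) (ennreal N)) * indicator {-N..N} t" for N t
  have u0: "u N t \<ge> 0" for N t by (simp add: u_def)
  have [measurable]: "u N \<in> borel_measurable borel" for N unfolding u_def by measurable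
  have uN: "u N t \<le> N" if "N \<ge> 0" for N t
  proof -
    have "enn2real (min (riesz f t) (ennreal N)) \<le> N"
      by (rule enn2real_leI) (use that in auto)
    then show ?thesis using that by (auto simp: u_def indicator_def)
  qed
  have u_eq: "ennreal (u N t) = min (riesz f t) (ennreal N) * indicator {-N..N} t" for N t
  proof -
    have "ennreal (enn2real (min (riesz f t) (ennreal N))) = min (riesz f t) (ennreal N)"
      by (rule ennreal_enn2real) (simp add: min.strict_coboundedI2)
    then show ?thesis by (auto simp: u_def indicator_def)
  qed
  have bound: "(\<integral>\<^sup>+ t. ennreal (u N t ^ 4) \<partial>lborel) \<le> ennreal (14 ^ 4 * A ^ 3)" if N: "N \<ge> 0" for N
  proof -
    have fin: "(\<integral>\<^sup>+ t. ennreal (u N t ^ 4) \<partial>lborel) \<le> ennreal (N^4 * (2 * N))"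
    proof -
      have "(\<integral>\<^sup>+ t. ennreal (u N t ^ 4) \<partial>lborel) \<le> (\<integral>\<^sup>+ t. ennreal (N ^ 4) * indicator {-N..N} t \<partial>lborel)"
      proof (rule nn_integral_mono)
        fix t
        have "u N t ^ 4 \<le> N ^ 4 * indicator {-N..N} t"
        proof (cases "t \<in> {-N..N}")
          case True
          then show ?thesis using power_mono[OF uN[OF N, of t] u0[of N t], of 4] by simp
        qed (simp add: u_def)
        then have "ennreal (u N t ^ 4) \<le> ennreal (N ^ 4 * indicator {-N..N} t)" by (rule ennreal_leI)
        then show "ennreal (u N t ^ 4) \<le> ennreal (N ^ 4) * indicator {-N..N} t"
          by (auto simp: indicator_def split: if_splits)
      qed
      also have "\<dots> = ennreal (N^4 * (2 * N))" using N by (simp add: nn_integral_cmult_indicator ennreal_mult)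
      finally show ?thesis .
    qed
    define X where "X = enn2real (\<integral>\<^sup>+ t. ennreal (u N t ^ 4) \<partial>lborel)"
    have X: "(\<integral>\<^sup>+ t. ennreal (u N t ^ 4) \<partial>lborel) = ennreal X"
      unfolding X_def by (rule ennreal_enn2real[symmetric]) (use fin in \<open>auto simp: top_unique less_top[symmetric]\<close>)
    have X0: "X \<ge> 0" by (simp add: X_def)
    have "ennreal X \<le> (\<integral>\<^sup>+ t. \<integral>\<^sup>+ s. ennreal (u N t ^ 3 * (cmod (f s) powr (1/3)) ^ 3 / sqrt \<bar>t - s\<bar>) \<partial>lborel \<partial>lborel)"
      unfolding X[symmetric]
    proof (rule nn_integral_mono)
      fix t
      have "ennreal (u N t ^ 4) = ennreal (u N t ^ 3) * ennreal (u N t)"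
        using u0[of N t] by (simp add: power_numeral_reduce mult_ac flip: ennreal_mult)
      also have "\<dots> \<le> ennreal (u N t ^ 3) * riesz f t"
        by (intro mult_left_mono) (auto simp: u_eq indicator_def)
      also have "\<dots> = (\<integral>\<^sup>+ s. ennreal (u N t ^ 3) * ennreal (cmod (f s) / sqrt \<bar>t - s\<bar>) \<partial>lborel)"
        unfolding riesz_def by (rule nn_integral_cmult[symmetric]) measurable
      also have "\<dots> = (\<integral>\<^sup>+ s. ennreal (u N t ^ 3 * (cmod (f s) powr (1/3)) ^ 3 / sqrt \<bar>t - s\<bar>) \<partial>lborel)"
        using u0[of N t] by (intro nn_integral_cong) (simp add: cube_root_facts flip: ennreal_mult)
      finally show "ennreal (u N t ^ 4) \<le> \<dots>" .
    qed
    also have "\<dots> \<le> ennreal (14 * root 4 X ^ 3 * root 4 A ^ 3)"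
      by (rule hls) (use X X0 A u0 in \<open>auto simp: cube_root_facts\<close>)
    finally have le: "X \<le> 14 * root 4 X ^ 3 * root 4 A ^ 3" using X0 A by (simp add: ennreal_le_iff)
    define x where "x = root 4 X"
    define a where "a = root 4 A"
    have xa: "x \<ge> 0" "a \<ge> 0" "x ^ 4 = X" "a ^ 4 = A" using X0 A by (auto simp: x_def a_def)
    have "x \<le> 14 * a ^ 3"
    proof (cases "x = 0")
      case False
      have "x ^ 3 * x \<le> x ^ 3 * (14 * a ^ 3)" using le xa by (simp add: x_def[symmetric] a_def[symmetric] power_numeral_reduce mult_ac)
      then show ?thesis using False xa by (simp add: mult_le_cancel_left)
    qed (use xa in auto)
    then have "x ^ 4 \<le> (14 * a ^ 3) ^ 4" using xa by (intro power_mono) auto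
    also have "\<dots> = 14 ^ 4 * (a ^ 4) ^ 3" by (simp add: power_mult_distrib flip: power_mult)
    finally have "X \<le> 14 ^ 4 * A ^ 3" by (simp add: xa)
    then show ?thesis unfolding X by (rule ennreal_leI)
  qed
  have u_mono: "ennreal (u (real m) t) ^ 4 \<le> ennreal (u (real n) t) ^ 4" if "m \<le> n" for m n t
  proof (intro power_mono)
    have "min (riesz f t) (ennreal (real m)) \<le> min (riesz f t) (ennreal (real n))"
      using that by (intro min.mono ennreal_leI) auto
    moreover have "{-real m..real m} \<subseteq> {-real n..real n}" using that by auto
    ultimately show "ennreal (u (real m) t) \<le> ennreal (u (real n) t)"
      unfolding u_eq by (intro mult_mono) (auto simp: indicator_def)
  qed auto
  have "(\<integral>\<^sup>+ t. riesz f t ^ 4 \<partial>lborel) = (\<integral>\<^sup>+ t. (SUP n. ennreal (u (real n) t) ^ 4) \<partial>lborel)"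
  proof (rule nn_integral_cong)
    fix t
    have inc: "incseq (\<lambda>n. ennreal (u (real n) t) ^ 4)"
      by (intro monoI u_mono)
    have "(\<lambda>n. ennreal (u (real n) t) ^ 4) \<longlonglongrightarrow> riesz f t ^ 4"
    proof -
      have "(\<lambda>n. min (riesz f t) (ennreal (real n))) \<longlonglongrightarrow> min (riesz f t) \<top>"
        unfolding ennreal_of_nat_eq_real_of_nat[symmetric]
        by (intro tendsto_min tendsto_const of_nat_tendsto_top_ennreal)
      then have l: "(\<lambda>n. min (riesz f t) (ennreal (real n))) \<longlonglongrightarrow> riesz f t" by simp
      have ev: "\<forall>\<^sub>F n in sequentially. min (riesz f t) (ennreal (real n)) = ennreal (u (real n) t)"
        using eventually_ge_at_top[of "nat \<lceil>\<bar>t\<bar>\<rceil>"]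
      proof eventually_elim
        case (elim n)
        then have "t \<in> {- real n..real n}" by (simp add: nat_le_iff ceiling_le_iff abs_le_iff)
        then show ?case by (simp add: u_eq)
      qed
      have "(\<lambda>n. ennreal (u (real n) t)) \<longlonglongrightarrow> riesz f t"
        using Lim_transform_eventually[OF l ev] .
      then show ?thesis
        by (simp add: power_numeral_reduce) (intro tendsto_mult_ennreal, auto simp: ennreal_mult_eq_top_iff)
    qed
    then show "riesz f t ^ 4 = (SUP n. ennreal (u (real n) t) ^ 4)"
      using LIMSEQ_SUP[OF inc] LIMSEQ_unique by blast
  qed
  also have "\<dots> = (SUP n. \<integral>\<^sup>+ t. ennreal (u (real n) t) ^ 4 \<partial>lborel)"
    by (intro nn_integral_monotone_convergence_SUP)
       (auto simp: incseq_def le_fun_def intro!: u_mono)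
  also have "\<dots> \<le> ennreal (14 ^ 4 * A ^ 3)"
    using bound u0 by (intro SUP_least) (simp add: ennreal_power)
  finally show ?thesis .
qed

section \<open>Superpositions of damped waves and the Fourier integral\<close>

lemma borel_measurable_cnj [measurable]: "cnj \<in> borel_measurable borel"
  by (intro borel_measurable_continuous_onI continuous_intros)

lemma ennreal_norm_integral_le:
  fixes f :: "'a \<Rightarrow> 'b::{banach, second_countable_topology}"
  shows "ennreal (norm (LINT x|M. f x)) \<le> (\<integral>\<^sup>+ x. ennreal (norm (f x)) \<partial>M)"
  by (cases "integrable M f") (auto simp: integral_norm_bound_ennreal not_integrable_integral_eq)

lemma integrable_tensor:
  fixes f g :: "real \<Rightarrow> complex"
  assumes f: "integrable lborel f" and g: "integrable lborel g"
    and [measurable]: "(\<lambda>(x, y). e x y) \<in> borel_measurable (borel \<Otimes>\<^sub>M borel)"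
    and e: "\<And>x y. cmod (e x y) \<le> cmod (f x) * cmod (g y)"
  shows "integrable (lborel \<Otimes>\<^sub>M lborel) (\<lambda>(x, y). e x y)"
proof (rule integrableI_bounded)
  have [measurable]: "f \<in> borel_measurable borel" "g \<in> borel_measurable borel"
    using f g by auto
  show "(\<lambda>(x, y). e x y) \<in> borel_measurable (lborel \<Otimes>\<^sub>M lborel)" by measurable
  have "(\<integral>\<^sup>+ p. ennreal (norm (case p of (x, y) \<Rightarrow> e x y)) \<partial>(lborel \<Otimes>\<^sub>M lborel)) \<le>
      (\<integral>\<^sup>+ p. ennreal (cmod (f (fst p))) * ennreal (cmod (g (snd p))) \<partial>(lborel \<Otimes>\<^sub>M lborel))"
    by (intro nn_integral_mono) (auto simp: e ennreal_leI simp flip: ennreal_mult)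
  also have "\<dots> = (\<integral>\<^sup>+ x. \<integral>\<^sup>+ y. ennreal (cmod (f x)) * ennreal (cmod (g y)) \<partial>lborel \<partial>lborel)"
    by (subst lborel.nn_integral_fst[symmetric]) auto
  also have "\<dots> = (\<integral>\<^sup>+ x. ennreal (cmod (f x)) \<partial>lborel) * (\<integral>\<^sup>+ y. ennreal (cmod (g y)) \<partial>lborel)"
    by (subst nn_integral_cmult, measurable) (subst nn_integral_multc, auto)
  also have "\<dots> < \<infinity>"
    using f g by (auto simp: integrable_iff_bounded ennreal_mult_less_top)
  finally show "(\<integral>\<^sup>+ p. ennreal (norm (case p of (x, y) \<Rightarrow> e x y)) \<partial>(lborel \<Otimes>\<^sub>M lborel)) < \<infinity>" .
qed

text \<open>A plane wave damped by $\mathrm{Re}\,w$ and evolved by the time $\mathrm{Im}\,w$: the multiplier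
  of $e^{w\partial_x^2}$ together with the phase of the point $x$.\<close>

definition wave :: "complex \<Rightarrow> real \<Rightarrow> real \<Rightarrow> complex" where
  "wave w x \<xi> = exp (\<i> * of_real (x * \<xi>) - w * (complex_of_real \<xi>)\<^sup>2)"

lemma norm_wave: "cmod (wave w x \<xi>) = exp (- Re w * \<xi>\<^sup>2)"
  by (simp add: wave_def power2_eq_square)

lemma wave_measurable [measurable (raw)]:
  assumes [measurable]: "w \<in> borel_measurable M" "x \<in> borel_measurable M" "\<xi> \<in> borel_measurable M"
  shows "(\<lambda>t. wave (w t) (x t) (\<xi> t)) \<in> borel_measurable M"
  unfolding wave_def by measurable

lemma norm_wave_le:
  assumes "Re w \<ge> e" shows "cmod (wave w x \<xi>) \<le> exp (- e * \<xi>\<^sup>2)"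
  using assms by (simp add: norm_wave mult_right_mono)

lemma wave_mult_cnj: "wave w x \<xi> * cnj (wave w' x' \<xi>) = wave (w + cnj w') (x - x') \<xi>"
  by (simp add: wave_def exp_cnj exp_add[symmetric] algebra_simps)

text \<open>The adjoint of evaluation along a path $t \mapsto (w(t), x(t))$. With $w = 0$ and $x(t) = -t$ it
  is the Fourier integral; with oscillating $w$ it is a source at the origin.\<close>

definition superpose :: "(real \<Rightarrow> complex) \<Rightarrow> (real \<Rightarrow> real) \<Rightarrow> (real \<Rightarrow> complex) \<Rightarrow> real \<Rightarrow> complex" where
  "superpose w x h \<xi> = (LINT t|lborel. h t * wave (w t) (x t) \<xi>)"

lemma superpose_measurable [measurable]:
  assumes [measurable]: "w \<in> borel_measurable borel" "x \<in> borel_measurable borel" "h \<in> borel_measurable borel"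
  shows "superpose w x h \<in> borel_measurable borel"
  unfolding superpose_def by measurable

lemma norm_superpose_le:
  assumes h: "integrable lborel h" and w: "\<And>t. Re (w t) \<ge> e"
    and [measurable]: "w \<in> borel_measurable borel" "x \<in> borel_measurable borel"
  shows "cmod (superpose w x h \<xi>) \<le> (LINT t|lborel. cmod (h t)) * exp (- e * \<xi>\<^sup>2)"
proof -
  have [measurable]: "h \<in> borel_measurable borel" using h by auto
  have b: "cmod (h t * wave (w t) (x t) \<xi>) \<le> cmod (h t) * exp (- e * \<xi>\<^sup>2)" for t
    unfolding norm_mult by (intro mult_left_mono norm_wave_le w) auto
  have i: "integrable lborel (\<lambda>t. cmod (h t) * exp (- e * \<xi>\<^sup>2))" using h by auto
  have "cmod (superpose w x h \<xi>) \<le> (LINT t|lborel. cmod (h t * wave (w t) (x t) \<xi>))"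
    unfolding superpose_def by (rule integral_norm_bound)
  also have "\<dots> \<le> (LINT t|lborel. cmod (h t) * exp (- e * \<xi>\<^sup>2))"
  proof (rule integral_mono)
    show "integrable lborel (\<lambda>t. cmod (h t * wave (w t) (x t) \<xi>))"
      by (rule Bochner_Integration.integrable_bound[OF i]) (use b in \<open>auto simp: abs_mult\<close>)
  qed (use i b in auto)
  finally show ?thesis by simp
qed

text \<open>The damping $e^{-e\xi^2}$ is attached to the partner \<open>a\<close>, so that the identity
  serves both undamped superpositions against integrable partners ($e = 0$) and damped ones
  against square-integrable partners.\<close>

lemma superpose_Fubini:
  assumes h: "integrable lborel h" and w: "\<And>t. Re (w t) \<ge> e"
    and [measurable]: "w \<in> borel_measurable borel" "x \<in> borel_measurable borel"
    and a: "integrable lborel (\<lambda>\<xi>. a \<xi> * exp (- e * \<xi>\<^sup>2))" and [measurable]: "a \<in> borel_measurable borel"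
  shows "integrable lborel (\<lambda>\<xi>. superpose w x h \<xi> * a \<xi>)"
    and "(LINT \<xi>|lborel. superpose w x h \<xi> * a \<xi>) = (LINT t|lborel. h t * (LINT \<xi>|lborel. a \<xi> * wave (w t) (x t) \<xi>))"
proof -
  have [measurable]: "h \<in> borel_measurable borel" using h by auto
  have int: "integrable (lborel \<Otimes>\<^sub>M lborel) (\<lambda>(t, \<xi>). h t * (a \<xi> * wave (w t) (x t) \<xi>))"
  proof (rule integrable_tensor[OF h a])
    show "cmod (h t * (a \<xi> * wave (w t) (x t) \<xi>)) \<le> cmod (h t) * cmod (a \<xi> * exp (- e * \<xi>\<^sup>2))" for t \<xi>
      unfolding norm_mult norm_of_real using norm_wave_le[OF w] by (auto intro!: mult_left_mono)
  qed measurable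
  have eq: "(LINT t|lborel. h t * (a \<xi> * wave (w t) (x t) \<xi>)) = superpose w x h \<xi> * a \<xi>" for \<xi>
    unfolding superpose_def by (subst integral_mult_left_zero[symmetric]) (simp add: mult_ac)
  show "integrable lborel (\<lambda>\<xi>. superpose w x h \<xi> * a \<xi>)"
    using lborel_pair.integrable_snd[OF int] by (simp add: eq)
  show "(LINT \<xi>|lborel. superpose w x h \<xi> * a \<xi>) = (LINT t|lborel. h t * (LINT \<xi>|lborel. a \<xi> * wave (w t) (x t) \<xi>))"
    using lborel_pair.Fubini_integral[OF int] by (simp add: eq)
qed

lemma LINT_wave:
  assumes "Re w > 0" shows "(LINT \<xi>|lborel. wave w x \<xi>) = gauss_kernel w x"
  unfolding wave_def by (rule gaussian_fourier(2)[OF assms])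

text \<open>The scalar product of two superpositions is a double integral against Gaussian kernels. This one
  identity yields the contraction property of the Fourier integral, the Strichartz estimate and
  the positivity of the trace operator.\<close>

lemma superpose_inner:
  assumes h: "integrable lborel h" and w: "\<And>t. Re (w t) \<ge> e"
    and g: "integrable lborel g" and v: "\<And>t. Re (v t) \<ge> e" and e: "e > 0"
    and [measurable]: "w \<in> borel_measurable borel" "x \<in> borel_measurable borel"
      "v \<in> borel_measurable borel" "y \<in> borel_measurable borel"
  shows "integrable lborel (\<lambda>\<xi>. superpose w x h \<xi> * cnj (superpose v y g \<xi>))"
    and "(LINT \<xi>|lborel. superpose w x h \<xi> * cnj (superpose v y g \<xi>)) =
      (LINT t|lborel. LINT s|lborel. h t * (cnj (g s) * gauss_kernel (w t + cnj (v s)) (x t - y s)))"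
proof -
  have [measurable]: "h \<in> borel_measurable borel" "g \<in> borel_measurable borel" using h g by auto
  have i1: "integrable lborel (\<lambda>\<xi>. cnj (superpose v y g \<xi>) * exp (- e * \<xi>\<^sup>2))"
  proof (rule Bochner_Integration.integrable_bound)
    show "integrable lborel (\<lambda>\<xi>. (LINT t|lborel. cmod (g t)) * exp (- e * \<xi>\<^sup>2))"
      by (intro integrable_mult_right integrable_gaussian e)
    show "AE \<xi> in lborel. norm (cnj (superpose v y g \<xi>) * exp (- e * \<xi>\<^sup>2)) \<le> norm ((LINT t|lborel. cmod (g t)) * exp (- e * \<xi>\<^sup>2))"
    proof (rule AE_I2)
      fix \<xi>
      have "cmod (superpose v y g \<xi>) \<le> (LINT t|lborel. cmod (g t)) * exp (- e * \<xi>\<^sup>2)"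
        by (rule norm_superpose_le[OF g v]) auto
      also have "\<dots> \<le> (LINT t|lborel. cmod (g t)) * 1"
        using e by (intro mult_left_mono) auto
      finally show "norm (cnj (superpose v y g \<xi>) * exp (- e * \<xi>\<^sup>2)) \<le> norm ((LINT t|lborel. cmod (g t)) * exp (- e * \<xi>\<^sup>2))"
        by (auto simp: norm_mult abs_mult intro!: mult_right_mono)
    qed
  qed measurable
  note F1 = superpose_Fubini[where a="\<lambda>\<xi>. cnj (superpose v y g \<xi>)" and e=e and w=w and x=x, OF h w _ _ i1]
  show "integrable lborel (\<lambda>\<xi>. superpose w x h \<xi> * cnj (superpose v y g \<xi>))"
    by (rule F1(1)) auto
  have "(LINT \<xi>|lborel. superpose w x h \<xi> * cnj (superpose v y g \<xi>)) =
    (LINT t|lborel. h t * (LINT \<xi>|lborel. cnj (superpose v y g \<xi>) * wave (w t) (x t) \<xi>))"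
    by (rule F1(2)) auto
  also have "\<dots> = (LINT t|lborel. LINT s|lborel. h t * (cnj (g s) * gauss_kernel (w t + cnj (v s)) (x t - y s)))"
  proof (rule Bochner_Integration.integral_cong[OF refl])
    fix t
    have i2: "integrable lborel (\<lambda>\<xi>. cnj (wave (w t) (x t) \<xi>) * exp (- e * \<xi>\<^sup>2))"
    proof (rule Bochner_Integration.integrable_bound[OF integrable_gaussian[OF e]])
      have "Re (w t) \<ge> 0" using w[of t] e by linarith
      then show "AE \<xi> in lborel. norm (cnj (wave (w t) (x t) \<xi>) * exp (- e * \<xi>\<^sup>2)) \<le> norm (exp (- e * \<xi>\<^sup>2))"
        by (auto simp: norm_mult norm_wave)
    qed measurable
    have "(LINT \<xi>|lborel. superpose v y g \<xi> * cnj (wave (w t) (x t) \<xi>)) =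
        (LINT s|lborel. g s * (LINT \<xi>|lborel. cnj (wave (w t) (x t) \<xi>) * wave (v s) (y s) \<xi>))"
      by (rule superpose_Fubini(2)[OF g v _ _ i2]) auto
    then have "cnj (LINT \<xi>|lborel. superpose v y g \<xi> * cnj (wave (w t) (x t) \<xi>)) =
        cnj (LINT s|lborel. g s * (LINT \<xi>|lborel. cnj (wave (w t) (x t) \<xi>) * wave (v s) (y s) \<xi>))" by simp
    then have "(LINT \<xi>|lborel. cnj (superpose v y g \<xi>) * wave (w t) (x t) \<xi>) =
        (LINT s|lborel. cnj (g s) * (LINT \<xi>|lborel. wave (w t) (x t) \<xi> * cnj (wave (v s) (y s) \<xi>)))"
      by (simp flip: Bochner_Integration.integral_cnj)
    also have "\<dots> = (LINT s|lborel. cnj (g s) * gauss_kernel (w t + cnj (v s)) (x t - y s))"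
    proof (rule Bochner_Integration.integral_cong[OF refl])
      fix s
      have "Re (w t + cnj (v s)) > 0" using w[of t] v[of s] e by simp
      then show "cnj (g s) * (LINT \<xi>|lborel. wave (w t) (x t) \<xi> * cnj (wave (v s) (y s) \<xi>)) =
        cnj (g s) * gauss_kernel (w t + cnj (v s)) (x t - y s)"
        by (simp add: wave_mult_cnj LINT_wave)
    qed
    finally show "h t * (LINT \<xi>|lborel. cnj (superpose v y g \<xi>) * wave (w t) (x t) \<xi>) =
      (LINT s|lborel. h t * (cnj (g s) * gauss_kernel (w t + cnj (v s)) (x t - y s)))"
      by (simp del: integral_mult_right_zero add: integral_mult_right_zero[symmetric])
  qed
  finally show "(LINT \<xi>|lborel. superpose w x h \<xi> * cnj (superpose v y g \<xi>)) =
      (LINT t|lborel. LINT s|lborel. h t * (cnj (g s) * gauss_kernel (w t + cnj (v s)) (x t - y s)))" .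
qed

definition ft :: "(real \<Rightarrow> complex) \<Rightarrow> real \<Rightarrow> complex" where
  "ft f \<xi> = complex_of_real (1 / sqrt (2 * pi)) * (LINT x|lborel. cis (- (x * \<xi>)) * f x)"

lemma ft_measurable [measurable]:
  assumes [measurable]: "f \<in> borel_measurable borel" shows "ft f \<in> borel_measurable borel"
  unfolding ft_def cis_conv_exp by measurable

lemma ft_conv_superpose: "ft f \<xi> = complex_of_real (1 / sqrt (2 * pi)) * superpose (\<lambda>_. 0) uminus f \<xi>"
  unfolding ft_def superpose_def wave_def cis_conv_exp by (simp add: mult.commute)

lemma superpose_damped: "superpose (\<lambda>t. w t + e) x f \<xi> = exp (- e * (complex_of_real \<xi>)\<^sup>2) * superpose w x f \<xi>"
  unfolding superpose_def
  by (subst integral_mult_right_zero[symmetric])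
     (simp add: wave_def exp_add[symmetric] exp_diff exp_minus algebra_simps divide_simps)

text \<open>For real parameters the kernel is a Gaussian probability density, so that small parameters form
  an approximate identity.\<close>

lemma gauss_kernel_real:
  assumes "e > 0"
  shows "gauss_kernel (complex_of_real e) x = complex_of_real (2 * pi * normal_density 0 (sqrt (2 * e)) x)"
proof -
  have "sqrt pi / sqrt e = 2 * pi / sqrt (2 * pi * (2 * e))"
    using assms by (simp add: real_sqrt_mult field_simps)
  moreover have "csqrt (complex_of_real e) = complex_of_real (sqrt e)"
    by (rule of_real_sqrt[symmetric]) (use assms in simp)
  moreover have "exp (- (complex_of_real x)\<^sup>2 / (4 * complex_of_real e)) = complex_of_real (exp (- x\<^sup>2 / (4 * e)))"
    by (simp add: exp_of_real[symmetric])
  ultimately show ?thesis using assms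
    by (simp add: gauss_kernel_def normal_density_def mult.assoc flip: of_real_divide of_real_mult)
qed

lemma ft_inner_damped:
  assumes f: "integrable lborel f" and g: "integrable lborel g" and e: "e > 0"
  shows "integrable lborel (\<lambda>\<xi>. complex_of_real (exp (- e * \<xi>\<^sup>2)) * (ft f \<xi> * cnj (ft g \<xi>)))"
    and "(LINT \<xi>|lborel. complex_of_real (exp (- e * \<xi>\<^sup>2)) * (ft f \<xi> * cnj (ft g \<xi>))) =
      (LINT t|lborel. LINT s|lborel. f t * (cnj (g s) * complex_of_real (normal_density 0 (sqrt (2 * e)) (t - s))))"
proof -
  have w: "Re (0 + complex_of_real (e / 2)) \<ge> e / 2" "e / 2 > 0" using e by auto
  note I = superpose_inner[OF f w(1) g w(1) w(2), of uminus uminus]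
  have eq: "complex_of_real (exp (- e * \<xi>\<^sup>2)) * (ft f \<xi> * cnj (ft g \<xi>)) = complex_of_real (1 / (2 * pi)) *
     (superpose (\<lambda>t. 0 + complex_of_real (e / 2)) uminus f \<xi> * cnj (superpose (\<lambda>t. 0 + complex_of_real (e / 2)) uminus g \<xi>))" for \<xi>
  proof -
    have 1: "complex_of_real (exp (- e * \<xi>\<^sup>2)) = exp (- complex_of_real (e / 2) * (complex_of_real \<xi>)\<^sup>2) * cnj (exp (- complex_of_real (e / 2) * (complex_of_real \<xi>)\<^sup>2))"
      by (simp add: exp_of_real[symmetric] exp_cnj exp_add[symmetric])
    have 2: "complex_of_real (1 / (2 * pi)) = complex_of_real (1 / sqrt (2 * pi)) * complex_of_real (1 / sqrt (2 * pi))"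
      by (simp flip: of_real_mult)
    show ?thesis unfolding superpose_damped ft_conv_superpose 1 2 by simp
  qed
  show "integrable lborel (\<lambda>\<xi>. complex_of_real (exp (- e * \<xi>\<^sup>2)) * (ft f \<xi> * cnj (ft g \<xi>)))"
    unfolding eq by (intro integrable_mult_right I) auto
  have "complex_of_real (e / 2) + cnj (complex_of_real (e / 2)) = complex_of_real e" by simp
  then show "(LINT \<xi>|lborel. complex_of_real (exp (- e * \<xi>\<^sup>2)) * (ft f \<xi> * cnj (ft g \<xi>))) =
      (LINT t|lborel. LINT s|lborel. f t * (cnj (g s) * complex_of_real (normal_density 0 (sqrt (2 * e)) (t - s))))"
    unfolding eq
    apply (subst integral_mult_right_zero)
    apply (subst I(2), measurable)
    apply (subst integral_mult_right_zero[symmetric])+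
    apply (intro Bochner_Integration.integral_cong refl)
    apply (simp add: gauss_kernel_real[OF e])
    apply (simp add: normal_density_def power2_commute)
    done
qed

lemma nn_integral_normal_shift:
  assumes "\<sigma> > 0"
  shows "(\<integral>\<^sup>+ s. ennreal (normal_density 0 \<sigma> (t - s)) \<partial>lborel) = 1"
    and "(\<integral>\<^sup>+ s. ennreal (normal_density 0 \<sigma> (s - t)) \<partial>lborel) = 1"
proof -
  have 1: "(\<integral>\<^sup>+ s. ennreal (normal_density 0 \<sigma> s) \<partial>lborel) = 1"
    using nn_integral_eq_integral[OF integrable_normal_density[OF assms]] integral_normal_density[OF assms] by simp
  show "(\<integral>\<^sup>+ s. ennreal (normal_density 0 \<sigma> (t - s)) \<partial>lborel) = 1"
    using nn_integral_real_affine[of "\<lambda>s. ennreal (normal_density 0 \<sigma> s)" "-1" t] 1 by simp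
  show "(\<integral>\<^sup>+ s. ennreal (normal_density 0 \<sigma> (s - t)) \<partial>lborel) = 1"
    using nn_integral_real_affine[of "\<lambda>s. ennreal (normal_density 0 \<sigma> s)" 1 "-t"] 1 by simp
qed

text \<open>The damped quadratic form is a convolution with a probability density, bounded by Schur's test;
  the damping is then removed by Fatou's lemma.\<close>

lemma ft_contraction:
  assumes f: "integrable lborel f" and f2: "square_integrable f"
  shows "(\<integral>\<^sup>+ \<xi>. ennreal ((cmod (ft f \<xi>))\<^sup>2) \<partial>lborel) \<le> (\<integral>\<^sup>+ x. ennreal ((cmod (f x))\<^sup>2) \<partial>lborel)"
proof -
  have [measurable]: "f \<in> borel_measurable borel" using f by auto
  define L where "L = (\<integral>\<^sup>+ x. ennreal ((cmod (f x))\<^sup>2) \<partial>lborel)"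
  have damped: "(\<integral>\<^sup>+ \<xi>. ennreal (exp (- e * \<xi>\<^sup>2) * (cmod (ft f \<xi>))\<^sup>2) \<partial>lborel) \<le> L" if e: "e > 0" for e
  proof -
    define N where "N = normal_density 0 (sqrt (2 * e))"
    have [measurable]: "N \<in> borel_measurable borel" unfolding N_def by measurable
    have sg: "sqrt (2 * e) > 0" using e by simp
    note I = ft_inner_damped[OF f f e, folded N_def]
    have eq: "complex_of_real (exp (- e * \<xi>\<^sup>2)) * (ft f \<xi> * cnj (ft f \<xi>)) = complex_of_real (exp (- e * \<xi>\<^sup>2) * (cmod (ft f \<xi>))\<^sup>2)" for \<xi>
      by (simp flip: complex_norm_square)
    have int: "integrable lborel (\<lambda>\<xi>. exp (- e * \<xi>\<^sup>2) * (cmod (ft f \<xi>))\<^sup>2)"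
      using I(1) unfolding eq by (simp only: complex_of_real_integrable_eq)
    have "(\<integral>\<^sup>+ \<xi>. ennreal (exp (- e * \<xi>\<^sup>2) * (cmod (ft f \<xi>))\<^sup>2) \<partial>lborel) = ennreal (LINT \<xi>|lborel. exp (- e * \<xi>\<^sup>2) * (cmod (ft f \<xi>))\<^sup>2)"
      by (rule nn_integral_eq_integral[OF int]) auto
    also have "(LINT \<xi>|lborel. exp (- e * \<xi>\<^sup>2) * (cmod (ft f \<xi>))\<^sup>2) = cmod (LINT \<xi>|lborel. complex_of_real (exp (- e * \<xi>\<^sup>2)) * (ft f \<xi> * cnj (ft f \<xi>)))"
      unfolding eq integral_complex_of_real norm_of_real by (simp add: integral_nonneg_AE)
    also have "\<dots> = cmod (LINT t|lborel. LINT s|lborel. f t * (cnj (f s) * complex_of_real (N (t - s))))"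
      unfolding I(2) ..
    also have "ennreal \<dots> \<le> (\<integral>\<^sup>+ t. ennreal (cmod (LINT s|lborel. f t * (cnj (f s) * complex_of_real (N (t - s))))) \<partial>lborel)"
      by (rule ennreal_norm_integral_le)
    also have "\<dots> \<le> (\<integral>\<^sup>+ t. \<integral>\<^sup>+ s. ennreal (cmod (f t * (cnj (f s) * complex_of_real (N (t - s))))) \<partial>lborel \<partial>lborel)"
      by (intro nn_integral_mono ennreal_norm_integral_le)
    also have "\<dots> \<le> (\<integral>\<^sup>+ t. \<integral>\<^sup>+ s. ennreal ((cmod (f t))\<^sup>2 / 2) * ennreal (N (t - s)) + ennreal ((cmod (f s))\<^sup>2 / 2) * ennreal (N (t - s)) \<partial>lborel \<partial>lborel)"
    proof (intro nn_integral_mono)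
      fix t s
      have N0: "N u \<ge> 0" for u by (simp add: N_def)
      have "cmod (f t) * cmod (f s) * N (t - s) \<le> ((cmod (f t))\<^sup>2 / 2 + (cmod (f s))\<^sup>2 / 2) * N (t - s)"
        using N0 sum_squares_bound[of "cmod (f t)" "cmod (f s)"] by (intro mult_right_mono) auto
      then show "ennreal (cmod (f t * (cnj (f s) * complex_of_real (N (t - s))))) \<le> ennreal ((cmod (f t))\<^sup>2 / 2) * ennreal (N (t - s)) + ennreal ((cmod (f s))\<^sup>2 / 2) * ennreal (N (t - s))"
        using N0 by (simp add: norm_mult mult.assoc distrib_right ennreal_leI flip: ennreal_plus ennreal_mult)
    qed
    also have "\<dots> = (\<integral>\<^sup>+ t. \<integral>\<^sup>+ s. ennreal ((cmod (f t))\<^sup>2 / 2) * ennreal (N (t - s)) \<partial>lborel \<partial>lborel) + (\<integral>\<^sup>+ t. \<integral>\<^sup>+ s. ennreal ((cmod (f s))\<^sup>2 / 2) * ennreal (N (t - s)) \<partial>lborel \<partial>lborel)"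
      by (subst nn_integral_add[symmetric]) (auto intro!: nn_integral_cong nn_integral_add)
    also have "(\<integral>\<^sup>+ t. \<integral>\<^sup>+ s. ennreal ((cmod (f s))\<^sup>2 / 2) * ennreal (N (t - s)) \<partial>lborel \<partial>lborel) = (\<integral>\<^sup>+ s. \<integral>\<^sup>+ t. ennreal ((cmod (f s))\<^sup>2 / 2) * ennreal (N (t - s)) \<partial>lborel \<partial>lborel)"
      by (rule lborel_pair.Fubini') measurable
    also have "(\<integral>\<^sup>+ t. \<integral>\<^sup>+ s. ennreal ((cmod (f t))\<^sup>2 / 2) * ennreal (N (t - s)) \<partial>lborel \<partial>lborel) = (\<integral>\<^sup>+ t. ennreal ((cmod (f t))\<^sup>2 / 2) \<partial>lborel)"
      by (subst nn_integral_cmult) (auto simp: N_def nn_integral_normal_shift[OF sg])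
    also have "(\<integral>\<^sup>+ s. \<integral>\<^sup>+ t. ennreal ((cmod (f s))\<^sup>2 / 2) * ennreal (N (t - s)) \<partial>lborel \<partial>lborel) = (\<integral>\<^sup>+ t. ennreal ((cmod (f t))\<^sup>2 / 2) \<partial>lborel)"
      by (subst nn_integral_cmult) (auto simp: N_def nn_integral_normal_shift[OF sg])
    also have "(\<integral>\<^sup>+ t. ennreal ((cmod (f t))\<^sup>2 / 2) \<partial>lborel) + (\<integral>\<^sup>+ t. ennreal ((cmod (f t))\<^sup>2 / 2) \<partial>lborel) = L"
      unfolding L_def by (subst nn_integral_add[symmetric]) (auto intro!: nn_integral_cong simp flip: ennreal_plus)
    finally show ?thesis .
  qed
  have "(\<integral>\<^sup>+ \<xi>. ennreal ((cmod (ft f \<xi>))\<^sup>2) \<partial>lborel) = (\<integral>\<^sup>+ \<xi>. liminf (\<lambda>n. ennreal (exp (- (1 / real (Suc n)) * \<xi>\<^sup>2) * (cmod (ft f \<xi>))\<^sup>2)) \<partial>lborel)"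
  proof (intro nn_integral_cong)
    fix \<xi>
    have "(\<lambda>n. exp (- (1 / real (Suc n)) * \<xi>\<^sup>2)) \<longlonglongrightarrow> exp (- 0 * \<xi>\<^sup>2)"
      using LIMSEQ_inverse_real_of_nat by (intro tendsto_intros) (simp add: inverse_eq_divide)
    then have "(\<lambda>n. ennreal (exp (- (1 / real (Suc n)) * \<xi>\<^sup>2) * (cmod (ft f \<xi>))\<^sup>2)) \<longlonglongrightarrow> ennreal (1 * (cmod (ft f \<xi>))\<^sup>2)"
      by (intro tendsto_ennrealI tendsto_mult tendsto_const) simp
    from lim_imp_Liminf[OF _ this]
    show "ennreal ((cmod (ft f \<xi>))\<^sup>2) = liminf (\<lambda>n. ennreal (exp (- (1 / real (Suc n)) * \<xi>\<^sup>2) * (cmod (ft f \<xi>))\<^sup>2))"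
      by simp
  qed
  also have "\<dots> \<le> liminf (\<lambda>n. \<integral>\<^sup>+ \<xi>. ennreal (exp (- (1 / real (Suc n)) * \<xi>\<^sup>2) * (cmod (ft f \<xi>))\<^sup>2) \<partial>lborel)"
    by (intro nn_integral_liminf) measurable
  also have "\<dots> \<le> liminf (\<lambda>n::nat. L)"
    by (intro Liminf_mono always_eventually allI damped) auto
  also have "\<dots> = L" by (rule Liminf_const) simp
  finally show ?thesis unfolding L_def .
qed

lemma square_integrable_iff_nn:
  "square_integrable f \<longleftrightarrow> f \<in> borel_measurable borel \<and> (\<integral>\<^sup>+ x. ennreal ((cmod (f x))\<^sup>2) \<partial>lborel) < \<infinity>"
  unfolding square_integrable_def integrable_iff_bounded by auto

lemma square_integrable_ft:
  assumes f: "integrable lborel f" and f2: "square_integrable f"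
  shows "square_integrable (ft f)"
  using ft_contraction[OF assms] f2 by (auto simp: square_integrable_iff_nn)

lemma normal_average_tendsto:
  assumes ab: "t \<noteq> a" "t \<noteq> b"
  shows "((\<lambda>\<sigma>. LINT s|lborel. indicator {a..b} s * normal_density 0 \<sigma> (t - s)) \<longlongrightarrow> indicator {a..b} t) (at_right 0)"
proof -
  have eq: "(LINT s|lborel. indicator {a..b} s * normal_density 0 \<sigma> (t - s)) = (LINT u|lborel. indicator {a..b} (t - \<sigma> * u) * std_normal_density u)"
    if "\<sigma> > 0" for \<sigma>
  proof -
    have "(LINT s|lborel. indicator {a..b} s * normal_density 0 \<sigma> (t - s)) = \<bar>- \<sigma>\<bar> *\<^sub>R (LINT u|lborel. indicator {a..b} (t + - \<sigma> * u) * normal_density 0 \<sigma> (t - (t + - \<sigma> * u)))"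
      by (rule lborel_integral_real_affine) (use that in auto)
    also have "\<dots> = (LINT u|lborel. \<sigma> * (indicator {a..b} (t - \<sigma> * u) * normal_density 0 \<sigma> (\<sigma> * u)))"
      using that by simp
    also have "\<dots> = (LINT u|lborel. indicator {a..b} (t - \<sigma> * u) * std_normal_density u)"
      using that by (intro Bochner_Integration.integral_cong) (auto simp: normal_density_def real_sqrt_mult power_mult_distrib)
    finally show ?thesis .
  qed
  have seq: "(\<lambda>n. LINT u|lborel. indicator {a..b} (t - X n * u) * std_normal_density u) \<longlonglongrightarrow> (LINT u|lborel. indicator {a..b} t * std_normal_density u)"
    if X: "X \<longlonglongrightarrow> 0" for X
  proof (rule integral_dominated_convergence)
    show "integrable lborel std_normal_density" by (intro integrable_normal_density) simp
    show "AE u in lborel. (\<lambda>n. indicator {a..b} (t - X n * u) * std_normal_density u) \<longlonglongrightarrow> indicator {a..b} t * std_normal_density u"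
    proof (rule AE_I2, intro tendsto_mult tendsto_const)
      fix u :: real
      have l: "(\<lambda>n. t - X n * u) \<longlonglongrightarrow> t" using X by (auto intro!: tendsto_eq_intros)
      have "isCont (indicator {a..b} :: real \<Rightarrow> real) t"
        using ab by (simp add: isCont_indicator frontier_def)
      then show "(\<lambda>n. indicator {a..b} (t - X n * u) :: real) \<longlonglongrightarrow> indicator {a..b} t"
        using l isCont_tendsto_compose by blast
    qed
  qed (auto simp: indicator_def)
  have "((\<lambda>\<sigma>. LINT u|lborel. indicator {a..b} (t - \<sigma> * u) * std_normal_density u) \<longlongrightarrow> indicator {a..b} t) (at_right 0)"
    unfolding tendsto_at_iff_sequentially o_def using seq by (simp add: integral_normal_density)
  then show ?thesis
    by (rule Lim_transform_eventually) (auto simp: eventually_at_filter eq intro!: always_eventually)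
qed

text \<open>Parseval's identity against an indicator function. Intervals suffice to identify a function, and
  for them the approximate identity converges pointwise off the two endpoints.\<close>

lemma ft_Parseval_interval:
  assumes f: "integrable lborel f" and f2: "square_integrable f"
  shows "(LINT \<xi>|lborel. ft f \<xi> * cnj (ft (indicator {a..b}) \<xi>)) = (LINT x|lborel. f x * indicator {a..b} x)"
proof -
  let ?I = "indicator {a..b} :: real \<Rightarrow> complex"
  have [measurable]: "f \<in> borel_measurable borel" using f by auto
  have I1: "integrable lborel ?I"
  proof -
    have "integrable lborel (\<lambda>x. complex_of_real (indicator {a..b} x))"
      by (intro integrable_of_real integrable_real_indicator) (simp_all add: emeasure_lborel_Icc_eq)
    also have "(\<lambda>x. complex_of_real (indicator {a..b} x)) = ?I" by (auto simp: fun_eq_iff indicator_def)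
    finally show ?thesis .
  qed
  have I2: "square_integrable ?I"
  proof -
    have "(\<lambda>x. (cmod (?I x))\<^sup>2) = indicator {a..b}" by (auto simp: fun_eq_iff indicator_def)
    then show ?thesis by (simp add: square_integrable_def emeasure_lborel_Icc_eq)
  qed
  define e where "e n = 1 / real (Suc n)" for n
  have e: "e n > 0" for n by (simp add: e_def)
  have elim: "e \<longlonglongrightarrow> 0" unfolding e_def using LIMSEQ_inverse_real_of_nat by (simp add: inverse_eq_divide)
  have L1: "(\<lambda>n. LINT \<xi>|lborel. complex_of_real (exp (- e n * \<xi>\<^sup>2)) * (ft f \<xi> * cnj (ft ?I \<xi>))) \<longlonglongrightarrow> (LINT \<xi>|lborel. ft f \<xi> * cnj (ft ?I \<xi>))"
  proof (rule integral_dominated_convergence)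
    show "integrable lborel (\<lambda>\<xi>. cmod (ft f \<xi> * cnj (ft ?I \<xi>)))"
      by (intro integrable_norm integrable_mult_cnj square_integrable_ft f f2 I1 I2)
    show "AE \<xi> in lborel. (\<lambda>n. complex_of_real (exp (- e n * \<xi>\<^sup>2)) * (ft f \<xi> * cnj (ft ?I \<xi>))) \<longlonglongrightarrow> ft f \<xi> * cnj (ft ?I \<xi>)"
    proof (rule AE_I2)
      fix \<xi>
      have "(\<lambda>n. complex_of_real (exp (- e n * \<xi>\<^sup>2)) * (ft f \<xi> * cnj (ft ?I \<xi>))) \<longlonglongrightarrow> complex_of_real (exp (- 0 * \<xi>\<^sup>2)) * (ft f \<xi> * cnj (ft ?I \<xi>))"
        by (intro tendsto_intros elim)
      then show "(\<lambda>n. complex_of_real (exp (- e n * \<xi>\<^sup>2)) * (ft f \<xi> * cnj (ft ?I \<xi>))) \<longlonglongrightarrow> ft f \<xi> * cnj (ft ?I \<xi>)" by simp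
    qed
    have "exp (- e n * \<xi>\<^sup>2) \<le> 1" for n \<xi> using e[of n] by simp
    then show "AE \<xi> in lborel. norm (complex_of_real (exp (- e n * \<xi>\<^sup>2)) * (ft f \<xi> * cnj (ft ?I \<xi>))) \<le> cmod (ft f \<xi> * cnj (ft ?I \<xi>))" for n
      unfolding norm_mult norm_of_real by (intro AE_I2 mult_left_le_one_le) auto
  qed measurable
  have L2: "(\<lambda>n. LINT t|lborel. LINT s|lborel. f t * (cnj (?I s) * complex_of_real (normal_density 0 (sqrt (2 * e n)) (t - s)))) \<longlonglongrightarrow>
     (LINT t|lborel. f t * ?I t)"
  proof -
    define A where "A n t = (LINT s|lborel. indicator {a..b} s * normal_density 0 (sqrt (2 * e n)) (t - s))" for n t
    have [measurable]: "A n \<in> borel_measurable borel" for n unfolding A_def by measurable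
    have eqA: "(LINT s|lborel. f t * (cnj (?I s) * complex_of_real (normal_density 0 (sqrt (2 * e n)) (t - s)))) = f t * complex_of_real (A n t)" for n t
    proof -
      have "(LINT s|lborel. cnj (?I s) * complex_of_real (normal_density 0 (sqrt (2 * e n)) (t - s))) = (LINT s|lborel. complex_of_real (indicator {a..b} s * normal_density 0 (sqrt (2 * e n)) (t - s)))"
        by (intro Bochner_Integration.integral_cong) (auto simp: indicator_def)
      then show ?thesis by (simp only: A_def integral_complex_of_real integral_mult_right_zero)
    qed
    have A1: "\<bar>A n t\<bar> \<le> 1" for n t
    proof -
      have "ennreal (norm (A n t)) \<le> (\<integral>\<^sup>+ s. ennreal (norm (indicator {a..b} s * normal_density 0 (sqrt (2 * e n)) (t - s))) \<partial>lborel)"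
        unfolding A_def by (rule ennreal_norm_integral_le)
      also have "\<dots> \<le> (\<integral>\<^sup>+ s. ennreal (normal_density 0 (sqrt (2 * e n)) (t - s)) \<partial>lborel)"
        by (intro nn_integral_mono ennreal_leI) (auto simp: indicator_def)
      also have "\<dots> = 1" using e[of n] by (intro nn_integral_normal_shift) auto
      finally show ?thesis by simp
    qed
    show ?thesis unfolding eqA
    proof (rule integral_dominated_convergence)
      show "integrable lborel (\<lambda>t. cmod (f t))" using f by auto
      have "AE t in lborel. t \<noteq> a" "AE t in lborel. t \<noteq> b" by (rule AE_lborel_singleton)+
      then show "AE t in lborel. (\<lambda>n. f t * complex_of_real (A n t)) \<longlonglongrightarrow> f t * ?I t"
      proof eventually_elim
        case (elim t)
        have "filterlim (\<lambda>n. sqrt (2 * e n)) (at_right 0) sequentially"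
          using elim e by (auto simp: filterlim_at less_imp_neq[THEN not_sym] intro!: always_eventually tendsto_eq_intros \<open>e \<longlonglongrightarrow> 0\<close>)
        then have "(\<lambda>n. A n t) \<longlonglongrightarrow> indicator {a..b} t"
          unfolding A_def by (rule filterlim_compose[OF normal_average_tendsto[OF elim]])
        then have "(\<lambda>n. f t * complex_of_real (A n t)) \<longlonglongrightarrow> f t * complex_of_real (indicator {a..b} t)"
          by (intro tendsto_intros)
        then show ?case by (cases "t \<in> {a..b}") auto
      qed
      show "AE t in lborel. norm (f t * complex_of_real (A n t)) \<le> cmod (f t)" for n
        using A1 by (auto simp: norm_mult intro!: mult_right_le_one_le)
    qed measurable
  qed
  show ?thesis
    using LIMSEQ_unique[OF L1] L2 unfolding ft_inner_damped(2)[OF f I1 e] by simp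
qed

text \<open>Lebesgue differentiation.\<close>

lemma AE_zero_if_interval_integrals_zero:
  fixes g :: "real \<Rightarrow> complex"
  assumes i: "\<And>a b. set_integrable lborel {a..b} g"
    and z: "\<And>a b. (LINT x|lborel. g x * indicator {a..b} x) = 0"
  shows "AE x in lborel. g x = 0"
proof -
  have hk: "g integrable_on cbox a b" "integral (cbox a b) g = 0" for a b
  proof -
    have "(\<lambda>x. indicat_real {a..b} x *\<^sub>R g x) = (\<lambda>x. g x * indicator {a..b} x)"
      by (auto simp: fun_eq_iff indicator_def)
    then show "g integrable_on cbox a b" "integral (cbox a b) g = 0"
      using set_borel_integral_eq_integral[OF i[of a b]] z[of a b]
      by (simp_all add: set_lebesgue_integral_def)
  qed
  obtain N where N: "negligible N" "\<And>x e. \<lbrakk>x \<notin> N; 0 < e\<rbrakk> \<Longrightarrow>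
       \<exists>d>0. \<forall>h. 0 < h \<and> h < d \<longrightarrow> norm (integral (cbox x (x + h *\<^sub>R One)) g /\<^sub>R h ^ DIM(real) - g x) < e"
    using integrable_ccontinuous_explicit[of g] hk(1) by blast
  have g0: "g x = 0" if xN: "x \<notin> N" for x
  proof (rule ccontr)
    assume "g x \<noteq> 0"
    then obtain d where "d > 0" "\<forall>h. 0 < h \<and> h < d \<longrightarrow> norm (integral (cbox x (x + h *\<^sub>R One)) g /\<^sub>R h ^ DIM(real) - g x) < norm (g x)"
      using N(2)[OF xN, of "norm (g x)"] by auto
    then have "norm (integral (cbox x (x + (d / 2) *\<^sub>R One)) g /\<^sub>R (d / 2) ^ DIM(real) - g x) < norm (g x)"
      by (metis half_gt_zero field_sum_of_halves less_add_same_cancel1)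
    then show False unfolding hk(2) by simp
  qed
  have "AE x in lebesgue. x \<notin> N"
    using N(1) by (intro AE_not_in) (simp add: negligible_iff_null_sets)
  then have "AE x in lebesgue. g x = 0" by (rule eventually_mono) (rule g0)
  then show ?thesis by (simp add: AE_completion_iff)
qed

lemma ft_duality:
  assumes f: "integrable lborel f" and a: "integrable lborel a"
  shows "(LINT \<xi>|lborel. ft f \<xi> * cnj (a \<xi>)) = (LINT x|lborel. f x * cnj (ft a (- x)))"
proof -
  have [measurable]: "a \<in> borel_measurable borel" using a by auto
  have i: "integrable lborel (\<lambda>\<xi>. cnj (a \<xi>) * exp (- 0 * \<xi>\<^sup>2))" using a by simp
  have F: "(LINT \<xi>|lborel. superpose (\<lambda>_. 0) uminus f \<xi> * cnj (a \<xi>)) = (LINT x|lborel. f x * (LINT \<xi>|lborel. cnj (a \<xi>) * wave 0 (- x) \<xi>))"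
    by (rule superpose_Fubini(2)[OF f _ _ _ i]) auto
  have "cnj (ft a (- x)) = complex_of_real (1 / sqrt (2 * pi)) * (LINT \<xi>|lborel. cnj (a \<xi>) * wave 0 (- x) \<xi>)" for x
    unfolding ft_def wave_def cis_conv_exp
    by (simp flip: Bochner_Integration.integral_cnj add: exp_cnj mult_ac)
  then show ?thesis
    unfolding ft_conv_superpose mult.assoc integral_mult_right_zero F
    by (subst integral_mult_right_zero[symmetric]) (simp add: ac_simps)
qed

section \<open>The Hilbert space of square-integrable functions\<close>

lemma l2_eq_refl: "l2_eq f f \<longleftrightarrow> square_integrable f"
  by (auto simp: l2_eq_def)

lemma square_integrable_rep [simp]: "square_integrable (rep_l2 f)"
  using Quotient_rep_reflp[OF Quotient_l2, of f] by (simp add: l2_eq_refl)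

lemma square_integrable_measurable: "square_integrable f \<Longrightarrow> f \<in> borel_measurable borel"
  by (simp add: square_integrable_def)

lemma rep_l2_measurable [measurable]: "rep_l2 f \<in> borel_measurable borel"
  by (rule square_integrable_measurable) simp

lemma abs_rep_l2 [simp]: "abs_l2 (rep_l2 f) = f"
  by (rule Quotient_abs_rep[OF Quotient_l2])

lemma abs_l2_eqI:
  assumes "square_integrable f" "square_integrable g" "AE x in lborel. f x = g x"
  shows "abs_l2 f = abs_l2 g"
  by (rule Quotient_rel_abs[OF Quotient_l2]) (use assms in \<open>simp add: l2_eq_def\<close>)

lemma rep_abs_l2:
  assumes "square_integrable f" shows "AE x in lborel. rep_l2 (abs_l2 f) x = f x"
  using Quotient_rep_abs[OF Quotient_l2, of f] assms by (auto simp: l2_eq_def)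

lemma l2_eqI: "AE x in lborel. rep_l2 f x = rep_l2 g x \<Longrightarrow> f = g"
  using abs_l2_eqI[of "rep_l2 f" "rep_l2 g"] by simp

lemma rep_l2_add: "AE x in lborel. rep_l2 (f + g) x = rep_l2 f x + rep_l2 g x"
  using plus_l2.abs_eq[of "rep_l2 f" "rep_l2 g"] rep_abs_l2[OF square_integrable_add[of "rep_l2 f" "rep_l2 g"]]
  by (simp add: l2_eq_refl)

lemma rep_l2_scaleC: "AE x in lborel. rep_l2 (l2_scaleC c f) x = c * rep_l2 f x"
  using l2_scaleC.abs_eq[of "rep_l2 f" c] rep_abs_l2[OF square_integrable_scale[of "rep_l2 f" c]]
  by (simp add: l2_eq_refl)

lemma rep_l2_diff: "AE x in lborel. rep_l2 (f - g) x = rep_l2 f x - rep_l2 g x"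
proof -
  have eq: "f - g = f + l2_scaleC (-1) g" by (simp add: minus_l2_def uminus_l2_def)
  show ?thesis unfolding eq
    using rep_l2_add[of f "l2_scaleC (-1) g"] rep_l2_scaleC[of "-1" g] by eventually_elim simp
qed

lemma rep_l2_zero: "AE x in lborel. rep_l2 0 x = 0"
  using rep_abs_l2[OF square_integrable_zero] by (simp add: zero_l2_def)

lemma norm_l2_sq: "(norm f)\<^sup>2 = (LINT x|lborel. (cmod (rep_l2 f x))\<^sup>2)"
  by (simp add: norm_l2.rep_eq)

lemma nn_integral_square_integrable:
  "square_integrable f \<Longrightarrow> (\<integral>\<^sup>+ x. ennreal ((cmod (f x))\<^sup>2) \<partial>lborel) = ennreal (LINT x|lborel. (cmod (f x))\<^sup>2)"
  by (rule nn_integral_eq_integral) (auto simp: square_integrable_def)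

lemma ennreal_norm_l2_sq: "ennreal ((norm f)\<^sup>2) = (\<integral>\<^sup>+ x. ennreal ((cmod (rep_l2 f x))\<^sup>2) \<partial>lborel)"
  unfolding norm_l2_sq by (rule nn_integral_square_integrable[symmetric]) simp

lemma norm_abs_l2_sq: "square_integrable f \<Longrightarrow> (norm (abs_l2 f))\<^sup>2 = (LINT x|lborel. (cmod (f x))\<^sup>2)"
  by (simp add: norm_l2.abs_eq l2_eq_refl)

lemma ennreal_norm_abs_l2_sq:
  "square_integrable f \<Longrightarrow> ennreal ((norm (abs_l2 f))\<^sup>2) = (\<integral>\<^sup>+ x. ennreal ((cmod (f x))\<^sup>2) \<partial>lborel)"
  by (simp add: norm_abs_l2_sq nn_integral_square_integrable)

lemma cinner_abs_l2:
  "square_integrable f \<Longrightarrow> square_integrable g \<Longrightarrow> l2_cinner (abs_l2 f) (abs_l2 g) = (LINT x|lborel. f x * cnj (g x))"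
  by (simp add: l2_cinner.abs_eq l2_eq_refl)

lemma cinner_commute: "l2_cinner f g = cnj (l2_cinner g f)"
  unfolding l2_cinner.rep_eq
  by (simp add: Bochner_Integration.integral_cnj[symmetric] mult.commute del: Bochner_Integration.integral_cnj)

lemma cinner_add_left: "l2_cinner (f + g) h = l2_cinner f h + l2_cinner g h"
proof -
  have "l2_cinner (f + g) h = (LINT x|lborel. rep_l2 f x * cnj (rep_l2 h x) + rep_l2 g x * cnj (rep_l2 h x))"
    unfolding l2_cinner.rep_eq using rep_l2_add[of f g]
    by (intro integral_cong_AE) (auto simp: distrib_right)
  also have "\<dots> = l2_cinner f h + l2_cinner g h"
    unfolding l2_cinner.rep_eq by (intro Bochner_Integration.integral_add integrable_mult_cnj) auto
  finally show ?thesis .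
qed

lemma cinner_scaleC_left: "l2_cinner (l2_scaleC c f) g = c * l2_cinner f g"
proof -
  have "l2_cinner (l2_scaleC c f) g = (LINT x|lborel. c * (rep_l2 f x * cnj (rep_l2 g x)))"
    unfolding l2_cinner.rep_eq using rep_l2_scaleC[of c f]
    by (intro integral_cong_AE) (auto simp: mult.assoc)
  then show ?thesis by (simp add: l2_cinner.rep_eq)
qed

lemma cinner_diff_left: "l2_cinner (f - g) h = l2_cinner f h - l2_cinner g h"
  by (simp add: minus_l2_def uminus_l2_def cinner_add_left cinner_scaleC_left)

lemma cinner_diff_right: "l2_cinner h (f - g) = l2_cinner h f - l2_cinner h g"
  by (metis cinner_commute cinner_diff_left complex_cnj_diff)

lemma cinner_self: "l2_cinner f f = complex_of_real ((norm f)\<^sup>2)"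
  unfolding l2_cinner.rep_eq norm_l2_sq
  by (simp only: complex_norm_square[symmetric] integral_complex_of_real)

lemma cinner_scaleC_right: "l2_cinner f (l2_scaleC c g) = cnj c * l2_cinner f g"
  using cinner_scaleC_left[of c g f] cinner_commute[of f g] cinner_commute[of f "l2_scaleC c g"] by simp

lemma norm_scaleC: "norm (l2_scaleC c f) = cmod c * norm f"
proof -
  have "complex_of_real ((norm (l2_scaleC c f))\<^sup>2) = c * cnj c * complex_of_real ((norm f)\<^sup>2)"
    unfolding cinner_self[symmetric] cinner_scaleC_left cinner_scaleC_right by simp
  also have "\<dots> = complex_of_real ((cmod c * norm f)\<^sup>2)"
    by (simp add: power_mult_distrib flip: complex_norm_square)
  finally have "(norm (l2_scaleC c f))\<^sup>2 = (cmod c * norm f)\<^sup>2" by (simp only: of_real_eq_iff)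
  then show ?thesis by (simp add: power2_eq_iff_nonneg)
qed

lemma l2_scaleC_diff: "l2_scaleC c (f - g) = l2_scaleC c f - l2_scaleC c g"
proof (rule l2_eqI)
  show "AE x in lborel. rep_l2 (l2_scaleC c (f - g)) x = rep_l2 (l2_scaleC c f - l2_scaleC c g) x"
    using rep_l2_scaleC[of c "f - g"] rep_l2_diff[of "l2_scaleC c f" "l2_scaleC c g"] rep_l2_diff[of f g] rep_l2_scaleC[of c f] rep_l2_scaleC[of c g]
    by eventually_elim (simp add: right_diff_distrib)
qed

lemma cinner_Cauchy_Schwarz: "cmod (l2_cinner f g) \<le> norm f * norm g"
proof -
  define c where "c = sgn (cnj (l2_cinner f g))"
  have "c * l2_cinner f g = complex_of_real (cmod (l2_cinner f g))"
    by (cases "l2_cinner f g = 0") (auto simp: c_def sgn_div_norm scaleR_conv_of_real field_simps complex_norm_square[symmetric] power2_eq_square)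
  then have "cmod (l2_cinner f g) = inner (l2_scaleC c f) g"
    by (simp add: inner_l2_def cinner_scaleC_left)
  also have "\<dots> \<le> norm (l2_scaleC c f) * norm g" by (rule norm_cauchy_schwarz)
  also have "\<dots> \<le> norm f * norm g"
    by (intro mult_right_mono) (auto simp: norm_scaleC c_def norm_sgn mult_left_le_one_le)
  finally show ?thesis .
qed

lemma cinner_tendsto:
  assumes "(X \<longlongrightarrow> f) F" "(Y \<longlongrightarrow> g) F"
  shows "((\<lambda>n. l2_cinner (X n) (Y n)) \<longlongrightarrow> l2_cinner f g) F"
proof -
  have "((\<lambda>n. norm (X n - f) * norm (Y n) + norm f * norm (Y n - g)) \<longlongrightarrow> 0 * norm g + norm f * 0) F"
    using assms by (intro tendsto_intros) (auto intro: tendsto_norm_zero simp: LIM_zero)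
  then have z: "((\<lambda>n. norm (X n - f) * norm (Y n) + norm f * norm (Y n - g)) \<longlongrightarrow> 0) F" by simp
  have "cmod (l2_cinner (X n) (Y n) - l2_cinner f g) \<le> norm (X n - f) * norm (Y n) + norm f * norm (Y n - g)" for n
  proof -
    have "l2_cinner (X n) (Y n) - l2_cinner f g = l2_cinner (X n - f) (Y n) + l2_cinner f (Y n - g)"
      by (simp add: cinner_diff_left cinner_diff_right)
    also have "cmod \<dots> \<le> cmod (l2_cinner (X n - f) (Y n)) + cmod (l2_cinner f (Y n - g))" by (rule norm_triangle_ineq)
    also have "\<dots> \<le> norm (X n - f) * norm (Y n) + norm f * norm (Y n - g)"
      by (intro add_mono cinner_Cauchy_Schwarz)
    finally show ?thesis .
  qed
  then have "((\<lambda>n. l2_cinner (X n) (Y n) - l2_cinner f g) \<longlongrightarrow> 0) F"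
    by (intro Lim_null_comparison[OF _ z]) (auto intro: always_eventually)
  then show ?thesis by (simp add: LIM_zero_iff)
qed

lemma cinner_eqI: "(\<And>h. l2_cinner f h = l2_cinner g h) \<Longrightarrow> f = g"
proof -
  assume "\<And>h. l2_cinner f h = l2_cinner g h"
  then have "l2_cinner (f - g) (f - g) = 0" by (simp add: cinner_diff_left)
  then show "f = g" by (simp add: cinner_self)
qed

text \<open>The heart of completeness of $L^p$: if successive differences decay geometrically in the $p$-th
  mean, then they are almost everywhere summable.\<close>

lemma fast_Lp_AE_convergent:
  fixes F :: "nat \<Rightarrow> 'a \<Rightarrow> complex" and p :: nat
  assumes [measurable]: "\<And>n. F n \<in> borel_measurable M" and p: "p > 0"
    and fast: "\<And>n. (\<integral>\<^sup>+ x. ennreal (cmod (F (Suc n) x - F n x) ^ p) \<partial>M) \<le> ennreal (K * (1/4) ^ n)"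
    and K: "K \<ge> 0"
  shows "AE x in M. convergent (\<lambda>n. F n x)"
proof -
  define d where "d n x = cmod (F (Suc n) x - F n x)" for n x
  have [measurable]: "d n \<in> borel_measurable M" for n unfolding d_def by measurable
  have "(\<integral>\<^sup>+ x. (\<Sum>n. ennreal (2 ^ n) * ennreal (d n x ^ p)) \<partial>M) = (\<Sum>n. ennreal (2 ^ n) * (\<integral>\<^sup>+ x. ennreal (d n x ^ p) \<partial>M))"
    by (subst nn_integral_suminf, measurable) (subst nn_integral_cmult, auto)
  also have "\<dots> \<le> (\<Sum>n. ennreal (2 ^ n) * ennreal (K * (1/4) ^ n))"
    unfolding d_def by (intro suminf_le mult_left_mono fast) auto
  also have "\<dots> = (\<Sum>n. ennreal (K * (1/2) ^ n))"
  proof (intro suminf_cong)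
    fix n
    have "2 ^ n * (K * (1/4) ^ n) = K * (2 * (1/4)) ^ n" unfolding power_mult_distrib by simp
    then show "ennreal (2 ^ n) * ennreal (K * (1/4) ^ n) = ennreal (K * (1/2) ^ n)"
      using K by (simp flip: ennreal_mult)
  qed
  also have "\<dots> = ennreal (\<Sum>n. K * (1/2) ^ n)"
    using K by (intro suminf_ennreal_eq summable_sums summable_mult) auto
  also have "\<dots> < \<infinity>" by simp
  finally have "AE x in M. (\<Sum>n. ennreal (2 ^ n) * ennreal (d n x ^ p)) \<noteq> \<infinity>"
    by (intro nn_integral_PInf_AE) auto
  then show ?thesis
  proof eventually_elim
    case (elim x)
    define B where "B = enn2real (\<Sum>n. ennreal (2 ^ n) * ennreal (d n x ^ p))"
    have B: "(\<Sum>n. ennreal (2 ^ n) * ennreal (d n x ^ p)) = ennreal B" "B \<ge> 0"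
      using elim by (auto simp: B_def less_top)
    have bd: "d n x \<le> root p B * root p (1/2) ^ n" for n
    proof -
      have "ennreal (2 ^ n * d n x ^ p) = ennreal (2 ^ n) * ennreal (d n x ^ p)"
        by (simp add: ennreal_mult d_def)
      also have "\<dots> = (\<Sum>k\<in>{n}. ennreal (2 ^ k) * ennreal (d k x ^ p))" by simp
      also have "\<dots> \<le> ennreal B" unfolding B(1)[symmetric] by (intro sum_le_suminf) auto
      finally have "2 ^ n * d n x ^ p \<le> B" using B by (simp add: ennreal_le_iff)
      then have "d n x ^ p \<le> B * (1/2) ^ n" by (simp add: power_divide field_simps)
      then have "root p (d n x ^ p) \<le> root p (B * (1/2) ^ n)" using p by (intro real_root_le_mono) auto
      then show ?thesis using p by (simp add: real_root_mult real_root_power d_def real_root_power_cancel)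
    qed
    have "root p (1/2) < 1" "root p (1/2) \<ge> 0" using p by simp_all
    then have "summable (\<lambda>n. root p B * root p (1/2) ^ n)"
      by (intro summable_mult summable_geometric) auto
    then have "summable (\<lambda>n. F (Suc n) x - F n x)"
      by (rule summable_comparison_test') (use bd in \<open>auto simp: d_def\<close>)
    then have "convergent (\<lambda>n. \<Sum>k<n. F (Suc k) x - F k x)" by (simp add: summable_iff_convergent)
    then have "convergent (\<lambda>n. F n x - F 0 x)" using sum_lessThan_telescope[of "\<lambda>n. F n x"] by simp
    then show ?case by (simp add: convergent_diff_const_right_iff)
  qed
qed

text \<open>A subsequence so sparse that the distances to all later terms are summable.\<close>

lemma Cauchy_fast_subseq:
  fixes X :: "nat \<Rightarrow> 'a::metric_space"
  assumes "Cauchy X"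
  obtains r :: "nat \<Rightarrow> nat" where "strict_mono r" "\<And>n m. m \<ge> r n \<Longrightarrow> dist (X m) (X (r n)) \<le> (1/2) ^ n"
proof -
  have "\<exists>N. \<forall>m\<ge>N. \<forall>k\<ge>N. dist (X m) (X k) < (1/2) ^ n" for n
    using assms by (intro metric_CauchyD) auto
  then obtain N where N: "\<And>n m k. m \<ge> N n \<Longrightarrow> k \<ge> N n \<Longrightarrow> dist (X m) (X k) < (1/2) ^ n" by metis
  define r where "r n = n + (\<Sum>k\<le>n. N k)" for n
  have "strict_mono r" by (intro strict_monoI_Suc) (simp add: r_def)
  moreover have "dist (X m) (X (r n)) \<le> (1/2) ^ n" if "m \<ge> r n" for n m
  proof -
    have "N n \<le> (\<Sum>k\<le>n. N k)" by (intro member_le_sum) auto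
    then have "r n \<ge> N n" by (simp add: r_def)
    then show ?thesis using N[of n m "r n"] that by auto
  qed
  ultimately show ?thesis using that by blast
qed

lemma l2_tendsto_AE_unique:
  assumes conv: "X \<longlonglongrightarrow> f" and pt: "AE x in lborel. (\<lambda>n. rep_l2 (X n) x) \<longlonglongrightarrow> g x"
  shows "AE x in lborel. rep_l2 f x = g x"
proof -
  obtain r where r: "strict_mono r" "\<And>n m. m \<ge> r n \<Longrightarrow> dist (X m) (X (r n)) \<le> (1/2) ^ n"
    using Cauchy_fast_subseq[OF LIMSEQ_imp_Cauchy[OF conv]] by blast
  have lim: "(\<lambda>m. X m) \<longlonglongrightarrow> f" using conv by simp
  have df: "dist f (X (r n)) \<le> (1/2) ^ n" for n
    by (rule tendsto_upperbound[OF tendsto_dist[OF lim tendsto_const]])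
       (auto intro!: r(2) eventually_sequentiallyI[of "r n"])
  define d where "d n x = cmod (rep_l2 f x - rep_l2 (X (r n)) x)" for n x
  \<comment> \<open>Summability of the squared distances forces pointwise convergence almost everywhere.\<close>
  have "(\<integral>\<^sup>+ x. (\<Sum>n. ennreal (d n x ^ 2)) \<partial>lborel) = (\<Sum>n. (\<integral>\<^sup>+ x. ennreal (d n x ^ 2) \<partial>lborel))"
    unfolding d_def by (subst nn_integral_suminf) auto
  also have "\<dots> = (\<Sum>n. ennreal ((dist f (X (r n)))\<^sup>2))"
  proof (intro suminf_cong)
    fix n
    show "(\<integral>\<^sup>+ x. ennreal (d n x ^ 2) \<partial>lborel) = ennreal ((dist f (X (r n)))\<^sup>2)"
      unfolding dist_norm ennreal_norm_l2_sq d_def using rep_l2_diff[of f "X (r n)"]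
      by (intro nn_integral_cong_AE) auto
  qed
  also have "\<dots> \<le> (\<Sum>n. ennreal ((1/2) ^ n))"
  proof (intro suminf_le ennreal_leI)
    fix n
    have "(dist f (X (r n)))\<^sup>2 \<le> ((1/2) ^ n)\<^sup>2" by (intro power_mono df) auto
    also have "\<dots> \<le> (1/2) ^ n" by (simp add: power2_eq_square mult_left_le_one_le power_le_one)
    finally show "(dist f (X (r n)))\<^sup>2 \<le> (1/2) ^ n" .
  qed auto
  also have "\<dots> = ennreal (\<Sum>n. (1/2) ^ n)" by (intro suminf_ennreal_eq summable_sums) auto
  also have "\<dots> < \<infinity>" by simp
  finally have "AE x in lborel. (\<Sum>n. ennreal (d n x ^ 2)) \<noteq> \<infinity>"
    by (intro nn_integral_PInf_AE) (auto simp: d_def)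
  then show ?thesis using pt
  proof eventually_elim
    case (elim x)
    have "summable (\<lambda>n. d n x ^ 2)" using elim(1) by (intro summable_suminf_not_top) (auto simp: d_def)
    then have "(\<lambda>n. sqrt (d n x ^ 2)) \<longlonglongrightarrow> sqrt 0" by (intro tendsto_real_sqrt summable_LIMSEQ_zero)
    then have "(\<lambda>n. cmod (rep_l2 (X (r n)) x - rep_l2 f x)) \<longlonglongrightarrow> 0" by (simp add: d_def norm_minus_commute)
    then have "(\<lambda>n. rep_l2 (X (r n)) x) \<longlonglongrightarrow> rep_l2 f x" by (simp add: tendsto_norm_zero_iff LIM_zero_iff)
    moreover have "(\<lambda>n. rep_l2 (X (r n)) x) \<longlonglongrightarrow> g x" using LIMSEQ_subseq_LIMSEQ[OF elim(2) r(1)] by (simp add: o_def)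
    ultimately show ?case by (rule LIMSEQ_unique)
  qed
qed

text \<open>The Riesz--Fischer theorem.\<close>

instance l2 :: complete_space
proof
  fix X :: "nat \<Rightarrow> l2" assume C: "Cauchy X"
  obtain r where r: "strict_mono r" "\<And>n m. m \<ge> r n \<Longrightarrow> dist (X m) (X (r n)) \<le> (1/2) ^ n"
    using Cauchy_fast_subseq[OF C] by blast
  define F where "F n = rep_l2 (X (r n))" for n
  have [measurable]: "F n \<in> borel_measurable borel" for n by (simp add: F_def)
  have dF: "(\<integral>\<^sup>+ x. ennreal (cmod (F m x - F n x) ^ 2) \<partial>lborel) \<le> ennreal ((1/4) ^ n)" if "m \<ge> n" for m n
  proof -
    have "(\<integral>\<^sup>+ x. ennreal (cmod (F m x - F n x) ^ 2) \<partial>lborel) = ennreal ((norm (X (r m) - X (r n)))\<^sup>2)"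
      unfolding ennreal_norm_l2_sq F_def using rep_l2_diff[of "X (r m)" "X (r n)"]
      by (intro nn_integral_cong_AE) auto
    also have "(norm (X (r m) - X (r n)))\<^sup>2 \<le> ((1/2) ^ n)\<^sup>2"
      using r(2)[of n "r m"] strict_mono_less_eq[OF r(1)] that by (intro power_mono) (auto simp: dist_norm)
    also have "((1/2) ^ n)\<^sup>2 = (1/4::real) ^ n" by (simp add: power2_eq_square flip: power_mult_distrib)
    finally show ?thesis by (simp add: ennreal_leI)
  qed
  have cv: "AE x in lborel. convergent (\<lambda>n. F n x)"
    by (rule fast_Lp_AE_convergent[where p=2 and K=1]) (use dF in auto)
  define f where "f x = lim (\<lambda>n. F n x)" for x
  have [measurable]: "f \<in> borel_measurable borel" unfolding f_def by measurable
  have pt: "AE x in lborel. (\<lambda>n. F n x) \<longlonglongrightarrow> f x"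
    using cv by eventually_elim (simp add: f_def convergent_LIMSEQ_iff)
  have df: "(\<integral>\<^sup>+ x. ennreal (cmod (f x - F n x) ^ 2) \<partial>lborel) \<le> ennreal ((1/4) ^ n)" for n
  proof -
    have "(\<integral>\<^sup>+ x. ennreal (cmod (f x - F n x) ^ 2) \<partial>lborel) = (\<integral>\<^sup>+ x. liminf (\<lambda>m. ennreal (cmod (F m x - F n x) ^ 2)) \<partial>lborel)"
    proof (rule nn_integral_cong_AE, use pt in eventually_elim)
      case (elim x)
      have "(\<lambda>m. ennreal (cmod (F m x - F n x) ^ 2)) \<longlonglongrightarrow> ennreal (cmod (f x - F n x) ^ 2)"
        by (intro tendsto_intros elim)
      then show "ennreal (cmod (f x - F n x) ^ 2) = liminf (\<lambda>m. ennreal (cmod (F m x - F n x) ^ 2))"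
        using lim_imp_Liminf by (metis sequentially_bot)
    qed
    also have "\<dots> \<le> liminf (\<lambda>m. \<integral>\<^sup>+ x. ennreal (cmod (F m x - F n x) ^ 2) \<partial>lborel)"
      by (intro nn_integral_liminf) measurable
    also have "\<dots> \<le> liminf (\<lambda>m::nat. ennreal ((1/4) ^ n))"
      by (intro Liminf_mono eventually_sequentiallyI[of n] dF)
    also have "\<dots> = ennreal ((1/4) ^ n)" by (rule Liminf_const) simp
    finally show ?thesis .
  qed
  have sf: "square_integrable f"
  proof -
    have "square_integrable (\<lambda>x. f x - F 0 x)"
      using df[of 0] unfolding square_integrable_iff_nn by (auto simp: less_top[symmetric] top_unique)
    then have "square_integrable (\<lambda>x. (f x - F 0 x) + F 0 x)" by (intro square_integrable_add) (auto simp: F_def)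
    then show ?thesis by simp
  qed
  have bound: "norm (X (r n) - abs_l2 f) \<le> (1/2) ^ n" for n
  proof -
    have "ennreal ((norm (X (r n) - abs_l2 f))\<^sup>2) = (\<integral>\<^sup>+ x. ennreal (cmod (f x - F n x) ^ 2) \<partial>lborel)"
      unfolding ennreal_norm_l2_sq F_def using rep_l2_diff[of "X (r n)" "abs_l2 f"] rep_abs_l2[OF sf]
      by (intro nn_integral_cong_AE) (auto simp: norm_minus_commute)
    also have "\<dots> \<le> ennreal ((1/4) ^ n)" by (rule df)
    finally have "(norm (X (r n) - abs_l2 f))\<^sup>2 \<le> (1/4) ^ n" by (simp add: ennreal_le_iff)
    also have "(1/4::real) ^ n = ((1/2) ^ n)\<^sup>2" by (simp add: power2_eq_square flip: power_mult_distrib)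
    finally show ?thesis by (rule power2_le_imp_le) simp
  qed
  have "(\<lambda>n. X (r n)) \<longlonglongrightarrow> abs_l2 f"
    unfolding LIM_zero_iff[symmetric, of "\<lambda>n. X (r n)"]
    by (rule Lim_null_comparison[of _ "\<lambda>n. (1/2) ^ n"]) (use bound in \<open>auto intro!: always_eventually LIMSEQ_realpow_zero\<close>)
  then show "convergent X"
    using Cauchy_converges_subseq[of X r] C r(1) by (auto simp: convergent_def o_def intro: Cauchy_converges_subseq)
qed

instance l2 :: banach ..

section \<open>The Fourier transform on the Hilbert space\<close>

definition cutoff :: "nat \<Rightarrow> (real \<Rightarrow> complex) \<Rightarrow> real \<Rightarrow> complex" where
  "cutoff n f x = indicator {- real n..real n} x * f x"

lemma cutoff_measurable [measurable]:
  assumes [measurable]: "f \<in> borel_measurable borel" shows "cutoff n f \<in> borel_measurable borel"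
  unfolding cutoff_def by measurable

lemma square_integrable_bound:
  assumes "square_integrable f" "g \<in> borel_measurable borel" "\<And>x. cmod (g x) \<le> cmod (f x)"
  shows "square_integrable g"
  unfolding square_integrable_def
proof
  show "integrable lborel (\<lambda>x. (cmod (g x))\<^sup>2)"
    by (rule Bochner_Integration.integrable_bound[of _ "\<lambda>x. (cmod (f x))\<^sup>2"])
       (use assms in \<open>auto simp: square_integrable_def power_mono\<close>)
qed (use assms in auto)

lemma square_integrable_cutoff:
  assumes "square_integrable f" shows "square_integrable (cutoff n f)"
  by (rule square_integrable_bound[OF assms]) (use assms in \<open>auto simp: cutoff_def norm_mult indicator_def intro: cutoff_measurable square_integrable_measurable\<close>)

lemma square_integrable_indicator_interval: "square_integrable (indicator {a..b})"
proof -
  have "(\<lambda>x. (cmod (indicator {a..b} x))\<^sup>2) = indicator {a..b}" by (auto simp: fun_eq_iff indicator_def)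
  then show ?thesis by (simp add: square_integrable_def emeasure_lborel_Icc_eq)
qed

lemma integrable_mult_indicator_interval:
  assumes "square_integrable f" shows "integrable lborel (\<lambda>x. f x * indicator {a..b} x)"
proof -
  have "cnj (indicator {a..b} x) = indicator {a..b} x" for x :: real by (simp add: indicator_def)
  then show ?thesis
    using integrable_mult_cnj[OF assms square_integrable_indicator_interval[of a b]] by simp
qed

lemma integrable_cutoff:
  assumes "square_integrable f" shows "integrable lborel (cutoff n f)"
  using integrable_mult_indicator_interval[OF assms, of "- real n" "real n"] by (simp add: cutoff_def[abs_def] mult.commute)

lemma cutoff_tendsto: "(\<lambda>n. cutoff n f x) \<longlonglongrightarrow> f x"
proof (rule tendsto_eventually)
  show "\<forall>\<^sub>F n in sequentially. cutoff n f x = f x"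
    using eventually_ge_at_top[of "nat \<lceil>\<bar>x\<bar>\<rceil>"]
  proof eventually_elim
    case (elim n)
    then have "x \<in> {- real n..real n}" by (simp add: nat_le_iff ceiling_le_iff abs_le_iff)
    then show ?case by (simp add: cutoff_def)
  qed
qed

lemma l2_tendsto_dominated:
  assumes f: "square_integrable f" and g: "\<And>n. square_integrable (g n)"
    and b: "\<And>n x. cmod (g n x) \<le> cmod (f x)" and l: "\<And>x. (\<lambda>n. g n x) \<longlonglongrightarrow> f x"
  shows "(\<lambda>n. abs_l2 (g n)) \<longlonglongrightarrow> abs_l2 f"
proof -
  have [measurable]: "f \<in> borel_measurable borel" "g n \<in> borel_measurable borel" for n
    using f g by (auto intro: square_integrable_measurable)
  have "(\<lambda>n. LINT x|lborel. (cmod (g n x - f x))\<^sup>2) \<longlonglongrightarrow> (LINT x|(lborel :: real measure). 0)"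
  proof (rule integral_dominated_convergence[where w="\<lambda>x. 4 * (cmod (f x))\<^sup>2"])
    show "integrable lborel (\<lambda>x. 4 * (cmod (f x))\<^sup>2)" using f by (simp add: square_integrable_def)
    show "AE x in lborel. (\<lambda>n. (cmod (g n x - f x))\<^sup>2) \<longlonglongrightarrow> 0"
    proof (rule AE_I2)
      fix x
      have "(\<lambda>n. (cmod (g n x - f x))\<^sup>2) \<longlonglongrightarrow> (cmod (f x - f x))\<^sup>2" by (intro tendsto_intros l)
      then show "(\<lambda>n. (cmod (g n x - f x))\<^sup>2) \<longlonglongrightarrow> 0" by simp
    qed
    show "AE x in lborel. norm ((cmod (g n x - f x))\<^sup>2) \<le> 4 * (cmod (f x))\<^sup>2" for n
    proof (rule AE_I2)
      fix x
      have "cmod (g n x - f x) \<le> 2 * cmod (f x)" using norm_triangle_ineq4[of "g n x" "f x"] b[of n x] by linarith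
      then have "(cmod (g n x - f x))\<^sup>2 \<le> (2 * cmod (f x))\<^sup>2" by (intro power_mono) auto
      then show "norm ((cmod (g n x - f x))\<^sup>2) \<le> 4 * (cmod (f x))\<^sup>2" by (simp add: power_mult_distrib)
    qed
  qed measurable
  moreover have "(LINT x|lborel. (cmod (g n x - f x))\<^sup>2) = (norm (abs_l2 (g n) - abs_l2 f))\<^sup>2" for n
    unfolding norm_l2_sq using rep_l2_diff[of "abs_l2 (g n)" "abs_l2 f"] rep_abs_l2[OF g[of n]] rep_abs_l2[OF f]
    by (intro integral_cong_AE) auto
  ultimately have "(\<lambda>n. (norm (abs_l2 (g n) - abs_l2 f))\<^sup>2) \<longlonglongrightarrow> 0" by simp
  then have "(\<lambda>n. sqrt ((norm (abs_l2 (g n) - abs_l2 f))\<^sup>2)) \<longlonglongrightarrow> sqrt 0" by (rule tendsto_real_sqrt)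
  then have "(\<lambda>n. norm (abs_l2 (g n) - abs_l2 f)) \<longlonglongrightarrow> 0" by simp
  then show ?thesis by (simp add: tendsto_norm_zero_iff LIM_zero_iff)
qed

lemma l2_cutoff_tendsto: "(\<lambda>n. abs_l2 (cutoff n (rep_l2 f))) \<longlonglongrightarrow> f"
  using l2_tendsto_dominated[of "rep_l2 f" "\<lambda>n. cutoff n (rep_l2 f)"]
  by (simp add: square_integrable_cutoff cutoff_tendsto) (simp add: cutoff_def norm_mult indicator_def)

lemma ft_add: "integrable lborel f \<Longrightarrow> integrable lborel g \<Longrightarrow> ft (\<lambda>x. f x + g x) \<xi> = ft f \<xi> + ft g \<xi>"
proof -
  assume f: "integrable lborel f" and g: "integrable lborel g"
  have *: "integrable lborel (\<lambda>x. cis (- (x * \<xi>)) * f x)" if f: "integrable lborel f" for f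
    by (rule Bochner_Integration.integrable_bound[OF f]) (use f in \<open>auto simp: norm_mult cis_conv_exp\<close>)
  show ?thesis unfolding ft_def distrib_left
    by (subst Bochner_Integration.integral_add) (auto intro: * f g simp: distrib_left)
qed

lemma ft_scale: "ft (\<lambda>x. c * f x) \<xi> = c * ft f \<xi>"
proof -
  have "ft (\<lambda>x. c * f x) \<xi> = complex_of_real (1 / sqrt (2 * pi)) * (LINT x|lborel. c * (cis (- (x * \<xi>)) * f x))"
    unfolding ft_def by (simp only: mult.left_commute)
  then show ?thesis by (simp add: ft_def)
qed

lemma ft_cong_AE:
  assumes [measurable]: "f \<in> borel_measurable borel" "g \<in> borel_measurable borel" and "AE x in lborel. f x = g x"
  shows "ft f \<xi> = ft g \<xi>"
  unfolding ft_def cis_conv_exp using assms(3)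
  by (intro arg_cong2[where f="(*)"] refl integral_cong_AE) auto

lemma norm_ft_le:
  assumes f: "integrable lborel f" "square_integrable f"
  shows "norm (abs_l2 (ft f)) \<le> norm (abs_l2 f)"
proof -
  have "ennreal ((norm (abs_l2 (ft f)))\<^sup>2) \<le> ennreal ((norm (abs_l2 f))\<^sup>2)"
    unfolding ennreal_norm_abs_l2_sq[OF f(2)] ennreal_norm_abs_l2_sq[OF square_integrable_ft[OF f]]
    by (rule ft_contraction[OF f])
  then show ?thesis by (simp add: ennreal_le_iff power2_le_iff_abs_le power_mono_iff)
qed

lemma abs_l2_diff:
  assumes "square_integrable f" "square_integrable g"
  shows "abs_l2 f - abs_l2 g = abs_l2 (\<lambda>x. f x - g x)"
proof -
  have s: "square_integrable (\<lambda>x. f x - g x)"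
    using square_integrable_add[OF assms(1) square_integrable_scale[OF assms(2), of "-1"]] by simp
  show ?thesis
    by (rule l2_eqI) (use rep_l2_diff[of "abs_l2 f" "abs_l2 g"] rep_abs_l2[OF assms(1)] rep_abs_l2[OF assms(2)] rep_abs_l2[OF s] in
        \<open>eventually_elim, simp\<close>)
qed

lemma norm_ft_diff_le:
  assumes f: "integrable lborel f" "square_integrable f" and g: "integrable lborel g" "square_integrable g"
  shows "norm (abs_l2 (ft f) - abs_l2 (ft g)) \<le> norm (abs_l2 f - abs_l2 g)"
proof -
  have i: "integrable lborel (\<lambda>x. f x - g x)" using f g by auto
  have s: "square_integrable (\<lambda>x. f x - g x)"
    using square_integrable_add[OF f(2) square_integrable_scale[OF g(2), of "-1"]] by simp
  have "ft (\<lambda>x. f x - g x) = (\<lambda>\<xi>. ft f \<xi> - ft g \<xi>)"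
    using ft_add[OF f(1), of "\<lambda>x. (-1) * g x"] g(1) ft_scale[of "-1" g] by (auto simp: fun_eq_iff)
  then show ?thesis
    using norm_ft_le[OF i s] by (simp add: abs_l2_diff f g square_integrable_ft)
qed

lemma fourier_conv_cutoff: "fourier f = lim (\<lambda>n. abs_l2 (ft (cutoff n (rep_l2 f))))"
proof -
  have "(\<lambda>\<xi>. complex_of_real (1 / sqrt (2 * pi)) * (LINT x:{- real n..real n}|lborel. cis (- (x * \<xi>)) * rep_l2 f x)) = ft (cutoff n (rep_l2 f))" for n
    unfolding ft_def set_lebesgue_integral_def fun_eq_iff
    by (intro allI arg_cong2[where f="(*)"] refl Bochner_Integration.integral_cong) (auto simp: cutoff_def indicator_def)
  then show ?thesis by (simp add: fourier_def)
qed

text \<open>The truncations converge and the transform is a contraction on them, so their transforms form a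
  Cauchy sequence.\<close>

lemma fourier_limit: "(\<lambda>n. abs_l2 (ft (cutoff n (rep_l2 f)))) \<longlonglongrightarrow> fourier f"
proof -
  let ?X = "\<lambda>n. abs_l2 (ft (cutoff n (rep_l2 f)))"
  let ?Y = "\<lambda>n. abs_l2 (cutoff n (rep_l2 f))"
  have "Cauchy ?Y" using l2_cutoff_tendsto LIMSEQ_imp_Cauchy by blast
  have "Cauchy ?X"
  proof (rule metric_CauchyI)
    fix e :: real assume "e > 0"
    then obtain M where M: "\<And>m n. m \<ge> M \<Longrightarrow> n \<ge> M \<Longrightarrow> dist (?Y m) (?Y n) < e"
      using metric_CauchyD[OF \<open>Cauchy ?Y\<close>] by metis
    have "dist (?X m) (?X n) \<le> dist (?Y m) (?Y n)" for m n
      unfolding dist_norm by (intro norm_ft_diff_le integrable_cutoff square_integrable_cutoff) auto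
    then show "\<exists>M. \<forall>m\<ge>M. \<forall>n\<ge>M. dist (?X m) (?X n) < e" using M le_less_trans by meson
  qed
  then show ?thesis unfolding fourier_conv_cutoff by (simp add: Cauchy_convergent_iff convergent_LIMSEQ_iff)
qed

lemma norm_fourier_le: "norm (fourier f - fourier g) \<le> norm (f - g)"
proof (rule tendsto_le[OF _ tendsto_norm[OF tendsto_diff[OF l2_cutoff_tendsto l2_cutoff_tendsto]]
    tendsto_norm[OF tendsto_diff[OF fourier_limit fourier_limit]]])
  show "\<forall>\<^sub>F n in sequentially. norm (abs_l2 (ft (cutoff n (rep_l2 f))) - abs_l2 (ft (cutoff n (rep_l2 g))))
     \<le> norm (abs_l2 (cutoff n (rep_l2 f)) - abs_l2 (cutoff n (rep_l2 g)))"
    by (intro always_eventually allI norm_ft_diff_le integrable_cutoff square_integrable_cutoff) auto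
qed simp

lemma fourier_continuous:
  assumes "X \<longlonglongrightarrow> f" shows "(\<lambda>n. fourier (X n)) \<longlonglongrightarrow> fourier f"
proof -
  have "(\<lambda>n. norm (X n - f)) \<longlonglongrightarrow> 0" using assms by (simp add: tendsto_norm_zero_iff LIM_zero_iff)
  then have "(\<lambda>n. fourier (X n) - fourier f) \<longlonglongrightarrow> 0"
    by (rule Lim_null_comparison[rotated]) (auto intro!: always_eventually norm_fourier_le)
  then show ?thesis by (simp add: LIM_zero_iff)
qed

lemma fourier_abs_l2:
  assumes f: "integrable lborel f" "square_integrable f"
  shows "fourier (abs_l2 f) = abs_l2 (ft f)"
proof (rule LIMSEQ_unique[OF fourier_limit])
  let ?c = "\<lambda>n. cutoff n (rep_l2 (abs_l2 f))"
  have [measurable]: "f \<in> borel_measurable borel" using f by auto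
  have eq: "ft (?c n) = ft (cutoff n f)" for n
    by (intro ext ft_cong_AE) (use rep_abs_l2[OF f(2)] in \<open>auto simp: cutoff_def\<close>)
  have "(\<lambda>n. norm (abs_l2 (cutoff n f) - abs_l2 f)) \<longlonglongrightarrow> 0"
    using l2_tendsto_dominated[of f "\<lambda>n. cutoff n f"] f
    by (simp add: square_integrable_cutoff cutoff_tendsto tendsto_norm_zero_iff LIM_zero_iff) (simp add: cutoff_def norm_mult indicator_def)
  then have "(\<lambda>n. abs_l2 (ft (cutoff n f)) - abs_l2 (ft f)) \<longlonglongrightarrow> 0"
    by (rule Lim_null_comparison[rotated]) (auto intro!: always_eventually norm_ft_diff_le integrable_cutoff square_integrable_cutoff f)
  then show "(\<lambda>n. abs_l2 (ft (?c n))) \<longlonglongrightarrow> abs_l2 (ft f)" by (simp add: LIM_zero_iff eq)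
qed

lemma square_integrable_reflect:
  assumes "square_integrable f" shows "square_integrable (\<lambda>x. f (- x))"
proof -
  have [measurable]: "f \<in> borel_measurable borel" using assms by (rule square_integrable_measurable)
  show ?thesis
    unfolding square_integrable_def
  proof
    have "integrable lborel (\<lambda>x. (cmod (f (0 + (-1) * x)))\<^sup>2)"
      by (rule lborel_integrable_real_affine) (use assms in \<open>simp_all add: square_integrable_def\<close>)
    then show "integrable lborel (\<lambda>x. (cmod (f (- x)))\<^sup>2)" by simp
    show "(\<lambda>x. f (- x)) \<in> borel_measurable lborel"
      unfolding measurable_lborel2
      by (rule measurable_compose[of uminus borel borel f borel]) measurable
  qed
qed

lemma AE_lborel_reflect:
  fixes P :: "real \<Rightarrow> bool"
  assumes "AE x in lborel. P x" shows "AE x in lborel. P (- x)"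
  by (rule AE_distrD[of uminus lborel borel]) (simp, unfold lborel_distr_uminus, rule assms)

text \<open>The inverse transform is the transform followed by this reflection.\<close>

definition reflect :: "l2 \<Rightarrow> l2" where "reflect f = abs_l2 (\<lambda>x. rep_l2 f (- x))"

lemma rep_reflect: "AE x in lborel. rep_l2 (reflect f) x = rep_l2 f (- x)"
  unfolding reflect_def by (intro rep_abs_l2 square_integrable_reflect) simp

lemma LINT_reflect: "(LINT x|lborel. f (- x)) = (LINT x|lborel. f (x::real) :: 'a::{banach, second_countable_topology})"
  using lborel_integral_real_affine[of "-1" f 0] by simp

lemma cinner_reflect: "l2_cinner (reflect f) g = l2_cinner f (reflect g)"
proof -
  have "l2_cinner (reflect f) g = (LINT x|lborel. rep_l2 f (- x) * cnj (rep_l2 g x))"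
    unfolding l2_cinner.rep_eq using rep_reflect[of f] by (intro integral_cong_AE) auto
  also have "\<dots> = (LINT x|lborel. rep_l2 f x * cnj (rep_l2 g (- x)))"
    using LINT_reflect[of "\<lambda>x. rep_l2 f (- x) * cnj (rep_l2 g x)"] by simp
  also have "\<dots> = l2_cinner f (reflect g)"
    unfolding l2_cinner.rep_eq using rep_reflect[of g] by (intro integral_cong_AE) auto
  finally show ?thesis .
qed

lemma reflect_reflect: "reflect (reflect f) = f"
  by (rule l2_eqI) (use rep_reflect[of "reflect f"] AE_lborel_reflect[OF rep_reflect[of f]] in \<open>eventually_elim, simp\<close>)

lemma norm_reflect: "norm (reflect f - reflect g) = norm (f - g)"
proof -
  have "reflect f - reflect g = reflect (f - g)"
    by (rule l2_eqI) (use rep_l2_diff[of "reflect f" "reflect g"] rep_reflect[of f] rep_reflect[of g] rep_reflect[of "f - g"]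
      AE_lborel_reflect[OF rep_l2_diff[of f g]] in \<open>eventually_elim, simp\<close>)
  moreover have "complex_of_real ((norm (reflect (f - g)))\<^sup>2) = complex_of_real ((norm (f - g))\<^sup>2)"
    unfolding cinner_self[symmetric] cinner_reflect reflect_reflect ..
  ultimately show ?thesis by (simp add: power2_eq_iff_nonneg del: of_real_power)
qed

lemma reflect_continuous:
  assumes "X \<longlonglongrightarrow> f" shows "(\<lambda>n. reflect (X n)) \<longlonglongrightarrow> reflect f"
proof -
  have "(\<lambda>n. norm (X n - f)) \<longlonglongrightarrow> 0" using assms by (simp add: tendsto_norm_zero_iff LIM_zero_iff)
  then have "(\<lambda>n. reflect (X n) - reflect f) \<longlonglongrightarrow> 0"
    by (rule Lim_null_comparison[rotated]) (auto intro!: always_eventually simp: norm_reflect)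
  then show ?thesis by (simp add: LIM_zero_iff)
qed

lemma ft_reflect: "ft (\<lambda>x. f (- x)) \<xi> = ft f (- \<xi>)"
  unfolding ft_def using LINT_reflect[of "\<lambda>x. cis (- (x * - \<xi>)) * f x"] by simp

lemma reflect_fourier: "reflect (fourier f) = fourier (reflect f)"
proof (rule LIMSEQ_unique[OF reflect_continuous[OF fourier_limit]])
  have s: "square_integrable (ft (cutoff n (rep_l2 f)))" for f n
    by (intro square_integrable_ft integrable_cutoff square_integrable_cutoff) simp_all
  have "reflect (abs_l2 (ft (cutoff n (rep_l2 f)))) = abs_l2 (ft (cutoff n (rep_l2 (reflect f))))" for n
  proof (rule l2_eqI)
    have r: "ft (cutoff n (rep_l2 f)) (- \<xi>) = ft (cutoff n (rep_l2 (reflect f))) \<xi>" for \<xi>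
      unfolding ft_reflect[symmetric]
      by (rule ft_cong_AE) (use rep_reflect[of f] in \<open>auto simp: cutoff_def indicator_def\<close>)
    show "AE x in lborel. rep_l2 (reflect (abs_l2 (ft (cutoff n (rep_l2 f))))) x = rep_l2 (abs_l2 (ft (cutoff n (rep_l2 (reflect f))))) x"
      using rep_reflect[of "abs_l2 (ft (cutoff n (rep_l2 f)))"] AE_lborel_reflect[OF rep_abs_l2[OF s[of n f]]] rep_abs_l2[OF s[of n "reflect f"]]
      by eventually_elim (simp add: r)
  qed
  then show "(\<lambda>n. reflect (abs_l2 (ft (cutoff n (rep_l2 f))))) \<longlonglongrightarrow> fourier (reflect f)"
    using fourier_limit[of "reflect f"] by simp
qed

text \<open>Multiplication formula: the adjoint of the transform is the reflected transform.\<close>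

lemma cinner_fourier: "l2_cinner (fourier f) a = l2_cinner f (reflect (fourier a))"
proof (rule LIMSEQ_unique[OF cinner_tendsto[OF fourier_limit l2_cutoff_tendsto]])
  have s: "square_integrable (ft (cutoff n (rep_l2 f)))" "square_integrable (cutoff n (rep_l2 f))" "integrable lborel (cutoff n (rep_l2 f))" for f n
    by (auto intro!: square_integrable_ft integrable_cutoff square_integrable_cutoff)
  have "l2_cinner (abs_l2 (ft (cutoff n (rep_l2 f)))) (abs_l2 (cutoff n (rep_l2 a))) =
    l2_cinner (abs_l2 (cutoff n (rep_l2 f))) (reflect (abs_l2 (ft (cutoff n (rep_l2 a)))))" for n
  proof -
    have r: "reflect (abs_l2 (ft (cutoff n (rep_l2 a)))) = abs_l2 (\<lambda>x. ft (cutoff n (rep_l2 a)) (- x))"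
      unfolding reflect_def by (intro abs_l2_eqI square_integrable_reflect AE_lborel_reflect[OF rep_abs_l2] s) auto
    show ?thesis unfolding r
      by (simp add: cinner_abs_l2 s square_integrable_reflect ft_duality)
  qed
  then show "(\<lambda>n. l2_cinner (abs_l2 (ft (cutoff n (rep_l2 f)))) (abs_l2 (cutoff n (rep_l2 a)))) \<longlonglongrightarrow> l2_cinner f (reflect (fourier a))"
    using cinner_tendsto[OF l2_cutoff_tendsto reflect_continuous[OF fourier_limit]] by simp
qed

text \<open>By the multiplication formula and Parseval's identity for intervals, the two sides have the same
  integral over every interval.\<close>

lemma fourier_inversion: "reflect (fourier (fourier f)) = f"
proof -
  have main: "reflect (fourier (fourier (abs_l2 f))) = abs_l2 f" if f: "integrable lborel f" "square_integrable f" for f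
  proof -
    define g where "g = reflect (fourier (fourier (abs_l2 f))) - abs_l2 f"
    have "l2_cinner g (abs_l2 (indicator {a..b})) = 0" for a b
    proof -
      have I: "square_integrable (indicator {a..b})" by (rule square_integrable_indicator_interval)
      have I1: "integrable lborel (indicator {a..b} :: real \<Rightarrow> complex)"
      proof -
        have "(\<lambda>x. indicator {a..b} x * indicator {a..b} x :: complex) = indicator {a..b}"
          by (auto simp: fun_eq_iff indicator_def)
        then show ?thesis using integrable_mult_indicator_interval[OF I, of a b] by simp
      qed
      have ci: "cnj (indicator {a..b} x) = indicator {a..b} x" for x :: real by (simp add: indicator_def)
      have "l2_cinner (fourier (abs_l2 f)) (fourier (abs_l2 (indicator {a..b}))) = l2_cinner (abs_l2 f) (abs_l2 (indicator {a..b}))"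
        unfolding fourier_abs_l2[OF f] fourier_abs_l2[OF I1 I]
        by (simp add: cinner_abs_l2 square_integrable_ft f I I1 ft_Parseval_interval ci)
      moreover have "l2_cinner (reflect (fourier (fourier (abs_l2 f)))) (abs_l2 (indicator {a..b})) = l2_cinner (fourier (abs_l2 f)) (fourier (abs_l2 (indicator {a..b})))"
        by (metis cinner_commute cinner_fourier)
      ultimately show ?thesis by (simp add: g_def cinner_diff_left)
    qed
    then have z: "(LINT x|lborel. rep_l2 g x * indicator {a..b} x) = 0" for a b
    proof -
      have "(LINT x|lborel. rep_l2 g x * indicator {a..b} x) = l2_cinner g (abs_l2 (indicator {a..b}))"
        unfolding l2_cinner.rep_eq using rep_abs_l2[OF square_integrable_indicator_interval[of a b]]
        by (intro integral_cong_AE) (auto simp: indicator_def)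
      then show ?thesis using \<open>\<And>a b. l2_cinner g (abs_l2 (indicator {a..b})) = 0\<close> by simp
    qed
    have i: "set_integrable lborel {a..b} (rep_l2 g)" for a b
    proof -
      have "(\<lambda>x. indicat_real {a..b} x *\<^sub>R rep_l2 g x) = (\<lambda>x. rep_l2 g x * indicator {a..b} x)" by (auto simp: fun_eq_iff indicator_def)
      then show ?thesis unfolding set_integrable_def by (simp add: integrable_mult_indicator_interval)
    qed
    have "AE x in lborel. rep_l2 g x = 0" by (rule AE_zero_if_interval_integrals_zero[OF i z])
    then have "g = 0" using rep_l2_zero by (intro l2_eqI) auto
    then show ?thesis by (simp add: g_def)
  qed
  let ?c = "\<lambda>n. abs_l2 (cutoff n (rep_l2 f))"
  have "(\<lambda>n. reflect (fourier (fourier (?c n)))) \<longlonglongrightarrow> reflect (fourier (fourier f))"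
    by (intro reflect_continuous fourier_continuous l2_cutoff_tendsto)
  moreover have "reflect (fourier (fourier (?c n))) = ?c n" for n
    by (intro main integrable_cutoff square_integrable_cutoff) auto
  ultimately have "?c \<longlonglongrightarrow> reflect (fourier (fourier f))" by simp
  then show ?thesis using l2_cutoff_tendsto LIMSEQ_unique by blast
qed

lemma fourier_inversion': "fourier (reflect (fourier f)) = f"
  using fourier_inversion[of f] by (simp add: reflect_fourier)

lemma inv_fourier: "inv fourier a = reflect (fourier a)"
  by (rule inv_f_eq) (metis injI fourier_inversion, rule fourier_inversion')

lemma Plancherel: "l2_cinner (fourier f) (fourier g) = l2_cinner f g"
  by (simp add: cinner_fourier fourier_inversion)

lemma norm_fourier [simp]: "norm (fourier f) = norm f"
proof -
  have "complex_of_real ((norm (fourier f))\<^sup>2) = complex_of_real ((norm f)\<^sup>2)"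
    unfolding cinner_self[symmetric] Plancherel ..
  then show ?thesis by (simp add: power2_eq_iff_nonneg del: of_real_power)
qed

lemma fourier_eq_iff: "fourier f = fourier g \<longleftrightarrow> f = g"
  by (metis fourier_inversion)

lemma fourier_inv_fourier [simp]: "fourier (inv fourier a) = a"
  by (simp add: inv_fourier fourier_inversion')

lemma fourier_diff: "fourier (f - g) = fourier f - fourier g"
  by (rule cinner_eqI) (simp add: cinner_fourier cinner_diff_left)

lemma fourier_scaleC: "fourier (l2_scaleC c f) = l2_scaleC c (fourier f)"
  by (rule cinner_eqI) (simp add: cinner_fourier cinner_scaleC_left)

text \<open>For an integrable transform the inverse is given pointwise by the Fourier integral. This is the
  link between $L^2$ functions and the values of their regularisations.\<close>

lemma rep_inv_fourier:
  assumes a: "integrable lborel a" "square_integrable a"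
  shows "AE x in lborel. rep_l2 (inv fourier (abs_l2 a)) x = ft a (- x)"
proof -
  have "AE x in lborel. rep_l2 (inv fourier (abs_l2 a)) x = rep_l2 (abs_l2 (ft a)) (- x)"
    unfolding inv_fourier fourier_abs_l2[OF a] by (rule rep_reflect)
  moreover have "AE x in lborel. rep_l2 (abs_l2 (ft a)) (- x) = ft a (- x)"
    by (intro AE_lborel_reflect rep_abs_l2 square_integrable_ft a)
  ultimately show ?thesis by eventually_elim simp
qed

section \<open>The Schroedinger group\<close>

definition phase :: "real \<Rightarrow> (real \<Rightarrow> complex) \<Rightarrow> real \<Rightarrow> complex" where
  "phase t a \<xi> = cis (- (t * \<xi>\<^sup>2)) * a \<xi>"

lemma square_integrable_phase: "square_integrable a \<Longrightarrow> square_integrable (phase t a)"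
proof (rule square_integrable_bound)
  assume "square_integrable a"
  then have [measurable]: "a \<in> borel_measurable borel" by (rule square_integrable_measurable)
  show "phase t a \<in> borel_measurable borel" unfolding phase_def cis_conv_exp by measurable
qed (auto simp: phase_def norm_mult)

abbreviation hat :: "l2 \<Rightarrow> real \<Rightarrow> complex" where "hat f \<equiv> rep_l2 (fourier f)"

lemma schroedinger_conv_phase: "fourier (schroedinger t f) = abs_l2 (phase t (hat f))"
  by (simp add: schroedinger_def fourier_multiplier_def phase_def[abs_def])

lemma hat_schroedinger: "AE \<xi> in lborel. hat (schroedinger t f) \<xi> = phase t (hat f) \<xi>"
  unfolding schroedinger_conv_phase by (intro rep_abs_l2 square_integrable_phase) simp

lemma hat_diff: "AE \<xi> in lborel. hat (f - g) \<xi> = hat f \<xi> - hat g \<xi>"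
  unfolding fourier_diff by (rule rep_l2_diff)

lemma hat_scaleC: "AE \<xi> in lborel. hat (l2_scaleC c f) \<xi> = c * hat f \<xi>"
  unfolding fourier_scaleC by (rule rep_l2_scaleC)

lemma hat_eqI: "AE \<xi> in lborel. hat f \<xi> = hat g \<xi> \<Longrightarrow> f = g"
  using l2_eqI[of "fourier f" "fourier g"] by (simp add: fourier_eq_iff)

lemma schroedinger_0 [simp]: "schroedinger 0 f = f"
  by (rule hat_eqI) (use hat_schroedinger[of 0 f] in \<open>simp add: phase_def\<close>)

lemma schroedinger_group: "schroedinger s (schroedinger t f) = schroedinger (s + t) f"
  by (rule hat_eqI) (use hat_schroedinger[of s "schroedinger t f"] hat_schroedinger[of t f] hat_schroedinger[of "s + t" f]
     in \<open>eventually_elim, simp add: phase_def cis_mult distrib_right flip: mult.assoc\<close>)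

lemma schroedinger_diff: "schroedinger t (f - g) = schroedinger t f - schroedinger t g"
  by (rule hat_eqI) (use hat_schroedinger[of t "f - g"] hat_schroedinger[of t f] hat_schroedinger[of t g] hat_diff[of f g]
     hat_diff[of "schroedinger t f" "schroedinger t g"] in \<open>eventually_elim, simp add: phase_def right_diff_distrib\<close>)

lemma schroedinger_scaleC: "schroedinger t (l2_scaleC c f) = l2_scaleC c (schroedinger t f)"
  by (rule hat_eqI) (use hat_schroedinger[of t "l2_scaleC c f"] hat_schroedinger[of t f] hat_scaleC[of c f]
     hat_scaleC[of c "schroedinger t f"] in \<open>eventually_elim, simp add: phase_def\<close>)

lemma norm_schroedinger [simp]: "norm (schroedinger t f) = norm f"
proof -
  have "(norm (fourier (schroedinger t f)))\<^sup>2 = (norm (fourier f))\<^sup>2"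
    unfolding norm_l2_sq using hat_schroedinger[of t f]
    by (intro integral_cong_AE) (auto simp: phase_def norm_mult)
  then show ?thesis by (simp add: power2_eq_iff_nonneg)
qed

lemma schroedinger_continuous: "continuous_on UNIV (\<lambda>t. schroedinger t f)"
  unfolding continuous_on_sequentially
proof (intro allI ballI impI)
  fix X :: "nat \<Rightarrow> real" and t assume X: "(\<forall>n. X n \<in> UNIV) \<and> X \<longlonglongrightarrow> t"
  define a where "a = hat f"
  have a: "square_integrable a" by (simp add: a_def)
  have "(\<lambda>n. abs_l2 (phase (X n) a)) \<longlonglongrightarrow> abs_l2 (phase t a)"
  proof (rule l2_tendsto_dominated)
    show "(\<lambda>n. phase (X n) a \<xi>) \<longlonglongrightarrow> phase t a \<xi>" for \<xi>
      unfolding phase_def using X by (intro tendsto_intros) auto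
  qed (auto intro: square_integrable_phase a simp: phase_def norm_mult)
  then have "(\<lambda>n. fourier (schroedinger (X n) f)) \<longlonglongrightarrow> fourier (schroedinger t f)"
    by (simp add: a_def schroedinger_conv_phase)
  from reflect_continuous[OF fourier_continuous[OF this]]
  have "(\<lambda>n. schroedinger (X n) f) \<longlonglongrightarrow> schroedinger t f"
    by (simp add: fourier_inversion)
  then show "((\<lambda>t. schroedinger t f) \<circ> X) \<longlonglongrightarrow> schroedinger t f" by (simp add: o_def)
qed

section \<open>The maximal Strichartz estimate\<close>

lemma exp_gauss_square_integrable: "e > 0 \<Longrightarrow> square_integrable (\<lambda>\<xi>. complex_of_real (exp (- e * \<xi>\<^sup>2)))"
proof -
  assume e: "e > 0"
  have "(\<lambda>\<xi>::real. (cmod (complex_of_real (exp (- e * \<xi>\<^sup>2))))\<^sup>2) = (\<lambda>\<xi>. exp (- (2 * e) * \<xi>\<^sup>2))"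
    by (simp add: fun_eq_iff exp_double[symmetric] mult.assoc)
  then show ?thesis using integrable_gaussian[of "2 * e"] e by (simp add: square_integrable_def)
qed

lemma integrable_mult_gauss:
  assumes "square_integrable a" "e > 0"
  shows "integrable lborel (\<lambda>\<xi>. a \<xi> * exp (- e * \<xi>\<^sup>2))"
  using integrable_mult_cnj[OF assms(1) exp_gauss_square_integrable[OF assms(2)]] by simp

lemma integrable_mult_wave:
  assumes a: "square_integrable a" and w: "Re w > 0"
  shows "integrable lborel (\<lambda>\<xi>. a \<xi> * wave w x \<xi>)"
proof (rule Bochner_Integration.integrable_bound[OF integrable_mult_gauss[OF a w]])
  have [measurable]: "a \<in> borel_measurable borel" using a by (rule square_integrable_measurable)
  show "(\<lambda>\<xi>. a \<xi> * wave w x \<xi>) \<in> borel_measurable lborel" by measurable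
qed (simp add: norm_mult norm_wave)

text \<open>The value at $x$ of $e^{w\partial_x^2}$ applied to the function whose transform is
  \<open>a\<close>. For $\mathrm{Re}\,w > 0$ the integral converges absolutely at every point.\<close>

definition evol :: "complex \<Rightarrow> real \<Rightarrow> (real \<Rightarrow> complex) \<Rightarrow> complex" where
  "evol w x a = complex_of_real (1 / sqrt (2 * pi)) * (LINT \<xi>|lborel. a \<xi> * wave w x \<xi>)"

lemma evol_measurable [measurable (raw)]:
  assumes [measurable]: "w \<in> borel_measurable M" "x \<in> borel_measurable M" "a \<in> borel_measurable borel"
  shows "(\<lambda>t. evol (w t) (x t) a) \<in> borel_measurable M"
  unfolding evol_def by measurable

lemma evol_cong_AE:
  assumes "a \<in> borel_measurable borel" "b \<in> borel_measurable borel" "AE \<xi> in lborel. a \<xi> = b \<xi>"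
  shows "evol w x a = evol w x b"
proof -
  have [measurable]: "a \<in> borel_measurable borel" "b \<in> borel_measurable borel" using assms by auto
  show ?thesis unfolding evol_def
    by (intro arg_cong2[where f="(*)"] refl integral_cong_AE) (use assms(3) in auto)
qed

lemma evol_diff:
  assumes "square_integrable a" "square_integrable b" "Re w > 0"
  shows "evol w x (\<lambda>\<xi>. a \<xi> - b \<xi>) = evol w x a - evol w x b"
  unfolding evol_def left_diff_distrib
  by (subst Bochner_Integration.integral_diff) (auto intro: integrable_mult_wave assms simp: right_diff_distrib)

lemma evol_scale: "evol w x (\<lambda>\<xi>. c * a \<xi>) = c * evol w x a"
  unfolding evol_def by (simp add: mult.assoc)

definition L2 :: "(real \<Rightarrow> complex) \<Rightarrow> real" where "L2 a = sqrt (LINT \<xi>|lborel. (cmod (a \<xi>))\<^sup>2)"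

lemma L2_nonneg [simp]: "L2 a \<ge> 0" by (simp add: L2_def)

lemma L2_abs: "square_integrable a \<Longrightarrow> norm (abs_l2 a) = L2 a"
  by (simp add: L2_def norm_l2.abs_eq l2_eq_refl)

lemma L2_rep [simp]: "L2 (rep_l2 f) = norm f"
  by (simp add: L2_def norm_l2.rep_eq)

lemma L2_Cauchy_Schwarz:
  assumes a: "square_integrable a" and b: "square_integrable b"
  shows "cmod (LINT \<xi>|lborel. a \<xi> * b \<xi>) \<le> L2 a * L2 b"
proof -
  have b': "square_integrable (\<lambda>\<xi>. cnj (b \<xi>))"
    by (rule square_integrable_bound[OF b]) (use square_integrable_measurable[OF b] in auto)
  have "L2 (\<lambda>\<xi>. cnj (b \<xi>)) = L2 b" by (simp add: L2_def)
  then show ?thesis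
    using cinner_Cauchy_Schwarz[of "abs_l2 a" "abs_l2 (\<lambda>\<xi>. cnj (b \<xi>))"]
    by (simp add: L2_abs a b' cinner_abs_l2)
qed

lemma norm_evol_le:
  assumes a: "square_integrable a" and w: "Re w > 0"
  shows "cmod (evol w x a) \<le> L2 a * L2 (\<lambda>\<xi>. complex_of_real (exp (- Re w * \<xi>\<^sup>2)))"
proof -
  have s: "square_integrable (wave w x)"
    by (rule square_integrable_bound[OF exp_gauss_square_integrable[OF w]]) (auto simp: norm_wave)
  have "cmod (LINT \<xi>|lborel. a \<xi> * wave w x \<xi>) \<le> L2 a * L2 (wave w x)"
    by (rule L2_Cauchy_Schwarz[OF a s])
  moreover have "L2 (wave w x) = L2 (\<lambda>\<xi>. complex_of_real (exp (- Re w * \<xi>\<^sup>2)))"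
    by (simp add: L2_def norm_wave)
  moreover have "1 / sqrt (2 * pi) * y \<le> y" if "y \<ge> 0" for y
  proof (rule mult_left_le_one_le[OF that])
    have "sqrt 1 \<le> sqrt (2 * pi)" using pi_gt3 by (intro real_sqrt_le_mono) linarith
    then show "1 / sqrt (2 * pi) \<le> 1" by simp
  qed simp
  ultimately have le: "1 / sqrt (2 * pi) * cmod (LINT \<xi>|lborel. a \<xi> * wave w x \<xi>) \<le> L2 a * L2 (\<lambda>\<xi>. complex_of_real (exp (- Re w * \<xi>\<^sup>2)))"
    by (metis norm_ge_zero order_trans)
  have "cmod (complex_of_real (1 / sqrt (2 * pi))) = 1 / sqrt (2 * pi)"
    unfolding norm_of_real by simp
  then show ?thesis using le unfolding evol_def norm_mult by (simp only:)
qed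

text \<open>Expand the square: the kernel that appears is bounded by $|t-s|^{-1/2}$, whatever the points
  $x(t)$ and the damping, and the Hardy--Littlewood--Sobolev inequality applies. That
  \<open>x\<close> is an arbitrary function of time makes the bound maximal.\<close>

lemma superpose_L2_bound:
  assumes h: "integrable lborel h"
    and A: "(\<integral>\<^sup>+ t. ennreal (cmod (h t) powr (4/3)) \<partial>lborel) \<le> ennreal A" "A \<ge> 0"
    and w: "\<And>t. Re (w t) \<ge> e" and e: "e > 0"
    and im: "\<And>t s. \<bar>Im (w t) - Im (w s)\<bar> = \<bar>t - s\<bar>"
    and [measurable]: "w \<in> borel_measurable borel" "x \<in> borel_measurable borel"
  shows "(\<integral>\<^sup>+ \<xi>. ennreal ((cmod (superpose w x h \<xi>))\<^sup>2) \<partial>lborel) \<le> ennreal (14 * sqrt pi * root 4 A ^ 6)"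
proof -
  have [measurable]: "h \<in> borel_measurable borel" using h by auto
  note I = superpose_inner[OF h w h w e]
  have eq: "superpose w x h \<xi> * cnj (superpose w x h \<xi>) = complex_of_real ((cmod (superpose w x h \<xi>))\<^sup>2)" for \<xi>
    by (simp only: complex_norm_square)
  have int: "integrable lborel (\<lambda>\<xi>. (cmod (superpose w x h \<xi>))\<^sup>2)"
  proof -
    have "integrable lborel (\<lambda>\<xi>. superpose w x h \<xi> * cnj (superpose w x h \<xi>))" by (rule I(1)) auto
    then show ?thesis unfolding eq by (simp only: complex_of_real_integrable_eq)
  qed
  have "(\<integral>\<^sup>+ \<xi>. ennreal ((cmod (superpose w x h \<xi>))\<^sup>2) \<partial>lborel) = ennreal (LINT \<xi>|lborel. (cmod (superpose w x h \<xi>))\<^sup>2)"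
    by (rule nn_integral_eq_integral[OF int]) auto
  also have "(LINT \<xi>|lborel. (cmod (superpose w x h \<xi>))\<^sup>2) = cmod (LINT \<xi>|lborel. superpose w x h \<xi> * cnj (superpose w x h \<xi>))"
    unfolding eq integral_complex_of_real norm_of_real by (simp add: integral_nonneg_AE)
  also have "\<dots> = cmod (LINT t|lborel. LINT s|lborel. h t * (cnj (h s) * gauss_kernel (w t + cnj (w s)) (x t - x s)))"
    by (subst I(2)) auto
  also have "ennreal \<dots> \<le> (\<integral>\<^sup>+ t. ennreal (cmod (LINT s|lborel. h t * (cnj (h s) * gauss_kernel (w t + cnj (w s)) (x t - x s)))) \<partial>lborel)"
    by (rule ennreal_norm_integral_le)
  also have "\<dots> \<le> (\<integral>\<^sup>+ t. \<integral>\<^sup>+ s. ennreal (cmod (h t * (cnj (h s) * gauss_kernel (w t + cnj (w s)) (x t - x s)))) \<partial>lborel \<partial>lborel)"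
    by (intro nn_integral_mono ennreal_norm_integral_le)
  also have "\<dots> \<le> (\<integral>\<^sup>+ t. \<integral>\<^sup>+ s. ennreal (sqrt pi) * ennreal ((cmod (h t) powr (1/3)) ^ 3 * (cmod (h s) powr (1/3)) ^ 3 / sqrt \<bar>t - s\<bar>) \<partial>lborel \<partial>lborel)"
  proof (rule nn_integral_mono, rule nn_integral_mono_AE)
    fix t :: real
    show "AE s in lborel. ennreal (cmod (h t * (cnj (h s) * gauss_kernel (w t + cnj (w s)) (x t - x s)))) \<le>
      ennreal (sqrt pi) * ennreal ((cmod (h t) powr (1/3)) ^ 3 * (cmod (h s) powr (1/3)) ^ 3 / sqrt \<bar>t - s\<bar>)"
      using AE_lborel_singleton[of t]
    proof eventually_elim
      case (elim s)
      have z: "Re (w t + cnj (w s)) > 0" using w[of t] w[of s] e by simp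
      have "\<bar>t - s\<bar> = \<bar>Im (w t + cnj (w s))\<bar>" using im[of t s] by simp
      also have "\<dots> \<le> cmod (w t + cnj (w s))" by (rule abs_Im_le_cmod)
      finally have ts: "sqrt \<bar>t - s\<bar> \<le> sqrt (cmod (w t + cnj (w s)))" by simp
      have "w t + cnj (w s) \<noteq> 0" using z by force
      then have "cmod (gauss_kernel (w t + cnj (w s)) (x t - x s)) \<le> sqrt pi / sqrt (cmod (w t + cnj (w s)))"
        using z by (intro gauss_kernel_bound) auto
      also have "\<dots> \<le> sqrt pi / sqrt \<bar>t - s\<bar>"
        using ts elim by (intro divide_left_mono) (auto intro!: mult_pos_pos)
      finally have "cmod (h t) * (cmod (h s) * cmod (gauss_kernel (w t + cnj (w s)) (x t - x s))) \<le> cmod (h t) * (cmod (h s) * (sqrt pi / sqrt \<bar>t - s\<bar>))"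
        by (intro mult_left_mono) auto
      then show ?case
        by (simp add: cube_root_facts norm_mult ennreal_leI mult_ac flip: ennreal_mult)
    qed
  qed
  also have "\<dots> = ennreal (sqrt pi) * (\<integral>\<^sup>+ t. \<integral>\<^sup>+ s. ennreal ((cmod (h t) powr (1/3)) ^ 3 * (cmod (h s) powr (1/3)) ^ 3 / sqrt \<bar>t - s\<bar>) \<partial>lborel \<partial>lborel)"
    by (subst nn_integral_cmult[symmetric]) (auto intro!: nn_integral_cong nn_integral_cmult)
  also have "\<dots> \<le> ennreal (sqrt pi) * ennreal (14 * root 4 A ^ 3 * root 4 A ^ 3)"
    by (intro mult_left_mono hls) (use A in \<open>auto simp: cube_root_facts\<close>)
  also have "\<dots> = ennreal (14 * sqrt pi * root 4 A ^ 6)"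
    using A by (simp add: power_add[symmetric] mult.assoc flip: ennreal_mult)
  finally show ?thesis .
qed

text \<open>The norm of a superposition contributes $(14\sqrt\pi)^{1/2}$, the normalisation of the transform
  the denominator.\<close>

definition strichartz_K :: real where "strichartz_K = sqrt (14 * sqrt pi) / sqrt (2 * pi)"

lemma strichartz_K_pos: "strichartz_K > 0" by (simp add: strichartz_K_def)

text \<open>Linearise the supremum: among the first $N$ pairs choose at each time the one with the largest
  value, pair with the cube of that value, and apply the preceding bound to the resulting
  superposition. Restriction to a bounded time interval and to finitely many pairs makes all
  quantities finite, and monotone convergence removes it.\<close>

lemma maximal_strichartz:
  fixes \<epsilon> :: "nat \<Rightarrow> real" and x :: "nat \<Rightarrow> real"
  assumes a: "square_integrable a" and \<epsilon>: "\<And>j. \<epsilon> j > 0"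
  shows "(\<integral>\<^sup>+ t. (SUP j. ennreal (cmod (evol (Complex (\<epsilon> j) t) (x j) a))) ^ 4 \<partial>lborel) \<le> ennreal ((strichartz_K * L2 a) ^ 4)"
proof -
  have [measurable]: "a \<in> borel_measurable borel" using a by (rule square_integrable_measurable)
  have Cm: "Complex e t = of_real e + \<i> * of_real t" for e t by (simp add: complex_eq_iff)
  define V where "V j t = evol (Complex (\<epsilon> j) t) (x j) a" for j t
  have [measurable]: "V j \<in> borel_measurable borel" for j unfolding V_def Cm by measurable
  let ?M = "\<lambda>n t. Max ((\<lambda>j. cmod (V j t)) ` {..n})"
  let ?G = "\<lambda>n t. ennreal (indicator {- real (Suc n)..real (Suc n)} t * ?M n t ^ 4)"
  have part: "(\<integral>\<^sup>+ t. ennreal (indicator {-R..R} t * ?M N t ^ 4) \<partial>lborel) \<le> ennreal ((strichartz_K * L2 a) ^ 4)"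
    if R: "R > 0" for N :: nat and R
  proof -
    \<comment> \<open>The least maximiser is a measurable choice.\<close>
    define J where "J t = (LEAST j. j \<le> N \<and> (\<forall>i\<le>N. cmod (V i t) \<le> cmod (V j t)))" for t
    have [measurable]: "J \<in> measurable borel (count_space UNIV)" unfolding J_def by measurable
    have J: "J t \<le> N" "cmod (V (J t) t) = ?M N t" for t
    proof -
      have "?M N t \<in> (\<lambda>j. cmod (V j t)) ` {..N}" by (intro Max_in) auto
      then obtain j where j: "?M N t = cmod (V j t)" "j \<in> {..N}"
        by (rule imageE)
      have "j \<le> N \<and> (\<forall>i\<le>N. cmod (V i t) \<le> cmod (V j t))"
        using j(2) unfolding j(1)[symmetric] by (auto intro!: Max_ge)
      then have "J t \<le> N \<and> (\<forall>i\<le>N. cmod (V i t) \<le> cmod (V (J t) t))"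
        unfolding J_def by (rule LeastI)
      then show "J t \<le> N" "cmod (V (J t) t) = ?M N t"
        by (auto intro!: Max_eqI[symmetric])
    qed
    define m where "m t = cmod (V (J t) t)" for t
    define W where "W t = V (J t) t" for t
    have [measurable]: "W \<in> borel_measurable borel"
      unfolding W_def by (rule measurable_compose_countable[where g=J]) measurable
    have m_def': "m t = cmod (W t)" for t by (simp add: m_def W_def)
    have [measurable]: "m \<in> borel_measurable borel" unfolding m_def' by measurable
    define e where "e = Min (\<epsilon> ` {..N})"
    have e: "e > 0" "\<And>j. j \<le> N \<Longrightarrow> e \<le> \<epsilon> j" using \<epsilon> by (auto simp: e_def)
    define B where "B = L2 a * L2 (\<lambda>\<xi>. complex_of_real (exp (- e * \<xi>\<^sup>2)))"
    have B0: "B \<ge> 0" by (simp add: B_def)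
    have mB: "m t \<le> B" for t
    proof -
      have r: "Re (Complex (\<epsilon> (J t)) t) > 0" using \<epsilon> by simp
      have "m t \<le> L2 a * L2 (\<lambda>\<xi>. complex_of_real (exp (- \<epsilon> (J t) * \<xi>\<^sup>2)))"
        using norm_evol_le[OF a r, of "x (J t)"] by (simp add: m_def V_def)
      also have "\<dots> \<le> B" unfolding B_def
      proof (intro mult_left_mono)
        have "(LINT \<xi>|lborel. (cmod (complex_of_real (exp (- \<epsilon> (J t) * \<xi>\<^sup>2))))\<^sup>2) \<le> (LINT \<xi>|lborel. (cmod (complex_of_real (exp (- e * \<xi>\<^sup>2))))\<^sup>2)"
        proof (rule integral_mono)
          show "integrable lborel (\<lambda>\<xi>. (cmod (complex_of_real (exp (- \<epsilon> (J t) * \<xi>\<^sup>2))))\<^sup>2)"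
            using exp_gauss_square_integrable[OF \<epsilon>[of "J t"]] by (simp only: square_integrable_def)
          show "integrable lborel (\<lambda>\<xi>. (cmod (complex_of_real (exp (- e * \<xi>\<^sup>2))))\<^sup>2)"
            using exp_gauss_square_integrable[OF e(1)] by (simp only: square_integrable_def)
          show "(cmod (complex_of_real (exp (- \<epsilon> (J t) * \<xi>\<^sup>2))))\<^sup>2 \<le> (cmod (complex_of_real (exp (- e * \<xi>\<^sup>2))))\<^sup>2" for \<xi>
            using e(2)[OF J(1)] unfolding norm_of_real by (intro power_mono) (auto intro!: mult_right_mono)
        qed
        then show "L2 (\<lambda>\<xi>. complex_of_real (exp (- \<epsilon> (J t) * \<xi>\<^sup>2))) \<le> L2 (\<lambda>\<xi>. complex_of_real (exp (- e * \<xi>\<^sup>2)))"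
          unfolding L2_def by (rule real_sqrt_le_mono)
      qed simp
      finally show ?thesis .
    qed
    have m0: "m t \<ge> 0" for t by (simp add: m_def)
    \<comment> \<open>The multiple of the conjugate value whose pairing with the value is the fourth power of the maximum.\<close>
    define h where "h t = complex_of_real (indicator {-R..R} t * (m t)\<^sup>2) * cnj (W t)" for t
    have [measurable]: "h \<in> borel_measurable borel" unfolding h_def by measurable
    have nh: "cmod (h t) = indicator {-R..R} t * m t ^ 3" for t
      by (simp add: h_def norm_mult abs_mult m_def'[symmetric] power_numeral_reduce)
    have iR: "integrable lborel (\<lambda>t. indicator {-R..R} t * c)" for c :: real
      using R by (simp add: emeasure_lborel_Icc_eq)
    have ih: "integrable lborel h"
      by (rule Bochner_Integration.integrable_bound[OF iR[of "B ^ 3"]])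
         (use mB m0 B0 in \<open>auto simp: nh abs_mult indicator_def intro!: power_mono\<close>)
    define X where "X = (LINT t|lborel. indicator {-R..R} t * m t ^ 4)"
    have iX: "integrable lborel (\<lambda>t. indicator {-R..R} t * m t ^ 4)"
      by (rule Bochner_Integration.integrable_bound[OF iR[of "B ^ 4"]])
         (use mB m0 B0 in \<open>auto simp: abs_mult indicator_def intro!: power_mono\<close>)
    have X: "(\<integral>\<^sup>+ t. ennreal (indicator {-R..R} t * m t ^ 4) \<partial>lborel) = ennreal X"
      unfolding X_def by (rule nn_integral_eq_integral[OF iX]) (simp add: m0)
    have X0: "X \<ge> 0" unfolding X_def by (intro integral_nonneg_AE) (simp add: m0)
    have h43: "(\<integral>\<^sup>+ t. ennreal (cmod (h t) powr (4/3)) \<partial>lborel) \<le> ennreal X"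
    proof -
      have "cmod (h t) powr (4/3) = indicator {-R..R} t * m t ^ 4" for t
      proof (cases "t \<in> {-R..R} \<and> m t > 0")
        case True
        have p: "m t ^ 3 = m t powr 3" "m t ^ 4 = m t powr 4" using True by (simp_all add: powr_numeral)
        have "cmod (h t) powr (4/3) = (m t ^ 3) powr (4/3)" using True by (simp add: nh)
        also have "\<dots> = m t powr (3 * (4/3))" unfolding p(1) by (rule powr_powr)
        also have "\<dots> = m t ^ 4" unfolding p(2) by simp
        finally show ?thesis using True by simp
      next
        case False
        then show ?thesis using m0[of t] by (auto simp: nh order_less_le)
      qed
      then show ?thesis by (simp add: X)
    qed
    define w where "w t = Complex (\<epsilon> (J t)) t" for t
    have [measurable]: "w \<in> borel_measurable borel" unfolding w_def Cm by measurable
    define y where "y t = x (J t)" for t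
    have [measurable]: "y \<in> borel_measurable borel" unfolding y_def by measurable
    have w: "Re (w t) \<ge> e" for t using e(2)[OF J(1)] by (simp add: w_def)
    have im: "\<bar>Im (w t) - Im (w s)\<bar> = \<bar>t - s\<bar>" for t s by (simp add: w_def)
    have "(\<integral>\<^sup>+ \<xi>. ennreal ((cmod (superpose w y h \<xi>))\<^sup>2) \<partial>lborel) \<le> ennreal (14 * sqrt pi * root 4 X ^ 6)"
      by (rule superpose_L2_bound[OF ih h43 X0 w e(1) im]) auto
    then have S: "square_integrable (superpose w y h)" "L2 (superpose w y h) \<le> sqrt (14 * sqrt pi * root 4 X ^ 6)"
    proof -
      assume *: "(\<integral>\<^sup>+ \<xi>. ennreal ((cmod (superpose w y h \<xi>))\<^sup>2) \<partial>lborel) \<le> ennreal (14 * sqrt pi * root 4 X ^ 6)"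
      then show s: "square_integrable (superpose w y h)"
        unfolding square_integrable_iff_nn by (auto intro: le_less_trans)
      show "L2 (superpose w y h) \<le> sqrt (14 * sqrt pi * root 4 X ^ 6)"
        using * unfolding nn_integral_square_integrable[OF s] L2_def
        by (intro real_sqrt_le_mono) (simp add: ennreal_le_iff X0)
    qed
    have i: "integrable lborel (\<lambda>\<xi>. a \<xi> * exp (- e * \<xi>\<^sup>2))" by (rule integrable_mult_gauss[OF a e(1)])
    have F: "(LINT \<xi>|lborel. superpose w y h \<xi> * a \<xi>) = (LINT t|lborel. h t * (LINT \<xi>|lborel. a \<xi> * wave (w t) (y t) \<xi>))"
      by (rule superpose_Fubini(2)[OF ih w _ _ i]) auto
    have hV: "complex_of_real (1 / sqrt (2 * pi)) * (h t * (LINT \<xi>|lborel. a \<xi> * wave (w t) (y t) \<xi>)) = complex_of_real (indicator {-R..R} t * m t ^ 4)" for t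
    proof -
      have "complex_of_real (1 / sqrt (2 * pi)) * (h t * (LINT \<xi>|lborel. a \<xi> * wave (w t) (y t) \<xi>)) = h t * W t"
        unfolding W_def V_def evol_def w_def y_def by simp
      also have "\<dots> = complex_of_real (indicator {-R..R} t * (m t)\<^sup>2) * (W t * cnj (W t))"
        unfolding h_def by (simp only: mult_ac)
      also have "\<dots> = complex_of_real (indicator {-R..R} t * (m t)\<^sup>2 * (m t)\<^sup>2)"
        unfolding complex_norm_square[symmetric] m_def' by simp
      also have "indicator {-R..R} t * (m t)\<^sup>2 * (m t)\<^sup>2 = indicator {-R..R} t * m t ^ 4"
        by (simp add: power_numeral_reduce)
      finally show ?thesis .
    qed
    have "complex_of_real (1 / sqrt (2 * pi)) * (LINT \<xi>|lborel. superpose w y h \<xi> * a \<xi>) = complex_of_real X"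
      unfolding F X_def integral_complex_of_real[symmetric] hV[symmetric] by (simp del: of_real_divide)
    then have "X = cmod (complex_of_real (1 / sqrt (2 * pi)) * (LINT \<xi>|lborel. superpose w y h \<xi> * a \<xi>))"
      using X0 by simp
    also have "\<dots> \<le> 1 / sqrt (2 * pi) * (L2 (superpose w y h) * L2 a)"
      unfolding norm_mult by (simp add: norm_divide divide_right_mono L2_Cauchy_Schwarz S a)
    also have "\<dots> \<le> 1 / sqrt (2 * pi) * (sqrt (14 * sqrt pi * root 4 X ^ 6) * L2 a)"
      by (intro mult_left_mono mult_right_mono S) auto
    also have "sqrt (14 * sqrt pi * root 4 X ^ 6) = sqrt (14 * sqrt pi) * root 4 X ^ 3"
    proof -
      have "root 4 X ^ 6 = (root 4 X ^ 3)\<^sup>2" by (simp flip: power_mult)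
      then have "sqrt (root 4 X ^ 6) = root 4 X ^ 3" using X0 by (simp only: real_sqrt_abs) simp
      then show ?thesis by (simp add: real_sqrt_mult)
    qed
    finally have le: "X \<le> (strichartz_K * L2 a) * root 4 X ^ 3" by (simp add: strichartz_K_def mult_ac)
    define r where "r = root 4 X"
    have r: "r \<ge> 0" "r ^ 4 = X" using X0 by (auto simp: r_def)
    have K0: "strichartz_K * L2 a \<ge> 0" using strichartz_K_pos by simp
    have "r \<le> strichartz_K * L2 a"
    proof (cases "r = 0")
      case False
      have "r ^ 3 * r \<le> r ^ 3 * (strichartz_K * L2 a)" using le r by (simp add: r_def[symmetric] power_numeral_reduce mult_ac)
      then show ?thesis using False r by (simp add: mult_le_cancel_left)
    qed (use K0 in auto)
    then have "X \<le> (strichartz_K * L2 a) ^ 4" using power_mono[of r _ 4] r by simp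
    then have "ennreal X \<le> ennreal ((strichartz_K * L2 a) ^ 4)" by (rule ennreal_leI)
    then show ?thesis unfolding X[symmetric] m_def J(2) .
  qed
  have mono: "?G n t
      \<le> ?G n' t" if "n \<le> n'" for n n' t
  proof (intro ennreal_leI mult_mono power_mono)
    show "indicator {- real (Suc n)..real (Suc n)} t \<le> (indicator {- real (Suc n')..real (Suc n')} t :: real)"
      using that by (auto simp: indicator_def)
    show "?M n t \<le> ?M n' t"
      using that by (intro Max_mono) auto
    have "cmod (V 0 t) \<le> ?M n t" by (intro Max_ge) auto
    then show "0 \<le> ?M n t" using norm_ge_zero order_trans by blast
  qed auto
  have "(\<integral>\<^sup>+ t. (SUP j. ennreal (cmod (V j t))) ^ 4 \<partial>lborel) \<le>
      (\<integral>\<^sup>+ t. (SUP n. ?G n t) \<partial>lborel)"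
  proof (rule nn_integral_mono)
    fix t
    define s where "s = (SUP n. ?G n t)"
    have b: "ennreal (cmod (V j t) ^ 4) \<le> s" for j
    proof -
      define n where "n = max j (nat \<lceil>\<bar>t\<bar>\<rceil>)"
      have "real n \<ge> \<bar>t\<bar>" unfolding n_def by linarith
      then have "indicator {- real (Suc n)..real (Suc n)} t = (1::real)" by (auto simp: indicator_def)
      moreover have "cmod (V j t) \<le> ?M n t" by (intro Max_ge) (auto simp: n_def)
      ultimately have "ennreal (cmod (V j t) ^ 4) \<le> ?G n t"
        by (intro ennreal_leI) (simp add: power_mono)
      also have "\<dots> \<le> s" unfolding s_def by (rule SUP_upper) simp
      finally show ?thesis .
    qed
    show "(SUP j. ennreal (cmod (V j t))) ^ 4 \<le> s"
    proof (cases "s = \<top>")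
      case False
      then obtain r where r: "s = ennreal r" "r \<ge> 0" by (cases s) auto
      have "ennreal (cmod (V j t)) \<le> ennreal (root 4 r)" for j
      proof -
        have "cmod (V j t) ^ 4 \<le> r" using b[of j] r by (simp add: ennreal_le_iff)
        then have "root 4 (cmod (V j t) ^ 4) \<le> root 4 r" by (intro real_root_le_mono) auto
        then show ?thesis by (intro ennreal_leI) (simp add: real_root_power_cancel)
      qed
      then have "(SUP j. ennreal (cmod (V j t))) ^ 4 \<le> ennreal (root 4 r) ^ 4"
        by (intro power_mono SUP_least) auto
      also have "\<dots> = s" using r by (simp add: ennreal_power)
      finally show ?thesis .
    qed simp
  qed
  also have "\<dots> = (SUP n. \<integral>\<^sup>+ t. ?G n t \<partial>lborel)"
  proof (rule nn_integral_monotone_convergence_SUP)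
    have "(\<lambda>t. ?M n t) \<in> borel_measurable borel" for n
      by (intro borel_measurable_Max) auto
    then show "(\<lambda>t. ?G n t) \<in> borel_measurable lborel" for n
      by simp
    show "incseq (\<lambda>n t. ?G n t)"
      unfolding incseq_def le_fun_def by (intro allI impI mono)
  qed
  also have "\<dots> \<le> ennreal ((strichartz_K * L2 a) ^ 4)"
    by (intro SUP_least part) auto
  finally show ?thesis unfolding V_def .
qed

section \<open>Continuous representatives as limits of regularisations\<close>

lemma phase_measurable [measurable]:
  assumes [measurable]: "a \<in> borel_measurable borel" shows "phase t a \<in> borel_measurable borel"
  unfolding phase_def cis_conv_exp by measurable

lemma wave_real: "wave (complex_of_real e) x \<xi> = cis (x * \<xi>) * complex_of_real (exp (- e * \<xi>\<^sup>2))"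
  by (simp add: wave_def cis_conv_exp exp_diff exp_minus exp_of_real[symmetric] divide_inverse)

text \<open>The Gaussian regularisation $e^{\partial_x^2/(n+1)} w$ at the point \<open>x\<close>. It is
  defined for every $L^2$ function and every point.\<close>

definition reg :: "nat \<Rightarrow> real \<Rightarrow> l2 \<Rightarrow> complex" where
  "reg n x w = evol (complex_of_real (1 / real (Suc n))) x (hat w)"

lemma reg_diff: "reg n x (v - w) = reg n x v - reg n x w"
proof -
  have "reg n x (v - w) = evol (complex_of_real (1 / real (Suc n))) x (\<lambda>\<xi>. hat v \<xi> - hat w \<xi>)"
    unfolding reg_def by (rule evol_cong_AE) (auto intro: hat_diff)
  then show ?thesis by (simp add: reg_def evol_diff)
qed

lemma reg_scaleC: "reg n x (l2_scaleC c w) = c * reg n x w"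
proof -
  have "reg n x (l2_scaleC c w) = evol (complex_of_real (1 / real (Suc n))) x (\<lambda>\<xi>. c * hat w \<xi>)"
    unfolding reg_def by (rule evol_cong_AE) (auto intro: hat_scaleC)
  then show ?thesis by (simp add: reg_def evol_scale)
qed

lemma phase_wave: "phase t a \<xi> * wave (of_real e) x \<xi> = a \<xi> * wave (Complex e t) x \<xi>"
proof -
  have "cis (- (t * \<xi>\<^sup>2)) * wave (of_real e) x \<xi> = wave (Complex e t) x \<xi>"
    unfolding cis_conv_exp wave_def exp_add[symmetric]
    by (rule arg_cong[where f=exp]) (simp add: complex_eq_iff power2_eq_square algebra_simps)
  then show ?thesis by (simp add: phase_def mult.assoc mult.left_commute)
qed

text \<open>Regularisation commutes with the evolution: both only add to the complex parameter.\<close>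

lemma reg_schroedinger: "reg n x (schroedinger t w) = evol (Complex (1 / real (Suc n)) t) x (hat w)"
proof -
  have "reg n x (schroedinger t w) = evol (complex_of_real (1 / real (Suc n))) x (phase t (hat w))"
    unfolding reg_def by (rule evol_cong_AE) (auto intro: hat_schroedinger phase_measurable)
  then show ?thesis by (simp only: evol_def phase_wave)
qed

definition reg_C :: "nat \<Rightarrow> real" where
  "reg_C n = L2 (\<lambda>\<xi>. complex_of_real (exp (- (1 / real (Suc n)) * \<xi>\<^sup>2)))"

lemma norm_reg_le: "cmod (reg n x w) \<le> norm w * reg_C n"
  using norm_evol_le[of "hat w" "complex_of_real (1 / real (Suc n))" x] by (simp add: reg_def reg_C_def)

lemma reg_continuous: "continuous_on UNIV (\<lambda>x. reg n x w)"
  unfolding continuous_on_sequentially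
proof (intro allI ballI impI)
  fix X :: "nat \<Rightarrow> real" and x assume X: "(\<forall>n. X n \<in> UNIV) \<and> X \<longlonglongrightarrow> x"
  have "(\<lambda>k. LINT \<xi>|lborel. hat w \<xi> * wave (complex_of_real (1 / real (Suc n))) (X k) \<xi>) \<longlonglongrightarrow>
      (LINT \<xi>|lborel. hat w \<xi> * wave (complex_of_real (1 / real (Suc n))) x \<xi>)"
  proof (rule integral_dominated_convergence)
    show "integrable lborel (\<lambda>\<xi>. cmod (hat w \<xi> * exp (- (1 / real (Suc n)) * \<xi>\<^sup>2)))"
      by (intro integrable_norm integrable_mult_gauss) auto
    show "AE \<xi> in lborel. (\<lambda>k. hat w \<xi> * wave (complex_of_real (1 / real (Suc n))) (X k) \<xi>) \<longlonglongrightarrow> hat w \<xi> * wave (complex_of_real (1 / real (Suc n))) x \<xi>"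
      unfolding wave_def using X by (intro AE_I2 tendsto_intros) auto
  qed (auto simp: norm_mult norm_wave)
  then show "((\<lambda>x. reg n x w) \<circ> X) \<longlonglongrightarrow> reg n x w"
    unfolding reg_def evol_def o_def by (intro tendsto_intros)
qed

definition Reg :: "nat \<Rightarrow> l2 \<Rightarrow> (real \<Rightarrow>\<^sub>C complex)" where
  "Reg n w = Bcontfun (\<lambda>x. reg n x w)"

lemma apply_Reg [simp]: "apply_bcontfun (Reg n w) x = reg n x w"
proof -
  have "(\<lambda>x. reg n x w) \<in> bcontfun"
    by (rule bcontfun_normI[OF reg_continuous norm_reg_le])
  then show ?thesis by (simp add: Reg_def Bcontfun_inverse)
qed

lemma norm_bcontfun_le:
  fixes u :: "'a::topological_space \<Rightarrow>\<^sub>C 'b::real_normed_vector"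
  assumes "\<And>x. norm (apply_bcontfun u x) \<le> b" shows "norm u \<le> b"
  using dist_bound[of u 0 b] assms by (simp add: dist_norm)

lemma norm_apply_bcontfun_le:
  fixes u :: "'a::topological_space \<Rightarrow>\<^sub>C 'b::real_normed_vector"
  shows "norm (apply_bcontfun u x) \<le> norm u"
  using dist_bounded[of u x 0] by (simp add: dist_norm)

lemma Reg_diff: "Reg n (v - w) = Reg n v - Reg n w"
  by (rule bcontfun_eqI) (simp add: reg_diff)

lemma Reg_scaleC_apply: "apply_bcontfun (Reg n (l2_scaleC c w)) x = c * apply_bcontfun (Reg n w) x"
  by (simp add: reg_scaleC)

lemma norm_Reg_le: "norm (Reg n w) \<le> reg_C n * norm w"
  by (rule norm_bcontfun_le) (simp only: apply_Reg mult.commute[of "reg_C n"] norm_reg_le)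

lemma tendsto_apply_bcontfun:
  fixes X :: "nat \<Rightarrow> 'a::topological_space \<Rightarrow>\<^sub>C 'b::real_normed_vector"
  assumes "X \<longlonglongrightarrow> u" shows "(\<lambda>n. apply_bcontfun (X n) x) \<longlonglongrightarrow> apply_bcontfun u x"
proof -
  have "(\<lambda>n. norm (X n - u)) \<longlonglongrightarrow> 0" using assms by (simp add: tendsto_norm_zero_iff LIM_zero_iff)
  then have "(\<lambda>n. apply_bcontfun (X n) x - apply_bcontfun u x) \<longlonglongrightarrow> 0"
    by (rule Lim_null_comparison[rotated])
       (intro always_eventually allI, metis norm_apply_bcontfun_le minus_bcontfun.rep_eq)
  then show ?thesis by (simp add: LIM_zero_iff)
qed

definition reg_max :: "l2 \<Rightarrow> ennreal" where
  "reg_max w = (SUP n. ennreal (norm (Reg n w)))"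

lemma norm_Reg_le_reg_max: "ennreal (norm (Reg n w)) \<le> reg_max w"
  unfolding reg_max_def by (rule SUP_upper) simp

lemma reg_max_le:
  assumes "\<And>n x. ennreal (cmod (reg n x w)) \<le> b" shows "reg_max w \<le> b"
proof (cases "b = \<top>")
  case False
  then obtain r where r: "b = ennreal r" "r \<ge> 0" by (cases b) auto
  show ?thesis unfolding reg_max_def r(1)
  proof (intro SUP_least ennreal_leI norm_bcontfun_le)
    fix n x
    show "norm (apply_bcontfun (Reg n w) x) \<le> r" using assms[of n x] r by (simp add: ennreal_le_iff)
  qed
qed simp

text \<open>By continuity in space a countable dense set of points suffices in suprema.\<close>

definition rat_seq :: "nat \<Rightarrow> real" where "rat_seq = from_nat_into \<rat>"

lemma rat_seq_dense: "closure (range rat_seq) = UNIV"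
proof -
  have "range rat_seq = \<rat>" unfolding rat_seq_def
    by (rule range_from_nat_into) (auto simp: countable_rat)
  then show ?thesis by (simp add: Rats_closure_real)
qed

text \<open>A supremum over a countable index set, to which measurability and the maximal estimate apply.
  The index codes a pair of a regularisation and a point.\<close>

lemma reg_max_countable:
  "reg_max w = (SUP j. ennreal (cmod (reg (fst (prod_decode j)) (rat_seq (snd (prod_decode j))) w)))"
    (is "_ = ?S")
proof (rule antisym)
  show "?S \<le> reg_max w"
  proof (rule SUP_least)
    fix j :: nat
    have "cmod (reg (fst (prod_decode j)) (rat_seq (snd (prod_decode j))) w) \<le> norm (Reg (fst (prod_decode j)) w)"
      using norm_apply_bcontfun_le[of "Reg (fst (prod_decode j)) w"] by simp
    then show "ennreal (cmod (reg (fst (prod_decode j)) (rat_seq (snd (prod_decode j))) w)) \<le> reg_max w"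
      using norm_Reg_le_reg_max order_trans ennreal_leI by blast
  qed
  show "reg_max w \<le> ?S"
  proof (rule reg_max_le)
    fix n x
    have q: "ennreal (cmod (reg n (rat_seq k) w)) \<le> ?S" for k
      using SUP_upper[of "prod_encode (n, k)" UNIV "\<lambda>j. ennreal (cmod (reg (fst (prod_decode j)) (rat_seq (snd (prod_decode j))) w))"] by simp
    show "ennreal (cmod (reg n x w)) \<le> ?S"
    proof (cases "?S = \<top>")
      case False
      then obtain r where r: "?S = ennreal r" "r \<ge> 0" by (cases ?S) auto
      have "x \<in> {x. cmod (reg n x w) \<le> r}"
      proof (rule subsetD)
        show "closure (range rat_seq) \<subseteq> {x. cmod (reg n x w) \<le> r}"
        proof (rule closure_minimal)
          show "range rat_seq \<subseteq> {x. cmod (reg n x w) \<le> r}" using q r by (auto simp: ennreal_le_iff)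
          show "closed {x. cmod (reg n x w) \<le> r}"
            by (intro closed_Collect_le continuous_on_norm reg_continuous continuous_on_const)
        qed
      qed (simp add: rat_seq_dense)
      then show ?thesis unfolding r(1) by (simp add: ennreal_leI)
    next
      case True
      show ?thesis unfolding True by simp
    qed
  qed
qed

lemma reg_max_schroedinger:
  "reg_max (schroedinger t w) = (SUP j. ennreal (cmod (evol (Complex (1 / real (Suc (fst (prod_decode j)))) t) (rat_seq (snd (prod_decode j))) (hat w))))"
  unfolding reg_max_countable reg_schroedinger ..

lemma Complex_conv: "Complex e t = of_real e + \<i> * of_real t" by (simp add: complex_eq_iff)

lemma reg_max_schroedinger_measurable [measurable]: "(\<lambda>t. reg_max (schroedinger t w)) \<in> borel_measurable borel"
  unfolding reg_max_schroedinger Complex_conv by measurable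

lemma reg_max_strichartz:
  "(\<integral>\<^sup>+ t. reg_max (schroedinger t w) ^ 4 \<partial>lborel) \<le> ennreal ((strichartz_K * norm w) ^ 4)"
  unfolding reg_max_schroedinger
  using maximal_strichartz[of "hat w" "\<lambda>j. 1 / real (Suc (fst (prod_decode j)))" "\<lambda>j. rat_seq (snd (prod_decode j))"]
  by simp

text \<open>Uniform convergence of the regularisations yields a bounded continuous representative, and it is
  stable under approximation in the maximal function; this is how continuity in space is
  established throughout.\<close>

definition regular :: "l2 \<Rightarrow> bool" where "regular w \<longleftrightarrow> convergent (\<lambda>n. Reg n w)"

definition reg_limit :: "l2 \<Rightarrow> (real \<Rightarrow>\<^sub>C complex)" where "reg_limit w = lim (\<lambda>n. Reg n w)"

lemma regular_LIMSEQ: "regular w \<Longrightarrow> (\<lambda>n. Reg n w) \<longlonglongrightarrow> reg_limit w"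
  by (simp add: regular_def reg_limit_def convergent_LIMSEQ_iff)

lemma regular_diff:
  assumes "regular v" "regular w" shows "regular (v - w)" and "reg_limit (v - w) = reg_limit v - reg_limit w"
proof -
  have l: "(\<lambda>n. Reg n (v - w)) \<longlonglongrightarrow> reg_limit v - reg_limit w"
    unfolding Reg_diff by (intro tendsto_intros regular_LIMSEQ assms)
  show "regular (v - w)" unfolding regular_def using l by (auto simp: convergent_def)
  then show "reg_limit (v - w) = reg_limit v - reg_limit w" using l regular_LIMSEQ LIMSEQ_unique by blast
qed

lemma regular_scaleC:
  assumes "regular w" shows "regular (l2_scaleC c w)"
  unfolding regular_def
proof (rule Cauchy_convergent, rule metric_CauchyI)
  fix e :: real assume e: "e > 0"
  have d: "dist (Reg m (l2_scaleC c w)) (Reg n (l2_scaleC c w)) \<le> cmod c * dist (Reg m w) (Reg n w)" for m n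
    unfolding dist_norm
  proof (rule norm_bcontfun_le)
    fix x
    have "norm (apply_bcontfun (Reg m (l2_scaleC c w) - Reg n (l2_scaleC c w)) x) = cmod c * norm (apply_bcontfun (Reg m w - Reg n w) x)"
      by (simp add: reg_scaleC norm_mult flip: right_diff_distrib)
    also have "\<dots> \<le> cmod c * norm (Reg m w - Reg n w)"
      by (intro mult_left_mono norm_apply_bcontfun_le) auto
    finally show "norm (apply_bcontfun (Reg m (l2_scaleC c w) - Reg n (l2_scaleC c w)) x) \<le> cmod c * norm (Reg m w - Reg n w)" .
  qed
  have "Cauchy (\<lambda>n. Reg n w)" using assms unfolding regular_def by (rule convergent_Cauchy)
  moreover have "e / (cmod c + 1) > 0" using e by (simp add: add_nonneg_pos)
  ultimately obtain M where M: "\<And>m n. m \<ge> M \<Longrightarrow> n \<ge> M \<Longrightarrow> dist (Reg m w) (Reg n w) < e / (cmod c + 1)"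
    using metric_CauchyD by blast
  have "dist (Reg m (l2_scaleC c w)) (Reg n (l2_scaleC c w)) < e" if "m \<ge> M" "n \<ge> M" for m n
  proof -
    have "cmod c * dist (Reg m w) (Reg n w) \<le> (cmod c + 1) * dist (Reg m w) (Reg n w)" by (intro mult_right_mono) auto
    also have "\<dots> < (cmod c + 1) * (e / (cmod c + 1))" using M[OF that] by (intro mult_strict_left_mono) (auto simp: add_nonneg_pos)
    also have "\<dots> = e" by (simp add: add_nonneg_eq_0_iff)
    finally show ?thesis using d[of m n] by linarith
  qed
  then show "\<exists>M. \<forall>m\<ge>M. \<forall>n\<ge>M. dist (Reg m (l2_scaleC c w)) (Reg n (l2_scaleC c w)) < e" by blast
qed

lemma reg_limit_scaleC:
  assumes "regular w" shows "apply_bcontfun (reg_limit (l2_scaleC c w)) x = c * apply_bcontfun (reg_limit w) x"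
proof -
  have 1: "(\<lambda>n. apply_bcontfun (Reg n (l2_scaleC c w)) x) \<longlonglongrightarrow> apply_bcontfun (reg_limit (l2_scaleC c w)) x"
    by (intro tendsto_apply_bcontfun regular_LIMSEQ regular_scaleC assms)
  have 2: "(\<lambda>n. c * apply_bcontfun (Reg n w) x) \<longlonglongrightarrow> c * apply_bcontfun (reg_limit w) x"
    by (intro tendsto_intros tendsto_apply_bcontfun regular_LIMSEQ assms)
  show ?thesis using 1 2 unfolding Reg_scaleC_apply by (rule LIMSEQ_unique)
qed

lemma norm_reg_limit_le_reg_max: "regular w \<Longrightarrow> ennreal (norm (reg_limit w)) \<le> reg_max w"
  by (rule LIMSEQ_le_const2[OF tendsto_ennrealI[OF tendsto_norm[OF regular_LIMSEQ]]]) (auto intro: norm_Reg_le_reg_max)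

lemma reg_limit_apply_LIMSEQ: "regular w \<Longrightarrow> (\<lambda>n. reg n x w) \<longlonglongrightarrow> apply_bcontfun (reg_limit w) x"
  using tendsto_apply_bcontfun[OF regular_LIMSEQ, of w x] by simp

text \<open>The regularisations converge in $L^2$ as well, and the two limits agree almost everywhere.\<close>

lemma regular_represents:
  assumes "regular w" shows "represents (reg_limit w) w"
proof -
  define a where "a n \<xi> = hat w \<xi> * complex_of_real (exp (- (1 / real (Suc n)) * \<xi>\<^sup>2))" for n \<xi>
  have ai: "integrable lborel (a n)" for n unfolding a_def using integrable_mult_gauss[of "hat w" "1 / real (Suc n)"] by simp
  have am: "a n \<in> borel_measurable borel" for n unfolding a_def by measurable
  have as: "square_integrable (a n)" for n
    by (rule square_integrable_bound[of "hat w"]) (auto simp: am a_def norm_mult intro!: mult_right_le_one_le)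
  have "(\<lambda>n. abs_l2 (a n)) \<longlonglongrightarrow> abs_l2 (hat w)"
  proof (rule l2_tendsto_dominated)
    show "(\<lambda>n. a n \<xi>) \<longlonglongrightarrow> hat w \<xi>" for \<xi>
    proof -
      have "(\<lambda>n. a n \<xi>) \<longlonglongrightarrow> hat w \<xi> * complex_of_real (exp (- 0 * \<xi>\<^sup>2))"
        unfolding a_def using LIMSEQ_inverse_real_of_nat by (intro tendsto_intros) (simp add: inverse_eq_divide)
      then show ?thesis by simp
    qed
  qed (auto intro: as simp: a_def norm_mult intro!: mult_right_le_one_le)
  then have "(\<lambda>n. inv fourier (abs_l2 (a n))) \<longlonglongrightarrow> inv fourier (fourier w)"
    unfolding inv_fourier by (simp add: reflect_continuous fourier_continuous)
  then have l: "(\<lambda>n. inv fourier (abs_l2 (a n))) \<longlonglongrightarrow> w" by (simp add: inv_fourier fourier_inversion)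
  have eq: "ft (a n) (- x) = reg n x w" for n x
  proof -
    have "cis (- (\<xi> * - x)) * a n \<xi> = hat w \<xi> * wave (complex_of_real (1 / real (Suc n))) x \<xi>" for \<xi>
      unfolding wave_real a_def by (simp add: mult_ac)
    then show ?thesis by (simp only: ft_def reg_def evol_def)
  qed
  have "AE x in lborel. rep_l2 w x = apply_bcontfun (reg_limit w) x"
  proof (rule l2_tendsto_AE_unique[OF l])
    have "AE x in lborel. \<forall>n. rep_l2 (inv fourier (abs_l2 (a n))) x = ft (a n) (- x)"
      unfolding AE_all_countable by (intro allI rep_inv_fourier ai as)
    then show "AE x in lborel. (\<lambda>n. rep_l2 (inv fourier (abs_l2 (a n))) x) \<longlonglongrightarrow> apply_bcontfun (reg_limit w) x"
      by eventually_elim (simp add: eq reg_limit_apply_LIMSEQ[OF assms])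
  qed
  then show ?thesis by (simp add: represents_def)
qed

lemma regular_in_Cx: "regular w \<Longrightarrow> in_Cx w"
  using regular_represents unfolding in_Cx_def by blast

lemma regular_Cx_rep: "regular w \<Longrightarrow> Cx_rep w = reg_limit w"
  unfolding Cx_rep_def using regular_represents represents_unique by (intro the_equality) auto

text \<open>Closedness of uniform convergence with respect to the maximal function.\<close>

lemma regular_approx:
  assumes "\<And>\<delta>. \<delta> > 0 \<Longrightarrow> \<exists>v. regular v \<and> reg_max (w - v) \<le> ennreal \<delta>"
  shows "regular w"
  unfolding regular_def
proof (rule Cauchy_convergent, rule metric_CauchyI)
  fix e :: real assume e: "e > 0"
  then obtain v where v: "regular v" "reg_max (w - v) \<le> ennreal (e / 4)" using assms[of "e / 4"] by auto
  have d: "dist (Reg n w) (Reg n v) \<le> e / 4" for n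
  proof -
    have "ennreal (norm (Reg n (w - v))) \<le> ennreal (e / 4)"
      using norm_Reg_le_reg_max[of n "w - v"] v(2) by (rule order_trans)
    then show ?thesis using e by (simp add: dist_norm Reg_diff ennreal_le_iff)
  qed
  have "Cauchy (\<lambda>n. Reg n v)" using v(1) unfolding regular_def by (rule convergent_Cauchy)
  then obtain M where M: "\<And>m n. m \<ge> M \<Longrightarrow> n \<ge> M \<Longrightarrow> dist (Reg m v) (Reg n v) < e / 4"
    using metric_CauchyD[of "\<lambda>n. Reg n v" "e / 4"] e by auto
  have "dist (Reg m w) (Reg n w) < e" if "m \<ge> M" "n \<ge> M" for m n
    using d[of m] d[of n] M[OF that] dist_triangle[of "Reg m w" "Reg n w" "Reg m v"] dist_triangle[of "Reg m v" "Reg n w" "Reg n v"]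
    using e by (simp add: dist_commute)
  then show "\<exists>M. \<forall>m\<ge>M. \<forall>n\<ge>M. dist (Reg m w) (Reg n w) < e" by blast
qed

text \<open>If the transform is integrable, dominated convergence controls the regularisations uniformly in
  space.\<close>

lemma regular_if_integrable_hat:
  assumes i: "integrable lborel (hat v)" shows "regular v"
proof -
  define I where "I n = (LINT \<xi>|lborel. (1 - exp (- (1 / real (Suc n)) * \<xi>\<^sup>2)) * cmod (hat v \<xi>))" for n
  have g1: "0 \<le> 1 - exp (- (1 / real (Suc n)) * \<xi>\<^sup>2)" "1 - exp (- (1 / real (Suc n)) * \<xi>\<^sup>2) \<le> 1" for n \<xi> by auto
  have iI: "integrable lborel (\<lambda>\<xi>. (1 - exp (- (1 / real (Suc n)) * \<xi>\<^sup>2)) * cmod (hat v \<xi>))" for n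
    by (rule Bochner_Integration.integrable_bound[OF i]) (use g1[of n] in \<open>auto simp: abs_mult intro!: mult_left_le_one_le\<close>)
  have "I \<longlonglongrightarrow> (LINT \<xi>|(lborel :: real measure). 0)" unfolding I_def
  proof (rule integral_dominated_convergence[where w="\<lambda>\<xi>. cmod (hat v \<xi>)"])
    show "integrable lborel (\<lambda>\<xi>. cmod (hat v \<xi>))" using i by (rule integrable_norm)
    show "AE \<xi> in lborel. (\<lambda>n. (1 - exp (- (1 / real (Suc n)) * \<xi>\<^sup>2)) * cmod (hat v \<xi>)) \<longlonglongrightarrow> 0"
    proof (rule AE_I2)
      fix \<xi>
      have "(\<lambda>n. (1 - exp (- (1 / real (Suc n)) * \<xi>\<^sup>2)) * cmod (hat v \<xi>)) \<longlonglongrightarrow> (1 - exp (- 0 * \<xi>\<^sup>2)) * cmod (hat v \<xi>)"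
        using LIMSEQ_inverse_real_of_nat by (intro tendsto_intros) (simp add: inverse_eq_divide)
      then show "(\<lambda>n. (1 - exp (- (1 / real (Suc n)) * \<xi>\<^sup>2)) * cmod (hat v \<xi>)) \<longlonglongrightarrow> 0" by simp
    qed
    show "AE \<xi> in lborel. norm ((1 - exp (- (1 / real (Suc n)) * \<xi>\<^sup>2)) * cmod (hat v \<xi>)) \<le> cmod (hat v \<xi>)" for n
      using g1[of n] by (auto simp: abs_mult intro!: mult_left_le_one_le)
  qed measurable
  then have I0: "I \<longlonglongrightarrow> 0" by simp
  have d: "dist (Reg m v) (Reg n v) \<le> I m + I n" for m n
    unfolding dist_norm
  proof (rule norm_bcontfun_le)
    fix x
    have w0: "integrable lborel (\<lambda>\<xi>. hat v \<xi> * wave w x \<xi>)" if "Re w \<ge> 0" for w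
      by (rule Bochner_Integration.integrable_bound[OF i]) (use that in \<open>auto simp: norm_mult norm_wave intro!: mult_right_le_one_le\<close>)
    define wm where "wm = complex_of_real (1 / real (Suc m))"
    define wn where "wn = complex_of_real (1 / real (Suc n))"
    have w0: "integrable lborel (\<lambda>\<xi>. hat v \<xi> * wave wm x \<xi>)" "integrable lborel (\<lambda>\<xi>. hat v \<xi> * wave wn x \<xi>)"
      by (auto intro!: w0 simp: wm_def wn_def)
    have s: "1 / sqrt (2 * pi) \<le> 1"
    proof -
      have "sqrt 1 \<le> sqrt (2 * pi)" using pi_gt3 by (intro real_sqrt_le_mono) linarith
      then show ?thesis by simp
    qed
    have "norm (apply_bcontfun (Reg m v - Reg n v) x) = cmod (reg m x v - reg n x v)" by simp
    also have "reg m x v - reg n x v = complex_of_real (1 / sqrt (2 * pi)) * (LINT \<xi>|lborel. hat v \<xi> * wave wm x \<xi> - hat v \<xi> * wave wn x \<xi>)"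
      unfolding Bochner_Integration.integral_diff[OF w0] by (simp only: reg_def evol_def wm_def wn_def right_diff_distrib)
    also have "cmod \<dots> \<le> 1 * cmod (LINT \<xi>|lborel. hat v \<xi> * wave wm x \<xi> - hat v \<xi> * wave wn x \<xi>)"
      unfolding norm_mult norm_of_real by (intro mult_right_mono) (use s in auto)
    also have "\<dots> \<le> (LINT \<xi>|lborel. cmod (hat v \<xi> * wave wm x \<xi> - hat v \<xi> * wave wn x \<xi>))"
      by (simp add: integral_norm_bound)
    also have "\<dots> \<le> (LINT \<xi>|lborel. (1 - exp (- (1 / real (Suc m)) * \<xi>\<^sup>2)) * cmod (hat v \<xi>) + (1 - exp (- (1 / real (Suc n)) * \<xi>\<^sup>2)) * cmod (hat v \<xi>))"
    proof (rule integral_mono)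
      fix \<xi>
      have "cmod (hat v \<xi> * wave wm x \<xi> - hat v \<xi> * wave wn x \<xi>) = cmod (hat v \<xi>) * \<bar>exp (- (1 / real (Suc m)) * \<xi>\<^sup>2) - exp (- (1 / real (Suc n)) * \<xi>\<^sup>2)\<bar>"
        unfolding wm_def wn_def wave_real right_diff_distrib[symmetric] norm_mult of_real_diff[symmetric] norm_of_real by simp
      also have "\<dots> \<le> cmod (hat v \<xi>) * ((1 - exp (- (1 / real (Suc m)) * \<xi>\<^sup>2)) + (1 - exp (- (1 / real (Suc n)) * \<xi>\<^sup>2)))"
        by (intro mult_left_mono) (use g1[of m \<xi>] g1[of n \<xi>] in linarith, simp)
      finally show "cmod (hat v \<xi> * wave wm x \<xi> - hat v \<xi> * wave wn x \<xi>) \<le> (1 - exp (- (1 / real (Suc m)) * \<xi>\<^sup>2)) * cmod (hat v \<xi>) + (1 - exp (- (1 / real (Suc n)) * \<xi>\<^sup>2)) * cmod (hat v \<xi>)"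
        by (simp add: algebra_simps)
    qed (intro integrable_norm Bochner_Integration.integrable_diff Bochner_Integration.integrable_add w0 iI)+
    also have "\<dots> = I m + I n" unfolding I_def by (rule Bochner_Integration.integral_add[OF iI iI])
    finally show "norm (apply_bcontfun (Reg m v - Reg n v) x) \<le> I m + I n" .
  qed
  show ?thesis unfolding regular_def
  proof (rule Cauchy_convergent, rule metric_CauchyI)
    fix e :: real assume "e > 0"
    then obtain M where M: "\<And>n. n \<ge> M \<Longrightarrow> norm (I n - 0) < e / 2" using LIMSEQ_D[OF I0, of "e / 2"] by auto
    have "dist (Reg m v) (Reg n v) < e" if "m \<ge> M" "n \<ge> M" for m n
      using d[of m n] M[OF that(1)] M[OF that(2)] by (simp add: abs_less_iff)
    then show "\<exists>M. \<forall>m\<ge>M. \<forall>n\<ge>M. dist (Reg m v) (Reg n v) < e" by blast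
  qed
qed

text \<open>Approximate by data with compactly supported transform, for which the evolution is regular at
  every time. By the maximal Strichartz estimate and Fatou's lemma the error is small along a
  subsequence at almost every time.\<close>

lemma AE_regular_schroedinger: "AE t in lborel. regular (schroedinger t \<phi>)"
proof -
  define v where "v k = inv fourier (abs_l2 (cutoff k (hat \<phi>)))" for k
  have hv: "AE \<xi> in lborel. hat (v k) \<xi> = cutoff k (hat \<phi>) \<xi>" for k
    unfolding v_def fourier_inv_fourier by (intro rep_abs_l2 square_integrable_cutoff) simp
  have nv: "regular (schroedinger t (v k))" for t k
  proof (rule regular_if_integrable_hat)
    have 1: "integrable lborel (phase t (cutoff k (hat \<phi>)))"
      by (rule Bochner_Integration.integrable_bound[OF integrable_cutoff[of "hat \<phi>" k]])
         (auto simp: phase_def norm_mult intro!: square_integrable_measurable square_integrable_phase square_integrable_cutoff)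
    have "AE \<xi> in lborel. hat (schroedinger t (v k)) \<xi> = phase t (cutoff k (hat \<phi>)) \<xi>"
      using hat_schroedinger[of t "v k"] hv[of k] by eventually_elim (simp add: phase_def)
    then show "integrable lborel (hat (schroedinger t (v k)))"
      using 1 by (subst integrable_cong_AE) (auto intro: borel_measurable_integrable)
  qed
  have vl: "(\<lambda>k. norm (\<phi> - v k)) \<longlonglongrightarrow> 0"
  proof -
    have "(\<lambda>k. inv fourier (abs_l2 (cutoff k (hat \<phi>)))) \<longlonglongrightarrow> inv fourier (fourier \<phi>)"
      unfolding inv_fourier by (intro reflect_continuous fourier_continuous l2_cutoff_tendsto)
    then have "v \<longlonglongrightarrow> \<phi>" by (simp add: v_def[abs_def] inv_fourier fourier_inversion)
    then have "(\<lambda>k. norm (\<phi> - v k)) \<longlonglongrightarrow> norm (\<phi> - \<phi>)" by (intro tendsto_intros)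
    then show ?thesis by simp
  qed
  have "(\<integral>\<^sup>+ t. liminf (\<lambda>k. reg_max (schroedinger t (\<phi> - v k)) ^ 4) \<partial>lborel) \<le> liminf (\<lambda>k. \<integral>\<^sup>+ t. reg_max (schroedinger t (\<phi> - v k)) ^ 4 \<partial>lborel)"
    by (intro nn_integral_liminf) measurable
  also have "\<dots> \<le> liminf (\<lambda>k. ennreal ((strichartz_K * norm (\<phi> - v k)) ^ 4))"
    by (intro Liminf_mono always_eventually allI reg_max_strichartz)
  also have "\<dots> = ennreal ((strichartz_K * 0) ^ 4)"
    by (intro lim_imp_Liminf tendsto_ennrealI tendsto_intros vl) simp
  finally have "(\<integral>\<^sup>+ t. liminf (\<lambda>k. reg_max (schroedinger t (\<phi> - v k)) ^ 4) \<partial>lborel) = 0" by simp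
  then have "AE t in lborel. liminf (\<lambda>k. reg_max (schroedinger t (\<phi> - v k)) ^ 4) = 0"
    by (subst (asm) nn_integral_0_iff_AE) auto
  then show ?thesis
  proof eventually_elim
    case (elim t)
    show ?case
    proof (rule regular_approx)
      fix \<delta> :: real assume \<delta>: "\<delta> > 0"
      have "\<exists>k. reg_max (schroedinger t (\<phi> - v k)) ^ 4 < ennreal (\<delta> ^ 4)"
      proof (rule ccontr)
        assume "\<not> ?thesis"
        then have "ennreal (\<delta> ^ 4) \<le> liminf (\<lambda>k. reg_max (schroedinger t (\<phi> - v k)) ^ 4)"
          by (intro Liminf_bounded always_eventually) (auto simp: not_less)
        then show False using elim \<delta> by simp
      qed
      then obtain k where k: "reg_max (schroedinger t (\<phi> - v k)) ^ 4 < ennreal (\<delta> ^ 4)" ..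
      have "reg_max (schroedinger t (\<phi> - v k)) \<le> ennreal \<delta>"
      proof (rule ccontr)
        assume "\<not> ?thesis"
        then have "ennreal \<delta> ^ 4 \<le> reg_max (schroedinger t (\<phi> - v k)) ^ 4" by (intro power_mono) auto
        then show False using k \<delta> by (simp add: ennreal_power)
      qed
      then show "\<exists>v. regular v \<and> reg_max (schroedinger t \<phi> - v) \<le> ennreal \<delta>"
        using nv[of t k] by (auto simp: schroedinger_diff)
    qed
  qed
qed

section \<open>Sources concentrated at the origin\<close>

text \<open>The integral of the power $4/3$, that is, the norm in $L^{4/3}$ to that power.\<close>

definition N43 :: "(real \<Rightarrow> complex) \<Rightarrow> ennreal" where
  "N43 h = (\<integral>\<^sup>+ s. ennreal (cmod (h s) powr (4/3)) \<partial>lborel)"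

text \<open>Integrability makes the superposition a Lebesgue integral. Densities in $L^{4/3}$ have it on
  bounded time intervals.\<close>

definition admissible :: "(real \<Rightarrow> complex) \<Rightarrow> bool" where
  "admissible h \<longleftrightarrow> integrable lborel h \<and> N43 h < \<infinity>"

definition n43 :: "(real \<Rightarrow> complex) \<Rightarrow> real" where "n43 h = enn2real (N43 h)"

lemma n43_nonneg [simp]: "n43 h \<ge> 0" by (simp add: n43_def)

lemma admissible_integrable: "admissible h \<Longrightarrow> integrable lborel h" by (simp add: admissible_def)

lemma admissible_measurable: "admissible h \<Longrightarrow> h \<in> borel_measurable borel" by (auto simp: admissible_def)

lemma N43_admissible: "admissible h \<Longrightarrow> N43 h = ennreal (n43 h)"
  by (simp add: admissible_def n43_def less_top)

lemma powr_43_diff_le: "cmod (a - b) powr (4/3) \<le> 4 * cmod a powr (4/3) + 4 * cmod b powr (4/3)"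
proof -
  define m where "m = max (cmod a) (cmod b)"
  have "cmod (a - b) \<le> cmod a + cmod b" by (rule norm_triangle_ineq4)
  also have "\<dots> \<le> 2 * m" by (simp add: m_def)
  finally have "cmod (a - b) powr (4/3) \<le> (2 * m) powr (4/3)" by (intro powr_mono2) auto
  also have "\<dots> = 2 powr (4/3) * m powr (4/3)" by (rule powr_mult)
  also have "\<dots> \<le> 4 * m powr (4/3)"
  proof (intro mult_right_mono)
    have "(2::real) powr (4/3) \<le> 2 powr 2" by (intro powr_mono) auto
    then show "(2::real) powr (4/3) \<le> 4" by simp
  qed simp
  also have "m powr (4/3) \<le> cmod a powr (4/3) + cmod b powr (4/3)" by (auto simp: m_def max_def)
  finally show ?thesis by simp
qed

lemma admissible_diff:
  assumes h: "admissible h" and g: "admissible g" shows "admissible (\<lambda>s. h s - g s)"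
proof -
  have [measurable]: "h \<in> borel_measurable borel" "g \<in> borel_measurable borel" using h g by (auto intro: admissible_measurable)
  have "N43 (\<lambda>s. h s - g s) \<le> (\<integral>\<^sup>+ s. 4 * ennreal (cmod (h s) powr (4/3)) + 4 * ennreal (cmod (g s) powr (4/3)) \<partial>lborel)"
    unfolding N43_def
  proof (rule nn_integral_mono)
    fix s
    have "ennreal (cmod (h s - g s) powr (4/3)) \<le> ennreal (4 * cmod (h s) powr (4/3) + 4 * cmod (g s) powr (4/3))"
      by (intro ennreal_leI powr_43_diff_le)
    then show "ennreal (cmod (h s - g s) powr (4/3)) \<le> 4 * ennreal (cmod (h s) powr (4/3)) + 4 * ennreal (cmod (g s) powr (4/3))"
      by (simp add: ennreal_mult)
  qed
  also have "\<dots> = 4 * N43 h + 4 * N43 g"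
    unfolding N43_def by (subst nn_integral_add) (auto simp: nn_integral_cmult)
  also have "\<dots> < \<infinity>" using h g by (auto simp: admissible_def ennreal_mult_less_top)
  finally show ?thesis using h g by (simp add: admissible_def)
qed

definition restr :: "real set \<Rightarrow> (real \<Rightarrow> complex) \<Rightarrow> real \<Rightarrow> complex" where
  "restr S c s = indicator S s * c s"

lemma restr_measurable [measurable]:
  assumes [measurable]: "S \<in> sets borel" "c \<in> borel_measurable borel"
  shows "restr S c \<in> borel_measurable borel"
  unfolding restr_def by measurable

lemma cmod_restr: "cmod (restr S c s) = indicator S s * cmod (c s)"
  by (simp add: restr_def norm_mult indicator_def)

lemma restr_restr: "restr S (restr S' c) = restr (S \<inter> S') c"
  by (auto simp: restr_def fun_eq_iff indicator_def)

lemma N43_mono: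
  assumes "\<And>s. cmod (g s) \<le> cmod (h s)" shows "N43 g \<le> N43 h"
  unfolding N43_def by (intro nn_integral_mono ennreal_leI powr_mono2) (use assms in auto)

lemma admissible_zero: "admissible (\<lambda>_. 0)" by (simp add: admissible_def N43_def)

text \<open>On a set of finite measure $L^{4/3} \subseteq L^1$, since $|h| \le 1 + |h|^{4/3}$.\<close>

lemma admissible_bounded_interval:
  assumes [measurable]: "h \<in> borel_measurable borel" and N: "N43 h < \<infinity>" and supp: "\<And>s. s \<notin> {a..b} \<Longrightarrow> h s = 0"
  shows "admissible h"
proof -
  have "(\<integral>\<^sup>+ s. ennreal (cmod (h s)) \<partial>lborel) \<le> (\<integral>\<^sup>+ s. indicator {a..b} s + ennreal (cmod (h s) powr (4/3)) \<partial>lborel)"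
  proof (rule nn_integral_mono)
    fix s
    have "cmod (h s) \<le> indicator {a..b} s + cmod (h s) powr (4/3)"
    proof (cases "cmod (h s) \<le> 1")
      case True
      then show ?thesis using supp[of s] by (cases "s \<in> {a..b}") (auto simp: add_increasing2)
    next
      case False
      then have "cmod (h s) powr 1 \<le> cmod (h s) powr (4/3)" by (intro powr_mono) auto
      then show ?thesis by (simp add: add_increasing)
    qed
    then have "ennreal (cmod (h s)) \<le> ennreal (indicator {a..b} s + cmod (h s) powr (4/3))" by (rule ennreal_leI)
    then show "ennreal (cmod (h s)) \<le> indicator {a..b} s + ennreal (cmod (h s) powr (4/3))"
      by (simp add: ennreal_indicator)
  qed
  also have "\<dots> = emeasure lborel {a..b} + N43 h" unfolding N43_def by (subst nn_integral_add) auto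
  also have "\<dots> < \<infinity>" using N by (simp add: emeasure_lborel_Icc_eq)
  finally show ?thesis using N by (auto simp: admissible_def integrable_iff_bounded)
qed

text \<open>The parameter of $e^{-is\partial_x^2}$.\<close>

definition osc :: "real \<Rightarrow> complex" where "osc s = Complex 0 (- s)"

lemma osc_measurable [measurable]: "osc \<in> borel_measurable borel"
  unfolding osc_def Complex_conv by measurable

lemma osc_facts: "Re (osc s) = 0" "\<bar>Im (osc t) - Im (osc s)\<bar> = \<bar>t - s\<bar>" by (auto simp: osc_def)

text \<open>The transform of $\int e^{-is\partial_x^2}[h(s)\,\delta]\,ds$, up to normalisation: the
  transform of $\delta$ is constant.\<close>

definition source_hat :: "(real \<Rightarrow> complex) \<Rightarrow> real \<Rightarrow> complex" where
  "source_hat h = superpose osc (\<lambda>_. 0) h"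

lemma source_hat_measurable: "h \<in> borel_measurable borel \<Longrightarrow> source_hat h \<in> borel_measurable borel"
  unfolding source_hat_def by measurable

text \<open>The kernel estimate needs damping; Fatou's lemma removes it.\<close>

lemma source_hat_L2:
  assumes h: "admissible h"
  shows "(\<integral>\<^sup>+ \<xi>. ennreal ((cmod (source_hat h \<xi>))\<^sup>2) \<partial>lborel) \<le> ennreal (14 * sqrt pi * root 4 (n43 h) ^ 6)"
proof -
  have [measurable]: "h \<in> borel_measurable borel" using h by (rule admissible_measurable)
  define e where "e n = 1 / real (Suc n)" for n
  have e: "e n > 0" for n by (simp add: e_def)
  have d: "(\<integral>\<^sup>+ \<xi>. ennreal ((exp (- e n * \<xi>\<^sup>2) * cmod (source_hat h \<xi>))\<^sup>2) \<partial>lborel) \<le> ennreal (14 * sqrt pi * root 4 (n43 h) ^ 6)" for n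
  proof -
    have "cmod (superpose (\<lambda>t. osc t + complex_of_real (e n)) (\<lambda>_. 0) h \<xi>) = exp (- e n * \<xi>\<^sup>2) * cmod (source_hat h \<xi>)" for \<xi>
      unfolding superpose_damped source_hat_def by (simp add: norm_mult power2_eq_square)
    moreover have "(\<integral>\<^sup>+ \<xi>. ennreal ((cmod (superpose (\<lambda>t. osc t + complex_of_real (e n)) (\<lambda>_. 0) h \<xi>))\<^sup>2) \<partial>lborel) \<le> ennreal (14 * sqrt pi * root 4 (n43 h) ^ 6)"
      by (rule superpose_L2_bound[where e="e n"])
         (use h e[of n] N43_admissible[OF h] in \<open>auto simp: admissible_def osc_facts N43_def\<close>)
    ultimately show ?thesis by simp
  qed
  have "(\<integral>\<^sup>+ \<xi>. ennreal ((cmod (source_hat h \<xi>))\<^sup>2) \<partial>lborel) = (\<integral>\<^sup>+ \<xi>. liminf (\<lambda>n. ennreal ((exp (- e n * \<xi>\<^sup>2) * cmod (source_hat h \<xi>))\<^sup>2)) \<partial>lborel)"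
  proof (intro nn_integral_cong)
    fix \<xi>
    have "(\<lambda>n. ennreal ((exp (- e n * \<xi>\<^sup>2) * cmod (source_hat h \<xi>))\<^sup>2)) \<longlonglongrightarrow> ennreal ((exp (- 0 * \<xi>\<^sup>2) * cmod (source_hat h \<xi>))\<^sup>2)"
      unfolding e_def using LIMSEQ_inverse_real_of_nat by (intro tendsto_ennrealI tendsto_intros) (simp add: inverse_eq_divide)
    from lim_imp_Liminf[OF _ this]
    show "ennreal ((cmod (source_hat h \<xi>))\<^sup>2) = liminf (\<lambda>n. ennreal ((exp (- e n * \<xi>\<^sup>2) * cmod (source_hat h \<xi>))\<^sup>2))" by simp
  qed
  also have "\<dots> \<le> liminf (\<lambda>n. \<integral>\<^sup>+ \<xi>. ennreal ((exp (- e n * \<xi>\<^sup>2) * cmod (source_hat h \<xi>))\<^sup>2) \<partial>lborel)"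
    unfolding source_hat_def by (intro nn_integral_liminf) measurable
  also have "\<dots> \<le> liminf (\<lambda>n::nat. ennreal (14 * sqrt pi * root 4 (n43 h) ^ 6))"
    by (intro Liminf_mono always_eventually allI d)
  also have "\<dots> = ennreal (14 * sqrt pi * root 4 (n43 h) ^ 6)" by (rule Liminf_const) simp
  finally show ?thesis .
qed

lemma square_integrable_source_hat: "admissible h \<Longrightarrow> square_integrable (source_hat h)"
  using source_hat_L2[of h] by (auto simp: square_integrable_iff_nn source_hat_measurable admissible_measurable intro: le_less_trans)

abbreviation inv_sqrt_2pi :: complex where "inv_sqrt_2pi \<equiv> complex_of_real (1 / sqrt (2 * pi))"

text \<open>$\int e^{-is\partial_x^2}[h(s)\,\delta]\,ds$.\<close>

definition source :: "(real \<Rightarrow> complex) \<Rightarrow> l2" where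
  "source h = inv fourier (abs_l2 (\<lambda>\<xi>. inv_sqrt_2pi * source_hat h \<xi>))"

lemma hat_source: "admissible h \<Longrightarrow> AE \<xi> in lborel. hat (source h) \<xi> = inv_sqrt_2pi * source_hat h \<xi>"
  unfolding source_def fourier_inv_fourier by (intro rep_abs_l2 square_integrable_scale square_integrable_source_hat)

text \<open>The dual form of the Strichartz estimate.\<close>

lemma norm_source_le:
  assumes h: "admissible h" shows "norm (source h) \<le> strichartz_K * root 4 (n43 h) ^ 3"
proof -
  have "ennreal ((norm (source h))\<^sup>2) = ennreal ((norm (fourier (source h)))\<^sup>2)" by simp
  also have "\<dots> = (\<integral>\<^sup>+ \<xi>. ennreal (1 / (2 * pi)) * ennreal ((cmod (source_hat h \<xi>))\<^sup>2) \<partial>lborel)"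
    unfolding ennreal_norm_l2_sq
  proof (rule nn_integral_cong_AE, use hat_source[OF h] in eventually_elim)
    case (elim \<xi>)
    have "(cmod (hat (source h) \<xi>))\<^sup>2 = 1 / (2 * pi) * (cmod (source_hat h \<xi>))\<^sup>2"
      unfolding elim norm_mult power_mult_distrib norm_of_real by (simp add: power_divide)
    then show ?case by (simp flip: ennreal_mult)
  qed
  also have "\<dots> = ennreal (1 / (2 * pi)) * (\<integral>\<^sup>+ \<xi>. ennreal ((cmod (source_hat h \<xi>))\<^sup>2) \<partial>lborel)"
    using source_hat_measurable[OF admissible_measurable[OF h]] by (intro nn_integral_cmult) measurable
  also have "\<dots> \<le> ennreal (1 / (2 * pi)) * ennreal (14 * sqrt pi * root 4 (n43 h) ^ 6)"
    by (intro mult_left_mono source_hat_L2 h) simp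
  also have "\<dots> = ennreal ((strichartz_K * root 4 (n43 h) ^ 3)\<^sup>2)"
  proof -
    have "root 4 (n43 h) ^ 6 = (root 4 (n43 h) ^ 3)\<^sup>2" by (simp flip: power_mult)
    then have "1 / (2 * pi) * (14 * sqrt pi * root 4 (n43 h) ^ 6) = (strichartz_K * root 4 (n43 h) ^ 3)\<^sup>2"
      by (simp add: strichartz_K_def power_mult_distrib power_divide)
    then show ?thesis by (simp flip: ennreal_mult)
  qed
  finally have "(norm (source h))\<^sup>2 \<le> (strichartz_K * root 4 (n43 h) ^ 3)\<^sup>2" by (simp add: ennreal_le_iff)
  then show ?thesis by (rule power2_le_imp_le) (use strichartz_K_pos in simp)
qed

lemma source_hat_diff:
  assumes "admissible h" "admissible g" shows "source_hat (\<lambda>s. h s - g s) \<xi> = source_hat h \<xi> - source_hat g \<xi>"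
proof -
  have i: "integrable lborel (\<lambda>t. h t * wave (osc t) 0 \<xi>)" if h: "admissible h" for h
  proof (rule Bochner_Integration.integrable_bound[OF admissible_integrable[OF h]])
    have [measurable]: "h \<in> borel_measurable borel" using h by (rule admissible_measurable)
    show "(\<lambda>t. h t * wave (osc t) 0 \<xi>) \<in> borel_measurable lborel" by measurable
  qed (simp add: norm_mult norm_wave osc_facts)
  show ?thesis unfolding source_hat_def superpose_def left_diff_distrib
    by (rule Bochner_Integration.integral_diff) (intro i assms)+
qed

lemma source_diff:
  assumes "admissible h" "admissible g" shows "source (\<lambda>s. h s - g s) = source h - source g"
  by (rule hat_eqI) (use hat_source[OF admissible_diff[OF assms]] hat_source[OF assms(1)] hat_source[OF assms(2)] hat_diff[of "source h" "source g"]
      in \<open>eventually_elim, simp only: source_hat_diff[OF assms] right_diff_distrib\<close>)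

lemma source_zero [simp]: "source (\<lambda>_. 0) = 0"
  using source_diff[OF admissible_zero admissible_zero] by simp

lemma source_cong_AE:
  assumes h: "h \<in> borel_measurable borel" "g \<in> borel_measurable borel" "AE s in lborel. h s = g s"
  shows "source h = source g"
proof -
  have [measurable]: "h \<in> borel_measurable borel" "g \<in> borel_measurable borel" using h by auto
  have "source_hat h \<xi> = source_hat g \<xi>" for \<xi>
    unfolding source_hat_def superpose_def by (intro integral_cong_AE) (use h(3) in auto)
  then show ?thesis by (simp add: source_def)
qed

lemma source_split:
  assumes "admissible (restr S c)" "admissible (restr S' c)" "S \<inter> S' = {}"
  shows "admissible (restr (S \<union> S') c) \<Longrightarrow> source (restr (S \<union> S') c) - source (restr S' c) = source (restr S c)"
proof -
  assume a: "admissible (restr (S \<union> S') c)"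
  have "(\<lambda>s. restr (S \<union> S') c s - restr S' c s) = restr S c"
    using assms(3) by (auto simp: restr_def fun_eq_iff indicator_def)
  then show ?thesis using source_diff[OF a assms(2)] by simp
qed

lemma wave_mult: "wave w x \<xi> * wave w' x' \<xi> = wave (w + w') (x + x') \<xi>"
  by (simp add: wave_def exp_add[symmetric] algebra_simps)

text \<open>The evolved source is a superposition of translated kernels, each weighted by the density at the
  time of emission.\<close>

lemma evol_source:
  assumes h: "admissible h" and e: "e > 0"
  shows "evol (Complex e t) x (hat (source h)) = complex_of_real (1 / (2 * pi)) * (LINT s|lborel. h s * gauss_kernel (Complex e (t - s)) x)"
proof -
  have [measurable]: "h \<in> borel_measurable borel" using h by (rule admissible_measurable)
  have wi: "integrable lborel (\<lambda>\<xi>. wave (Complex e t) x \<xi> * exp (- 0 * \<xi>\<^sup>2))"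
    using gaussian_fourier(1)[of "Complex e t" x] e unfolding wave_def by simp
  have "evol (Complex e t) x (hat (source h)) = evol (Complex e t) x (\<lambda>\<xi>. inv_sqrt_2pi * source_hat h \<xi>)"
    by (rule evol_cong_AE) (use hat_source[OF h] source_hat_measurable[OF admissible_measurable[OF h]] in auto)
  also have "\<dots> = inv_sqrt_2pi * (inv_sqrt_2pi * (LINT \<xi>|lborel. source_hat h \<xi> * wave (Complex e t) x \<xi>))"
    unfolding evol_scale unfolding evol_def ..
  also have "\<dots> = complex_of_real (1 / (2 * pi)) * (LINT \<xi>|lborel. source_hat h \<xi> * wave (Complex e t) x \<xi>)"
    by (simp flip: of_real_mult mult.assoc)
  also have "(LINT \<xi>|lborel. source_hat h \<xi> * wave (Complex e t) x \<xi>) = (LINT s|lborel. h s * (LINT \<xi>|lborel. wave (Complex e t) x \<xi> * wave (osc s) 0 \<xi>))"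
    unfolding source_hat_def by (rule superpose_Fubini(2)[OF admissible_integrable[OF h] _ _ _ wi]) (auto simp: osc_facts)
  also have "\<dots> = (LINT s|lborel. h s * gauss_kernel (Complex e (t - s)) x)"
  proof (intro Bochner_Integration.integral_cong refl arg_cong2[where f="(*)"])
    fix s
    have c: "Complex e t + osc s = Complex e (t - s)" by (simp add: osc_def complex_eq_iff)
    show "(LINT \<xi>|lborel. wave (Complex e t) x \<xi> * wave (osc s) 0 \<xi>) = gauss_kernel (Complex e (t - s)) x"
      unfolding wave_mult c add_0_right by (rule LINT_wave) (use e in simp)
  qed
  finally show ?thesis .
qed

lemma gauss_kernel_decay:
  assumes "e \<ge> 0" "\<tau> \<noteq> 0" shows "cmod (gauss_kernel (Complex e \<tau>) x) \<le> sqrt pi / sqrt \<bar>\<tau>\<bar>"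
proof -
  have "Complex e \<tau> \<noteq> 0" using assms by (simp add: complex_eq_iff)
  then have "cmod (gauss_kernel (Complex e \<tau>) x) \<le> sqrt pi / sqrt (cmod (Complex e \<tau>))"
    using assms by (intro gauss_kernel_bound) auto
  also have "\<dots> \<le> sqrt pi / sqrt \<bar>\<tau>\<bar>"
    using abs_Im_le_cmod[of "Complex e \<tau>"] assms by (intro divide_left_mono) (auto intro!: mult_pos_pos)
  finally show ?thesis .
qed

lemma sqrt_pi_le: "sqrt pi \<le> 2 * pi"
proof (rule real_le_lsqrt)
  have "pi * 1 \<le> pi * (4 * pi)" using pi_gt3 by (intro mult_left_mono) auto
  then show "pi \<le> (2 * pi)\<^sup>2" by (simp add: power2_eq_square)
qed simp

text \<open>Pointwise in time, all regularisations at all points are dominated by the Riesz potential of the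
  density.\<close>

lemma reg_max_source_le:
  assumes h: "admissible h" shows "reg_max (schroedinger t (source h)) \<le> riesz h t"
proof (rule reg_max_le)
  fix n x
  have [measurable]: "h \<in> borel_measurable borel" using h by (rule admissible_measurable)
  let ?k = "\<lambda>s. gauss_kernel (Complex (1 / real (Suc n)) (t - s)) x"
  have "ennreal (cmod (reg n x (schroedinger t (source h)))) = ennreal (1 / (2 * pi)) * ennreal (cmod (LINT s|lborel. h s * ?k s))"
    by (simp add: reg_schroedinger evol_source[OF h] norm_mult norm_divide ennreal_mult[symmetric])
  also have "\<dots> \<le> ennreal (1 / (2 * pi)) * (\<integral>\<^sup>+ s. ennreal (cmod (h s * ?k s)) \<partial>lborel)"
    by (intro mult_left_mono ennreal_norm_integral_le) simp
  also have "\<dots> \<le> ennreal (1 / (2 * pi)) * (\<integral>\<^sup>+ s. ennreal (2 * pi) * ennreal (cmod (h s) / sqrt \<bar>t - s\<bar>) \<partial>lborel)"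
  proof (intro mult_left_mono nn_integral_mono_AE, use AE_lborel_singleton[of t] in eventually_elim)
    case (elim s)
    have "sqrt pi / sqrt \<bar>t - s\<bar> \<le> 2 * pi / sqrt \<bar>t - s\<bar>" by (intro divide_right_mono sqrt_pi_le) auto
    then have "cmod (?k s) \<le> 2 * pi / sqrt \<bar>t - s\<bar>"
      using gauss_kernel_decay[of "1 / real (Suc n)" "t - s" x] elim by simp
    then have "cmod (h s) * cmod (?k s) \<le> cmod (h s) * (2 * pi / sqrt \<bar>t - s\<bar>)" by (intro mult_left_mono) auto
    then show ?case by (simp add: norm_mult ennreal_leI mult_ac flip: ennreal_mult)
  qed simp
  also have "\<dots> = ennreal (1 / (2 * pi)) * (ennreal (2 * pi) * riesz h t)"
    unfolding riesz_def by (subst nn_integral_cmult) auto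
  also have "\<dots> = riesz h t" by (simp flip: mult.assoc ennreal_mult)
  finally show "ennreal (cmod (reg n x (schroedinger t (source h)))) \<le> riesz h t" .
qed

text \<open>The limit of the kernels at the origin as the damping vanishes: $(4\pi i\tau)^{-1/2}$.\<close>

definition kern :: "real \<Rightarrow> complex" where
  "kern \<tau> = complex_of_real (1 / (2 * pi)) * (complex_of_real (sqrt pi) / csqrt (\<i> * of_real \<tau>))"

lemma csqrt_measurable [measurable]: "csqrt \<in> borel_measurable borel"
proof -
  have "csqrt z = of_real (sqrt ((cmod z + Re z) / 2)) + \<i> * of_real ((if Im z \<ge> 0 then 1 else -1) * sqrt ((cmod z - Re z) / 2))" for z
    by (rule complex_eqI) (auto simp: sgn_if)
  then have eq: "csqrt = (\<lambda>z. of_real (sqrt ((cmod z + Re z) / 2)) + \<i> * of_real ((if Im z \<ge> 0 then 1 else -1) * sqrt ((cmod z - Re z) / 2)))"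
    by (rule ext)
  show ?thesis unfolding eq by measurable
qed

lemma kern_measurable [measurable]: "kern \<in> borel_measurable borel"
  unfolding kern_def by measurable

lemma gauss_kernel_tendsto:
  assumes "\<tau> \<noteq> 0"
  shows "(\<lambda>n. complex_of_real (1 / (2 * pi)) * gauss_kernel (Complex (1 / real (Suc n)) \<tau>) 0) \<longlonglongrightarrow> kern \<tau>"
proof -
  have "(\<lambda>n. of_real (1 / real (Suc n)) + \<i> * of_real \<tau>) \<longlonglongrightarrow> of_real 0 + \<i> * complex_of_real \<tau>"
    using LIMSEQ_inverse_real_of_nat by (intro tendsto_intros) (simp add: inverse_eq_divide)
  then have l: "(\<lambda>n. of_real (1 / real (Suc n)) + \<i> * of_real \<tau>) \<longlonglongrightarrow> \<i> * complex_of_real \<tau>" by simp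
  have "isCont csqrt (\<i> * of_real \<tau>)"
    using assms by (intro continuous_at_csqrt) (auto simp: complex_nonpos_Reals_iff)
  from isCont_tendsto_compose[OF this l]
  have "(\<lambda>n. csqrt (Complex (1 / real (Suc n)) \<tau>)) \<longlonglongrightarrow> csqrt (\<i> * of_real \<tau>)"
    by (simp only: Complex_conv)
  then show ?thesis unfolding gauss_kernel_def kern_def
    using assms by (auto intro!: tendsto_intros tendsto_eq_intros)
qed

lemma gauss_kernel_measurable [measurable (raw)]:
  assumes [measurable]: "z \<in> borel_measurable M" "x \<in> borel_measurable M"
  shows "(\<lambda>s. gauss_kernel (z s) (x s)) \<in> borel_measurable M"
  unfolding gauss_kernel_def by measurable

lemma riesz_finite_integrable:
  assumes [measurable]: "h \<in> borel_measurable borel" and "riesz h t < \<infinity>"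
  shows "integrable lborel (\<lambda>s. cmod (h s) / sqrt \<bar>t - s\<bar>)"
  using assms(2) unfolding riesz_def integrable_iff_bounded by auto

text \<open>The value at the origin, by dominated convergence with the integrand of the Riesz potential as
  majorant.\<close>

lemma reg_source_tendsto:
  assumes h: "admissible h" and fin: "riesz h t < \<infinity>"
  shows "(\<lambda>n. reg n 0 (schroedinger t (source h))) \<longlonglongrightarrow> (LINT s|lborel. h s * kern (t - s))"
proof -
  have [measurable]: "h \<in> borel_measurable borel" using h by (rule admissible_measurable)
  let ?k = "\<lambda>n s. complex_of_real (1 / (2 * pi)) * gauss_kernel (Complex (1 / real (Suc n)) (t - s)) 0"
  have "reg n 0 (schroedinger t (source h)) = (LINT s|lborel. h s * ?k n s)" for n
    unfolding reg_schroedinger by (subst evol_source[OF h], simp) (simp add: mult.left_commute flip: integral_mult_right_zero)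
  moreover have "(\<lambda>n. LINT s|lborel. h s * ?k n s) \<longlonglongrightarrow> (LINT s|lborel. h s * kern (t - s))"
  proof (rule integral_dominated_convergence)
    show "integrable lborel (\<lambda>s. cmod (h s) / sqrt \<bar>t - s\<bar>)" by (rule riesz_finite_integrable[OF _ fin]) simp
    show "AE s in lborel. (\<lambda>n. h s * ?k n s) \<longlonglongrightarrow> h s * kern (t - s)"
      using AE_lborel_singleton[of t] by eventually_elim (intro tendsto_mult tendsto_const gauss_kernel_tendsto, simp)
    show "AE s in lborel. norm (h s * ?k n s) \<le> cmod (h s) / sqrt \<bar>t - s\<bar>" for n
      using AE_lborel_singleton[of t]
    proof eventually_elim
      case (elim s)
      have "cmod (?k n s) \<le> 1 / (2 * pi) * (sqrt pi / sqrt \<bar>t - s\<bar>)"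
        unfolding norm_mult norm_of_real
        using gauss_kernel_decay[of "1 / real (Suc n)" "t - s" 0] elim by (intro mult_mono) auto
      also have "\<dots> \<le> 1 / sqrt \<bar>t - s\<bar>"
      proof -
        have "sqrt pi / (2 * pi) \<le> 1" using sqrt_pi_le by simp
        then have "sqrt pi / (2 * pi) / sqrt \<bar>t - s\<bar> \<le> 1 / sqrt \<bar>t - s\<bar>" by (intro divide_right_mono) auto
        then show ?thesis by simp
      qed
      finally show ?case unfolding norm_mult[of "h s"] using mult_left_mono[of "cmod (?k n s)" "1 / sqrt \<bar>t - s\<bar>" "cmod (h s)"] by simp
    qed
  qed (auto simp: Complex_conv)
  ultimately show ?thesis by simp
qed

text \<open>The evolution of a source up to the present time is compared with that of the source switched
  off shortly before; what is lost is controlled by the Riesz potential of the short remainder.\<close>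

lemma regular_source_limit:
  assumes h: "admissible h" and g: "\<And>n. admissible (g n)" and lim: "(\<lambda>n. riesz (g n) t) \<longlonglongrightarrow> 0"
    and regular: "\<And>n. regular (schroedinger t (source (\<lambda>s. h s - g n s)))"
  shows "regular (schroedinger t (source h))"
proof (rule regular_approx)
  fix \<delta> :: real assume \<delta>: "\<delta> > 0"
  then have "\<forall>\<^sub>F n in sequentially. riesz (g n) t < ennreal \<delta>"
    using order_tendstoD(2)[OF lim, of "ennreal \<delta>"] by simp
  then obtain n where n: "riesz (g n) t < ennreal \<delta>" by (auto simp: eventually_sequentially)
  have "schroedinger t (source h) - schroedinger t (source (\<lambda>s. h s - g n s)) = schroedinger t (source (g n))"
    by (simp add: source_diff[OF h g] flip: schroedinger_diff)
  then show "\<exists>v. regular v \<and> reg_max (schroedinger t (source h) - v) \<le> ennreal \<delta>"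
    using regular[of n] reg_max_source_le[OF g[of n], of t] n by (metis less_imp_le order_trans)
qed

text \<open>The value at the origin of the free evolution. Taking the limit at every time, whether or not it
  exists, makes this a Borel function of time.\<close>

definition origin_trace :: "l2 \<Rightarrow> real \<Rightarrow> complex" where
  "origin_trace \<phi> s = lim (\<lambda>n. reg n 0 (schroedinger s \<phi>))"

lemma trace_measurable [measurable]: "origin_trace \<phi> \<in> borel_measurable borel"
  unfolding origin_trace_def reg_schroedinger Complex_conv by measurable

lemma regular_trace_LIMSEQ:
  "regular (schroedinger s \<phi>) \<Longrightarrow> (\<lambda>n. reg n 0 (schroedinger s \<phi>)) \<longlonglongrightarrow> origin_trace \<phi> s"
  unfolding origin_trace_def using reg_limit_apply_LIMSEQ[of "schroedinger s \<phi>" 0] limI by fastforce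

lemma regular_trace: "regular (schroedinger s \<phi>) \<Longrightarrow> apply_bcontfun (reg_limit (schroedinger s \<phi>)) 0 = origin_trace \<phi> s"
  using regular_trace_LIMSEQ reg_limit_apply_LIMSEQ LIMSEQ_unique by blast

text \<open>Both sides are limits of the same damped expression: on the transform side by dominated
  convergence with $\hat h \hat\varphi$, on the time side with $|h|$ times the maximal function,
  which is integrable by Hoelder's inequality and the Strichartz estimate.\<close>

lemma source_pairing:
  assumes h: "admissible h"
  shows "integrable lborel (\<lambda>s. h s * cnj (origin_trace \<phi> s))"
    and "l2_cinner (source h) \<phi> = (LINT s|lborel. h s * cnj (origin_trace \<phi> s))"
proof -
  have [measurable]: "h \<in> borel_measurable borel" using h by (rule admissible_measurable)
  have [measurable]: "source_hat h \<in> borel_measurable borel" by (intro source_hat_measurable) simp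
  define r where "r n s = reg n 0 (schroedinger s \<phi>)" for n s
  have [measurable]: "r n \<in> borel_measurable borel" for n
    unfolding r_def reg_schroedinger Complex_conv by measurable
  \<comment> \<open>The maximal function, with value zero on the null set where it is infinite.\<close>
  define m where "m s = enn2real (reg_max (schroedinger s \<phi>))" for s
  have [measurable]: "m \<in> borel_measurable borel" unfolding m_def by measurable
  have fin: "AE s in lborel. reg_max (schroedinger s \<phi>) < \<infinity>"
  proof -
    have "AE s in lborel. reg_max (schroedinger s \<phi>) ^ 4 \<noteq> \<infinity>"
      using reg_max_strichartz[of \<phi>] by (intro nn_integral_PInf_AE) (auto simp: top_unique less_top[symmetric])
    then show ?thesis by eventually_elim (auto simp: less_top power_eq_top_ennreal)
  qed
  have m4: "(\<integral>\<^sup>+ s. ennreal (m s ^ 4) \<partial>lborel) < \<infinity>"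
  proof -
    have "(\<integral>\<^sup>+ s. ennreal (m s ^ 4) \<partial>lborel) = (\<integral>\<^sup>+ s. reg_max (schroedinger s \<phi>) ^ 4 \<partial>lborel)"
      by (rule nn_integral_cong_AE, use fin in eventually_elim) (simp add: m_def ennreal_power[symmetric])
    then show ?thesis using reg_max_strichartz[of \<phi>] by (auto intro: le_less_trans)
  qed
  have dom: "integrable lborel (\<lambda>s. cmod (h s) * m s)"
  proof (rule Bochner_Integration.integrable_bound)
    have "integrable lborel (\<lambda>s. cmod (h s) powr (4/3))"
      using h unfolding admissible_def N43_def integrable_iff_bounded by auto
    moreover have "integrable lborel (\<lambda>s. m s ^ 4)"
      using m4 unfolding integrable_iff_bounded by (auto simp: m_def)
    ultimately show "integrable lborel (\<lambda>s. cmod (h s) powr (4/3) + m s ^ 4)" by (rule Bochner_Integration.integrable_add)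
    show "AE s in lborel. norm (cmod (h s) * m s) \<le> norm (cmod (h s) powr (4/3) + m s ^ 4)"
    proof (rule AE_I2)
      fix s
      have "(cmod (h s) powr (1/3)) ^ 3 * m s \<le> 1 * (cmod (h s) powr (1/3)) ^ 4 + m s ^ 4 / 1 ^ 3"
        by (rule young_3_4) (auto simp: m_def)
      then show "norm (cmod (h s) * m s) \<le> norm (cmod (h s) powr (4/3) + m s ^ 4)"
        by (simp add: cube_root_facts m_def abs_mult)
    qed
  qed measurable
  have rlim: "AE s in lborel. (\<lambda>n. h s * cnj (r n s)) \<longlonglongrightarrow> h s * cnj (origin_trace \<phi> s)"
    using AE_regular_schroedinger[of \<phi>]
    by eventually_elim (auto intro!: tendsto_intros regular_trace_LIMSEQ simp: r_def)
  have rb: "AE s in lborel. norm (h s * cnj (r n s)) \<le> cmod (h s) * m s" for n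
    using fin
  proof eventually_elim
    case (elim s)
    have "ennreal (cmod (r n s)) \<le> reg_max (schroedinger s \<phi>)"
      using norm_apply_bcontfun_le[of "Reg n (schroedinger s \<phi>)" 0] norm_Reg_le_reg_max[of n "schroedinger s \<phi>"]
      by (auto simp: r_def intro: order_trans ennreal_leI)
    also have "\<dots> = ennreal (m s)" using elim by (simp add: m_def less_top)
    finally have "cmod (r n s) \<le> m s" by (simp add: m_def)
    then show ?case by (simp add: norm_mult mult_left_mono)
  qed
  show "integrable lborel (\<lambda>s. h s * cnj (origin_trace \<phi> s))"
    by (rule integrable_dominated_convergence[OF _ _ dom rlim rb]) auto
  have R: "(\<lambda>n. LINT s|lborel. h s * cnj (r n s)) \<longlonglongrightarrow> (LINT s|lborel. h s * cnj (origin_trace \<phi> s))"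
    by (rule integral_dominated_convergence[OF _ _ dom rlim rb]) auto
  let ?e = "\<lambda>n \<xi>. complex_of_real (exp (- (1 / real (Suc n)) * \<xi>\<^sup>2))"
  have eq: "inv_sqrt_2pi * (LINT \<xi>|lborel. source_hat h \<xi> * (cnj (hat \<phi> \<xi>) * ?e n \<xi>)) = (LINT s|lborel. h s * cnj (r n s))" for n
  proof -
    have "integrable lborel (\<lambda>\<xi>. cnj (hat \<phi> \<xi> * ?e n \<xi>))"
      by (intro integrable_bounded_linear[OF bounded_linear_cnj] integrable_mult_gauss) auto
    then have i: "integrable lborel (\<lambda>\<xi>. (cnj (hat \<phi> \<xi>) * ?e n \<xi>) * exp (- 0 * \<xi>\<^sup>2))" by simp
    have F: "(LINT \<xi>|lborel. source_hat h \<xi> * (cnj (hat \<phi> \<xi>) * ?e n \<xi>)) = (LINT s|lborel. h s * (LINT \<xi>|lborel. (cnj (hat \<phi> \<xi>) * ?e n \<xi>) * wave (osc s) 0 \<xi>))"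
      unfolding source_hat_def by (rule superpose_Fubini(2)[OF admissible_integrable[OF h] _ _ _ i]) (auto simp: osc_facts)
    have w: "(cnj (hat \<phi> \<xi>) * ?e n \<xi>) * wave (osc s) 0 \<xi> = cnj (hat \<phi> \<xi> * wave (Complex (1 / real (Suc n)) s) 0 \<xi>)" for s \<xi>
    proof -
      have "?e n \<xi> * wave (osc s) 0 \<xi> = cnj (wave (Complex (1 / real (Suc n)) s) 0 \<xi>)"
        unfolding wave_def osc_def exp_of_real[symmetric] exp_add[symmetric] exp_cnj
        by (rule arg_cong[where f=exp]) (simp add: complex_eq_iff power2_eq_square)
      then show ?thesis by (simp only: complex_cnj_mult mult.assoc)
    qed
    have "cnj (r n s) = inv_sqrt_2pi * (LINT \<xi>|lborel. (cnj (hat \<phi> \<xi>) * ?e n \<xi>) * wave (osc s) 0 \<xi>)" for s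
      unfolding r_def reg_schroedinger evol_def w Bochner_Integration.integral_cnj by simp
    then show ?thesis unfolding F
      by (simp add: mult.left_commute[of "h _"] del: of_real_divide)
  qed
  have hp: "integrable lborel (\<lambda>\<xi>. source_hat h \<xi> * cnj (hat \<phi> \<xi>))"
    by (intro integrable_mult_cnj square_integrable_source_hat h) simp
  have L: "(\<lambda>n. inv_sqrt_2pi * (LINT \<xi>|lborel. source_hat h \<xi> * (cnj (hat \<phi> \<xi>) * ?e n \<xi>))) \<longlonglongrightarrow> inv_sqrt_2pi * (LINT \<xi>|lborel. source_hat h \<xi> * cnj (hat \<phi> \<xi>))"
  proof (intro tendsto_mult tendsto_const integral_dominated_convergence[where w="\<lambda>\<xi>. cmod (source_hat h \<xi> * cnj (hat \<phi> \<xi>))"])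
    show "integrable lborel (\<lambda>\<xi>. cmod (source_hat h \<xi> * cnj (hat \<phi> \<xi>)))" by (rule integrable_norm[OF hp])
    show "AE \<xi> in lborel. (\<lambda>n. source_hat h \<xi> * (cnj (hat \<phi> \<xi>) * ?e n \<xi>)) \<longlonglongrightarrow> source_hat h \<xi> * cnj (hat \<phi> \<xi>)"
    proof (rule AE_I2)
      fix \<xi>
      have "(\<lambda>n. source_hat h \<xi> * (cnj (hat \<phi> \<xi>) * ?e n \<xi>)) \<longlonglongrightarrow> source_hat h \<xi> * (cnj (hat \<phi> \<xi>) * complex_of_real (exp (- 0 * \<xi>\<^sup>2)))"
        using LIMSEQ_inverse_real_of_nat by (intro tendsto_intros) (simp add: inverse_eq_divide)
      then show "(\<lambda>n. source_hat h \<xi> * (cnj (hat \<phi> \<xi>) * ?e n \<xi>)) \<longlonglongrightarrow> source_hat h \<xi> * cnj (hat \<phi> \<xi>)" by simp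
    qed
    show "AE \<xi> in lborel. norm (source_hat h \<xi> * (cnj (hat \<phi> \<xi>) * ?e n \<xi>)) \<le> cmod (source_hat h \<xi> * cnj (hat \<phi> \<xi>))" for n
      by (auto simp: norm_mult intro!: mult_left_mono mult_right_le_one_le)
  qed measurable
  have "l2_cinner (source h) \<phi> = l2_cinner (fourier (source h)) (fourier \<phi>)" by (simp add: Plancherel)
  also have "\<dots> = (LINT \<xi>|lborel. inv_sqrt_2pi * (source_hat h \<xi> * cnj (hat \<phi> \<xi>)))"
    unfolding l2_cinner.rep_eq using hat_source[OF h] by (intro integral_cong_AE) (auto simp: mult.assoc)
  also have "\<dots> = inv_sqrt_2pi * (LINT \<xi>|lborel. source_hat h \<xi> * cnj (hat \<phi> \<xi>))" by (rule integral_mult_right_zero)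
  finally show "l2_cinner (source h) \<phi> = (LINT s|lborel. h s * cnj (origin_trace \<phi> s))"
    using LIMSEQ_unique[OF L] R unfolding eq by simp
qed

section \<open>The trace operator of the Duhamel integral\<close>

lemma csqrt_i: "\<tau> > 0 \<Longrightarrow> csqrt (\<i> * of_real \<tau>) = of_real (sqrt (\<tau> / 2)) * (1 + \<i>)"
  by (rule complex_eqI) (auto simp: norm_mult)

text \<open>The factor $i$ turns the kernel into its own time reflection. This is why $iV$, and not $V$, is
  half of a Hermitian form.\<close>

lemma kern_reflect: "\<tau> > 0 \<Longrightarrow> \<i> * kern \<tau> = kern (- \<tau>)"
proof -
  assume \<tau>: "\<tau> > 0"
  have 1: "csqrt (\<i> * of_real (- \<tau>)) = of_real (sqrt (\<tau> / 2)) * (1 - \<i>)"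
    using \<tau> by (intro complex_eqI) (auto simp: norm_mult)
  have 2: "\<i> / (1 + \<i>) = 1 / (1 - \<i>)" by (simp add: complex_eq_iff Re_divide Im_divide)
  have "\<i> * kern \<tau> = complex_of_real (1 / (2 * pi)) * complex_of_real (sqrt pi) / of_real (sqrt (\<tau> / 2)) * (\<i> / (1 + \<i>))"
    unfolding kern_def csqrt_i[OF \<tau>] by (simp add: mult_ac)
  also have "\<dots> = kern (- \<tau>)" unfolding 2 kern_def 1 by simp
  finally show ?thesis .
qed

lemma norm_kern_le: "\<tau> \<noteq> 0 \<Longrightarrow> cmod (kern \<tau>) \<le> 1 / sqrt \<bar>\<tau>\<bar>"
proof -
  assume "\<tau> \<noteq> 0"
  have "cmod (csqrt z) = sqrt (cmod z)" for z
    by (metis norm_power power2_csqrt real_sqrt_abs abs_norm_cancel)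
  then have "cmod (kern \<tau>) = sqrt pi / (2 * pi) / sqrt \<bar>\<tau>\<bar>"
    by (simp add: kern_def norm_mult norm_divide)
  also have "\<dots> \<le> 1 / sqrt \<bar>\<tau>\<bar>" using sqrt_pi_le by (intro divide_right_mono) auto
  finally show ?thesis .
qed

text \<open>The value at the origin of $e^{it\partial_x^2}\int_{-\infty}^t
  e^{-is\partial_x^2}[c(s)\,\delta]\,ds$.\<close>

definition volt :: "(real \<Rightarrow> complex) \<Rightarrow> real \<Rightarrow> complex" where
  "volt c t = (LINT s|lborel. (if s < t then c s * kern (t - s) else 0))"

lemma volt_measurable [measurable]:
  assumes [measurable]: "c \<in> borel_measurable borel" shows "volt c \<in> borel_measurable borel"
  unfolding volt_def by measurable

lemma volt_integrand_le: "cmod (if s < t then c s * kern (t - s) else 0) \<le> cmod (c s) / sqrt \<bar>t - s\<bar>"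
  using mult_left_mono[OF norm_kern_le[of "t - s"], of "cmod (c s)"] by (auto simp: norm_mult)

lemma volt_integrable:
  assumes [measurable]: "c \<in> borel_measurable borel" and "riesz c t < \<infinity>"
  shows "integrable lborel (\<lambda>s. if s < t then c s * kern (t - s) else 0)"
  by (rule Bochner_Integration.integrable_bound[OF riesz_finite_integrable[OF assms]])
     (use volt_integrand_le in auto)

lemma norm_volt_le: "ennreal (cmod (volt c t)) \<le> riesz c t"
proof -
  have "ennreal (cmod (volt c t)) \<le> (\<integral>\<^sup>+ s. ennreal (cmod (if s < t then c s * kern (t - s) else 0)) \<partial>lborel)"
    unfolding volt_def by (rule ennreal_norm_integral_le)
  also have "\<dots> \<le> riesz c t" unfolding riesz_def by (intro nn_integral_mono ennreal_leI volt_integrand_le)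
  finally show ?thesis .
qed

lemma volt_diff:
  assumes "c \<in> borel_measurable borel" "riesz c t < \<infinity>" "d \<in> borel_measurable borel" "riesz d t < \<infinity>"
  shows "volt (\<lambda>s. c s - d s) t = volt c t - volt d t"
  unfolding volt_def Bochner_Integration.integral_diff[OF volt_integrable[OF assms(1,2)] volt_integrable[OF assms(3,4)], symmetric]
  by (intro Bochner_Integration.integral_cong) (auto simp: left_diff_distrib)

lemma volt_add:
  assumes "c \<in> borel_measurable borel" "riesz c t < \<infinity>" "d \<in> borel_measurable borel" "riesz d t < \<infinity>"
  shows "volt (\<lambda>s. c s + d s) t = volt c t + volt d t"
  unfolding volt_def Bochner_Integration.integral_add[OF volt_integrable[OF assms(1,2)] volt_integrable[OF assms(3,4)], symmetric]
  by (intro Bochner_Integration.integral_cong) (auto simp: distrib_right)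

lemma volt_cong: "(\<And>s. s < t \<Longrightarrow> c s = d s) \<Longrightarrow> volt c t = volt d t"
  unfolding volt_def by (intro Bochner_Integration.integral_cong) auto

lemma volt_cong_AE:
  assumes [measurable]: "c \<in> borel_measurable borel" "d \<in> borel_measurable borel"
    and "AE s in lborel. s < t \<longrightarrow> c s = d s"
  shows "volt c t = volt d t"
  unfolding volt_def by (intro integral_cong_AE) (use assms(3) in auto)

definition L43 :: "(real \<Rightarrow> complex) \<Rightarrow> bool" where
  "L43 c \<longleftrightarrow> c \<in> borel_measurable borel \<and> N43 c < \<infinity>"

lemma L43_measurable: "L43 c \<Longrightarrow> c \<in> borel_measurable borel" by (simp add: L43_def)

lemma N43_L43: "L43 c \<Longrightarrow> N43 c = ennreal (n43 c)" by (simp add: L43_def n43_def less_top)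

lemma riesz_L43:
  assumes "L43 c" shows "(\<integral>\<^sup>+ t. riesz c t ^ 4 \<partial>lborel) \<le> ennreal (14 ^ 4 * n43 c ^ 3)"
  using riesz_L4[of c "n43 c"] N43_L43[OF assms] assms by (simp add: L43_def N43_def)

lemma AE_riesz_finite:
  assumes "L43 c" shows "AE t in lborel. riesz c t < \<infinity>"
proof -
  have [measurable]: "c \<in> borel_measurable borel" using assms by (rule L43_measurable)
  have "AE t in lborel. riesz c t ^ 4 \<noteq> \<infinity>"
    using riesz_L43[OF assms] by (intro nn_integral_PInf_AE) (auto simp: top_unique less_top[symmetric])
  then show ?thesis by eventually_elim (auto simp: less_top power_eq_top_ennreal)
qed

definition L4 :: "(real \<Rightarrow> complex) \<Rightarrow> bool" where
  "L4 z \<longleftrightarrow> z \<in> borel_measurable borel \<and> integrable lborel (\<lambda>t. cmod (z t) ^ 4)"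

text \<open>The fourth power of the norm in $L^4$; working with this quantity avoids roots.\<close>

definition A4 :: "(real \<Rightarrow> complex) \<Rightarrow> real" where
  "A4 z = (LINT t|lborel. cmod (z t) ^ 4)"

lemma A4_nonneg [simp]: "A4 z \<ge> 0" unfolding A4_def by (intro integral_nonneg_AE) auto

lemma L4_measurable: "L4 z \<Longrightarrow> z \<in> borel_measurable borel" by (simp add: L4_def)

abbreviation int4 :: "(real \<Rightarrow> complex) \<Rightarrow> ennreal" where
  "int4 z \<equiv> (\<integral>\<^sup>+ t. ennreal (cmod (z t) ^ 4) \<partial>lborel)"

lemma ennreal_A4: "L4 z \<Longrightarrow> int4 z = ennreal (A4 z)"
  unfolding A4_def L4_def by (intro nn_integral_eq_integral) auto

lemma L4I:
  assumes "z \<in> borel_measurable borel" "int4 z \<le> ennreal B" "B \<ge> 0"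
  shows "L4 z" "A4 z \<le> B"
proof -
  show l: "L4 z" using assms(1,2) unfolding L4_def integrable_iff_bounded by (auto intro: le_less_trans)
  show "A4 z \<le> B" using assms(2,3) unfolding ennreal_A4[OF l] by (simp add: ennreal_le_iff)
qed

lemma L4_volt:
  assumes "L43 c" shows "L4 (volt c)" "A4 (volt c) \<le> 14 ^ 4 * n43 c ^ 3"
proof -
  have [measurable]: "c \<in> borel_measurable borel" using assms by (rule L43_measurable)
  have "(\<integral>\<^sup>+ t. ennreal (cmod (volt c t) ^ 4) \<partial>lborel) \<le> (\<integral>\<^sup>+ t. riesz c t ^ 4 \<partial>lborel)"
    by (intro nn_integral_mono) (simp add: ennreal_power[symmetric] power_mono norm_volt_le)
  also have "\<dots> \<le> ennreal (14 ^ 4 * n43 c ^ 3)" by (rule riesz_L43[OF assms])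
  finally have b: "(\<integral>\<^sup>+ t. ennreal (cmod (volt c t) ^ 4) \<partial>lborel) \<le> ennreal (14 ^ 4 * n43 c ^ 3)" .
  show "L4 (volt c)" "A4 (volt c) \<le> 14 ^ 4 * n43 c ^ 3" using L4I[OF _ b] by auto
qed

lemma L4_mono:
  assumes w: "L4 w" and [measurable]: "z \<in> borel_measurable borel" and le: "\<And>t. cmod (z t) \<le> cmod (w t)"
  shows "L4 z" "A4 z \<le> A4 w"
proof -
  have "int4 z \<le> int4 w"
    by (intro nn_integral_mono ennreal_leI power_mono le) auto
  then have "int4 z \<le> ennreal (A4 w)" using ennreal_A4[OF w] by simp
  from L4I[OF _ this] show "L4 z" "A4 z \<le> A4 w" by auto
qed

lemma L4_restr: "L4 z \<Longrightarrow> S \<in> sets borel \<Longrightarrow> L4 (restr S z)" "L4 z \<Longrightarrow> S \<in> sets borel \<Longrightarrow> A4 (restr S z) \<le> A4 z"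
  by (rule L4_mono; auto simp: cmod_restr indicator_def L4_measurable restr_measurable)+

lemma pow4_add_le: "cmod (a - b) ^ 4 \<le> 8 * cmod a ^ 4 + 8 * cmod b ^ 4"
proof -
  have sq: "(x + y) ^ 2 \<le> 2 * x ^ 2 + 2 * y ^ 2" for x y :: real
    using sum_squares_bound[of x y] by (simp add: power2_sum)
  have "cmod (a - b) ^ 4 \<le> (cmod a + cmod b) ^ 4" by (intro power_mono norm_triangle_ineq4) auto
  also have "\<dots> = ((cmod a + cmod b) ^ 2) ^ 2" by (simp flip: power_mult)
  also have "\<dots> \<le> (2 * cmod a ^ 2 + 2 * cmod b ^ 2) ^ 2" by (intro power_mono sq) auto
  also have "\<dots> \<le> 2 * (2 * cmod a ^ 2) ^ 2 + 2 * (2 * cmod b ^ 2) ^ 2" by (rule sq)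
  also have "\<dots> = 8 * cmod a ^ 4 + 8 * cmod b ^ 4" by (simp add: power_mult_distrib flip: power_mult)
  finally show ?thesis .
qed

lemma L4_diff:
  assumes "L4 z" "L4 w" shows "L4 (\<lambda>t. z t - w t)" "A4 (\<lambda>t. z t - w t) \<le> 8 * A4 z + 8 * A4 w"
proof -
  have [measurable]: "z \<in> borel_measurable borel" "w \<in> borel_measurable borel" using assms by (auto intro: L4_measurable)
  have "(\<integral>\<^sup>+ t. ennreal (cmod (z t - w t) ^ 4) \<partial>lborel) \<le> (\<integral>\<^sup>+ t. ennreal (8 * cmod (z t) ^ 4 + 8 * cmod (w t) ^ 4) \<partial>lborel)"
    by (intro nn_integral_mono ennreal_leI pow4_add_le)
  also have "\<dots> = (\<integral>\<^sup>+ t. 8 * ennreal (cmod (z t) ^ 4) + 8 * ennreal (cmod (w t) ^ 4) \<partial>lborel)"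
    by (intro nn_integral_cong) (simp add: ennreal_mult)
  also have "\<dots> = ennreal (8 * A4 z + 8 * A4 w)"
    by (subst nn_integral_add) (auto simp: nn_integral_cmult ennreal_A4 assms ennreal_mult)
  finally have b: "(\<integral>\<^sup>+ t. ennreal (cmod (z t - w t) ^ 4) \<partial>lborel) \<le> ennreal (8 * A4 z + 8 * A4 w)" .
  from L4I[OF _ b] show "L4 (\<lambda>t. z t - w t)" "A4 (\<lambda>t. z t - w t) \<le> 8 * A4 z + 8 * A4 w" by auto
qed

lemma A4_cong_AE:
  assumes "z \<in> borel_measurable borel" "w \<in> borel_measurable borel" "AE t in lborel. z t = w t"
  shows "A4 z = A4 w" and "L4 z \<Longrightarrow> L4 w"
proof -
  have [measurable]: "z \<in> borel_measurable borel" "w \<in> borel_measurable borel" using assms by auto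
  show "A4 z = A4 w" unfolding A4_def by (rule integral_cong_AE) (use assms(3) in auto)
  show "L4 z \<Longrightarrow> L4 w" unfolding L4_def
    by (subst (asm) integrable_cong_AE[where g="\<lambda>t. cmod (w t) ^ 4"]) (use assms(3) in auto)
qed

lemma A4_0_AE:
  assumes "L4 z" "A4 z = 0" shows "AE t in lborel. z t = 0"
proof -
  have [measurable]: "z \<in> borel_measurable borel" using assms by (auto intro: L4_measurable)
  have "int4 z = 0" using assms by (simp add: ennreal_A4)
  then show ?thesis by (subst (asm) nn_integral_0_iff_AE) (auto simp: ennreal_eq_0_iff)
qed

subsection \<open>The cubic nonlinearity\<close>

definition cubic :: "complex \<Rightarrow> complex" where "cubic z = complex_of_real ((cmod z)\<^sup>2) * z"

lemma cubic_measurable [measurable (raw)]: "z \<in> borel_measurable M \<Longrightarrow> (\<lambda>t. cubic (z t)) \<in> borel_measurable M"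
  unfolding cubic_def by measurable

lemma cubic_0 [simp]: "cubic 0 = 0" by (simp add: cubic_def)

lemma norm_cubic: "cmod (cubic z) = cmod z ^ 3"
  by (simp add: cubic_def norm_mult power_numeral_reduce)

lemma norm_cubic_43: "cmod (cubic z) powr (4/3) = cmod z ^ 4"
proof (cases "z = 0")
  case False
  then have p: "cmod z ^ 3 = cmod z powr 3" "cmod z ^ 4 = cmod z powr 4" by (simp_all add: powr_numeral)
  show ?thesis unfolding norm_cubic p by (simp only: powr_powr) simp
qed simp

lemma N43_cubic: "N43 (\<lambda>t. cubic (z t)) = int4 z"
  by (simp add: N43_def norm_cubic_43)

lemma L43_cubic: "L4 z \<Longrightarrow> L43 (\<lambda>t. cubic (z t))"
  by (simp add: L43_def N43_cubic ennreal_A4) (simp add: L4_def cubic_measurable)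

lemma n43_cubic: "L4 z \<Longrightarrow> n43 (\<lambda>t. cubic (z t)) = A4 z"
  by (simp add: n43_def N43_cubic ennreal_A4)

lemma restr_cubic: "restr S (\<lambda>t. cubic (z t)) = (\<lambda>t. cubic (restr S z t))"
  by (auto simp: restr_def fun_eq_iff indicator_def)

lemma cubic_diff_le: "cmod (cubic z - cubic w) \<le> 3/2 * (((cmod z)\<^sup>2 + (cmod w)\<^sup>2) * cmod (z - w))"
proof -
  have nl3: "cubic z = z * cnj z * z" for z by (simp only: cubic_def complex_norm_square)
  have "cubic z - cubic w = (z - w) * (z * cnj z) + (z - w) * (w * cnj z) + w * w * cnj (z - w)"
    unfolding nl3 by (simp add: algebra_simps)
  also have "cmod \<dots> \<le> cmod ((z - w) * (z * cnj z)) + cmod ((z - w) * (w * cnj z)) + cmod (w * w * cnj (z - w))"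
    by (intro norm_triangle_le add_mono) auto
  also have "\<dots> = ((cmod z)\<^sup>2 + cmod z * cmod w + (cmod w)\<^sup>2) * cmod (z - w)"
    unfolding norm_mult complex_mod_cnj by (simp add: power2_eq_square algebra_simps)
  also have "\<dots> \<le> (3/2 * ((cmod z)\<^sup>2 + (cmod w)\<^sup>2)) * cmod (z - w)"
    using sum_squares_bound[of "cmod z" "cmod w"] by (intro mult_right_mono) auto
  finally show ?thesis by (simp only: mult.assoc)
qed

text \<open>The difference of the two sides is half the square of $|z|^2 - |w|^2$.\<close>

lemma cubic_monotone: "1/2 * (((cmod z)\<^sup>2 + (cmod w)\<^sup>2) * (cmod (z - w))\<^sup>2) \<le> Re ((z - w) * cnj (cubic z - cubic w))"
proof -
  obtain a b c d where z: "z = Complex a b" and w: "w = Complex c d" by (metis complex.exhaust)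
  have n: "(cmod z)\<^sup>2 = a\<^sup>2 + b\<^sup>2" "(cmod w)\<^sup>2 = c\<^sup>2 + d\<^sup>2" "(cmod (z - w))\<^sup>2 = (a - c)\<^sup>2 + (b - d)\<^sup>2"
    by (simp_all add: z w cmod_power2)
  have eq: "Re ((z - w) * cnj (cubic z - cubic w)) - 1/2 * (((cmod z)\<^sup>2 + (cmod w)\<^sup>2) * (cmod (z - w))\<^sup>2) = 1/2 * ((a\<^sup>2 + b\<^sup>2) - (c\<^sup>2 + d\<^sup>2))\<^sup>2"
    unfolding cubic_def n by (simp add: z w power2_eq_square) (simp add: algebra_simps)
  have "0 \<le> 1/2 * ((a\<^sup>2 + b\<^sup>2) - (c\<^sup>2 + d\<^sup>2))\<^sup>2" by simp
  then show ?thesis unfolding eq[symmetric] by (simp only: diff_ge_0_iff_ge)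
qed

lemma young_43:
  fixes a b l :: real assumes "a \<ge> 0" "b \<ge> 0" "l > 0"
  shows "(a * b) powr (4/3) \<le> l * a\<^sup>2 + b ^ 4 / l\<^sup>2"
proof (cases "a = 0 \<or> b = 0")
  case True
  then show ?thesis using assms by auto
next
  case False
  then have ab: "a > 0" "b > 0" using assms by auto
  define x where "x = a powr (2/3)"
  define y where "y = b powr (4/3)"
  have xy: "x > 0" "y > 0" using ab by (auto simp: x_def y_def)
  have x3: "x ^ 3 = a\<^sup>2" unfolding x_def using ab by (simp add: powr_powr flip: powr_numeral)
  have y3: "y ^ 3 = b ^ 4" unfolding y_def using ab by (simp add: powr_powr flip: powr_numeral)
  have "(a * b) powr (4/3) = x ^ 2 * y" unfolding x_def y_def using ab by (simp add: powr_mult powr_powr flip: powr_numeral)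
  also have "\<dots> \<le> l * x ^ 3 + y ^ 3 / l ^ 2"
  proof (cases "y \<le> l * x")
    case True
    then have "x ^ 2 * y \<le> x ^ 2 * (l * x)" using xy by (intro mult_left_mono) auto
    then show ?thesis using xy assms by (simp add: power_numeral_reduce add_increasing2 mult_ac)
  next
    case False
    then have "x \<le> y / l" using assms by (simp add: field_simps)
    then have "x ^ 2 * y \<le> (y / l) ^ 2 * y" using xy by (intro mult_right_mono power_mono) auto
    also have "\<dots> = y ^ 3 / l ^ 2" by (simp add: power_divide power_numeral_reduce)
    finally show ?thesis using xy assms by (simp add: add_increasing)
  qed
  finally show ?thesis unfolding x3 y3 .
qed

text \<open>Optimising the weight \<open>l\<close> gives Hoelder's inequality with exponents $2/3$ and
  $1/3$. The optimum is perturbed because it is undefined when $U$ or $W$ vanishes.\<close>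

lemma cube_from_weights:
  fixes X U W k :: real
  assumes "\<And>l. l > 0 \<Longrightarrow> X \<le> k * (l * U + W / l\<^sup>2)" and pos: "U \<ge> 0" "W \<ge> 0" "k > 0" "X \<ge> 0"
  shows "X ^ 3 \<le> 8 * k ^ 3 * U\<^sup>2 * W"
proof -
  have pert: "X ^ 3 \<le> 8 * k ^ 3 * (U + e)\<^sup>2 * (W + e)" if e: "e > 0" for e
  proof -
    \<comment> \<open>Both summands become equal for this weight.\<close>
    define l where "l = root 3 ((W + e) / (U + e))"
    have q: "(W + e) / (U + e) > 0" using pos e by (simp add: add_nonneg_pos)
    have l: "l > 0" "l ^ 3 = (W + e) / (U + e)" using q by (auto simp: l_def)
    have "X \<le> k * (l * U + W / l\<^sup>2)" by (rule assms(1)[OF l(1)])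
    also have "\<dots> \<le> k * (l * (U + e) + (W + e) / l\<^sup>2)"
      using e l pos by (intro mult_left_mono add_mono divide_right_mono) auto
    also have "(W + e) / l\<^sup>2 = l * (U + e)"
    proof -
      have "W + e = l ^ 3 * (U + e)" using l pos e by simp
      then show ?thesis using l by (simp add: power_numeral_reduce)
    qed
    finally have "X \<le> 2 * k * l * (U + e)" by simp
    then have "X ^ 3 \<le> (2 * k * l * (U + e)) ^ 3" using pos by (intro power_mono) auto
    also have "\<dots> = 8 * k ^ 3 * (U + e) ^ 3 * l ^ 3" by (simp add: power_mult_distrib)
    also have "\<dots> = 8 * k ^ 3 * (U + e)\<^sup>2 * (W + e)"
      unfolding l(2) using pos e by (simp add: power_numeral_reduce)
    finally show ?thesis .
  qed
  have "((\<lambda>e. 8 * k ^ 3 * (U + e)\<^sup>2 * (W + e)) \<longlongrightarrow> 8 * k ^ 3 * (U + 0)\<^sup>2 * (W + 0)) (at_right 0)"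
    by (intro tendsto_intros)
  then have "X ^ 3 \<le> 8 * k ^ 3 * (U + 0)\<^sup>2 * (W + 0)"
    by (rule tendsto_lowerbound) (use pert in \<open>auto simp: eventually_at_filter intro!: always_eventually\<close>)
  then show ?thesis by simp
qed

text \<open>Local Lipschitz continuity of $z \mapsto |z|^2 z$ from $L^4$ to $L^{4/3}$.\<close>

lemma n43_cubic_diff:
  assumes z: "L4 z" and w: "L4 w"
  shows "L43 (\<lambda>t. cubic (z t) - cubic (w t))"
    and "n43 (\<lambda>t. cubic (z t) - cubic (w t)) ^ 3 \<le> 2 ^ 12 * (A4 z + A4 w)\<^sup>2 * A4 (\<lambda>t. z t - w t)"
proof -
  have [measurable]: "z \<in> borel_measurable borel" "w \<in> borel_measurable borel" using z w by (auto intro: L4_measurable)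
  let ?N = "N43 (\<lambda>t. cubic (z t) - cubic (w t))"
  have b: "?N \<le> ennreal (4 * (l * (A4 z + A4 w) + A4 (\<lambda>t. z t - w t) / l\<^sup>2))" if l: "l > 0" for l
  proof -
    have "?N \<le> (\<integral>\<^sup>+ t. ennreal (4 * l) * ennreal (cmod (z t) ^ 4) + (ennreal (4 * l) * ennreal (cmod (w t) ^ 4) + ennreal (4 / l\<^sup>2) * ennreal (cmod (z t - w t) ^ 4)) \<partial>lborel)"
      unfolding N43_def
    proof (rule nn_integral_mono)
      fix t
      define a where "a = (cmod (z t))\<^sup>2 + (cmod (w t))\<^sup>2"
      define d where "d = cmod (z t - w t)"
      have "cmod (cubic (z t) - cubic (w t)) powr (4/3) \<le> (3/2 * (a * d)) powr (4/3)"
        unfolding a_def d_def by (intro powr_mono2 cubic_diff_le) auto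
      also have "\<dots> = (3/2) powr (4/3) * (a * d) powr (4/3)" by (rule powr_mult)
      also have "\<dots> \<le> 2 * (a * d) powr (4/3)"
      proof (intro mult_right_mono)
        have "((3/2::real) powr (4/3)) ^ 3 \<le> 2 ^ 3" by (simp add: powr_powr flip: powr_numeral) (simp add: powr_numeral power_divide)
        then show "(3/2::real) powr (4/3) \<le> 2" by (rule power_mono_iff[THEN iffD1, rotated -1]) simp_all
      qed simp
      also have "\<dots> \<le> 2 * (l * a\<^sup>2 + d ^ 4 / l\<^sup>2)"
        by (intro mult_left_mono young_43) (auto simp: a_def d_def l)
      also have "\<dots> \<le> 2 * (l * (2 * cmod (z t) ^ 4 + 2 * cmod (w t) ^ 4) + d ^ 4 / l\<^sup>2)"
      proof -
        have "a\<^sup>2 \<le> 2 * ((cmod (z t))\<^sup>2)\<^sup>2 + 2 * ((cmod (w t))\<^sup>2)\<^sup>2"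
          unfolding a_def using sum_squares_bound[of "(cmod (z t))\<^sup>2" "(cmod (w t))\<^sup>2"] by (simp add: power2_sum)
        then have "a\<^sup>2 \<le> 2 * cmod (z t) ^ 4 + 2 * cmod (w t) ^ 4" by (simp flip: power_mult)
        then show ?thesis using l by simp
      qed
      also have "\<dots> \<le> 4 * l * cmod (z t) ^ 4 + (4 * l * cmod (w t) ^ 4 + 4 / l\<^sup>2 * d ^ 4)"
      proof -
        have "2 * (d ^ 4 / l\<^sup>2) \<le> 4 * (d ^ 4 / l\<^sup>2)" by (intro mult_right_mono) (auto simp: d_def)
        then show ?thesis by (simp add: algebra_simps)
      qed
      finally show "ennreal (cmod (cubic (z t) - cubic (w t)) powr (4/3)) \<le> ennreal (4 * l) * ennreal (cmod (z t) ^ 4) + (ennreal (4 * l) * ennreal (cmod (w t) ^ 4) + ennreal (4 / l\<^sup>2) * ennreal (cmod (z t - w t) ^ 4))"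
        using l by (simp add: d_def ennreal_leI flip: ennreal_mult ennreal_plus)
    qed
    also have "\<dots> = ennreal (4 * l) * ennreal (A4 z) + (ennreal (4 * l) * ennreal (A4 w) + ennreal (4 / l\<^sup>2) * ennreal (A4 (\<lambda>t. z t - w t)))"
      by (simp add: nn_integral_add nn_integral_cmult ennreal_A4 z w L4_diff)
    also have "\<dots> = ennreal (4 * (l * (A4 z + A4 w) + A4 (\<lambda>t. z t - w t) / l\<^sup>2))"
      using l by (simp add: algebra_simps flip: ennreal_mult ennreal_plus)
    finally show ?thesis .
  qed
  show l: "L43 (\<lambda>t. cubic (z t) - cubic (w t))"
    unfolding L43_def using b[of 1] by (auto intro: le_less_trans)
  have "n43 (\<lambda>t. cubic (z t) - cubic (w t)) ^ 3 \<le> 8 * 4 ^ 3 * (A4 z + A4 w)\<^sup>2 * A4 (\<lambda>t. z t - w t)"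
  proof (rule cube_from_weights)
    fix l :: real assume l': "l > 0"
    show "n43 (\<lambda>t. cubic (z t) - cubic (w t)) \<le> 4 * (l * (A4 z + A4 w) + A4 (\<lambda>t. z t - w t) / l\<^sup>2)"
      using b[OF l'] l' unfolding N43_L43[OF l] by (subst (asm) ennreal_le_iff) auto
  qed auto
  also have "\<dots> \<le> 2 ^ 12 * (A4 z + A4 w)\<^sup>2 * A4 (\<lambda>t. z t - w t)" by (intro mult_right_mono) auto
  finally show "n43 (\<lambda>t. cubic (z t) - cubic (w t)) ^ 3 \<le> 2 ^ 12 * (A4 z + A4 w)\<^sup>2 * A4 (\<lambda>t. z t - w t)" .
qed

subsection \<open>Positivity of the kernel\<close>

lemma riesz_energy_finite:
  assumes c: "L43 c"
  shows "(\<integral>\<^sup>+ t. ennreal (cmod (c t)) * riesz c t \<partial>lborel) < \<infinity>"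
proof -
  have [measurable]: "c \<in> borel_measurable borel" using c by (rule L43_measurable)
  have "(\<integral>\<^sup>+ t. ennreal (cmod (c t)) * riesz c t \<partial>lborel) = (\<integral>\<^sup>+ t. \<integral>\<^sup>+ s. ennreal ((cmod (c t) powr (1/3)) ^ 3 * (cmod (c s) powr (1/3)) ^ 3 / sqrt \<bar>t - s\<bar>) \<partial>lborel \<partial>lborel)"
  proof (rule nn_integral_cong)
    fix t
    have "ennreal (cmod (c t)) * riesz c t = (\<integral>\<^sup>+ s. ennreal (cmod (c t)) * ennreal (cmod (c s) / sqrt \<bar>t - s\<bar>) \<partial>lborel)"
      unfolding riesz_def by (subst nn_integral_cmult) auto
    also have "\<dots> = (\<integral>\<^sup>+ s. ennreal ((cmod (c t) powr (1/3)) ^ 3 * (cmod (c s) powr (1/3)) ^ 3 / sqrt \<bar>t - s\<bar>) \<partial>lborel)"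
      by (intro nn_integral_cong) (simp add: cube_root_facts flip: ennreal_mult)
    finally show "ennreal (cmod (c t)) * riesz c t = \<dots>" .
  qed
  also have "\<dots> \<le> ennreal (14 * root 4 (n43 c) ^ 3 * root 4 (n43 c) ^ 3)"
    by (rule hls) (use N43_L43[OF c] in \<open>auto simp: cube_root_facts N43_def\<close>)
  finally show ?thesis by (auto intro: le_less_trans)
qed

text \<open>The damped kernel is a scalar product of waves, hence Hermitian positive definite; the undamped
  one is too singular for this identity to be used directly.\<close>

definition kern_reg :: "nat \<Rightarrow> real \<Rightarrow> complex" where
  "kern_reg n \<tau> = complex_of_real (1 / (2 * pi)) * gauss_kernel (Complex (1 / real (Suc n)) \<tau>) 0"

lemma kern_reg_measurable [measurable]: "kern_reg n \<in> borel_measurable borel"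
  unfolding kern_reg_def Complex_conv by measurable

lemma norm_kern_reg_le: "\<tau> \<noteq> 0 \<Longrightarrow> cmod (kern_reg n \<tau>) \<le> 1 / sqrt \<bar>\<tau>\<bar>"
proof -
  assume \<tau>: "\<tau> \<noteq> 0"
  have "cmod (kern_reg n \<tau>) \<le> 1 / (2 * pi) * (sqrt pi / sqrt \<bar>\<tau>\<bar>)"
    unfolding kern_reg_def norm_mult norm_of_real
    using gauss_kernel_decay[of "1 / real (Suc n)" \<tau> 0] \<tau> by (intro mult_mono) auto
  also have "\<dots> = sqrt pi / (2 * pi) / sqrt \<bar>\<tau>\<bar>" by simp
  also have "\<dots> \<le> 1 / sqrt \<bar>\<tau>\<bar>" using sqrt_pi_le by (intro divide_right_mono) auto
  finally show ?thesis .
qed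

lemma cnj_csqrt_pos: "Re z > 0 \<Longrightarrow> csqrt (cnj z) = cnj (csqrt z)"
  by (rule complex_eqI) (auto simp: sgn_if cmod_eq_Re)

lemma cnj_kern_reg: "cnj (kern_reg n \<tau>) = kern_reg n (- \<tau>)"
proof -
  have "Complex (1 / real (Suc n)) (- \<tau>) = cnj (Complex (1 / real (Suc n)) \<tau>)" by (simp add: complex_eq_iff)
  then have "csqrt (Complex (1 / real (Suc n)) (- \<tau>)) = cnj (csqrt (Complex (1 / real (Suc n)) \<tau>))"
    using cnj_csqrt_pos[of "Complex (1 / real (Suc n)) \<tau>"] by (simp del: csqrt.sel)
  then show ?thesis by (simp add: kern_reg_def gauss_kernel_def del: csqrt.sel)
qed

abbreviation lborel2 :: "(real \<times> real) measure" where "lborel2 \<equiv> lborel \<Otimes>\<^sub>M lborel"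

text \<open>The region $t < s$ and its mirror image contribute complex conjugates to the Hermitian form of
  the damped kernel, so the real part of either is half of a nonnegative number. The Riesz energy
  dominates the passage to the undamped kernel.\<close>

lemma volt_positive:
  assumes c: "admissible c"
  shows "integrable lborel (\<lambda>t. cnj (c t) * (\<i> * volt c t))"
    and "Re (LINT t|lborel. cnj (c t) * (\<i> * volt c t)) \<ge> 0"
proof -
  have [measurable]: "c \<in> borel_measurable borel" using c by (rule admissible_measurable)
  have c43: "L43 c" using c by (simp add: admissible_def L43_def)
  define H where "H = (\<lambda>(t, s). cmod (c t) * (cmod (c s) / sqrt \<bar>t - s\<bar>))"
  have [measurable]: "H \<in> borel_measurable (borel \<Otimes>\<^sub>M borel)" unfolding H_def by measurable
  have H: "integrable lborel2 H"
  proof (rule integrableI_bounded)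
    have "(\<integral>\<^sup>+ p. ennreal (norm (H p)) \<partial>lborel2) = (\<integral>\<^sup>+ t. \<integral>\<^sup>+ s. ennreal (norm (H (t, s))) \<partial>lborel \<partial>lborel)"
      by (subst lborel.nn_integral_fst[symmetric]) auto
    also have "\<dots> = (\<integral>\<^sup>+ t. ennreal (cmod (c t)) * riesz c t \<partial>lborel)"
      unfolding riesz_def H_def
      by (intro nn_integral_cong) (simp add: nn_integral_cmult[symmetric] abs_mult ennreal_mult'[symmetric] ennreal_mult[symmetric])
    finally show "(\<integral>\<^sup>+ p. ennreal (norm (H p)) \<partial>lborel2) < \<infinity>"
      using riesz_energy_finite[OF c43] by simp
  qed auto
  \<comment> \<open>The part of the form above the diagonal; it is integrated in $t$ first, where the reflected kernel produces $iV$.\<close>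
  define P where "P k = (\<lambda>(t, s). if t < s then c t * (cnj (c s) * k (t - s)) else 0)" for k :: "real \<Rightarrow> complex"
  have Pm: "P k \<in> borel_measurable lborel2" if [measurable]: "k \<in> borel_measurable borel" for k
    unfolding P_def by measurable
  have Ple: "norm (P k p) \<le> H p" if k: "\<And>\<tau>. \<tau> \<noteq> 0 \<Longrightarrow> cmod (k \<tau>) \<le> 1 / sqrt \<bar>\<tau>\<bar>" for k p
  proof (cases p)
    case (Pair t s)
    show ?thesis
    proof (cases "t < s")
      case True
      then have "cmod (c t) * (cmod (c s) * cmod (k (t - s))) \<le> cmod (c t) * (cmod (c s) * (1 / sqrt \<bar>t - s\<bar>))"
        by (intro mult_left_mono k) auto
      then show ?thesis using True by (simp add: Pair P_def H_def norm_mult)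
    qed (auto simp: Pair P_def H_def)
  qed
  have Pint: "integrable lborel2 (P k)"
    if "\<And>\<tau>. \<tau> \<noteq> 0 \<Longrightarrow> cmod (k \<tau>) \<le> 1 / sqrt \<bar>\<tau>\<bar>" "k \<in> borel_measurable borel" for k
  proof (rule Bochner_Integration.integrable_bound[OF H Pm[OF that(2)]])
    have "norm (P k p) \<le> norm (H p)" for p using Ple[OF that(1), of p] by simp
    then show "AE p in lborel2. norm (P k p) \<le> norm (H p)" by simp
  qed
  have lim: "(\<lambda>n. integral\<^sup>L lborel2 (P (kern_reg n))) \<longlonglongrightarrow> integral\<^sup>L lborel2 (P kern)"
  proof (rule integral_dominated_convergence[where w=H])
    show "AE p in lborel2. (\<lambda>n. P (kern_reg n) p) \<longlonglongrightarrow> P kern p"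
    proof (rule AE_I2)
      fix p :: "real \<times> real"
      obtain t s where p: "p = (t, s)" by (cases p)
      show "(\<lambda>n. P (kern_reg n) p) \<longlonglongrightarrow> P kern p"
      proof (cases "t < s")
        case True
        then have "(\<lambda>n. kern_reg n (t - s)) \<longlonglongrightarrow> kern (t - s)"
          unfolding kern_reg_def by (intro gauss_kernel_tendsto) simp
        then show ?thesis using True by (auto simp: p P_def intro!: tendsto_intros)
      qed (simp add: p P_def)
    qed
    show "AE p in lborel2. norm (P (kern_reg n) p) \<le> H p" for n
      by (intro AE_I2 Ple norm_kern_reg_le)
  qed (auto intro!: Pm H)
  have pos: "Re (integral\<^sup>L lborel2 (P (kern_reg n))) \<ge> 0" for n
  proof -
    \<comment> \<open>Half of the damping goes to each factor of the scalar product.\<close>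
    define e where "e = 1 / real (Suc n) / 2"
    define w where "w s = of_real e + \<i> * of_real s" for s
    have e: "e > 0" "e + e = 1 / real (Suc n)" by (auto simp: e_def simp del: of_nat_Suc)
    have w: "Re (w s) \<ge> e" for s by (simp add: w_def)
    have [measurable]: "w \<in> borel_measurable borel" unfolding w_def by measurable
    have ww: "w t + cnj (w s) = Complex (1 / real (Suc n)) (t - s)" for t s
      unfolding e(2)[symmetric] by (simp add: w_def complex_eq_iff)
    define S where "S = superpose w (\<lambda>_. 0) c"
    have "(LINT \<xi>|lborel. S \<xi> * cnj (S \<xi>)) = complex_of_real (LINT \<xi>|lborel. (cmod (S \<xi>))\<^sup>2)"
      unfolding integral_complex_of_real[symmetric] by (simp only: complex_norm_square)
    then have S0: "Re (LINT \<xi>|lborel. S \<xi> * cnj (S \<xi>)) \<ge> 0" by simp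
    have "complex_of_real (1 / (2 * pi)) * (LINT \<xi>|lborel. S \<xi> * cnj (S \<xi>)) = (LINT t|lborel. LINT s|lborel. c t * (cnj (c s) * kern_reg n (t - s)))"
    proof -
      have i: "(LINT \<xi>|lborel. S \<xi> * cnj (S \<xi>)) = (LINT t|lborel. LINT s|lborel. c t * (cnj (c s) * gauss_kernel (Complex (1 / real (Suc n)) (t - s)) 0))"
      proof -
        have "(LINT \<xi>|lborel. S \<xi> * cnj (S \<xi>)) = (LINT t|lborel. LINT s|lborel. c t * (cnj (c s) * gauss_kernel (w t + cnj (w s)) ((\<lambda>_. 0) t - (\<lambda>_. 0) s)))"
          unfolding S_def by (rule superpose_inner(2)[OF admissible_integrable[OF c] w admissible_integrable[OF c] w e(1)]) measurable
        then show ?thesis by (simp only: ww diff_self)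
      qed
      have k: "c t * (cnj (c s) * kern_reg n (t - s)) = complex_of_real (1 / (2 * pi)) * (c t * (cnj (c s) * gauss_kernel (Complex (1 / real (Suc n)) (t - s)) 0))" for t s
        by (simp only: kern_reg_def mult.left_commute)
      show ?thesis unfolding k i integral_mult_right_zero ..
    qed
    also have "\<dots> = (LINT t|lborel. LINT s|lborel. P (kern_reg n) (t, s) + cnj (P (kern_reg n) (s, t)))"
    proof (rule Bochner_Integration.integral_cong[OF refl])
      fix t :: real
      show "(LINT s|lborel. c t * (cnj (c s) * kern_reg n (t - s))) = (LINT s|lborel. P (kern_reg n) (t, s) + cnj (P (kern_reg n) (s, t)))"
      proof (rule integral_cong_AE)
        show "AE s in lborel. c t * (cnj (c s) * kern_reg n (t - s)) = P (kern_reg n) (t, s) + cnj (P (kern_reg n) (s, t))"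
          using AE_lborel_singleton[of t]
        proof eventually_elim
          case (elim s)
          have "cnj (kern_reg n (s - t)) = kern_reg n (t - s)" by (simp add: cnj_kern_reg)
          then show ?case using elim by (auto simp: P_def)
        qed
      qed (auto simp: P_def)
    qed
    also have "\<dots> = integral\<^sup>L lborel2 (\<lambda>(t, s). P (kern_reg n) (t, s) + cnj (P (kern_reg n) (s, t)))"
    proof (rule lborel_pair.integral_fst)
      have "integrable lborel2 (\<lambda>(t, s). P (kern_reg n) (s, t))"
        by (intro lborel_pair.integrable_product_swap Pint norm_kern_reg_le) auto
      then have "integrable lborel2 (\<lambda>p. cnj (case p of (t, s) \<Rightarrow> P (kern_reg n) (s, t)))"
        by (rule integrable_bounded_linear[OF bounded_linear_cnj])
      then have "integrable lborel2 (\<lambda>p. P (kern_reg n) p + cnj (case p of (t, s) \<Rightarrow> P (kern_reg n) (s, t)))"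
        by (intro Bochner_Integration.integrable_add Pint norm_kern_reg_le) auto
      then show "integrable lborel2 (\<lambda>(t, s). P (kern_reg n) (t, s) + cnj (P (kern_reg n) (s, t)))"
        by (simp add: case_prod_beta')
    qed
    also have "\<dots> = integral\<^sup>L lborel2 (P (kern_reg n)) + cnj (integral\<^sup>L lborel2 (P (kern_reg n)))"
    proof -
      have i1: "integrable lborel2 (P (kern_reg n))"
        by (intro Pint norm_kern_reg_le) auto
      have i2: "integrable lborel2 (\<lambda>(t, s). P (kern_reg n) (s, t))"
        by (intro lborel_pair.integrable_product_swap i1)
      have sw: "integral\<^sup>L lborel2 (\<lambda>(t, s). P (kern_reg n) (s, t)) = integral\<^sup>L lborel2 (P (kern_reg n))"
        by (rule lborel_pair.integral_product_swap) (auto intro: Pm)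
      have "integral\<^sup>L lborel2 (\<lambda>(t, s). P (kern_reg n) (t, s) + cnj (P (kern_reg n) (s, t)))
        = integral\<^sup>L lborel2 (\<lambda>p. P (kern_reg n) p + cnj (case p of (t, s) \<Rightarrow> P (kern_reg n) (s, t)))"
        by (intro Bochner_Integration.integral_cong) auto
      also have "\<dots> = integral\<^sup>L lborel2 (P (kern_reg n)) + cnj (integral\<^sup>L lborel2 (\<lambda>(t, s). P (kern_reg n) (s, t)))"
        by (subst Bochner_Integration.integral_add[OF i1 integrable_bounded_linear[OF bounded_linear_cnj i2]]) (simp only: Bochner_Integration.integral_cnj)
      finally show ?thesis unfolding sw .
    qed
    finally have "complex_of_real (1 / (2 * pi)) * (LINT \<xi>|lborel. S \<xi> * cnj (S \<xi>)) = integral\<^sup>L lborel2 (P (kern_reg n)) + cnj (integral\<^sup>L lborel2 (P (kern_reg n)))" .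
    then have "Re (complex_of_real (1 / (2 * pi)) * (LINT \<xi>|lborel. S \<xi> * cnj (S \<xi>))) = 2 * Re (integral\<^sup>L lborel2 (P (kern_reg n)))"
      by simp
    moreover have "Re (complex_of_real (1 / (2 * pi)) * (LINT \<xi>|lborel. S \<xi> * cnj (S \<xi>))) \<ge> 0"
      using S0 by (simp only: Re_complex_of_real Im_complex_of_real times_complex.sel) simp
    ultimately show ?thesis by simp
  qed
  have eqV: "(LINT t|lborel. P kern (t, s)) = cnj (c s) * (\<i> * volt c s)" for s
  proof -
    have "(LINT t|lborel. P kern (t, s)) = (LINT t|lborel. (cnj (c s) * \<i>) * (if t < s then c t * kern (s - t) else 0))"
    proof (rule Bochner_Integration.integral_cong[OF refl])
      fix t
      show "P kern (t, s) = (cnj (c s) * \<i>) * (if t < s then c t * kern (s - t) else 0)"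
        using kern_reflect[of "s - t"] by (auto simp: P_def)
    qed
    also have "\<dots> = (cnj (c s) * \<i>) * volt c s" unfolding volt_def by (rule integral_mult_right_zero)
    finally show ?thesis by (simp add: mult.assoc)
  qed
  have PK: "integrable lborel2 (case_prod (\<lambda>t s. P kern (t, s)))"
    using Pint[of kern] norm_kern_le by (simp add: case_prod_beta')
  show "integrable lborel (\<lambda>t. cnj (c t) * (\<i> * volt c t))"
    using lborel_pair.integrable_snd[OF PK] by (simp only: eqV)
  have "(LINT t|lborel. cnj (c t) * (\<i> * volt c t)) = integral\<^sup>L lborel2 (P kern)"
    using lborel_pair.integral_snd[OF PK] by (simp only: eqV) (simp add: case_prod_beta')
  moreover have "Re (integral\<^sup>L lborel2 (P kern)) \<ge> 0"
    by (rule tendsto_lowerbound[OF tendsto_Re[OF lim]]) (auto intro: pos always_eventually)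
  ultimately show "Re (LINT t|lborel. cnj (c t) * (\<i> * volt c t)) \<ge> 0" by simp
qed

section \<open>The Volterra equation for the trace\<close>

text \<open>The equation on $[0,T)$. The nonlinearity is extended by zero, so that an operator on the whole
  line can be applied.\<close>

definition volterra :: "real \<Rightarrow> (real \<Rightarrow> complex) \<Rightarrow> (real \<Rightarrow> complex) \<Rightarrow> bool" where
  "volterra T f z \<longleftrightarrow> z \<in> borel_measurable borel \<and> L4 (restr {0..<T} z) \<and>
     (AE t in lborel. t \<in> {0..<T} \<longrightarrow> z t + \<i> * volt (restr {0..<T} (\<lambda>s. cubic (z s))) t = f t)"

lemma L43_restr: "L43 c \<Longrightarrow> S \<in> sets borel \<Longrightarrow> L43 (restr S c)"
proof -
  assume c: "L43 c" and S: "S \<in> sets borel"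
  have "N43 (restr S c) \<le> N43 c" by (rule N43_mono) (simp add: cmod_restr indicator_def)
  then show ?thesis using c S by (auto simp: L43_def restr_measurable intro: le_less_trans)
qed

lemma restr_zero [simp]: "restr S (\<lambda>_. 0) = (\<lambda>_. 0)"
  by (simp add: restr_def fun_eq_iff)

lemma volt_zero [simp]: "volt (\<lambda>_. 0) t = 0"
  unfolding volt_def by (simp only: mult_zero_left if_cancel Bochner_Integration.integral_zero)

lemma volt_restr_initial:
  assumes "t \<le> T" "T \<le> T'" shows "volt (restr {a..<T'} c) t = volt (restr {a..<T} c) t"
  by (rule volt_cong) (use assms in \<open>auto simp: restr_def indicator_def\<close>)

lemma volterra_mono:
  assumes "volterra T' f z" "T \<le> T'" shows "volterra T f z"
proof -
  have [measurable]: "z \<in> borel_measurable borel" using assms by (simp add: volterra_def)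
  have "restr {0..<T} z = restr {0..<T} (restr {0..<T'} z)" unfolding restr_restr using assms(2) by (intro arg_cong2[where f=restr]) auto
  then have "L4 (restr {0..<T} z)" using assms(1) by (simp add: volterra_def L4_restr)
  moreover have "AE t in lborel. t \<in> {0..<T} \<longrightarrow> z t + \<i> * volt (restr {0..<T} (\<lambda>s. cubic (z s))) t = f t"
  proof -
    have "AE t in lborel. t \<in> {0..<T'} \<longrightarrow> z t + \<i> * volt (restr {0..<T'} (\<lambda>s. cubic (z s))) t = f t"
      using assms(1) by (simp add: volterra_def)
    then show ?thesis
    proof eventually_elim
      case (elim t)
      show ?case
      proof
        assume t: "t \<in> {0..<T}"
        then have "volt (restr {0..<T'} (\<lambda>s. cubic (z s))) t = volt (restr {0..<T} (\<lambda>s. cubic (z s))) t"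
          by (intro volt_restr_initial assms(2)) auto
        then show "z t + \<i> * volt (restr {0..<T} (\<lambda>s. cubic (z s))) t = f t" using elim t assms(2) by simp
      qed
    qed
  qed
  ultimately show ?thesis by (simp add: volterra_def)
qed

text \<open>Multiply the difference of the equations by the conjugate of the difference $c$ of the
  nonlinearities and integrate. The operator contributes a nonnegative real part, monotonicity
  bounds the first term from below, and the right-hand side is absorbed. The free parameter
  \<open>l\<close> comes from a weighted Cauchy--Schwarz inequality on the right.\<close>

lemma volterra_stability:
  assumes z: "volterra T f z" and w: "volterra T g w" and f: "L4 (restr {0..<T} (\<lambda>t. f t - g t))"
    and fm: "f \<in> borel_measurable borel" "g \<in> borel_measurable borel" and l: "l > 0"
  shows "A4 (restr {0..<T} (\<lambda>t. z t - w t)) \<le> 36 * l * (A4 (restr {0..<T} z) + A4 (restr {0..<T} w)) + 18 / l * A4 (restr {0..<T} (\<lambda>t. f t - g t))"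
proof -
  let ?I = "{0..<T}"
  have [measurable]: "z \<in> borel_measurable borel" "w \<in> borel_measurable borel" "f \<in> borel_measurable borel" "g \<in> borel_measurable borel"
    using z w fm by (auto simp: volterra_def)
  define Z where "Z = restr ?I z"
  define W where "W = restr ?I w"
  define D where "D = restr ?I (\<lambda>t. f t - g t)"
  have L: "L4 Z" "L4 W" "L4 D" using z w f by (auto simp: volterra_def Z_def W_def D_def)
  have [measurable]: "Z \<in> borel_measurable borel" "W \<in> borel_measurable borel" "D \<in> borel_measurable borel"
    using L by (auto intro: L4_measurable)
  define c where "c t = cubic (Z t) - cubic (W t)" for t
  have c43: "L43 c" unfolding c_def by (rule n43_cubic_diff(1)[OF L(1,2)])
  have [measurable]: "c \<in> borel_measurable borel" using c43 by (rule L43_measurable)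
  have cz: "Z t = 0" "W t = 0" "D t = 0" "c t = 0" if "t \<notin> ?I" for t
    using that by (auto simp: Z_def W_def D_def c_def restr_def)
  have ac: "admissible c"
    by (rule admissible_bounded_interval[of c 0 T]) (use c43 cz in \<open>auto simp: L43_def\<close>)
  have nz: "restr ?I (\<lambda>s. cubic (z s)) = (\<lambda>s. cubic (Z s))" "restr ?I (\<lambda>s. cubic (w s)) = (\<lambda>s. cubic (W s))"
    by (simp_all add: restr_cubic Z_def W_def)
  have eq: "AE t in lborel. cnj (c t) * (Z t - W t) + cnj (c t) * (\<i> * volt c t) = cnj (c t) * D t"
    using AE_riesz_finite[OF L43_cubic[OF L(1)]] AE_riesz_finite[OF L43_cubic[OF L(2)]] z[unfolded volterra_def nz, THEN conjunct2, THEN conjunct2]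
      w[unfolded volterra_def nz, THEN conjunct2, THEN conjunct2]
  proof eventually_elim
    case (elim t)
    show ?case
    proof (cases "t \<in> ?I")
      case True
      have ZW: "Z t = z t" "W t = w t" "D t = f t - g t" using True by (simp_all add: Z_def W_def D_def restr_def)
      have Vc: "volt c t = volt (\<lambda>s. cubic (Z s)) t - volt (\<lambda>s. cubic (W s)) t"
        unfolding c_def by (rule volt_diff) (use elim in auto)
      have "Z t - W t + \<i> * volt c t = (z t + \<i> * volt (\<lambda>s. cubic (Z s)) t) - (w t + \<i> * volt (\<lambda>s. cubic (W s)) t)"
        unfolding ZW Vc right_diff_distrib by simp
      also have "\<dots> = D t" using elim True by (simp add: ZW)
      finally show ?thesis by (simp flip: distrib_left)
    qed (simp add: cz)
  qed
  define \<rho> where "\<rho> t = (cmod (Z t))\<^sup>2 + (cmod (W t))\<^sup>2" for t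
  have \<rho>0: "\<rho> t \<ge> 0" for t by (simp add: \<rho>_def)
  have [measurable]: "\<rho> \<in> borel_measurable borel" unfolding \<rho>_def by measurable
  have i4: "integrable lborel (\<lambda>t. cmod (Z t) ^ 4)" "integrable lborel (\<lambda>t. cmod (W t) ^ 4)" "integrable lborel (\<lambda>t. cmod (D t) ^ 4)"
    using L by (auto simp: L4_def)
  have i\<rho>2: "integrable lborel (\<lambda>t. (\<rho> t)\<^sup>2)" and \<rho>2: "(\<rho> t)\<^sup>2 \<le> 2 * cmod (Z t) ^ 4 + 2 * cmod (W t) ^ 4" for t
  proof -
    show le: "(\<rho> t)\<^sup>2 \<le> 2 * cmod (Z t) ^ 4 + 2 * cmod (W t) ^ 4" for t
    proof -
      have "(\<rho> t)\<^sup>2 \<le> 2 * ((cmod (Z t))\<^sup>2)\<^sup>2 + 2 * ((cmod (W t))\<^sup>2)\<^sup>2"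
        unfolding \<rho>_def using sum_squares_bound[of "(cmod (Z t))\<^sup>2" "(cmod (W t))\<^sup>2"] by (simp add: power2_sum)
      then show ?thesis by (simp flip: power_mult)
    qed
    show "integrable lborel (\<lambda>t. (\<rho> t)\<^sup>2)"
      by (rule Bochner_Integration.integrable_bound[of _ "\<lambda>t. 2 * cmod (Z t) ^ 4 + 2 * cmod (W t) ^ 4"])
         (use i4 le in auto)
  qed
  have i\<rho>D: "integrable lborel (\<lambda>t. \<rho> t * (cmod (D t))\<^sup>2)"
  proof (rule Bochner_Integration.integrable_bound[of _ "\<lambda>t. (\<rho> t)\<^sup>2 + cmod (D t) ^ 4"])
    have "\<rho> t * (cmod (D t))\<^sup>2 \<le> (\<rho> t)\<^sup>2 + cmod (D t) ^ 4" for t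
    proof -
      have "2 * (\<rho> t * (cmod (D t))\<^sup>2) \<le> (\<rho> t)\<^sup>2 + ((cmod (D t))\<^sup>2)\<^sup>2"
        using sum_squares_bound[of "\<rho> t" "(cmod (D t))\<^sup>2"] by (simp add: mult.assoc)
      moreover have "0 \<le> \<rho> t * (cmod (D t))\<^sup>2" using \<rho>0[of t] by simp
      ultimately show ?thesis by (simp flip: power_mult)
    qed
    then show "AE t in lborel. norm (\<rho> t * (cmod (D t))\<^sup>2) \<le> norm ((\<rho> t)\<^sup>2 + cmod (D t) ^ 4)"
      using \<rho>0 by (auto simp: abs_mult)
  qed (use i4 i\<rho>2 in auto)
  have zw2: "(cmod (Z t - W t))\<^sup>2 \<le> 2 * \<rho> t" for t
  proof -
    have "(cmod (Z t - W t))\<^sup>2 \<le> (cmod (Z t) + cmod (W t))\<^sup>2" by (intro power_mono norm_triangle_ineq4) auto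
    also have "\<dots> \<le> 2 * \<rho> t" unfolding \<rho>_def using sum_squares_bound[of "cmod (Z t)" "cmod (W t)"] by (simp add: power2_sum)
    finally show ?thesis .
  qed
  have i\<rho>d: "integrable lborel (\<lambda>t. \<rho> t * (cmod (Z t - W t))\<^sup>2)"
  proof (rule Bochner_Integration.integrable_bound[of _ "\<lambda>t. 2 * (\<rho> t)\<^sup>2"])
    show "AE t in lborel. norm (\<rho> t * (cmod (Z t - W t))\<^sup>2) \<le> norm (2 * (\<rho> t)\<^sup>2)"
    proof (rule AE_I2)
      fix t
      have "\<rho> t * (cmod (Z t - W t))\<^sup>2 \<le> \<rho> t * (2 * \<rho> t)" using zw2 \<rho>0 by (intro mult_left_mono)
      then show "norm (\<rho> t * (cmod (Z t - W t))\<^sup>2) \<le> norm (2 * (\<rho> t)\<^sup>2)"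
        using \<rho>0[of t] by (simp add: abs_mult power2_eq_square)
    qed
  qed (use i\<rho>2 in auto)
  \<comment> \<open>Monotonicity gives one half of the weighted square; one quarter is spent on absorbing the datum.\<close>
  have pt: "AE t in lborel. 1/4 * (\<rho> t * (cmod (Z t - W t))\<^sup>2) + Re (cnj (c t) * (\<i> * volt c t)) \<le> 9/4 * (\<rho> t * (cmod (D t))\<^sup>2)"
    using eq
  proof eventually_elim
    case (elim t)
    have "Re (cnj (c t) * (Z t - W t)) + Re (cnj (c t) * (\<i> * volt c t)) = Re (cnj (c t) * D t)"
      using arg_cong[OF elim, of Re] by simp
    moreover have "1/2 * (\<rho> t * (cmod (Z t - W t))\<^sup>2) \<le> Re (cnj (c t) * (Z t - W t))"
      using cubic_monotone[of "Z t" "W t"] unfolding c_def \<rho>_def by (simp only: mult.commute)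
    moreover have "Re (cnj (c t) * D t) \<le> 1/4 * (\<rho> t * (cmod (Z t - W t))\<^sup>2) + 9/4 * (\<rho> t * (cmod (D t))\<^sup>2)"
    proof -
      have "Re (cnj (c t) * D t) \<le> cmod (c t) * cmod (D t)"
        using complex_Re_le_cmod[of "cnj (c t) * D t"] by (simp add: norm_mult)
      also have "\<dots> \<le> (3/2 * (\<rho> t * cmod (Z t - W t))) * cmod (D t)"
        unfolding c_def \<rho>_def by (intro mult_right_mono cubic_diff_le) auto
      also have "\<dots> = \<rho> t * (2 * (1/2 * cmod (Z t - W t)) * (3/2 * cmod (D t)))" by simp
      also have "\<dots> \<le> \<rho> t * ((1/2 * cmod (Z t - W t))\<^sup>2 + (3/2 * cmod (D t))\<^sup>2)"
        by (intro mult_left_mono sum_squares_bound \<rho>0)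
      also have "\<dots> = 1/4 * (\<rho> t * (cmod (Z t - W t))\<^sup>2) + 9/4 * (\<rho> t * (cmod (D t))\<^sup>2)"
        by (simp add: power_mult_distrib distrib_left power_divide)
      finally show ?thesis .
    qed
    ultimately show ?case by linarith
  qed
  note Vp = volt_positive[OF ac]
  have iR: "integrable lborel (\<lambda>t. Re (cnj (c t) * (\<i> * volt c t)))" using Vp(1) by (rule integrable_Re)
  have "(LINT t|lborel. 1/4 * (\<rho> t * (cmod (Z t - W t))\<^sup>2) + Re (cnj (c t) * (\<i> * volt c t))) \<le> (LINT t|lborel. 9/4 * (\<rho> t * (cmod (D t))\<^sup>2))"
    by (intro integral_mono_AE pt Bochner_Integration.integrable_add integrable_mult_right i\<rho>d iR i\<rho>D)
  moreover have "(LINT t|lborel. 1/4 * (\<rho> t * (cmod (Z t - W t))\<^sup>2) + Re (cnj (c t) * (\<i> * volt c t)))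
      = 1/4 * (LINT t|lborel. \<rho> t * (cmod (Z t - W t))\<^sup>2) + Re (LINT t|lborel. cnj (c t) * (\<i> * volt c t))"
    by (subst Bochner_Integration.integral_add) (use i\<rho>d iR Vp(1) in \<open>auto simp: integral_Re simp del: times_complex.sel\<close>)
  ultimately have main: "(LINT t|lborel. \<rho> t * (cmod (Z t - W t))\<^sup>2) \<le> 9 * (LINT t|lborel. \<rho> t * (cmod (D t))\<^sup>2)"
    using Vp(2) by simp
  have "A4 (\<lambda>t. Z t - W t) \<le> (LINT t|lborel. 2 * (\<rho> t * (cmod (Z t - W t))\<^sup>2))"
    unfolding A4_def
  proof (rule integral_mono)
    show "integrable lborel (\<lambda>t. cmod (Z t - W t) ^ 4)" using L4_diff(1)[OF L(1,2)] by (simp add: L4_def)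
    show "cmod (Z t - W t) ^ 4 \<le> 2 * (\<rho> t * (cmod (Z t - W t))\<^sup>2)" for t
      using mult_right_mono[OF zw2[of t], of "(cmod (Z t - W t))\<^sup>2"] by (simp add: mult.assoc flip: power_add)
  qed (use i\<rho>d in auto)
  also have "\<dots> \<le> 18 * (LINT t|lborel. \<rho> t * (cmod (D t))\<^sup>2)" using main by simp
  also have "\<dots> \<le> 18 * (LINT t|lborel. 2 * l * cmod (Z t) ^ 4 + 2 * l * cmod (W t) ^ 4 + 1 / l * cmod (D t) ^ 4)"
  proof (intro mult_left_mono integral_mono i\<rho>D)
    fix t
    have "2 * ((l * \<rho> t) * (cmod (D t))\<^sup>2) \<le> (l * \<rho> t)\<^sup>2 + ((cmod (D t))\<^sup>2)\<^sup>2"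
      using sum_squares_bound[of "l * \<rho> t" "(cmod (D t))\<^sup>2"] by (simp add: mult.assoc)
    moreover have "((cmod (D t))\<^sup>2)\<^sup>2 = cmod (D t) ^ 4" "(l * \<rho> t)\<^sup>2 = l * (l * (\<rho> t)\<^sup>2)"
      by (simp_all add: power2_eq_square[of "l * \<rho> t"] power2_eq_square[of "\<rho> t"] flip: power_mult)
    ultimately have "2 * (l * (\<rho> t * (cmod (D t))\<^sup>2)) \<le> l * (l * (\<rho> t)\<^sup>2) + cmod (D t) ^ 4"
      by (simp only: mult.assoc)
    then have "2 * (\<rho> t * (cmod (D t))\<^sup>2) \<le> l * (\<rho> t)\<^sup>2 + 1 / l * cmod (D t) ^ 4"
      using l by (simp add: field_simps)
    moreover have "l * (\<rho> t)\<^sup>2 \<le> l * (2 * cmod (Z t) ^ 4 + 2 * cmod (W t) ^ 4)" using l \<rho>2 by (intro mult_left_mono) auto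
    moreover have "\<rho> t * (cmod (D t))\<^sup>2 \<ge> 0" using \<rho>0 by simp
    ultimately show "\<rho> t * (cmod (D t))\<^sup>2 \<le> 2 * l * cmod (Z t) ^ 4 + 2 * l * cmod (W t) ^ 4 + 1 / l * cmod (D t) ^ 4"
      by (simp add: distrib_left)
  qed (use i4 in auto)
  also have "\<dots> = 36 * l * (A4 Z + A4 W) + 18 / l * A4 D"
    unfolding A4_def using i4 by (simp add: distrib_left)
  finally have "A4 (\<lambda>t. Z t - W t) \<le> 36 * l * (A4 Z + A4 W) + 18 / l * A4 D" .
  moreover have "restr ?I (\<lambda>t. z t - w t) = (\<lambda>t. Z t - W t)" by (auto simp: Z_def W_def restr_def fun_eq_iff right_diff_distrib)
  ultimately show ?thesis unfolding Z_def W_def D_def by simp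
qed

lemma volterra_zero: "volterra T (\<lambda>_. 0) (\<lambda>_. 0)"
  by (simp add: volterra_def L4_def)

text \<open>Stability against the zero solution, with the parameter so small that the norm of
  \<open>z\<close> on the right is absorbed.\<close>

lemma volterra_apriori:
  assumes z: "volterra T f z" and f: "L4 f"
  shows "A4 (restr {0..<T} z) \<le> 2592 * A4 f"
proof -
  have fm: "f \<in> borel_measurable borel" using f by (rule L4_measurable)
  have c: "L4 (restr {0..<T} (\<lambda>t. f t - 0))" "A4 (restr {0..<T} (\<lambda>t. f t - 0)) \<le> A4 f" using L4_restr[OF f, of "{0..<T}"] by auto
  have "A4 (restr {0..<T} z) \<le> 36 * (1/72) * A4 (restr {0..<T} z) + 18 * 72 * A4 (restr {0..<T} (\<lambda>t. f t - 0))"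
    using volterra_stability[OF z volterra_zero c(1) fm, of "1/72"] by (simp add: restr_def A4_def)
  then show ?thesis using c(2) by simp
qed

text \<open>For equal data the parameter may tend to zero.\<close>

lemma volterra_unique:
  assumes z: "volterra T f z" and w: "volterra T f w" and f: "f \<in> borel_measurable borel"
  shows "AE t in lborel. t \<in> {0..<T} \<longrightarrow> z t = w t"
proof -
  let ?D = "restr {0..<T} (\<lambda>t. z t - w t)"
  have [measurable]: "z \<in> borel_measurable borel" "w \<in> borel_measurable borel" using z w by (auto simp: volterra_def)
  have L: "L4 ?D"
  proof -
    have "?D = (\<lambda>t. restr {0..<T} z t - restr {0..<T} w t)" by (auto simp: restr_def fun_eq_iff right_diff_distrib)
    then show ?thesis using z w by (simp add: volterra_def L4_diff)
  qed
  define K where "K = 36 * (A4 (restr {0..<T} z) + A4 (restr {0..<T} w))"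
  have b: "A4 ?D \<le> l * K" if "l > 0" for l
  proof -
    have 0: "L4 (restr {0..<T} (\<lambda>t. f t - f t))" "A4 (restr {0..<T} (\<lambda>t. f t - f t)) = 0"
      by (simp_all add: restr_def L4_def A4_def)
    show ?thesis using volterra_stability[OF z w 0(1) f f that] 0(2) by (simp add: K_def algebra_simps)
  qed
  have "((\<lambda>l. l * K) \<longlongrightarrow> 0 * K) (at_right 0)" by (intro tendsto_intros)
  then have "A4 ?D \<le> 0 * K"
    by (rule tendsto_lowerbound) (use b in \<open>auto simp: eventually_at_filter intro!: always_eventually\<close>)
  then have "A4 ?D = 0" using A4_nonneg[of ?D] by simp
  from A4_0_AE[OF L this] show ?thesis by eventually_elim (auto simp: restr_def)
qed

subsection \<open>Local existence\<close>

lemma L4_scale_i: "L4 z \<Longrightarrow> L4 (\<lambda>t. \<i> * z t)" "A4 (\<lambda>t. \<i> * z t) = A4 z"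
  by (auto simp: L4_def A4_def norm_mult intro!: borel_measurable_times)

lemma A4_volt_cubic_diff:
  assumes z: "L4 z" and w: "L4 w"
  shows "A4 (\<lambda>t. volt (\<lambda>s. cubic (z s)) t - volt (\<lambda>s. cubic (w s)) t) \<le> 14 ^ 4 * 2 ^ 12 * (A4 z + A4 w)\<^sup>2 * A4 (\<lambda>t. z t - w t)"
proof -
  note D = n43_cubic_diff[OF z w]
  have m: "volt (\<lambda>s. cubic (z s)) \<in> borel_measurable borel" "volt (\<lambda>s. cubic (w s)) \<in> borel_measurable borel"
    by (intro L4_measurable L4_volt(1) L43_cubic z w)+
  have "AE t in lborel. volt (\<lambda>s. cubic (z s)) t - volt (\<lambda>s. cubic (w s)) t = volt (\<lambda>s. cubic (z s) - cubic (w s)) t"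
    using AE_riesz_finite[OF L43_cubic[OF z]] AE_riesz_finite[OF L43_cubic[OF w]]
    by eventually_elim (intro volt_diff[symmetric] L43_measurable L43_cubic z w)
  then have "A4 (\<lambda>t. volt (\<lambda>s. cubic (z s)) t - volt (\<lambda>s. cubic (w s)) t) = A4 (volt (\<lambda>s. cubic (z s) - cubic (w s)))"
    by (intro A4_cong_AE(1) borel_measurable_diff m volt_measurable L43_measurable D(1))
  also have "\<dots> \<le> 14 ^ 4 * n43 (\<lambda>s. cubic (z s) - cubic (w s)) ^ 3" by (rule L4_volt(2)[OF D(1)])
  also have "\<dots> \<le> 14 ^ 4 * (2 ^ 12 * (A4 z + A4 w)\<^sup>2 * A4 (\<lambda>t. z t - w t))" by (intro mult_left_mono D(2)) auto
  finally show ?thesis by simp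
qed

lemma L4_Fatou:
  assumes u: "\<And>n. L4 (u n)" "\<And>n. A4 (u n) \<le> B" and lim: "AE t in lborel. (\<lambda>n. u n t) \<longlonglongrightarrow> w t"
    and w: "w \<in> borel_measurable borel"
  shows "L4 w" "A4 w \<le> B"
proof -
  have [measurable]: "u n \<in> borel_measurable borel" for n using u(1) by (rule L4_measurable)
  have "int4 w = (\<integral>\<^sup>+ t. liminf (\<lambda>n. ennreal (cmod (u n t) ^ 4)) \<partial>lborel)"
  proof (rule nn_integral_cong_AE, use lim in eventually_elim)
    case (elim t)
    have "(\<lambda>n. ennreal (cmod (u n t) ^ 4)) \<longlonglongrightarrow> ennreal (cmod (w t) ^ 4)" by (intro tendsto_intros elim)
    then show ?case using lim_imp_Liminf by (metis sequentially_bot)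
  qed
  also have "\<dots> \<le> liminf (\<lambda>n. \<integral>\<^sup>+ t. ennreal (cmod (u n t) ^ 4) \<partial>lborel)" by (intro nn_integral_liminf) measurable
  also have "\<dots> \<le> liminf (\<lambda>n::nat. ennreal B)"
    by (intro Liminf_mono always_eventually allI) (simp add: ennreal_A4 u ennreal_leI)
  also have "\<dots> = ennreal B" by (rule Liminf_const) simp
  finally have b: "int4 w \<le> ennreal B" .
  have "B \<ge> 0" using u(2)[of 0] A4_nonneg[of "u 0"] by linarith
  with L4I[OF w b] show "L4 w" "A4 w \<le> B" by auto
qed

text \<open>Picard iteration in a ball of $L^4$. The datum is small rather than the interval because the
  Lipschitz constant carries no power of the length of the interval. Limits are taken almost
  everywhere, along a sequence with geometrically decaying differences.\<close>

lemma small_data_fixpoint: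
  assumes g: "L4 g" and S: "S \<in> sets borel" and \<eta>: "A4 g \<le> \<eta>" "\<eta> > 0" "2 ^ 50 * \<eta>\<^sup>2 \<le> 1"
  obtains w where "L4 w" "AE t in lborel. w t = restr S (\<lambda>t. g t - \<i> * volt (\<lambda>s. cubic (w s)) t) t"
proof -
  define \<Phi> where "\<Phi> w = restr S (\<lambda>t. g t - \<i> * volt (\<lambda>s. cubic (w s)) t)" for w
  have [measurable]: "g \<in> borel_measurable borel" "S \<in> sets borel" using g S by (auto intro: L4_measurable)
  have diff: "A4 (\<lambda>t. \<Phi> z t - \<Phi> w t) \<le> 14 ^ 4 * 2 ^ 12 * (A4 z + A4 w)\<^sup>2 * A4 (\<lambda>t. z t - w t)"
    and L\<Phi>: "L4 (\<Phi> z)" if z: "L4 z" and w: "L4 w" for z w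
  proof -
    have LV: "L4 (volt (\<lambda>s. cubic (u s)))" if "L4 u" for u by (intro L4_volt(1) L43_cubic that)
    show L\<Phi>: "L4 (\<Phi> z)" unfolding \<Phi>_def by (intro L4_restr(1) L4_diff(1) g L4_scale_i(1) LV z S)
    let ?D = "\<lambda>t. volt (\<lambda>s. cubic (z s)) t - volt (\<lambda>s. cubic (w s)) t"
    have eq: "(\<lambda>t. \<Phi> z t - \<Phi> w t) = restr S (\<lambda>t. - (\<i> * ?D t))"
      unfolding \<Phi>_def by (rule ext) (simp add: restr_def right_diff_distrib)
    have LD: "L4 ?D" by (intro L4_diff(1) LV z w)
    have [measurable]: "z \<in> borel_measurable borel" "w \<in> borel_measurable borel" using z w by (auto intro: L4_measurable)
    have LD': "L4 (\<lambda>t. - (\<i> * ?D t))" "A4 (\<lambda>t. - (\<i> * ?D t)) = A4 ?D"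
    proof -
      have "(\<lambda>t. - (\<i> * ?D t)) \<in> borel_measurable borel" by measurable
      then show "L4 (\<lambda>t. - (\<i> * ?D t))" by (rule L4_mono(1)[OF LD]) (simp add: norm_mult)
      show "A4 (\<lambda>t. - (\<i> * ?D t)) = A4 ?D" by (simp add: A4_def norm_mult)
    qed
    have "A4 (\<lambda>t. \<Phi> z t - \<Phi> w t) \<le> A4 ?D" unfolding eq LD'(2)[symmetric] by (intro L4_restr(2) LD' S)
    also have "\<dots> \<le> 14 ^ 4 * 2 ^ 12 * (A4 z + A4 w)\<^sup>2 * A4 (\<lambda>t. z t - w t)" by (rule A4_volt_cubic_diff[OF z w])
    finally show "A4 (\<lambda>t. \<Phi> z t - \<Phi> w t) \<le> 14 ^ 4 * 2 ^ 12 * (A4 z + A4 w)\<^sup>2 * A4 (\<lambda>t. z t - w t)" .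
  qed
  have z0: "L4 (\<lambda>_. 0)" "A4 (\<lambda>_. 0) = 0" by (simp_all add: L4_def A4_def)
  have \<Phi>0: "A4 (\<Phi> (\<lambda>_. 0)) \<le> \<eta>" using L4_restr(2)[OF g S] \<eta> by (simp add: \<Phi>_def)
  \<comment> \<open>The fourth power of the norm of a sum is at most eight times the sum of the fourth powers; two summands of size $\eta$ lead to the radius $16\eta$.\<close>
  have ball: "A4 (\<Phi> z) \<le> 16 * \<eta>" if z: "L4 z" "A4 z \<le> 16 * \<eta>" for z
  proof -
    let ?d = "\<lambda>t. \<Phi> z t - \<Phi> (\<lambda>_. 0) t"
    have "A4 ?d \<le> 14 ^ 4 * 2 ^ 12 * (A4 z)\<^sup>2 * A4 z" using diff[OF z(1) z0(1)] z0 by simp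
    also have "\<dots> \<le> 14 ^ 4 * 2 ^ 12 * (16 * \<eta>)\<^sup>2 * (16 * \<eta>)"
      using z \<eta> by (intro mult_mono power_mono) auto
    also have "\<dots> = (14 ^ 4 * 2 ^ 24 * \<eta>\<^sup>2) * \<eta>" by (simp add: power2_eq_square)
    also have "\<dots> \<le> 1 * \<eta>" using \<eta> by (intro mult_right_mono) auto
    finally have d: "A4 ?d \<le> \<eta>" by simp
    have "\<Phi> z = (\<lambda>t. ?d t - (- \<Phi> (\<lambda>_. 0) t))" by simp
    moreover have n: "L4 (\<lambda>t. - \<Phi> (\<lambda>_. 0) t)" "A4 (\<lambda>t. - \<Phi> (\<lambda>_. 0) t) = A4 (\<Phi> (\<lambda>_. 0))"
      using L\<Phi>[OF z0(1) z0(1)] by (simp_all add: L4_def A4_def)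
    ultimately have "A4 (\<Phi> z) \<le> 8 * A4 ?d + 8 * A4 (\<Phi> (\<lambda>_. 0))"
      using L4_diff(2)[OF L4_diff(1)[OF L\<Phi>[OF z(1) z(1)] L\<Phi>[OF z0(1) z0(1)]] n(1)] n(2) by simp
    then show ?thesis using d \<Phi>0 by simp
  qed
  have contr: "A4 (\<lambda>t. \<Phi> z t - \<Phi> w t) \<le> 1/4 * A4 (\<lambda>t. z t - w t)"
    if "L4 z" "A4 z \<le> 16 * \<eta>" "L4 w" "A4 w \<le> 16 * \<eta>" for z w
  proof -
    have "A4 (\<lambda>t. \<Phi> z t - \<Phi> w t) \<le> 14 ^ 4 * 2 ^ 12 * (A4 z + A4 w)\<^sup>2 * A4 (\<lambda>t. z t - w t)" by (rule diff) fact+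
    also have "\<dots> \<le> 14 ^ 4 * 2 ^ 12 * (16 * \<eta> + 16 * \<eta>)\<^sup>2 * A4 (\<lambda>t. z t - w t)"
      using that \<eta> by (intro mult_right_mono mult_left_mono power_mono add_mono) auto
    also have "14 ^ 4 * 2 ^ 12 * (16 * \<eta> + 16 * \<eta>)\<^sup>2 = 14 ^ 4 * 2 ^ 22 * \<eta>\<^sup>2" by (simp add: power2_eq_square)
    also have "\<dots> * A4 (\<lambda>t. z t - w t) \<le> 1/4 * A4 (\<lambda>t. z t - w t)"
      using \<eta> by (intro mult_right_mono) auto
    finally show ?thesis .
  qed
  define u where "u n = (\<Phi> ^^ n) (\<lambda>_. 0)" for n
  have u: "L4 (u n) \<and> A4 (u n) \<le> 16 * \<eta>" for n
    by (induction n) (use z0 \<eta> L\<Phi> ball in \<open>auto simp: u_def\<close>)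
  have [measurable]: "u n \<in> borel_measurable borel" for n using u by (auto intro: L4_measurable)
  have uS: "u (Suc n) = \<Phi> (u n)" for n by (simp add: u_def)
  have step: "A4 (\<lambda>t. u (Suc n) t - u n t) \<le> \<eta> * (1/4) ^ n" for n
  proof (induction n)
    case 0
    show ?case using \<Phi>0 by (simp add: u_def)
  next
    case (Suc n)
    have "A4 (\<lambda>t. u (Suc (Suc n)) t - u (Suc n) t) \<le> 1/4 * A4 (\<lambda>t. u (Suc n) t - u n t)"
      unfolding uS[of "Suc n"] uS[of n] using contr[of "u (Suc n)" "u n"] u uS by (metis)
    then show ?case using Suc by simp
  qed
  have cv: "AE t in lborel. convergent (\<lambda>n. u n t)"
  proof (rule fast_Lp_AE_convergent[where p=4 and K=\<eta>])
    fix n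
    have "L4 (\<lambda>t. u (Suc n) t - u n t)" using u by (intro L4_diff) auto
    then show "(\<integral>\<^sup>+ t. ennreal (cmod (u (Suc n) t - u n t) ^ 4) \<partial>lborel) \<le> ennreal (\<eta> * (1/4) ^ n)"
      using step[of n] by (simp add: ennreal_A4 ennreal_leI)
  qed (use \<eta> in auto)
  define w where "w t = lim (\<lambda>n. u n t)" for t
  have [measurable]: "w \<in> borel_measurable borel" unfolding w_def by measurable
  have pt: "AE t in lborel. (\<lambda>n. u n t) \<longlonglongrightarrow> w t"
    using cv by eventually_elim (simp add: w_def convergent_LIMSEQ_iff)
  \<comment> \<open>Both iterates are images of earlier ones, so the contraction can be applied repeatedly.\<close>
  have tail: "A4 (\<lambda>t. u (n + k) t - u n t) \<le> 16 * \<eta> * (1/4) ^ n" for n k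
  proof (induction n)
    case 0
    show ?case using u[of k] by (simp add: u_def)
  next
    case (Suc n)
    have "A4 (\<lambda>t. \<Phi> (u (n + k)) t - \<Phi> (u n) t) \<le> 1/4 * A4 (\<lambda>t. u (n + k) t - u n t)"
      using u by (intro contr) auto
    then show ?case using Suc by (simp add: uS)
  qed
  have dw: "L4 (\<lambda>t. w t - u n t) \<and> A4 (\<lambda>t. w t - u n t) \<le> 16 * \<eta> * (1/4) ^ n" for n
  proof -
    have 1: "L4 (\<lambda>t. u (n + k) t - u n t)" for k using u by (intro L4_diff) auto
    have 2: "AE t in lborel. (\<lambda>k. u (n + k) t - u n t) \<longlonglongrightarrow> w t - u n t"
      using pt
    proof eventually_elim
      case (elim t)
      have "(\<lambda>k. u (n + k) t) \<longlonglongrightarrow> w t" using LIMSEQ_ignore_initial_segment[OF elim, of n] by (simp add: add.commute)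
      then show ?case by (intro tendsto_intros)
    qed
    have 3: "(\<lambda>t. w t - u n t) \<in> borel_measurable borel" by measurable
    show ?thesis using L4_Fatou[OF 1 tail 2 3] by simp
  qed
  have Lw: "L4 w" "A4 w \<le> 16 * \<eta>" using dw[of 0] by (simp_all add: u_def)
  have LF: "L4 (\<Phi> w)" by (rule L\<Phi>[OF Lw(1) Lw(1)])
  have fin: "A4 (\<lambda>t. w t - \<Phi> w t) \<le> 256 * \<eta> * (1/4) ^ n" for n
  proof -
    have a: "A4 (\<lambda>t. \<Phi> w t - u (Suc n) t) \<le> 1/4 * A4 (\<lambda>t. w t - u n t)"
      unfolding uS using u Lw by (intro contr) auto
    have "(\<lambda>t. w t - \<Phi> w t) = (\<lambda>t. (w t - u (Suc n) t) - (\<Phi> w t - u (Suc n) t))" by simp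
    then have "A4 (\<lambda>t. w t - \<Phi> w t) \<le> 8 * A4 (\<lambda>t. w t - u (Suc n) t) + 8 * A4 (\<lambda>t. \<Phi> w t - u (Suc n) t)"
      using L4_diff(2)[of "\<lambda>t. w t - u (Suc n) t" "\<lambda>t. \<Phi> w t - u (Suc n) t"] dw[of "Suc n"] L4_diff(1)[OF LF, of "u (Suc n)"] u by simp
    also have "\<dots> \<le> 8 * (16 * \<eta> * (1/4) ^ n) + 8 * (1/4 * (16 * \<eta> * (1/4) ^ n))"
    proof (intro add_mono mult_left_mono order_trans[OF a])
      have "(1/4::real) ^ Suc n \<le> (1/4) ^ n" by simp
      then show "A4 (\<lambda>t. w t - u (Suc n) t) \<le> 16 * \<eta> * (1/4) ^ n"
        using dw[of "Suc n"] \<eta> mult_left_mono[of "(1/4::real) ^ Suc n" "(1/4) ^ n" "16 * \<eta>"] by linarith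
    qed (use dw[of n] in auto)
    also have "\<dots> \<le> 256 * \<eta> * (1/4) ^ n" using \<eta> by (simp add: mult_right_mono)
    finally show ?thesis .
  qed
  have "(\<lambda>n. 256 * \<eta> * (1/4) ^ n) \<longlonglongrightarrow> 256 * \<eta> * 0" by (intro tendsto_intros LIMSEQ_realpow_zero) auto
  then have "A4 (\<lambda>t. w t - \<Phi> w t) \<le> 256 * \<eta> * 0" by (rule LIMSEQ_le_const) (use fin in auto)
  then have "A4 (\<lambda>t. w t - \<Phi> w t) = 0" using A4_nonneg[of "\<lambda>t. w t - \<Phi> w t"] by simp
  from A4_0_AE[OF L4_diff(1)[OF Lw(1) LF] this]
  have "AE t in lborel. w t = \<Phi> w t" by eventually_elim simp
  then show ?thesis using that[OF Lw(1)] unfolding \<Phi>_def by blast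
qed

text \<open>Absolute continuity of the integral. The strength of the nonlinearity on a set is measured by
  this quantity, so it replaces smallness of the length of an interval.\<close>

lemma L4_shrinking:
  assumes g: "L4 g" and S: "\<And>n. S n \<in> sets borel" and sh: "AE s in lborel. \<forall>\<^sub>F n in sequentially. s \<notin> S n"
  shows "(\<lambda>n. A4 (restr (S n) g)) \<longlonglongrightarrow> 0"
proof -
  have [measurable]: "g \<in> borel_measurable borel" "S n \<in> sets borel" for n using g S by (auto intro: L4_measurable)
  have "(\<lambda>n. LINT t|lborel. cmod (restr (S n) g t) ^ 4) \<longlonglongrightarrow> (LINT t|(lborel :: real measure). 0)"
  proof (rule integral_dominated_convergence[where w="\<lambda>t. cmod (g t) ^ 4"])
    show "integrable lborel (\<lambda>t. cmod (g t) ^ 4)" using g by (simp add: L4_def)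
    show "AE t in lborel. (\<lambda>n. cmod (restr (S n) g t) ^ 4) \<longlonglongrightarrow> 0"
      using sh
    proof eventually_elim
      case (elim t)
      have "\<forall>\<^sub>F n in sequentially. cmod (restr (S n) g t) ^ 4 = 0"
        using elim by eventually_elim (simp add: restr_def)
      then show ?case by (rule tendsto_eventually)
    qed
    show "AE t in lborel. norm (cmod (restr (S n) g t) ^ 4) \<le> cmod (g t) ^ 4" for n
      by (auto simp: cmod_restr indicator_def)
  qed measurable
  then show ?thesis unfolding A4_def by simp
qed

lemma L4_interval_tendsto_0:
  assumes g: "L4 g" shows "(\<lambda>n. A4 (restr {\<tau>..<\<tau> + 1 / real (Suc n)} g)) \<longlonglongrightarrow> 0"
proof (rule L4_shrinking[OF g], simp, use AE_lborel_singleton[of \<tau>] in eventually_elim)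
  case (elim t)
  show ?case
  proof (cases "t < \<tau>")
    case False
    then have "t - \<tau> > 0" using elim by simp
    then have "\<forall>\<^sub>F n in sequentially. 1 / real (Suc n) < t - \<tau>"
      using order_tendstoD(2)[OF LIMSEQ_inverse_real_of_nat, of "t - \<tau>"] by (simp add: inverse_eq_divide)
    then show ?thesis by eventually_elim auto
  qed auto
qed

text \<open>Freeze the solution up to \<open>\<tau>\<close> and absorb its contribution into the datum. On a
  short interval after \<open>\<tau>\<close> the new datum is small in $L^4$.\<close>

lemma volterra_extend:
  assumes z: "volterra \<tau> f z" and f: "L4 f" and \<tau>: "\<tau> \<ge> 0"
  obtains h z' where "h > 0" "volterra (\<tau> + h) f z'"
proof -
  have [measurable]: "z \<in> borel_measurable borel" "f \<in> borel_measurable borel"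
    using z f by (auto simp: volterra_def intro: L4_measurable)
  define Z where "Z = restr {0..<\<tau>} z"
  have LZ: "L4 Z" using z by (simp add: volterra_def Z_def)
  define g where "g t = f t - \<i> * volt (\<lambda>s. cubic (Z s)) t" for t
  have g: "L4 g" unfolding g_def by (intro L4_diff(1) f L4_scale_i(1) L4_volt(1) L43_cubic LZ)
  \<comment> \<open>Small enough for the constants $14^4 \cdot 2^{22}$ of the contraction.\<close>
  define \<eta> :: real where "\<eta> = 1 / 2 ^ 25"
  have \<eta>: "\<eta> > 0" "2 ^ 50 * \<eta>\<^sup>2 \<le> 1" by (simp_all add: \<eta>_def power_divide)
  obtain n where n: "A4 (restr {\<tau>..<\<tau> + 1 / real (Suc n)} g) < \<eta>"
    using order_tendstoD(2)[OF L4_interval_tendsto_0[OF g, of \<tau>] \<eta>(1)] by (auto simp: eventually_sequentially)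
  define h where "h = 1 / real (Suc n)"
  have h: "h > 0" by (simp add: h_def)
  let ?S = "{\<tau>..<\<tau> + h}"
  have gS: "L4 (restr ?S g)" by (intro L4_restr(1) g) simp
  obtain w where w: "L4 w" "AE t in lborel. w t = restr ?S (\<lambda>t. restr ?S g t - \<i> * volt (\<lambda>s. cubic (w s)) t) t"
    by (rule small_data_fixpoint[OF gS _ _ \<eta>, of ?S]) (use n in \<open>auto simp: h_def\<close>)
  have [measurable]: "w \<in> borel_measurable borel" using w(1) by (rule L4_measurable)
  define y where "y t = (if t < \<tau> then z t else restr ?S w t)" for t
  have [measurable]: "y \<in> borel_measurable borel" unfolding y_def by measurable
  have LW: "L4 (restr ?S w)" by (intro L4_restr(1) w) simp
  have w0: "AE t in lborel. w t = restr ?S w t"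
    using w(2)
  proof eventually_elim
    case (elim t)
    show ?case
    proof (cases "t \<in> ?S")
      case False
      then have "w t = 0" by (subst elim) (simp add: restr_def)
      then show ?thesis by (simp add: restr_def)
    qed (simp add: restr_def)
  qed
  have Y: "restr {0..<\<tau> + h} y = (\<lambda>t. Z t - (- restr ?S w t))"
    using h \<tau> by (auto simp: y_def Z_def restr_def fun_eq_iff indicator_def)
  have "L4 (\<lambda>t. - restr ?S w t)" using LW by (simp add: L4_def)
  then have LY: "L4 (restr {0..<\<tau> + h} y)" unfolding Y by (intro L4_diff(1) LZ)
  have nlY: "restr {0..<\<tau> + h} (\<lambda>s. cubic (y s)) = (\<lambda>s. cubic (Z s) + cubic (restr ?S w s))"
    using h \<tau> by (auto simp: y_def Z_def restr_def fun_eq_iff indicator_def)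
  have VW: "volt (\<lambda>s. cubic (restr ?S w s)) t = volt (\<lambda>s. cubic (w s)) t" for t
    by (rule volt_cong_AE) (use w0 in auto)
  have VW0: "volt (\<lambda>s. cubic (restr ?S w s)) t = 0" if "t \<le> \<tau>" for t
  proof -
    have "volt (\<lambda>s. cubic (restr ?S w s)) t = volt (\<lambda>_. 0) t" by (rule volt_cong) (use that in \<open>auto simp: restr_def\<close>)
    then show ?thesis by simp
  qed
  have nz: "restr {0..<\<tau>} (\<lambda>s. cubic (z s)) = (\<lambda>s. cubic (Z s))" by (simp add: restr_cubic Z_def)
  have eq: "AE t in lborel. t \<in> {0..<\<tau> + h} \<longrightarrow> y t + \<i> * volt (restr {0..<\<tau> + h} (\<lambda>s. cubic (y s))) t = f t"
    using AE_riesz_finite[OF L43_cubic[OF LZ]] AE_riesz_finite[OF L43_cubic[OF LW]] z[unfolded volterra_def nz, THEN conjunct2, THEN conjunct2] w(2)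
  proof eventually_elim
    case (elim t)
    have VY: "volt (restr {0..<\<tau> + h} (\<lambda>s. cubic (y s))) t = volt (\<lambda>s. cubic (Z s)) t + volt (\<lambda>s. cubic (restr ?S w s)) t"
      unfolding nlY by (rule volt_add) (use elim LZ LW in \<open>auto intro!: L43_measurable L43_cubic\<close>)
    show ?case
    proof
      assume t: "t \<in> {0..<\<tau> + h}"
      show "y t + \<i> * volt (restr {0..<\<tau> + h} (\<lambda>s. cubic (y s))) t = f t"
      proof (cases "t < \<tau>")
        case True
        then show ?thesis unfolding VY using t elim VW0[of t] by (simp add: y_def)
      next
        case False
        then have tS: "t \<in> ?S" using t by simp
        then have wt: "w t = g t - \<i> * volt (\<lambda>s. cubic (w s)) t" using elim(4) by (simp add: restr_def)
        have "y t = w t" using False tS by (simp add: y_def restr_def)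
        then show ?thesis unfolding VY VW using wt by (simp add: g_def distrib_left)
      qed
    qed
  qed
  have "volterra (\<tau> + h) f y" unfolding volterra_def using LY eq by auto
  then show ?thesis using that h by blast
qed

subsection \<open>Global existence\<close>

text \<open>Solutions on an increasing sequence of intervals agree by uniqueness, and the a priori bound,
  being independent of the interval, survives in the union.\<close>

lemma volterra_glue:
  assumes T: "\<And>n. volterra (T n) f (z n)" and inc: "incseq T" and f: "L4 f" and lim: "\<And>t. t < T' \<Longrightarrow> \<exists>n. t < T n"
  obtains y where "y \<in> borel_measurable borel" "volterra T' f y" "\<And>n. volterra (T n) f y"
proof -
  have [measurable]: "z n \<in> borel_measurable borel" for n using T by (auto simp: volterra_def)
  have fm: "f \<in> borel_measurable borel" using f by (rule L4_measurable)
  \<comment> \<open>The first interval that contains $t$ supplies the value at $t$.\<close>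
  define k where "k t = (LEAST n. t < T n)" for t
  have [measurable]: "k \<in> measurable borel (count_space UNIV)" unfolding k_def by measurable
  define y where "y t = z (k t) t" for t
  have ym [measurable]: "y \<in> borel_measurable borel"
    unfolding y_def by (rule measurable_compose_countable[where g=k]) measurable
  have agree: "AE t in lborel. \<forall>m n. t \<in> {0..<T m} \<longrightarrow> t \<in> {0..<T n} \<longrightarrow> z m t = z n t"
  proof -
    have "AE t in lborel. t \<in> {0..<T m} \<longrightarrow> t \<in> {0..<T n} \<longrightarrow> z m t = z n t" for m n
    proof -
      have "AE t in lborel. t \<in> {0..<min (T m) (T n)} \<longrightarrow> z m t = z n t"
        by (rule volterra_unique[OF volterra_mono[OF T[of m]] volterra_mono[OF T[of n]] fm]) auto
      then show ?thesis by eventually_elim auto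
    qed
    then show ?thesis by (intro AE_all_countable[THEN iffD2] allI)
  qed
  have yz: "AE t in lborel. \<forall>n. t \<in> {0..<T n} \<longrightarrow> y t = z n t"
    using agree
  proof eventually_elim
    case (elim t)
    show ?case
    proof (intro allI impI)
      fix n assume t: "t \<in> {0..<T n}"
      then have "t < T n" by simp
      then have lt: "t < T (k t)" unfolding k_def by (rule LeastI)
      show "y t = z n t" unfolding y_def by (rule elim[rule_format]) (use t lt in simp_all)
    qed
  qed
  have yn: "volterra (T n) f y" for n
  proof -
    have c: "AE t in lborel. restr {0..<T n} y t = restr {0..<T n} (z n) t"
      using yz by eventually_elim (auto simp: restr_def indicator_def)
    have "L4 (restr {0..<T n} y)"
      by (rule A4_cong_AE(2)[of "restr {0..<T n} (z n)"]) (use T[of n] c in \<open>auto simp: volterra_def elim: eventually_mono\<close>)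
    moreover have "volt (restr {0..<T n} (\<lambda>s. cubic (y s))) t = volt (restr {0..<T n} (\<lambda>s. cubic (z n s))) t" for t
      by (rule volt_cong_AE) (use c in \<open>auto simp: restr_cubic elim: eventually_mono\<close>)
    ultimately show ?thesis using T[of n] yz unfolding volterra_def by (auto elim: eventually_elim2)
  qed
  have "volterra T' f y"
  proof -
    have "int4 (restr {0..<T'} y) \<le> (\<integral>\<^sup>+ t. liminf (\<lambda>n. ennreal (cmod (restr {0..<T n} y t) ^ 4)) \<partial>lborel)"
    proof (rule nn_integral_mono)
      fix t
      show "ennreal (cmod (restr {0..<T'} y t) ^ 4) \<le> liminf (\<lambda>n. ennreal (cmod (restr {0..<T n} y t) ^ 4))"
      proof (cases "t \<in> {0..<T'}")
        case True
        then obtain n where n: "t < T n" using lim by auto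
        have "ennreal (cmod (restr {0..<T'} y t) ^ 4) \<le> ennreal (cmod (restr {0..<T m} y t) ^ 4)" if "m \<ge> n" for m
        proof -
          have "T n \<le> T m" using inc that by (simp add: incseq_def)
          then show ?thesis using n True by (auto simp: restr_def)
        qed
        then show ?thesis by (intro Liminf_bounded eventually_sequentiallyI[of n])
      qed (simp add: restr_def)
    qed
    also have "\<dots> \<le> liminf (\<lambda>n. \<integral>\<^sup>+ t. ennreal (cmod (restr {0..<T n} y t) ^ 4) \<partial>lborel)"
      by (intro nn_integral_liminf) measurable
    also have "\<dots> \<le> liminf (\<lambda>n::nat. ennreal (2592 * A4 f))"
    proof (intro Liminf_mono always_eventually allI)
      fix n
      have "L4 (restr {0..<T n} y)" using yn[of n] by (simp add: volterra_def)
      then show "int4 (restr {0..<T n} y) \<le> ennreal (2592 * A4 f)"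
        using volterra_apriori[OF yn[of n] f] by (simp add: ennreal_A4 ennreal_leI)
    qed
    also have "\<dots> = ennreal (2592 * A4 f)" by (rule Liminf_const) simp
    finally have b: "int4 (restr {0..<T'} y) \<le> ennreal (2592 * A4 f)" .
    have L: "L4 (restr {0..<T'} y)" by (rule L4I(1)[OF _ b]) auto
    have "AE t in lborel. \<forall>n. t \<in> {0..<T n} \<longrightarrow> y t + \<i> * volt (restr {0..<T n} (\<lambda>s. cubic (y s))) t = f t"
      unfolding AE_all_countable using yn by (simp add: volterra_def)
    then have "AE t in lborel. t \<in> {0..<T'} \<longrightarrow> y t + \<i> * volt (restr {0..<T'} (\<lambda>s. cubic (y s))) t = f t"
    proof eventually_elim
      case (elim t)
      show ?case
      proof
        assume t: "t \<in> {0..<T'}"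
        then obtain n where n: "t < T n" using lim by auto
        have "volt (restr {0..<T'} (\<lambda>s. cubic (y s))) t = volt (restr {0..<T n} (\<lambda>s. cubic (y s))) t"
          by (rule volt_cong) (use t n in \<open>auto simp: restr_def indicator_def\<close>)
        then show "y t + \<i> * volt (restr {0..<T'} (\<lambda>s. cubic (y s))) t = f t" using elim t n by auto
      qed
    qed
    then show ?thesis using L by (simp add: volterra_def)
  qed
  then show ?thesis using that ym yn by blast
qed

text \<open>Let \<open>s\<close> be the supremum of the existence times. The solution exists up to
  \<open>s\<close> by gluing and then beyond it by extension.\<close>

lemma volterra_global:
  assumes f: "L4 f"
  obtains z where "z \<in> borel_measurable borel" "\<And>T. volterra T f z"
proof -
  define P where "P T \<longleftrightarrow> (\<exists>z. volterra T f z)" for T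
  have P0: "P 0" unfolding P_def by (rule exI[of _ "\<lambda>_. 0"]) (simp add: volterra_def L4_def)
  have all: "P T" if "T \<ge> 0" for T
  proof (rule ccontr)
    assume nP: "\<not> P T"
    define A where "A = {T. T \<ge> 0 \<and> P T}"
    have bd: "t \<le> T" if tA: "t \<in> A" for t
    proof (rule ccontr)
      assume "\<not> t \<le> T"
      then have le: "T \<le> t" by simp
      obtain z where "volterra t f z" using tA by (auto simp: A_def P_def)
      then have "volterra T f z" using le by (rule volterra_mono)
      then show False using nP unfolding P_def by blast
    qed
    have A0: "0 \<in> A" using P0 by (simp add: A_def)
    have bdd: "bdd_above A" using bd by (rule bdd_aboveI)
    define s where "s = Sup A"
    have s0: "s \<ge> 0" unfolding s_def using A0 bdd by (rule cSup_upper)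
    have Pt: "P t" if ts: "t < s" for t
    proof -
      have "A \<noteq> {}" using A0 by blast
      then obtain t' where "t' \<in> A" "t < t'" using ts less_cSup_iff[of A t] bdd unfolding s_def by auto
      then obtain z where "volterra t' f z" by (auto simp: A_def P_def)
      then have "volterra t f z" by (rule volterra_mono) (use \<open>t < t'\<close> in simp)
      then show ?thesis unfolding P_def by blast
    qed
    define Tn where "Tn n = s - 1 / real (Suc n)" for n
    have "\<exists>z. volterra (Tn n) f z" for n using Pt[of "Tn n"] by (simp add: P_def Tn_def)
    then obtain zn where zn: "\<And>n. volterra (Tn n) f (zn n)" by metis
    have inc: "incseq Tn" unfolding Tn_def by (intro incseq_SucI) (simp add: frac_le)
    have lim: "\<exists>n. t < Tn n" if ts: "t < s" for t
    proof -
      have "s - t > 0" using ts by simp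
      then obtain n where "inverse (real (Suc n)) < s - t" using reals_Archimedean by blast
      then show ?thesis by (auto simp: Tn_def inverse_eq_divide intro!: exI[of _ n])
    qed
    obtain y where "volterra s f y" using volterra_glue[OF zn inc f lim] by blast
    then obtain h z' where "h > 0" "volterra (s + h) f z'" using volterra_extend[OF _ f s0] by blast
    then have "s + h \<in> A" using s0 by (auto simp: A_def P_def)
    then have "s + h \<le> s" unfolding s_def using bdd by (rule cSup_upper)
    then show False using \<open>h > 0\<close> by simp
  qed
  have "\<exists>z. volterra (real n) f z" for n using all[of "real n"] by (simp add: P_def)
  then obtain zn where zn: "\<And>n. volterra (real n) f (zn n)" by metis
  have inc: "incseq (\<lambda>n. real n)" by (intro incseq_SucI) simp
  have lim: "\<exists>n. t < real n" for t using reals_Archimedean2 by blast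
  obtain y where y: "y \<in> borel_measurable borel" "\<And>n. volterra (real n) f y"
    using volterra_glue[OF zn inc f, of 0] lim by blast
  have "volterra T f y" for T
  proof -
    obtain n where "T < real n" using lim by blast
    then show ?thesis using volterra_mono[OF y(2)[of n], of T] by simp
  qed
  then show ?thesis using that y(1) by blast
qed

section \<open>The Duhamel path and its trace\<close>

text \<open>The times between $0$ and $t$; half-open so that consecutive spans are disjoint.\<close>

definition time_span :: "real \<Rightarrow> real set" where "time_span t = (if t \<ge> 0 then {0..<t} else {t..<0})"

definition time_sign :: "real \<Rightarrow> complex" where "time_sign t = (if t \<ge> 0 then 1 else -1)"

text \<open>$\int_0^t e^{-is\partial_x^2}[c(s)\,\delta]\,ds$, with the orientation of the integral carried
  by the sign.\<close>

definition duhamel :: "(real \<Rightarrow> complex) \<Rightarrow> real \<Rightarrow> l2" where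
  "duhamel c t = l2_scaleC (time_sign t) (source (restr (time_span t) c))"

lemma time_span_borel [measurable]: "time_span t \<in> sets borel" by (simp add: time_span_def)

lemma cmod_time_sign [simp]: "cmod (time_sign t) = 1" by (simp add: time_sign_def)

definition loc_admissible :: "(real \<Rightarrow> complex) \<Rightarrow> bool" where
  "loc_admissible c \<longleftrightarrow> c \<in> borel_measurable borel \<and> (\<forall>a b. admissible (restr {a..<b} c))"

lemma loc_admissible_measurable: "loc_admissible c \<Longrightarrow> c \<in> borel_measurable borel" by (simp add: loc_admissible_def)

lemma loc_admissible_time_span: "loc_admissible c \<Longrightarrow> admissible (restr (time_span t) c)" by (simp add: loc_admissible_def time_span_def)

lemma loc_admissible_L43:
  assumes c: "L43 c" shows "loc_admissible c"
  unfolding loc_admissible_def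
proof (intro conjI allI L43_measurable c)
  fix a b :: real
  show "admissible (restr {a..<b} c)"
    by (rule admissible_bounded_interval[of _ a b]) (use L43_restr[OF c, of "{a..<b}"] in \<open>auto simp: L43_def restr_def\<close>)
qed

lemma l2_scaleC_1 [simp]: "l2_scaleC 1 f = f"
  by (rule l2_eqI) (use rep_l2_scaleC[of 1 f] in simp)

lemma l2_scaleC_minus1: "l2_scaleC (-1) f = - f" by (simp add: uminus_l2_def)

lemma l2_scaleC_scaleC: "l2_scaleC a (l2_scaleC b f) = l2_scaleC (a * b) f"
  by (rule l2_eqI) (use rep_l2_scaleC[of a "l2_scaleC b f"] rep_l2_scaleC[of b f] rep_l2_scaleC[of "a * b" f] in \<open>eventually_elim, simp add: mult.assoc\<close>)

lemma duhamel_0 [simp]: "duhamel c 0 = 0"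
proof -
  have "restr (time_span 0) c = (\<lambda>_. 0)" by (simp add: restr_def time_span_def fun_eq_iff)
  then show ?thesis by (simp add: duhamel_def time_sign_def)
qed

lemma duhamel_increment:
  assumes c: "loc_admissible c" and st: "s \<le> t" shows "duhamel c t - duhamel c s = source (restr {s..<t} c)"
proof -
  have a: "admissible (restr {a..<b} c)" for a b using c by (simp add: loc_admissible_def)
  have split: "source (restr {x..<z} c) = source (restr {x..<y} c) + source (restr {y..<z} c)" if "x \<le> y" "y \<le> z" for x y z
  proof -
    have u: "{x..<z} = {x..<y} \<union> {y..<z}" using that by auto
    show ?thesis using source_split[of "{x..<y}" c "{y..<z}", OF a a] a[of x z] unfolding u by (simp add: algebra_simps)
  qed
  consider "0 \<le> s" | "s < 0" "0 \<le> t" | "t < 0" by linarith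
  then show ?thesis
  proof cases
    case 1
    then show ?thesis using split[of 0 s t] st by (simp add: duhamel_def time_sign_def time_span_def)
  next
    case 2
    then show ?thesis using split[of s 0 t] by (simp add: duhamel_def time_sign_def time_span_def l2_scaleC_minus1)
  next
    case 3
    then show ?thesis using split[of s t 0] st by (simp add: duhamel_def time_sign_def time_span_def l2_scaleC_minus1)
  qed
qed

lemma restr_diff: "restr S (\<lambda>s. c s - d s) = (\<lambda>s. restr S c s - restr S d s)"
  by (simp add: restr_def fun_eq_iff right_diff_distrib)

lemma duhamel_diff:
  assumes "loc_admissible c" "loc_admissible d" shows "duhamel (\<lambda>s. c s - d s) t = duhamel c t - duhamel d t"
  unfolding duhamel_def restr_diff by (simp add: source_diff loc_admissible_time_span assms l2_scaleC_diff)

lemma riesz_mono: "(\<And>s. cmod (g s) \<le> cmod (h s)) \<Longrightarrow> riesz g t \<le> riesz h t"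
  unfolding riesz_def by (intro nn_integral_mono ennreal_leI divide_right_mono) auto

lemma admissible_L43: "admissible c \<Longrightarrow> L43 c" by (auto simp: admissible_def L43_def)

lemma riesz_shrinking:
  assumes c: "c \<in> borel_measurable borel" "riesz c t < \<infinity>" and S: "\<And>n. S n \<in> sets borel"
    and shrink: "\<And>s. s \<noteq> t \<Longrightarrow> \<forall>\<^sub>F n in sequentially. s \<notin> S n"
  shows "(\<lambda>n. riesz (restr (S n) c) t) \<longlonglongrightarrow> 0"
proof -
  have [measurable]: "c \<in> borel_measurable borel" "S n \<in> sets borel" for n using c S by auto
  have "(\<lambda>n. \<integral>\<^sup>+ s. ennreal (cmod (restr (S n) c s) / sqrt \<bar>t - s\<bar>) \<partial>lborel) \<longlonglongrightarrow> (\<integral>\<^sup>+ s. 0 \<partial>(lborel :: real measure))"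
  proof (rule nn_integral_dominated_convergence[where w="\<lambda>s. ennreal (cmod (c s) / sqrt \<bar>t - s\<bar>)"])
    show "(\<integral>\<^sup>+ s. ennreal (cmod (c s) / sqrt \<bar>t - s\<bar>) \<partial>lborel) < \<infinity>" using c(2) by (simp add: riesz_def)
    show "AE s in lborel. (\<lambda>n. ennreal (cmod (restr (S n) c s) / sqrt \<bar>t - s\<bar>)) \<longlonglongrightarrow> 0"
      using AE_lborel_singleton[of t]
    proof eventually_elim
      case (elim s)
      then have "\<forall>\<^sub>F n in sequentially. ennreal (cmod (restr (S n) c s) / sqrt \<bar>t - s\<bar>) = 0"
        by (intro eventually_mono[OF shrink]) (auto simp: restr_def indicator_def)
      then show ?case by (rule tendsto_eventually)
    qed
    show "AE s in lborel. ennreal (cmod (restr (S n) c s) / sqrt \<bar>t - s\<bar>) \<le> ennreal (cmod (c s) / sqrt \<bar>t - s\<bar>)" for n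
      by (intro AE_I2 ennreal_leI divide_right_mono) (auto simp: cmod_restr indicator_def)
  qed measurable
  then show ?thesis by (simp add: riesz_def)
qed

lemma AE_riesz_time_span:
  assumes c: "loc_admissible c" shows "AE t in lborel. riesz (restr (time_span t) c) t < \<infinity>"
proof -
  have "AE t in lborel. \<forall>n. riesz (restr {- real n..<real n} c) t < \<infinity>"
    unfolding AE_all_countable using c by (intro allI AE_riesz_finite admissible_L43) (simp add: loc_admissible_def)
  then show ?thesis
  proof eventually_elim
    case (elim t)
    obtain n where n: "\<bar>t\<bar> < real n" using reals_Archimedean2 by blast
    have "riesz (restr (time_span t) c) t \<le> riesz (restr {- real n..<real n} c) t"
      by (rule riesz_mono) (use n in \<open>auto simp: cmod_restr indicator_def time_span_def split: if_splits\<close>)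
    then show ?case using elim by (auto intro: le_less_trans)
  qed
qed

text \<open>For the source switched off at a rational time the free evolution result applies, and there are
  countably many such times. At almost every $t$ the Riesz potential is finite, and then the
  contribution of the times near $t$ is small.\<close>

lemma AE_regular_duhamel:
  assumes c: "loc_admissible c" shows "AE t in lborel. regular (schroedinger t (source (restr (time_span t) c)))"
proof -
  have a: "admissible (restr {a..<b} c)" for a b using c by (simp add: loc_admissible_def)
  have [measurable]: "c \<in> borel_measurable borel" using c by (rule loc_admissible_measurable)
  have "AE t in lborel. \<forall>q. regular (schroedinger t (source (restr {0..<rat_seq q} c))) \<and> regular (schroedinger t (source (restr {rat_seq q..<0} c)))"
    unfolding AE_all_countable using AE_regular_schroedinger by (intro allI AE_conjI)
  then show ?thesis using AE_riesz_time_span[OF c] AE_lborel_singleton[of 0]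
  proof eventually_elim
    case (elim t)
    have rat: "\<exists>q. a < rat_seq q \<and> rat_seq q < b" if "a < b" for a b
    proof -
      have "range rat_seq = \<rat>" unfolding rat_seq_def by (rule range_from_nat_into) (auto simp: countable_rat)
      then show ?thesis using Rats_dense_in_real[OF that] by (metis imageE)
    qed
    let ?h = "restr (time_span t) c"
    have "\<exists>q. \<forall>n. (if t > 0 then max 0 (t - 1 / real (Suc n)) < rat_seq (q n) \<and> rat_seq (q n) < t
        else t < rat_seq (q n) \<and> rat_seq (q n) < min 0 (t + 1 / real (Suc n)))"
    proof (rule choice, rule allI)
      fix n
      show "\<exists>q. if t > 0 then max 0 (t - 1 / real (Suc n)) < rat_seq q \<and> rat_seq q < t
        else t < rat_seq q \<and> rat_seq q < min 0 (t + 1 / real (Suc n))"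
        using rat[of "max 0 (t - 1 / real (Suc n))" t] rat[of t "min 0 (t + 1 / real (Suc n))"] elim
        by (cases "t > 0") auto
    qed
    then obtain q where q: "\<And>n. (if t > 0 then max 0 (t - 1 / real (Suc n)) < rat_seq (q n) \<and> rat_seq (q n) < t
        else t < rat_seq (q n) \<and> rat_seq (q n) < min 0 (t + 1 / real (Suc n)))" by blast
    \<comment> \<open>The remainder between a rational time close to $t$ and $t$.\<close>
    define S where "S n = (if t > 0 then {rat_seq (q n)..<t} else {t..<rat_seq (q n)})" for n
    have Sb: "S n \<in> sets borel" for n by (simp add: S_def)
    have Ssub: "S n \<subseteq> time_span t" for n using q[of n] by (auto simp: S_def time_span_def)
    have small: "\<forall>\<^sub>F n in sequentially. s \<notin> S n" if "s \<noteq> t" for s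
    proof -
      have "\<bar>s - t\<bar> > 0" using that by simp
      then have "\<forall>\<^sub>F n in sequentially. 1 / real (Suc n) < \<bar>s - t\<bar>"
        using order_tendstoD(2)[OF LIMSEQ_inverse_real_of_nat, of "\<bar>s - t\<bar>"] by (simp add: inverse_eq_divide)
      then show ?thesis
      proof eventually_elim
        case (elim n)
        then show ?case using q[of n] by (auto simp: S_def split: if_splits)
      qed
    qed
    show ?case
    proof (rule regular_source_limit[where g="\<lambda>n. restr (S n) c"])
      show "admissible ?h" by (rule loc_admissible_time_span[OF c])
      show "admissible (restr (S n) c)" for n using a by (simp add: S_def)
      have "restr (S n) ?h = restr (S n) c" for n unfolding restr_restr using Ssub[of n] by (simp add: Int_absorb2)
      then show "(\<lambda>n. riesz (restr (S n) c) t) \<longlonglongrightarrow> 0"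
        using riesz_shrinking[of ?h t S, OF _ _ Sb small] elim by simp
      fix n
      have "(\<lambda>s. ?h s - restr (S n) c s) = (if t > 0 then restr {0..<rat_seq (q n)} c else restr {rat_seq (q n)..<0} c)"
        using q[of n] by (auto simp: S_def time_span_def restr_def fun_eq_iff indicator_def)
      then show "regular (schroedinger t (source (\<lambda>s. ?h s - restr (S n) c s)))" using elim by simp
    qed
  qed
qed

text \<open>The value at the origin of the evolved Duhamel integral, for either sign of time.\<close>

definition duhamel_trace :: "(real \<Rightarrow> complex) \<Rightarrow> real \<Rightarrow> complex" where
  "duhamel_trace c t = time_sign t * (LINT s|lborel. restr (time_span t) c s * kern (t - s))"

lemma duhamel_conv:
  "schroedinger t (\<psi>\<^sub>0 - l2_scaleC \<i> (duhamel c t)) = schroedinger t \<psi>\<^sub>0 - l2_scaleC (\<i> * time_sign t) (schroedinger t (source (restr (time_span t) c)))"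
  by (simp add: schroedinger_diff schroedinger_scaleC duhamel_def l2_scaleC_scaleC)

lemma ennreal_norm_diff_le:
  fixes u v :: "'a::real_normed_vector"
  assumes "ennreal (norm u) \<le> a" "ennreal (norm v) \<le> b" shows "ennreal (norm (u - v)) \<le> a + b"
proof -
  have "ennreal (norm (u - v)) \<le> ennreal (norm u + norm v)" by (intro ennreal_leI norm_triangle_ineq4)
  also have "\<dots> = ennreal (norm u) + ennreal (norm v)" by simp
  also have "\<dots> \<le> a + b" using assms by (rule add_mono)
  finally show ?thesis .
qed

text \<open>Everything that is needed at a fixed time about $e^{it\partial_x^2}(\psi_0 - iF(t))$: it is
  continuous, its value at the origin is given by the kernel, and its supremum is dominated by
  functions in $L^4$.\<close>

lemma duhamel_regular:
  assumes c: "loc_admissible c"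
  shows "AE t in lborel. regular (schroedinger t (\<psi>\<^sub>0 - l2_scaleC \<i> (duhamel c t)))
     \<and> apply_bcontfun (reg_limit (schroedinger t (\<psi>\<^sub>0 - l2_scaleC \<i> (duhamel c t)))) 0 = origin_trace \<psi>\<^sub>0 t - \<i> * duhamel_trace c t
     \<and> ennreal (norm (reg_limit (schroedinger t (\<psi>\<^sub>0 - l2_scaleC \<i> (duhamel c t))))) \<le> reg_max (schroedinger t \<psi>\<^sub>0) + riesz (restr (time_span t) c) t"
  using AE_regular_duhamel[OF c] AE_riesz_time_span[OF c] AE_regular_schroedinger[of \<psi>\<^sub>0]
proof eventually_elim
  case (elim t)
  let ?u = "schroedinger t \<psi>\<^sub>0"
  let ?v = "schroedinger t (source (restr (time_span t) c))"
  let ?k = "\<i> * time_sign t"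
  have a: "admissible (restr (time_span t) c)" by (rule loc_admissible_time_span[OF c])
  have nk: "regular (l2_scaleC ?k ?v)" by (rule regular_scaleC[OF elim(1)])
  have n: "regular (?u - l2_scaleC ?k ?v)" and C: "reg_limit (?u - l2_scaleC ?k ?v) = reg_limit ?u - reg_limit (l2_scaleC ?k ?v)"
    by (rule regular_diff[OF elim(3) nk])+
  have "apply_bcontfun (reg_limit ?v) 0 = (LINT s|lborel. restr (time_span t) c s * kern (t - s))"
    by (rule LIMSEQ_unique[OF reg_limit_apply_LIMSEQ[OF elim(1)] reg_source_tendsto[OF a elim(2)]])
  then have v: "apply_bcontfun (reg_limit (?u - l2_scaleC ?k ?v)) 0 = origin_trace \<psi>\<^sub>0 t - \<i> * duhamel_trace c t"
    unfolding C by (simp add: regular_trace[OF elim(3)] reg_limit_scaleC[OF elim(1)] duhamel_trace_def mult.assoc)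
  have nC: "norm (reg_limit (l2_scaleC ?k ?v)) \<le> norm (reg_limit ?v)"
  proof (rule norm_bcontfun_le)
    fix x
    show "norm (apply_bcontfun (reg_limit (l2_scaleC ?k ?v)) x) \<le> norm (reg_limit ?v)"
      unfolding reg_limit_scaleC[OF elim(1)] using norm_apply_bcontfun_le[of "reg_limit ?v" x] by (simp add: norm_mult)
  qed
  have "ennreal (norm (reg_limit (l2_scaleC ?k ?v))) \<le> ennreal (norm (reg_limit ?v))" using nC by (rule ennreal_leI)
  also have "\<dots> \<le> reg_max ?v" by (rule norm_reg_limit_le_reg_max[OF elim(1)])
  also have "\<dots> \<le> riesz (restr (time_span t) c) t" by (rule reg_max_source_le[OF a])
  finally have "ennreal (norm (reg_limit ?u - reg_limit (l2_scaleC ?k ?v))) \<le> reg_max ?u + riesz (restr (time_span t) c) t"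
    by (intro ennreal_norm_diff_le norm_reg_limit_le_reg_max elim)
  then show ?case unfolding duhamel_conv using n v by (simp add: C)
qed

lemma cnj_kern: "\<tau> > 0 \<Longrightarrow> cnj (kern (- \<tau>)) = kern \<tau>"
proof -
  assume \<tau>: "\<tau> > 0"
  have 1: "csqrt (\<i> * of_real (- \<tau>)) = of_real (sqrt (\<tau> / 2)) * (1 - \<i>)"
    using \<tau> by (intro complex_eqI) (auto simp: norm_mult)
  show ?thesis unfolding kern_def 1 csqrt_i[OF \<tau>] by simp
qed

text \<open>Time reversal of the Schroedinger equation.\<close>

definition rev_cnj :: "(real \<Rightarrow> complex) \<Rightarrow> real \<Rightarrow> complex" where "rev_cnj z t = cnj (z (- t))"

lemma measurable_reflect: "z \<in> borel_measurable borel \<Longrightarrow> (\<lambda>t::real. z (- t)) \<in> borel_measurable borel"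
  by (rule measurable_compose[of uminus borel borel z borel]) auto

lemma rev_cnj_measurable: "z \<in> borel_measurable borel \<Longrightarrow> rev_cnj z \<in> borel_measurable borel"
  unfolding rev_cnj_def by (rule measurable_compose[OF measurable_reflect borel_measurable_cnj])

lemma cubic_cnj: "cubic (cnj z) = cnj (cubic z)" by (simp add: cubic_def)

lemma duhamel_trace_forward: "0 \<le> t \<Longrightarrow> t \<le> T \<Longrightarrow> duhamel_trace c t = volt (restr {0..<T} c) t"
  unfolding duhamel_trace_def volt_def time_sign_def time_span_def
  by (auto intro!: Bochner_Integration.integral_cong simp: restr_def indicator_def)

text \<open>The kernel satisfies $\overline{\kappa(-\tau)} = \kappa(\tau)$, so conjugation turns the
  backward integral into the forward operator. The sign comes from the orientation of the
  integral.\<close>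

lemma duhamel_trace_backward:
  assumes t: "0 < t" "t \<le> T" and [measurable]: "c \<in> borel_measurable borel"
  shows "cnj (duhamel_trace c (- t)) = - volt (restr {0..<T} (rev_cnj c)) t"
proof -
  have [measurable]: "rev_cnj c \<in> borel_measurable borel" by (rule rev_cnj_measurable) simp
  have m [measurable]: "(\<lambda>r. c (- r)) \<in> borel_measurable borel" by (rule measurable_reflect) simp
  have "cnj (duhamel_trace c (- t)) = - (LINT s|lborel. cnj (restr {- t..<0} c s * kern (- t - s)))"
    unfolding Bochner_Integration.integral_cnj using t by (simp add: duhamel_trace_def time_sign_def time_span_def)
  also have "(LINT s|lborel. cnj (restr {- t..<0} c s * kern (- t - s))) = (LINT r|lborel. cnj (restr {- t..<0} c (- r) * kern (- t + r)))"
    using LINT_reflect[of "\<lambda>s. cnj (restr {- t..<0} c s * kern (- t - s))"] by simp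
  also have "\<dots> = (LINT r|lborel. (if r < t then restr {0..<T} (rev_cnj c) r * kern (t - r) else 0))"
  proof (rule integral_cong_AE)
    show "(\<lambda>r. cnj (restr {- t..<0} c (- r) * kern (- t + r))) \<in> borel_measurable lborel"
      unfolding restr_def by measurable
    show "AE r in lborel. cnj (restr {- t..<0} c (- r) * kern (- t + r)) = (if r < t then restr {0..<T} (rev_cnj c) r * kern (t - r) else 0)"
      using AE_lborel_singleton[of 0] AE_lborel_singleton[of t]
    proof eventually_elim
      case (elim r)
      show ?case
      proof (cases "0 < r \<and> r < t")
        case True
        have "- (t - r) = - t + r" by simp
        then have "cnj (kern (- t + r)) = kern (t - r)" using cnj_kern[of "t - r"] True by simp
        then show ?thesis using True t by (simp add: restr_def rev_cnj_def)
      next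
        case False
        then show ?thesis using elim t by (auto simp: restr_def)
      qed
    qed
  qed measurable
  also have "\<dots> = volt (restr {0..<T} (rev_cnj c)) t" by (simp add: volt_def)
  finally show ?thesis .
qed

lemma A4_rev: "L4 z \<Longrightarrow> L4 (rev_cnj z)" "A4 (rev_cnj z) = A4 z"
proof -
  show "A4 (rev_cnj z) = A4 z" unfolding A4_def rev_cnj_def using LINT_reflect[of "\<lambda>t. cmod (z t) ^ 4"] by simp
  assume z: "L4 z"
  have "integrable lborel (\<lambda>t. cmod (z (0 + (-1) * t)) ^ 4)"
    by (rule lborel_integrable_real_affine) (use z in \<open>simp_all add: L4_def\<close>)
  then show "L4 (rev_cnj z)" using z by (simp add: L4_def rev_cnj_measurable) (simp add: rev_cnj_def)
qed

definition trace_equation :: "l2 \<Rightarrow> (real \<Rightarrow> complex) \<Rightarrow> bool" where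
  "trace_equation \<psi>\<^sub>0 z \<longleftrightarrow> (AE t in lborel. z t = origin_trace \<psi>\<^sub>0 t - \<i> * duhamel_trace (\<lambda>s. cubic (z s)) t)"

text \<open>The same equation as two forward problems, one for each direction of time.\<close>

definition trace_solution :: "l2 \<Rightarrow> (real \<Rightarrow> complex) \<Rightarrow> bool" where
  "trace_solution \<psi>\<^sub>0 z \<longleftrightarrow> (\<forall>T. volterra T (origin_trace \<psi>\<^sub>0) z) \<and> (\<forall>T. volterra T (rev_cnj (origin_trace \<psi>\<^sub>0)) (rev_cnj z))"

lemma cubic_rev_cnj: "(\<lambda>s. cubic (rev_cnj z s)) = rev_cnj (\<lambda>s. cubic (z s))"
  by (simp add: rev_cnj_def cubic_cnj fun_eq_iff)

lemma trace_equation_at: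
  assumes "t > 0" and m: "z \<in> borel_measurable borel" and T: "t \<le> T"
  shows "z t = f t - \<i> * duhamel_trace (\<lambda>s. cubic (z s)) t \<longleftrightarrow> z t + \<i> * volt (restr {0..<T} (\<lambda>s. cubic (z s))) t = f t"
    and "z (- t) = f (- t) - \<i> * duhamel_trace (\<lambda>s. cubic (z s)) (- t) \<longleftrightarrow>
      rev_cnj z t + \<i> * volt (restr {0..<T} (\<lambda>s. cubic (rev_cnj z s))) t = rev_cnj f t"
proof -
  show "z t = f t - \<i> * duhamel_trace (\<lambda>s. cubic (z s)) t \<longleftrightarrow> z t + \<i> * volt (restr {0..<T} (\<lambda>s. cubic (z s))) t = f t"
    using duhamel_trace_forward[of t T "\<lambda>s. cubic (z s)"] assms by (auto simp: algebra_simps)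
  have b: "cnj (duhamel_trace (\<lambda>s. cubic (z s)) (- t)) = - volt (restr {0..<T} (rev_cnj (\<lambda>s. cubic (z s)))) t"
    by (rule duhamel_trace_backward) (use assms in auto)
  have "z (- t) = f (- t) - \<i> * duhamel_trace (\<lambda>s. cubic (z s)) (- t) \<longleftrightarrow> cnj (z (- t)) = cnj (f (- t) - \<i> * duhamel_trace (\<lambda>s. cubic (z s)) (- t))"
    by (simp only: complex_cnj_cancel_iff)
  also have "cnj (f (- t) - \<i> * duhamel_trace (\<lambda>s. cubic (z s)) (- t)) = rev_cnj f t - \<i> * volt (restr {0..<T} (rev_cnj (\<lambda>s. cubic (z s)))) t"
    by (simp add: b rev_cnj_def)
  finally show "z (- t) = f (- t) - \<i> * duhamel_trace (\<lambda>s. cubic (z s)) (- t) \<longleftrightarrow>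
      rev_cnj z t + \<i> * volt (restr {0..<T} (\<lambda>s. cubic (rev_cnj z s))) t = rev_cnj f t"
    unfolding cubic_rev_cnj by (auto simp: rev_cnj_def algebra_simps)
qed

lemma trace_equation_imp_trace_solution:
  assumes z: "z \<in> borel_measurable borel" "\<And>T. L4 (restr {-T..<T} z)" and e: "trace_equation \<psi>\<^sub>0 z"
  shows "trace_solution \<psi>\<^sub>0 z"
proof -
  have [measurable]: "z \<in> borel_measurable borel" by (rule z(1))
  have [measurable]: "rev_cnj z \<in> borel_measurable borel" by (rule rev_cnj_measurable) simp
  have e1: "AE t in lborel. z t = origin_trace \<psi>\<^sub>0 t - \<i> * duhamel_trace (\<lambda>s. cubic (z s)) t" using e by (simp add: trace_equation_def)
  have e2: "AE t in lborel. z (- t) = origin_trace \<psi>\<^sub>0 (- t) - \<i> * duhamel_trace (\<lambda>s. cubic (z s)) (- t)" by (rule AE_lborel_reflect[OF e1])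
  have f: "L4 (restr {0..<T} z)" for T
    by (rule L4_mono(1)[OF z(2)[of T]]) (auto simp: cmod_restr indicator_def)
  have b: "L4 (restr {0..<T} (rev_cnj z))" for T
    by (rule L4_mono(1)[OF A4_rev(1)[OF z(2)[of "T + 1"]]]) (auto simp: cmod_restr indicator_def rev_cnj_def)
  have "volterra T (origin_trace \<psi>\<^sub>0) z" for T
    unfolding volterra_def
  proof (intro conjI f)
    show "AE t in lborel. t \<in> {0..<T} \<longrightarrow> z t + \<i> * volt (restr {0..<T} (\<lambda>s. cubic (z s))) t = origin_trace \<psi>\<^sub>0 t"
      using e1 AE_lborel_singleton[of 0]
    proof eventually_elim
      case (elim t)
      then show ?case using trace_equation_at(1)[of t z T "origin_trace \<psi>\<^sub>0"] z(1) by auto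
    qed
  qed simp
  moreover have "volterra T (rev_cnj (origin_trace \<psi>\<^sub>0)) (rev_cnj z)" for T
    unfolding volterra_def
  proof (intro conjI b)
    show "AE t in lborel. t \<in> {0..<T} \<longrightarrow> rev_cnj z t + \<i> * volt (restr {0..<T} (\<lambda>s. cubic (rev_cnj z s))) t = rev_cnj (origin_trace \<psi>\<^sub>0) t"
      using e2 AE_lborel_singleton[of 0]
    proof eventually_elim
      case (elim t)
      then show ?case using trace_equation_at(2)[of t z T "origin_trace \<psi>\<^sub>0"] z(1) by auto
    qed
  qed simp
  ultimately show ?thesis by (simp add: trace_solution_def)
qed

lemma trace_solution_imp_trace_equation:
  assumes "trace_solution \<psi>\<^sub>0 z" shows "trace_equation \<psi>\<^sub>0 z"
proof -
  have z: "z \<in> borel_measurable borel" using assms by (auto simp: trace_solution_def volterra_def)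
  have "AE t in lborel. \<forall>n. t \<in> {0..<real n} \<longrightarrow> z t + \<i> * volt (restr {0..<real n} (\<lambda>s. cubic (z s))) t = origin_trace \<psi>\<^sub>0 t"
    unfolding AE_all_countable using assms by (auto simp: trace_solution_def volterra_def)
  moreover have "AE t in lborel. \<forall>n. t \<in> {0..<real n} \<longrightarrow> rev_cnj z t + \<i> * volt (restr {0..<real n} (\<lambda>s. cubic (rev_cnj z s))) t = rev_cnj (origin_trace \<psi>\<^sub>0) t"
    unfolding AE_all_countable using assms by (auto simp: trace_solution_def volterra_def)
  note AE_lborel_reflect[OF this]
  ultimately have "AE t in lborel. z t = origin_trace \<psi>\<^sub>0 t - \<i> * duhamel_trace (\<lambda>s. cubic (z s)) t"
    using AE_lborel_singleton[of 0]
  proof eventually_elim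
    case (elim t)
    obtain n where n: "\<bar>t\<bar> < real n" using reals_Archimedean2 by blast
    show ?case
    proof (cases "t > 0")
      case True
      then show ?thesis using elim(1)[rule_format, of n] n trace_equation_at(1)[of t z "real n" "origin_trace \<psi>\<^sub>0"] z by auto
    next
      case False
      then have "- t > 0" using elim by simp
      then show ?thesis using elim(2)[rule_format, of n] n trace_equation_at(2)[of "- t" z "real n" "origin_trace \<psi>\<^sub>0"] z by auto
    qed
  qed
  then show ?thesis by (simp add: trace_equation_def)
qed

lemma AE_trace: "AE t in lborel. ennreal (cmod (origin_trace \<phi> t)) \<le> reg_max (schroedinger t \<phi>)"
  using AE_regular_schroedinger[of \<phi>]
proof eventually_elim
  case (elim t)
  have "cmod (origin_trace \<phi> t) \<le> norm (reg_limit (schroedinger t \<phi>))"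
    using norm_apply_bcontfun_le[of "reg_limit (schroedinger t \<phi>)" 0] by (simp add: regular_trace[OF elim])
  then show ?case using norm_reg_limit_le_reg_max[OF elim] by (meson ennreal_leI order_trans)
qed

lemma L4_trace: "L4 (origin_trace \<phi>)" "A4 (origin_trace \<phi>) \<le> (strichartz_K * norm \<phi>) ^ 4"
proof -
  have "(\<integral>\<^sup>+ t. ennreal (cmod (origin_trace \<phi> t) ^ 4) \<partial>lborel) \<le> (\<integral>\<^sup>+ t. reg_max (schroedinger t \<phi>) ^ 4 \<partial>lborel)"
    by (rule nn_integral_mono_AE, use AE_trace[of \<phi>] in eventually_elim) (simp add: ennreal_power[symmetric] power_mono)
  also have "\<dots> \<le> ennreal ((strichartz_K * norm \<phi>) ^ 4)" by (rule reg_max_strichartz)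
  finally have b: "(\<integral>\<^sup>+ t. ennreal (cmod (origin_trace \<phi> t) ^ 4) \<partial>lborel) \<le> ennreal ((strichartz_K * norm \<phi>) ^ 4)" .
  from L4I[OF _ b] show "L4 (origin_trace \<phi>)" "A4 (origin_trace \<phi>) \<le> (strichartz_K * norm \<phi>) ^ 4" by auto
qed

text \<open>The a priori bound does not depend on the interval, so it passes to the half line.\<close>

lemma volterra_half_line:
  assumes "\<And>T. volterra T f z" and f: "L4 f"
  shows "int4 (restr {0..} z) \<le> ennreal (2592 * A4 f)"
proof -
  have [measurable]: "z \<in> borel_measurable borel" using assms(1) by (auto simp: volterra_def)
  have "int4 (restr {0..} z) \<le> (\<integral>\<^sup>+ t. liminf (\<lambda>n. ennreal (cmod (restr {0..<real n} z t) ^ 4)) \<partial>lborel)"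
  proof (rule nn_integral_mono)
    fix t
    obtain n where n: "t < real n" using reals_Archimedean2 by blast
    have "ennreal (cmod (restr {0..} z t) ^ 4) \<le> ennreal (cmod (restr {0..<real m} z t) ^ 4)" if "m \<ge> n" for m
    proof -
      have "t < real m" using n that by (meson less_le_trans of_nat_mono)
      then show ?thesis by (auto simp: restr_def indicator_def)
    qed
    then show "ennreal (cmod (restr {0..} z t) ^ 4) \<le> liminf (\<lambda>n. ennreal (cmod (restr {0..<real n} z t) ^ 4))"
      by (intro Liminf_bounded eventually_sequentiallyI[of n])
  qed
  also have "\<dots> \<le> liminf (\<lambda>n. \<integral>\<^sup>+ t. ennreal (cmod (restr {0..<real n} z t) ^ 4) \<partial>lborel)"
    by (intro nn_integral_liminf) measurable
  also have "\<dots> \<le> liminf (\<lambda>n::nat. ennreal (2592 * A4 f))"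
  proof (intro Liminf_mono always_eventually allI)
    fix n
    have "L4 (restr {0..<real n} z)" using assms(1) by (simp add: volterra_def)
    then show "int4 (restr {0..<real n} z) \<le> ennreal (2592 * A4 f)"
      using volterra_apriori[OF assms(1) f] by (simp add: ennreal_A4 ennreal_leI)
  qed
  also have "\<dots> = ennreal (2592 * A4 f)" by (rule Liminf_const) simp
  finally show ?thesis .
qed

lemma trace_solution_L4:
  assumes "trace_solution \<psi>\<^sub>0 z"
  shows "L4 z" "A4 z \<le> 5184 * (strichartz_K * norm \<psi>\<^sub>0) ^ 4"
proof -
  have [measurable]: "z \<in> borel_measurable borel" using assms by (auto simp: trace_solution_def volterra_def)
  let ?f = "origin_trace \<psi>\<^sub>0"
  have f: "L4 ?f" "L4 (rev_cnj ?f)" "A4 (rev_cnj ?f) = A4 ?f" using L4_trace A4_rev by auto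
  have 1: "int4 (restr {0..} z) \<le> ennreal (2592 * A4 ?f)"
    by (rule volterra_half_line) (use assms f in \<open>auto simp: trace_solution_def\<close>)
  have "int4 (restr {0..} (rev_cnj z)) \<le> ennreal (2592 * A4 (rev_cnj ?f))"
    by (rule volterra_half_line) (use assms f in \<open>auto simp: trace_solution_def\<close>)
  moreover have "int4 (restr {..0} z) = int4 (restr {0..} (rev_cnj z))"
  proof -
    have "int4 (restr {..0} z) = ennreal \<bar>-1\<bar> * (\<integral>\<^sup>+ t. ennreal (cmod (restr {..0} z (0 + -1 * t)) ^ 4) \<partial>lborel)"
      by (rule nn_integral_real_affine) auto
    also have "\<dots> = int4 (restr {0..} (rev_cnj z))"
      by (simp add: cmod_restr rev_cnj_def indicator_def cong: if_cong)
    finally show ?thesis .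
  qed
  ultimately have 2: "int4 (restr {..0} z) \<le> ennreal (2592 * A4 ?f)" using f by simp
  have "int4 z \<le> (\<integral>\<^sup>+ t. ennreal (cmod (restr {0..} z t) ^ 4) + ennreal (cmod (restr {..0} z t) ^ 4) \<partial>lborel)"
    by (intro nn_integral_mono) (auto simp: restr_def indicator_def)
  also have "\<dots> = int4 (restr {0..} z) + int4 (restr {..0} z)"
    by (rule nn_integral_add) auto
  also have "\<dots> \<le> ennreal (2592 * A4 ?f) + ennreal (2592 * A4 ?f)" by (rule add_mono[OF 1 2])
  also have "\<dots> = ennreal (5184 * A4 ?f)" by (simp flip: ennreal_plus)
  also have "\<dots> \<le> ennreal (5184 * (strichartz_K * norm \<psi>\<^sub>0) ^ 4)"
    by (intro ennreal_leI mult_left_mono L4_trace) auto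
  finally have b: "int4 z \<le> ennreal (5184 * (strichartz_K * norm \<psi>\<^sub>0) ^ 4)" .
  from L4I[OF _ b] show "L4 z" "A4 z \<le> 5184 * (strichartz_K * norm \<psi>\<^sub>0) ^ 4" by auto
qed

lemma trace_solution_exists: "\<exists>z. trace_solution \<psi>\<^sub>0 z"
proof -
  let ?f = "origin_trace \<psi>\<^sub>0"
  obtain y where y: "y \<in> borel_measurable borel" "\<And>T. volterra T ?f y"
    using volterra_global[OF L4_trace(1)[of \<psi>\<^sub>0]] by blast
  obtain x where x: "x \<in> borel_measurable borel" "\<And>T. volterra T (rev_cnj ?f) x"
    using volterra_global[OF A4_rev(1)[OF L4_trace(1)[of \<psi>\<^sub>0]]] by blast
  have [measurable]: "x \<in> borel_measurable borel" "y \<in> borel_measurable borel" by fact+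
  have [measurable]: "rev_cnj x \<in> borel_measurable borel" by (rule rev_cnj_measurable) simp
  define z where "z t = (if t \<ge> 0 then y t else rev_cnj x t)" for t
  have [measurable]: "z \<in> borel_measurable borel" unfolding z_def by measurable
  have [measurable]: "rev_cnj z \<in> borel_measurable borel" by (rule rev_cnj_measurable) simp
  have "volterra T ?f z" for T
  proof -
    have c: "restr {0..<T} z = restr {0..<T} y" by (auto simp: z_def restr_def fun_eq_iff indicator_def)
    have "restr {0..<T} (\<lambda>s. cubic (z s)) = restr {0..<T} (\<lambda>s. cubic (y s))" by (simp add: restr_cubic c)
    then show ?thesis using y(2)[of T] unfolding volterra_def c by (auto simp: z_def elim: eventually_mono)
  qed
  moreover have "volterra T (rev_cnj ?f) (rev_cnj z)" for T
  proof -
    have c: "AE t in lborel. restr {0..<T} (rev_cnj z) t = restr {0..<T} x t"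
      using AE_lborel_singleton[of 0] by eventually_elim (auto simp: z_def restr_def rev_cnj_def indicator_def)
    have "L4 (restr {0..<T} (rev_cnj z))"
      by (rule A4_cong_AE(2)[of "restr {0..<T} x"]) (use x(2)[of T] c in \<open>auto simp: volterra_def elim: eventually_mono\<close>)
    moreover have volt: "volt (restr {0..<T} (\<lambda>s. cubic (rev_cnj z s))) t = volt (restr {0..<T} (\<lambda>s. cubic (x s))) t" for t
      by (rule volt_cong_AE) (use c in \<open>auto simp: restr_cubic elim: eventually_mono\<close>)
    moreover have "AE t in lborel. t \<in> {0..<T} \<longrightarrow> rev_cnj z t + \<i> * volt (restr {0..<T} (\<lambda>s. cubic (x s))) t = rev_cnj ?f t"
      using x(2)[of T, unfolded volterra_def, THEN conjunct2, THEN conjunct2] AE_lborel_singleton[of 0]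
      by eventually_elim (auto simp: z_def rev_cnj_def)
    ultimately show ?thesis by (simp add: volterra_def)
  qed
  ultimately show ?thesis by (auto simp: trace_solution_def)
qed

section \<open>Solutions in terms of their trace\<close>

text \<open>Values at the origin of a solution are only Lebesgue measurable; they agree almost everywhere
  with Borel functions, for which the integration theory of \<^const>\<open>lborel\<close> is
  available.\<close>

lemma lebesgue_AE_borel:
  fixes p q :: "real \<Rightarrow> complex"
  assumes q: "q \<in> borel_measurable borel" and pq: "AE s in lborel. p s = q s"
  shows "p \<in> borel_measurable lebesgue" "integrable lborel q \<Longrightarrow> integrable lebesgue p"
    "integral\<^sup>L lebesgue p = integral\<^sup>L lborel q"
proof -
  have ql: "q \<in> borel_measurable lebesgue" using q by (simp add: measurable_completion)
  have ae: "AE s in lebesgue. q s = p s" unfolding AE_completion_iff using pq by eventually_elim simp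
  show p: "p \<in> borel_measurable lebesgue" by (rule borel_measurable_AE[OF ql ae])
  show "integrable lborel q \<Longrightarrow> integrable lebesgue p"
    by (rule integrable_cong_AE_imp[OF _ p ae]) (use q in \<open>simp add: integrable_completion\<close>)
  have "integral\<^sup>L lebesgue p = integral\<^sup>L lebesgue q"
    by (rule integral_cong_AE[OF p ql]) (use ae in \<open>eventually_elim, simp\<close>)
  then show "integral\<^sup>L lebesgue p = integral\<^sup>L lborel q" using q by (simp add: integral_completion)
qed

lemma interval_pairing:
  assumes c: "loc_admissible c" and p: "AE s in lborel. p s = c s * cnj (origin_trace \<phi> s)"
  shows "interval_lebesgue_integrable lebesgue (ereal a) (ereal b) p"
    and "interval_lebesgue_integral lebesgue (ereal a) (ereal b) p = l2_cinner (duhamel c b - duhamel c a) \<phi>"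
proof -
  have cm [measurable]: "c \<in> borel_measurable borel" using c by (rule loc_admissible_measurable)
  have main: "set_integrable lebesgue {a<..<b} p" "(LINT s:{a<..<b}|lebesgue. p s) = l2_cinner (duhamel c b - duhamel c a) \<phi>" if "a \<le> b" for a b
  proof -
    let ?q = "\<lambda>s. restr {a..<b} c s * cnj (origin_trace \<phi> s)"
    have a: "admissible (restr {a..<b} c)" using c by (simp add: loc_admissible_def)
    have e: "AE s in lborel. indicat_real {a<..<b} s *\<^sub>R p s = ?q s"
      using p AE_lborel_singleton[of a] by eventually_elim (auto simp: restr_def indicator_def)
    have q: "?q \<in> borel_measurable borel" by measurable
    note L = lebesgue_AE_borel[OF q e]
    show "set_integrable lebesgue {a<..<b} p" unfolding set_integrable_def by (rule L(2)[OF source_pairing(1)[OF a]])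
    show "(LINT s:{a<..<b}|lebesgue. p s) = l2_cinner (duhamel c b - duhamel c a) \<phi>"
      unfolding set_lebesgue_integral_def L(3) duhamel_increment[OF c that] by (rule source_pairing(2)[OF a, symmetric])
  qed
  show "interval_lebesgue_integrable lebesgue (ereal a) (ereal b) p"
    unfolding interval_lebesgue_integrable_def using main(1)[of a b] main(1)[of b a] by auto
  show "interval_lebesgue_integral lebesgue (ereal a) (ereal b) p = l2_cinner (duhamel c b - duhamel c a) \<phi>"
    unfolding interval_lebesgue_integral_def using main(2)[of a b] main(2)[of b a] by (auto simp: cinner_diff_left)
qed

lemma integral_dirac: "(LINT x|dirac. cnj (apply_bcontfun u x)) = cnj (apply_bcontfun u 0)"
proof -
  have "apply_bcontfun u \<in> borel_measurable borel"
    by (rule borel_measurable_continuous_onI[OF continuous_on_apply_bcontfun])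
  then show ?thesis unfolding dirac_def by (subst integral_return) auto
qed

lemma AE_Cx_rep_trace: "AE s in lborel. apply_bcontfun (Cx_rep (schroedinger s \<phi>)) 0 = origin_trace \<phi> s"
  using AE_regular_schroedinger[of \<phi>] by eventually_elim (simp add: regular_Cx_rep regular_trace)

text \<open>The duality pairing determines its $L^2$ element, and the pairing with the Duhamel integral is
  known.\<close>

lemma has_schroedinger_integral_iff:
  assumes c: "loc_admissible c" and c0: "AE s in lborel. c0 s = c s"
  shows "has_schroedinger_integral dirac c0 a b F \<longleftrightarrow> F = duhamel c b - duhamel c a"
proof -
  have p: "AE s in lborel. c0 s * (LINT x|dirac. cnj (apply_bcontfun (Cx_rep (schroedinger s \<phi>)) x)) = c s * cnj (origin_trace \<phi> s)" for \<phi>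
    using c0 AE_Cx_rep_trace[of \<phi>] by eventually_elim (simp only: integral_dirac)
  show ?thesis
    unfolding has_schroedinger_integral_def Let_def interval_pairing(2)[OF c p]
    using interval_pairing(1)[OF c p] by (blast intro: cinner_eqI)
qed

text \<open>Evaluation at the origin is continuous on the bounded continuous functions, so strong
  measurability of the path passes to the trace. Exhausting the line by compact intervals, on
  which it is assumed, gives measurability everywhere.\<close>

lemma solution_measurable_trace:
  assumes "\<And>a b. in_L4Cx {a..b} \<psi>"
  obtains z where "z \<in> borel_measurable borel" "AE t in lborel. apply_bcontfun (Cx_rep (\<psi> t)) 0 = z t"
proof -
  define y where "y t = apply_bcontfun (Cx_rep (\<psi> t)) 0" for t
  have yn: "(\<lambda>t. indicat_real {- real n..real n} t *\<^sub>R y t) \<in> borel_measurable lebesgue" for n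
  proof -
    let ?M = "lebesgue_on {- real n..real n}"
    have "strongly_measurable ?M (\<lambda>t. Cx_rep (\<psi> t))" using assms unfolding in_L4Cx_def by blast
    then obtain s where s: "\<And>k. simple_function ?M (s k)" "AE t in ?M. (\<lambda>k. s k t) \<longlonglongrightarrow> Cx_rep (\<psi> t)"
      unfolding strongly_measurable_def by blast
    have [measurable]: "(\<lambda>t. apply_bcontfun (s k t) 0) \<in> borel_measurable ?M" for k
      by (intro borel_measurable_simple_function simple_function_compose1[OF s(1)])
    define l where "l t = lim (\<lambda>k. apply_bcontfun (s k t) 0)" for t
    have lm: "l \<in> borel_measurable ?M" unfolding l_def by measurable
    have "AE t in ?M. l t = y t"
      using s(2) by eventually_elim (simp add: l_def y_def limI tendsto_apply_bcontfun)
    then have ae: "AE t in lebesgue. indicat_real {- real n..real n} t *\<^sub>R l t = indicat_real {- real n..real n} t *\<^sub>R y t"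
      by (subst (asm) AE_restrict_space_iff) (auto simp: indicator_def elim: eventually_mono)
    have "(\<lambda>t. indicat_real {- real n..real n} t *\<^sub>R l t) \<in> borel_measurable lebesgue"
      using lm by (subst (asm) borel_measurable_restrict_space_iff) auto
    then show ?thesis using ae by (rule borel_measurable_AE)
  qed
  have "y \<in> borel_measurable lebesgue"
  proof (rule borel_measurable_LIMSEQ_metric[OF yn])
    fix t
    show "(\<lambda>n. indicat_real {- real n..real n} t *\<^sub>R y t) \<longlonglongrightarrow> y t"
    proof -
      have "(\<lambda>n. indicat_real {- real n..real n} t *\<^sub>R y t) = (\<lambda>n. cutoff n y t)"
        by (auto simp: cutoff_def indicator_def fun_eq_iff)
      then show ?thesis using cutoff_tendsto[of y t] by simp
    qed
  qed
  then have "(\<lambda>t. Re (y t)) \<in> borel_measurable lebesgue" "(\<lambda>t. Im (y t)) \<in> borel_measurable lebesgue" by auto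
  then obtain g h where gh: "g \<in> borel_measurable lborel" "AE t in lborel. Re (y t) = g t" "h \<in> borel_measurable lborel" "AE t in lborel. Im (y t) = h t"
    using completion_ex_borel_measurable_real by blast
  have [measurable]: "g \<in> borel_measurable borel" "h \<in> borel_measurable borel" using gh by auto
  have "(\<lambda>t. complex_of_real (g t) + \<i> * complex_of_real (h t)) \<in> borel_measurable borel" by measurable
  moreover have "AE t in lborel. y t = complex_of_real (g t) + \<i> * complex_of_real (h t)"
    using gh(2,4) by eventually_elim (simp add: complex_eq_iff)
  ultimately show ?thesis using that unfolding y_def by blast
qed

lemma nn_integral_lebesgue_on: "S \<in> sets borel \<Longrightarrow> (\<integral>\<^sup>+ t. f t \<partial>lebesgue_on S) = (\<integral>\<^sup>+ t. f t * indicator S t \<partial>lborel)"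
  by (subst nn_integral_restrict_space) (auto simp: nn_integral_completion)

lemma loc_admissible_cubic:
  assumes z: "z \<in> borel_measurable borel" and L: "\<And>a b. L4 (restr {a..b} z)"
  shows "loc_admissible (\<lambda>s. cubic (z s))"
  unfolding loc_admissible_def
proof (intro conjI allI)
  have [measurable]: "z \<in> borel_measurable borel" by fact
  show "(\<lambda>s. cubic (z s)) \<in> borel_measurable borel" by measurable
  fix a b
  have "L4 (restr {a..<b} z)" by (rule L4_mono(1)[OF L[of a b]]) (auto simp: cmod_restr indicator_def)
  then have l: "L43 (restr {a..<b} (\<lambda>s. cubic (z s)))" unfolding restr_cubic by (rule L43_cubic)
  show "admissible (restr {a..<b} (\<lambda>s. cubic (z s)))"
  proof (rule admissible_bounded_interval[of _ a b])
    show "restr {a..<b} (\<lambda>s. cubic (z s)) s = 0" if "s \<notin> {a..b}" for s using that by (auto simp: restr_def)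
  qed (use l in \<open>auto simp: L43_def\<close>)
qed

lemma l2_scaleC_0 [simp]: "l2_scaleC c 0 = 0"
  using l2_scaleC_diff[of c 0 0] by simp

lemma l2_scaleC_uminus: "l2_scaleC c (- f) = - l2_scaleC c f"
  using l2_scaleC_diff[of c 0 f] by simp

text \<open>Duhamel integrals from \<open>t\<^sub>0\<close> are differences of those from $0$, and the value
  at $0$ converts one formula into the other. The trace then satisfies its equation because the
  path is continuous in space at almost every time.\<close>

lemma solution_imp_trace_solution:
  assumes \<psi>: "solution UNIV \<psi>"
  obtains z where "trace_solution (\<psi> 0) z" "\<And>t. \<psi> t = schroedinger t (\<psi> 0 - l2_scaleC \<i> (duhamel (\<lambda>s. cubic (z s)) t))"
    "AE t in lborel. apply_bcontfun (Cx_rep (\<psi> t)) 0 = z t"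
proof -
  have L: "in_L4Cx {a..b} \<psi>" for a b using \<psi> by (simp add: solution_def in_L4Cx_loc_def)
  obtain z where z: "z \<in> borel_measurable borel" "AE t in lborel. apply_bcontfun (Cx_rep (\<psi> t)) 0 = z t"
    using solution_measurable_trace[OF L] by blast
  have [measurable]: "z \<in> borel_measurable borel" by (rule z(1))
  have L4z: "L4 (restr {a..b} z)" for a b
  proof -
    have "int4 (restr {a..b} z) \<le> (\<integral>\<^sup>+ t. ennreal (norm (Cx_rep (\<psi> t)) ^ 4) * indicator {a..b} t \<partial>lborel)"
    proof (rule nn_integral_mono_AE, use z(2) in eventually_elim)
      case (elim t)
      have "cmod (z t) \<le> norm (Cx_rep (\<psi> t))" using norm_apply_bcontfun_le[of "Cx_rep (\<psi> t)" 0] elim by simp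
      then show ?case by (auto simp: restr_def indicator_def intro!: ennreal_leI power_mono)
    qed
    also have "\<dots> = (\<integral>\<^sup>+ t. ennreal (norm (norm (Cx_rep (\<psi> t)) ^ 4)) \<partial>lebesgue_on {a..b})"
      by (simp add: nn_integral_lebesgue_on)
    also have "\<dots> < \<infinity>" using L[of a b] unfolding in_L4Cx_def integrable_iff_bounded by blast
    finally show ?thesis unfolding L4_def integrable_iff_bounded by simp
  qed
  let ?c = "\<lambda>s. cubic (z s)"
  have c: "loc_admissible ?c" by (rule loc_admissible_cubic[OF z(1) L4z])
  have c0: "AE s in lborel. (let z = apply_bcontfun (Cx_rep (\<psi> s)) 0 in complex_of_real ((cmod z)\<^sup>2) * z) = ?c s"
    using z(2) by eventually_elim (simp add: cubic_def Let_def)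
  obtain t\<^sub>0 where t0: "\<And>t. \<psi> t = schroedinger (t - t\<^sub>0) (\<psi> t\<^sub>0) - l2_scaleC \<i> (schroedinger t (duhamel ?c t - duhamel ?c t\<^sub>0))"
    using \<psi> unfolding solution_def has_schroedinger_integral_iff[OF c c0] by auto
  have "\<psi> 0 = schroedinger (- t\<^sub>0) (\<psi> t\<^sub>0) - l2_scaleC \<i> (duhamel ?c 0 - duhamel ?c t\<^sub>0)" using t0[of 0] by simp
  then have p0: "schroedinger (- t\<^sub>0) (\<psi> t\<^sub>0) = \<psi> 0 + l2_scaleC \<i> (duhamel ?c 0 - duhamel ?c t\<^sub>0)" by simp
  have form: "\<psi> t = schroedinger t (\<psi> 0 - l2_scaleC \<i> (duhamel ?c t))" for t
  proof -
    have "\<psi> t = schroedinger t (schroedinger (- t\<^sub>0) (\<psi> t\<^sub>0) - l2_scaleC \<i> (duhamel ?c t - duhamel ?c t\<^sub>0))"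
      using t0[of t] by (simp add: schroedinger_diff schroedinger_scaleC schroedinger_group)
    also have "schroedinger (- t\<^sub>0) (\<psi> t\<^sub>0) - l2_scaleC \<i> (duhamel ?c t - duhamel ?c t\<^sub>0) = \<psi> 0 - l2_scaleC \<i> (duhamel ?c t)"
      unfolding p0 by (simp add: l2_scaleC_diff l2_scaleC_uminus algebra_simps)
    finally show ?thesis .
  qed
  have "trace_equation (\<psi> 0) z" unfolding trace_equation_def
    using duhamel_regular[OF c, of "\<psi> 0"] z(2)
  proof eventually_elim
    case (elim t)
    then show ?case unfolding form[symmetric] by (simp add: regular_Cx_rep)
  qed
  moreover have "L4 (restr {-T..<T} z)" for T
    by (rule L4_mono(1)[OF L4z[of "-T" T]]) (auto simp: cmod_restr indicator_def)
  ultimately have "trace_solution (\<psi> 0) z" by (intro trace_equation_imp_trace_solution z(1))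
  then show ?thesis using that form z(2) by blast
qed

subsection \<open>Continuity and space-time bounds of the Duhamel path\<close>

lemma n43_restr_cubic: "L4 z \<Longrightarrow> S \<in> sets borel \<Longrightarrow> n43 (restr S (\<lambda>s. cubic (z s))) = A4 (restr S z)"
  unfolding restr_cubic by (intro n43_cubic L4_restr(1))

lemma n43_mono:
  assumes h: "L43 h" and le: "\<And>s. cmod (g s) \<le> cmod (h s)" shows "n43 g \<le> n43 h"
  unfolding n43_def by (rule enn2real_mono[OF N43_mono[OF le]]) (use h in \<open>auto simp: L43_def\<close>)

lemma norm_duhamel_le:
  assumes h: "L43 h" shows "norm (duhamel h t) \<le> strichartz_K * root 4 (n43 h) ^ 3"
proof -
  have "norm (duhamel h t) \<le> strichartz_K * root 4 (n43 (restr (time_span t) h)) ^ 3"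
    unfolding duhamel_def norm_scaleC using norm_source_le[OF loc_admissible_time_span[OF loc_admissible_L43[OF h]], of t] by simp
  also have "\<dots> \<le> strichartz_K * root 4 (n43 h) ^ 3"
    by (intro mult_left_mono power_mono real_root_le_mono n43_mono h)
       (use strichartz_K_pos in \<open>auto simp: cmod_restr indicator_def\<close>)
  finally show ?thesis .
qed

lemma norm_duhamel_increment_le:
  assumes z: "L4 z" and "s \<le> t" and S: "{s..<t} \<subseteq> S" "S \<in> sets borel"
  shows "norm (duhamel (\<lambda>s. cubic (z s)) t - duhamel (\<lambda>s. cubic (z s)) s) \<le> strichartz_K * root 4 (A4 (restr S z)) ^ 3"
proof -
  have l: "loc_admissible (\<lambda>s. cubic (z s))" by (intro loc_admissible_L43 L43_cubic z)
  have "norm (duhamel (\<lambda>s. cubic (z s)) t - duhamel (\<lambda>s. cubic (z s)) s) \<le> strichartz_K * root 4 (n43 (restr {s..<t} (\<lambda>s. cubic (z s)))) ^ 3"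
    unfolding duhamel_increment[OF l assms(2)] by (rule norm_source_le) (use l in \<open>simp add: loc_admissible_def\<close>)
  also have "\<dots> = strichartz_K * root 4 (A4 (restr {s..<t} z)) ^ 3" using z by (simp add: n43_restr_cubic)
  also have "\<dots> \<le> strichartz_K * root 4 (A4 (restr S z)) ^ 3"
  proof (intro mult_left_mono power_mono real_root_le_mono)
    have "restr {s..<t} z = restr {s..<t} (restr S z)" unfolding restr_restr using S by (simp add: Int_absorb2)
    then show "A4 (restr {s..<t} z) \<le> A4 (restr S z)" using L4_restr(2)[OF L4_restr(1)[OF z S(2)], of "{s..<t}"] by simp
  qed (use strichartz_K_pos in auto)
  finally show ?thesis .
qed

lemma duhamel_continuous:
  assumes z: "L4 z" shows "continuous_on UNIV (duhamel (\<lambda>s. cubic (z s)))"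
  unfolding continuous_on_sequentially
proof (intro allI ballI impI)
  fix X :: "nat \<Rightarrow> real" and t assume X: "(\<forall>n. X n \<in> UNIV) \<and> X \<longlonglongrightarrow> t"
  let ?c = "\<lambda>s. cubic (z s)"
  define S where "S n = {min (X n) t..<max (X n) t}" for n
  have A: "(\<lambda>n. A4 (restr (S n) z)) \<longlonglongrightarrow> 0"
  proof (rule L4_shrinking[OF z])
    show "AE s in lborel. \<forall>\<^sub>F n in sequentially. s \<notin> S n"
      using AE_lborel_singleton[of t]
    proof eventually_elim
      case (elim s)
      then have "\<bar>s - t\<bar> > 0" by simp
      then have "\<forall>\<^sub>F n in sequentially. dist (X n) t < \<bar>s - t\<bar>" using X tendstoD by blast
      then show ?case by eventually_elim (auto simp: S_def dist_real_def)
    qed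
  qed (simp add: S_def)
  have b: "norm (duhamel ?c (X n) - duhamel ?c t) \<le> strichartz_K * root 4 (A4 (restr (S n) z)) ^ 3" for n
  proof (cases "X n \<le> t")
    case True
    then show ?thesis using norm_duhamel_increment_le[OF z True, of "S n"] by (simp add: S_def norm_minus_commute)
  next
    case False
    then show ?thesis using norm_duhamel_increment_le[OF z, of t "X n" "S n"] by (simp add: S_def)
  qed
  have "(\<lambda>n. strichartz_K * root 4 (A4 (restr (S n) z)) ^ 3) \<longlonglongrightarrow> strichartz_K * root 4 0 ^ 3"
    by (intro tendsto_intros A)
  then have "(\<lambda>n. strichartz_K * root 4 (A4 (restr (S n) z)) ^ 3) \<longlonglongrightarrow> 0" by simp
  then have "(\<lambda>n. duhamel ?c (X n) - duhamel ?c t) \<longlonglongrightarrow> 0"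
    by (rule Lim_null_comparison[rotated]) (use b in \<open>auto intro: always_eventually\<close>)
  then show "(duhamel ?c \<circ> X) \<longlonglongrightarrow> duhamel ?c t" by (simp add: LIM_zero_iff o_def)
qed

lemma schroedinger_path_continuous:
  assumes g: "continuous_on UNIV g" shows "continuous_on UNIV (\<lambda>t. schroedinger t (g t))"
  unfolding continuous_on_sequentially
proof (intro allI ballI impI)
  fix X :: "nat \<Rightarrow> real" and t assume X: "(\<forall>n. X n \<in> UNIV) \<and> X \<longlonglongrightarrow> t"
  have 1: "(\<lambda>n. g (X n)) \<longlonglongrightarrow> g t" using g X unfolding continuous_on_sequentially o_def by blast
  have 2: "(\<lambda>n. schroedinger (X n) (g t)) \<longlonglongrightarrow> schroedinger t (g t)"
    using schroedinger_continuous[of "g t"] X unfolding continuous_on_sequentially o_def by blast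
  have "(\<lambda>n. norm (g (X n) - g t)) \<longlonglongrightarrow> 0" using 1 by (simp add: tendsto_norm_zero_iff LIM_zero_iff)
  then have "(\<lambda>n. schroedinger (X n) (g (X n) - g t)) \<longlonglongrightarrow> 0"
    by (rule Lim_null_comparison[rotated]) (auto intro: always_eventually)
  from tendsto_add[OF this 2] show "((\<lambda>t. schroedinger t (g t)) \<circ> X) \<longlonglongrightarrow> schroedinger t (g t)"
    by (simp add: o_def schroedinger_diff)
qed

lemma ennreal_add_pow4_le: "(a + b :: ennreal) ^ 4 \<le> 8 * a ^ 4 + 8 * b ^ 4"
proof (cases "a = \<top> \<or> b = \<top>")
  case True
  then show ?thesis by (auto simp: power_eq_top_ennreal ennreal_mult_eq_top_iff)
next
  case False
  then obtain x y where xy: "a = ennreal x" "x \<ge> 0" "b = ennreal y" "y \<ge> 0" by (cases a; cases b) auto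
  have "(x + y) ^ 4 \<le> 8 * x ^ 4 + 8 * y ^ 4"
    using pow4_add_le[of "complex_of_real x" "complex_of_real (- y)"] xy by (simp add: norm_of_real flip: of_real_add of_real_diff)
  then have "ennreal ((x + y) ^ 4) \<le> ennreal (8 * x ^ 4 + 8 * y ^ 4)"
    by (rule ennreal_leI)
  also have "\<dots> = 8 * ennreal (x ^ 4) + 8 * ennreal (y ^ 4)" using xy by (simp add: ennreal_plus ennreal_mult)
  finally show ?thesis using xy by (simp add: ennreal_power flip: ennreal_plus)
qed

text \<open>The bound in $L^4_t C_x$: the maximal function controls the free part, the Riesz potential the
  Duhamel part. It also serves for differences of solutions, which are again of this form.\<close>

lemma duhamel_L4_bound:
  assumes c: "L43 c"
  shows "(\<integral>\<^sup>+ t. ennreal (norm (Cx_rep (schroedinger t (\<psi>\<^sub>0 - l2_scaleC \<i> (duhamel c t)))) ^ 4) \<partial>lborel) \<le>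
    ennreal (8 * (strichartz_K * norm \<psi>\<^sub>0) ^ 4 + 8 * (14 ^ 4 * n43 c ^ 3))"
proof -
  have [measurable]: "c \<in> borel_measurable borel" using c by (rule L43_measurable)
  have "(\<integral>\<^sup>+ t. ennreal (norm (Cx_rep (schroedinger t (\<psi>\<^sub>0 - l2_scaleC \<i> (duhamel c t)))) ^ 4) \<partial>lborel) \<le>
    (\<integral>\<^sup>+ t. 8 * reg_max (schroedinger t \<psi>\<^sub>0) ^ 4 + 8 * riesz c t ^ 4 \<partial>lborel)"
  proof (rule nn_integral_mono_AE, use duhamel_regular[OF loc_admissible_L43[OF c], of \<psi>\<^sub>0] in eventually_elim)
    case (elim t)
    let ?w = "schroedinger t (\<psi>\<^sub>0 - l2_scaleC \<i> (duhamel c t))"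
    have "riesz (restr (time_span t) c) t \<le> riesz c t" by (rule riesz_mono) (simp add: cmod_restr indicator_def)
    then have "ennreal (norm (Cx_rep ?w)) \<le> reg_max (schroedinger t \<psi>\<^sub>0) + riesz c t"
      using elim by (simp add: regular_Cx_rep) (meson add_left_mono order_trans)
    then have "ennreal (norm (Cx_rep ?w)) ^ 4 \<le> (reg_max (schroedinger t \<psi>\<^sub>0) + riesz c t) ^ 4" by (intro power_mono) auto
    also have "\<dots> \<le> 8 * reg_max (schroedinger t \<psi>\<^sub>0) ^ 4 + 8 * riesz c t ^ 4" by (rule ennreal_add_pow4_le)
    finally show ?case by (simp add: ennreal_power)
  qed
  also have "\<dots> = 8 * (\<integral>\<^sup>+ t. reg_max (schroedinger t \<psi>\<^sub>0) ^ 4 \<partial>lborel) + 8 * (\<integral>\<^sup>+ t. riesz c t ^ 4 \<partial>lborel)"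
    by (subst nn_integral_add) (auto simp: nn_integral_cmult)
  also have "\<dots> \<le> 8 * ennreal ((strichartz_K * norm \<psi>\<^sub>0) ^ 4) + 8 * ennreal (14 ^ 4 * n43 c ^ 3)"
    by (intro add_mono mult_left_mono reg_max_strichartz riesz_L43 c) auto
  also have "\<dots> = ennreal (8 * (strichartz_K * norm \<psi>\<^sub>0) ^ 4 + 8 * (14 ^ 4 * n43 c ^ 3))"
    by (simp add: ennreal_plus ennreal_mult)
  finally show ?thesis .
qed

lemma Reg_path_continuous:
  fixes \<psi> :: "real \<Rightarrow> l2"
  assumes \<psi>: "continuous_on UNIV \<psi>" shows "continuous_on S (\<lambda>t. Reg n (\<psi> t))"
proof (rule continuous_on_subset[of UNIV], unfold continuous_on_sequentially, intro allI ballI impI)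
  fix X :: "nat \<Rightarrow> real" and t assume X: "(\<forall>n. X n \<in> UNIV) \<and> X \<longlonglongrightarrow> t"
  have "(\<lambda>k. \<psi> (X k)) \<longlonglongrightarrow> \<psi> t" using \<psi> X unfolding continuous_on_sequentially o_def by blast
  then have "(\<lambda>k. norm (\<psi> (X k) - \<psi> t)) \<longlonglongrightarrow> 0" by (simp add: tendsto_norm_zero_iff LIM_zero_iff)
  then have "(\<lambda>k. reg_C n * norm (\<psi> (X k) - \<psi> t)) \<longlonglongrightarrow> reg_C n * 0" by (rule tendsto_mult_left)
  then have b: "(\<lambda>k. reg_C n * norm (\<psi> (X k) - \<psi> t)) \<longlonglongrightarrow> 0" by simp
  have "(\<lambda>k. Reg n (\<psi> (X k)) - Reg n (\<psi> t)) \<longlonglongrightarrow> 0"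
    unfolding Reg_diff[symmetric]
    by (rule Lim_null_comparison[OF always_eventually b]) (intro allI norm_Reg_le)
  then show "((\<lambda>t. Reg n (\<psi> t)) \<circ> X) \<longlonglongrightarrow> Reg n (\<psi> t)" by (simp add: LIM_zero_iff o_def)
qed simp

text \<open>Simple functions are obtained by freezing the path on a grid. The regularisations are uniformly
  continuous in time, so a grid can be chosen on which the error is at most $1/(n+1)$; as $n$
  grows both this error and that of the regularisation vanish at almost every time.\<close>

lemma strongly_measurable_regular_path:
  fixes \<psi> :: "real \<Rightarrow> l2"
  assumes \<psi>: "continuous_on UNIV \<psi>" and regular: "AE t in lborel. regular (\<psi> t)"
  shows "strongly_measurable (lebesgue_on {a..b}) (\<lambda>t. Cx_rep (\<psi> t))"
proof -
  \<comment> \<open>A grid point below a time in $[a,b]$ may precede $a$, by less than one.\<close>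
  have "\<exists>d. 0 < d \<and> d \<le> 1 \<and> (\<forall>s\<in>{a - 1..b}. \<forall>t\<in>{a - 1..b}. dist s t < d \<longrightarrow> dist (Reg n (\<psi> s)) (Reg n (\<psi> t)) < 1 / real (Suc n))" for n
  proof -
    have "uniformly_continuous_on {a - 1..b} (\<lambda>t. Reg n (\<psi> t))" by (intro compact_uniformly_continuous Reg_path_continuous \<psi>) simp
    moreover have "0 < 1 / real (Suc n)" by simp
    ultimately obtain d where "d > 0" "\<forall>s\<in>{a - 1..b}. \<forall>t\<in>{a - 1..b}. dist t s < d \<longrightarrow> dist (Reg n (\<psi> t)) (Reg n (\<psi> s)) < 1 / real (Suc n)"
      unfolding uniformly_continuous_on_def by meson
    then show ?thesis by (intro exI[of _ "min d 1"]) auto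
  qed
  then obtain d where d: "\<And>n. 0 < d n" "\<And>n. d n \<le> 1"
    "\<And>n s t. s \<in> {a - 1..b} \<Longrightarrow> t \<in> {a - 1..b} \<Longrightarrow> dist s t < d n \<Longrightarrow> dist (Reg n (\<psi> s)) (Reg n (\<psi> t)) < 1 / real (Suc n)"
    by metis
  \<comment> \<open>Freeze the path at the grid point below the current time.\<close>
  define g where "g n t = real_of_int \<lfloor>t / d n\<rfloor> * d n" for n t
  define u where "u n t = Reg n (\<psi> (g n t))" for n t
  have gt: "g n t \<le> t" "t < g n t + d n" for n t
  proof -
    have f: "real_of_int \<lfloor>t / d n\<rfloor> \<le> t / d n" "t / d n < real_of_int \<lfloor>t / d n\<rfloor> + 1" by linarith+
    show "g n t \<le> t" using f(1) unfolding g_def pos_le_divide_eq[OF d(1)] .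
    show "t < g n t + d n" using f(2) unfolding g_def pos_divide_less_eq[OF d(1)] by (simp add: distrib_right)
  qed
  have simple: "simple_function (lebesgue_on {a..b}) (u n)" for n
  proof -
    have "simple_function (lebesgue_on {a..b}) (\<lambda>t. \<lfloor>t / d n\<rfloor>)"
      unfolding simple_function_def
    proof (intro conjI ballI)
      have "(\<lambda>t. \<lfloor>t / d n\<rfloor>) ` {a..b} \<subseteq> {\<lfloor>a / d n\<rfloor>..\<lfloor>b / d n\<rfloor>}"
        using d(1)[of n] by (auto intro!: floor_mono divide_right_mono)
      then show "finite ((\<lambda>t. \<lfloor>t / d n\<rfloor>) ` space (lebesgue_on {a..b}))"
        by (simp add: finite_subset)
      fix k
      have "(\<lambda>t. \<lfloor>t / d n\<rfloor>) -` {k} \<inter> {a..b} = {a..b} \<inter> {real_of_int k * d n..<(real_of_int k + 1) * d n}"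
        by (simp add: set_eq_iff floor_eq_iff pos_le_divide_eq[OF d(1)] pos_divide_less_eq[OF d(1)]) blast
      then show "(\<lambda>t. \<lfloor>t / d n\<rfloor>) -` {k} \<inter> space (lebesgue_on {a..b}) \<in> sets (lebesgue_on {a..b})"
        by (simp add: sets_restrict_space_iff)
    qed
    then show ?thesis unfolding u_def g_def
      by (rule simple_function_compose1[where g="\<lambda>k. Reg n (\<psi> (real_of_int k * d n))"])
  qed
  have "AE t in lebesgue. t \<in> {a..b} \<longrightarrow> (\<lambda>n. u n t) \<longlonglongrightarrow> Cx_rep (\<psi> t)"
    unfolding AE_completion_iff using regular
  proof eventually_elim
    case (elim t)
    show ?case
    proof
      assume t: "t \<in> {a..b}"
      have "dist (u n t) (Reg n (\<psi> t)) < 1 / real (Suc n)" for n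
        unfolding u_def using gt(1)[of n t] gt(2)[of t n] d(2)[of n] t by (intro d(3)) (auto simp: dist_real_def)
      then have le: "norm (u n t - Reg n (\<psi> t)) \<le> inverse (real (Suc n))" for n by (simp add: dist_norm less_imp_le inverse_eq_divide)
      have "(\<lambda>n. u n t - Reg n (\<psi> t)) \<longlonglongrightarrow> 0"
        by (rule Lim_null_comparison[OF always_eventually LIMSEQ_inverse_real_of_nat]) (use le in blast)
      from tendsto_add[OF this regular_LIMSEQ[OF elim]]
      show "(\<lambda>n. u n t) \<longlonglongrightarrow> Cx_rep (\<psi> t)" by (simp add: regular_Cx_rep[OF elim])
    qed
  qed
  then have "AE t in lebesgue_on {a..b}. (\<lambda>n. u n t) \<longlonglongrightarrow> Cx_rep (\<psi> t)"
    by (subst AE_restrict_space_iff) auto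
  then show ?thesis unfolding strongly_measurable_def using simple by blast
qed

section \<open>Existence and uniqueness\<close>

abbreviation flow :: "l2 \<Rightarrow> (real \<Rightarrow> complex) \<Rightarrow> real \<Rightarrow> l2" where
  "flow \<psi>\<^sub>0 c t \<equiv> schroedinger t (\<psi>\<^sub>0 - l2_scaleC \<i> (duhamel c t))"

lemma norm_Cx_rep_measurable:
  fixes \<psi> :: "real \<Rightarrow> l2"
  assumes \<psi>: "continuous_on UNIV \<psi>" and regular: "AE t in lborel. regular (\<psi> t)"
  shows "(\<lambda>t. norm (Cx_rep (\<psi> t))) \<in> borel_measurable lebesgue"
proof (rule borel_measurable_AE)
  have [measurable]: "(\<lambda>t. norm (Reg n (\<psi> t))) \<in> borel_measurable borel" for n
    by (intro borel_measurable_continuous_onI continuous_on_norm Reg_path_continuous \<psi>)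
  have "(\<lambda>t. lim (\<lambda>n. norm (Reg n (\<psi> t)))) \<in> borel_measurable borel" by measurable
  then show "(\<lambda>t. lim (\<lambda>n. norm (Reg n (\<psi> t)))) \<in> borel_measurable lebesgue"
    by (simp add: measurable_completion)
  show "AE t in lebesgue. lim (\<lambda>n. norm (Reg n (\<psi> t))) = norm (Cx_rep (\<psi> t))"
    unfolding AE_completion_iff using regular
    by eventually_elim (simp add: regular_Cx_rep limI tendsto_norm regular_LIMSEQ)
qed

lemma in_L4CxI:
  fixes \<psi> :: "real \<Rightarrow> l2"
  assumes \<psi>: "continuous_on UNIV \<psi>" and regular: "AE t in lborel. regular (\<psi> t)"
    and b: "(\<integral>\<^sup>+ t. ennreal (norm (Cx_rep (\<psi> t)) ^ 4) \<partial>lborel) < \<infinity>"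
  shows "in_L4Cx {a..b} \<psi>"
  unfolding in_L4Cx_def
proof (intro conjI strongly_measurable_regular_path[OF \<psi> regular])
  have "AE t in lebesgue. regular (\<psi> t)" unfolding AE_completion_iff by (rule regular)
  then show "AE t in lebesgue_on {a..b}. in_Cx (\<psi> t)"
    by (subst AE_restrict_space_iff) (auto intro: regular_in_Cx elim: eventually_mono)
  show "integrable (lebesgue_on {a..b}) (\<lambda>t. norm (Cx_rep (\<psi> t)) ^ 4)"
  proof (rule integrableI_bounded)
    show "(\<lambda>t. norm (Cx_rep (\<psi> t)) ^ 4) \<in> borel_measurable (lebesgue_on {a..b})"
      by (intro measurable_restrict_space1 borel_measurable_power norm_Cx_rep_measurable \<psi> regular)
    have "(\<integral>\<^sup>+ t. ennreal (norm (norm (Cx_rep (\<psi> t)) ^ 4)) \<partial>lebesgue_on {a..b}) =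
        (\<integral>\<^sup>+ t. ennreal (norm (Cx_rep (\<psi> t)) ^ 4) * indicator {a..b} t \<partial>lborel)"
      by (simp add: nn_integral_lebesgue_on)
    also have "\<dots> \<le> (\<integral>\<^sup>+ t. ennreal (norm (Cx_rep (\<psi> t)) ^ 4) \<partial>lborel)"
      by (intro nn_integral_mono) (auto simp: indicator_def)
    also note b
    finally show "(\<integral>\<^sup>+ t. ennreal (norm (norm (Cx_rep (\<psi> t)) ^ 4)) \<partial>lebesgue_on {a..b}) < \<infinity>" .
  qed
qed

lemma l2_scaleC_continuous:
  assumes "continuous_on S f" shows "continuous_on S (\<lambda>t. l2_scaleC c (f t))"
proof (rule continuous_on_compose2[OF _ assms subset_UNIV])
  show "continuous_on UNIV (l2_scaleC c)"
  proof (rule lipschitz_on_continuous_on)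
    show "(cmod c)-lipschitz_on UNIV (l2_scaleC c)"
      by (rule lipschitz_onI) (simp_all add: dist_norm norm_scaleC flip: l2_scaleC_diff)
  qed
qed

lemma trace_solution_imp_solution:
  assumes z: "trace_solution \<psi>\<^sub>0 z"
  shows "solution UNIV (flow \<psi>\<^sub>0 (\<lambda>s. cubic (z s)))"
proof -
  let ?c = "\<lambda>s. cubic (z s)"
  let ?\<psi> = "flow \<psi>\<^sub>0 ?c"
  have L4: "L4 z" by (rule trace_solution_L4(1)[OF z])
  have L: "L43 ?c" by (rule L43_cubic[OF L4])
  have l: "loc_admissible ?c" by (rule loc_admissible_L43[OF L])
  have cont: "continuous_on UNIV ?\<psi>"
    by (intro schroedinger_path_continuous continuous_intros l2_scaleC_continuous duhamel_continuous L4)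
  have bdd: "bounded (?\<psi> ` UNIV)"
  proof (rule boundedI)
    fix f assume "f \<in> ?\<psi> ` UNIV"
    then obtain t where t: "f = ?\<psi> t" by auto
    have "norm f \<le> norm \<psi>\<^sub>0 + norm (duhamel ?c t)"
      unfolding t using norm_triangle_ineq4[of \<psi>\<^sub>0 "l2_scaleC \<i> (duhamel ?c t)"] by (simp add: norm_scaleC)
    then show "norm f \<le> norm \<psi>\<^sub>0 + strichartz_K * root 4 (n43 ?c) ^ 3" using norm_duhamel_le[OF L, of t] by linarith
  qed
  have regular: "AE t in lborel. regular (?\<psi> t)" using duhamel_regular[OF l, of \<psi>\<^sub>0] by eventually_elim simp
  have fin: "(\<integral>\<^sup>+ t. ennreal (norm (Cx_rep (?\<psi> t)) ^ 4) \<partial>lborel) < \<infinity>"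
    by (rule le_less_trans[OF duhamel_L4_bound[OF L]]) simp
  have c0: "AE s in lborel. (let w = apply_bcontfun (Cx_rep (?\<psi> s)) 0 in complex_of_real ((cmod w)\<^sup>2) * w) = ?c s"
    using duhamel_regular[OF l, of \<psi>\<^sub>0] trace_solution_imp_trace_equation[OF z, unfolded trace_equation_def]
  proof eventually_elim
    case (elim s)
    then have "apply_bcontfun (Cx_rep (?\<psi> s)) 0 = z s" by (simp add: regular_Cx_rep)
    then show ?case by (simp only: Let_def cubic_def)
  qed
  have "\<exists>F. has_schroedinger_integral dirac (\<lambda>s. let w = apply_bcontfun (Cx_rep (?\<psi> s)) 0 in complex_of_real ((cmod w)\<^sup>2) * w) 0 t F
      \<and> ?\<psi> t = schroedinger (t - 0) (?\<psi> 0) - l2_scaleC \<i> (schroedinger t F)" for t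
    unfolding has_schroedinger_integral_iff[OF l c0] by (simp add: schroedinger_diff schroedinger_scaleC)
  then show ?thesis
    unfolding solution_def in_CL2_def in_L4Cx_loc_def using cont bdd in_L4CxI[OF cont regular fin] by blast
qed

lemma trace_solution_unique:
  assumes z: "trace_solution \<psi>\<^sub>0 z" and w: "trace_solution \<psi>\<^sub>0 w"
  shows "AE t in lborel. z t = w t"
proof -
  have "AE t in lborel. \<forall>n. t \<in> {0..<real n} \<longrightarrow> z t = w t"
    unfolding AE_all_countable using z w
    by (intro allI volterra_unique[where f="origin_trace \<psi>\<^sub>0"]) (auto simp: trace_solution_def)
  moreover have "AE t in lborel. \<forall>n. t \<in> {0..<real n} \<longrightarrow> rev_cnj z t = rev_cnj w t"
    unfolding AE_all_countable using z w
    by (intro allI volterra_unique[where f="rev_cnj (origin_trace \<psi>\<^sub>0)"]) (auto simp: trace_solution_def intro: rev_cnj_measurable)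
  note AE_lborel_reflect[OF this]
  ultimately show ?thesis
  proof eventually_elim
    case (elim t)
    obtain n where n: "\<bar>t\<bar> < real n" using reals_Archimedean2 by blast
    show ?case
      using elim(1)[rule_format, of n] elim(2)[rule_format, of n] n by (cases "t \<ge> 0") (auto simp: rev_cnj_def)
  qed
qed

lemma duhamel_cong_AE:
  assumes [measurable]: "c \<in> borel_measurable borel" "d \<in> borel_measurable borel" and e: "AE s in lborel. c s = d s"
  shows "duhamel c t = duhamel d t"
proof -
  have "AE s in lborel. restr (time_span t) c s = restr (time_span t) d s"
    using e by eventually_elim (simp add: restr_def)
  then have "source (restr (time_span t) c) = source (restr (time_span t) d)" by (intro source_cong_AE) measurable
  then show ?thesis by (simp add: duhamel_def)
qed

lemma solution_unique:
  assumes \<psi>: "solution UNIV \<psi>" and \<phi>: "solution UNIV \<phi>" and "\<psi> 0 = \<phi> 0"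
  shows "\<psi> = \<phi>"
proof
  fix t
  obtain z where z: "trace_solution (\<psi> 0) z" "\<And>t. \<psi> t = flow (\<psi> 0) (\<lambda>s. cubic (z s)) t"
    using solution_imp_trace_solution[OF \<psi>] by metis
  obtain w where w: "trace_solution (\<phi> 0) w" "\<And>t. \<phi> t = flow (\<phi> 0) (\<lambda>s. cubic (w s)) t"
    using solution_imp_trace_solution[OF \<phi>] by metis
  have [measurable]: "z \<in> borel_measurable borel" "w \<in> borel_measurable borel"
    using z(1) w(1) by (auto simp: trace_solution_def volterra_def)
  have "AE s in lborel. cubic (z s) = cubic (w s)"
    using trace_solution_unique[OF z(1) w(1)[folded assms(3)]] by eventually_elim simp
  then have "duhamel (\<lambda>s. cubic (z s)) t = duhamel (\<lambda>s. cubic (w s)) t" by (intro duhamel_cong_AE) measurable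
  then show "\<psi> t = \<phi> t" unfolding z(2)[of t] w(2)[of t] assms(3) by simp
qed

section \<open>Continuous dependence\<close>

lemma trace_diff: "AE t in lborel. origin_trace (\<phi> - \<psi>) t = origin_trace \<phi> t - origin_trace \<psi> t"
  using AE_regular_schroedinger[of \<phi>] AE_regular_schroedinger[of \<psi>]
proof eventually_elim
  case (elim t)
  note d = regular_diff[OF elim, folded schroedinger_diff]
  show ?case using regular_trace[OF d(1)] regular_trace[OF elim(1)] regular_trace[OF elim(2)] d(2) by simp
qed

lemma A4_half_line_le:
  assumes g: "L4 g" and b: "\<And>n::nat. A4 (restr {0..<real n} g) \<le> B" shows "A4 (restr {0..} g) \<le> B"
proof (rule L4_Fatou(2)[where u="\<lambda>n. restr {0..<real n} g"])
  show "AE t in lborel. (\<lambda>n. restr {0..<real n} g t) \<longlonglongrightarrow> restr {0..} g t"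
  proof (intro AE_I2 tendsto_eventually)
    fix t
    obtain k where k: "t < real k" using reals_Archimedean2 by blast
    show "\<forall>\<^sub>F n in sequentially. restr {0..<real n} g t = restr {0..} g t"
      using eventually_ge_at_top[of k]
    proof eventually_elim
      case (elim n)
      then have "t < real n" using k by (meson less_le_trans of_nat_mono)
      then show ?case by (auto simp: restr_def indicator_def)
    qed
  qed
qed (use g b in \<open>auto intro: L4_restr restr_measurable L4_measurable\<close>)

lemma A4_two_half_lines:
  assumes g: "L4 g" and b: "\<And>n::nat. A4 (restr {0..<real n} g) \<le> B" "\<And>n::nat. A4 (restr {0..<real n} (rev_cnj g)) \<le> B"
  shows "A4 g \<le> 2 * B"
proof -
  have m [measurable]: "g \<in> borel_measurable borel" by (rule L4_measurable[OF g])
  have [measurable]: "rev_cnj g \<in> borel_measurable borel" by (rule rev_cnj_measurable[OF m])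
  have r: "L4 (rev_cnj g)" by (rule A4_rev(1)[OF g])
  have "rev_cnj (restr {..<0} g) = restr {0<..} (rev_cnj g)"
    by (auto simp: rev_cnj_def restr_def fun_eq_iff indicator_def)
  then have "A4 (restr {..<0} g) = A4 (restr {0<..} (rev_cnj g))" using A4_rev(2)[of "restr {..<0} g"] by simp
  also have "\<dots> \<le> A4 (restr {0..} (rev_cnj g))"
    by (rule L4_mono(2)) (use r in \<open>auto simp: cmod_restr indicator_def intro: L4_restr\<close>)
  also have "\<dots> \<le> B" by (rule A4_half_line_le[OF r b(2)])
  finally have neg: "A4 (restr {..<0} g) \<le> B" .
  have i: "integrable lborel (\<lambda>t. cmod (restr S g t) ^ 4)" if "S \<in> sets borel" for S
    using L4_restr(1)[OF g that] by (simp add: L4_def)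
  have "A4 g = (LINT t|lborel. cmod (restr {0..} g t) ^ 4 + cmod (restr {..<0} g t) ^ 4)"
    unfolding A4_def by (intro Bochner_Integration.integral_cong) (auto simp: restr_def indicator_def)
  also have "\<dots> = A4 (restr {0..} g) + A4 (restr {..<0} g)"
    unfolding A4_def by (intro Bochner_Integration.integral_add i) auto
  finally show ?thesis using neg A4_half_line_le[OF g b(1)] by linarith
qed

text \<open>Stability on $[0,n)$ in both directions of time, with bounds that do not depend on $n$.\<close>

lemma trace_solution_stability:
  assumes z: "trace_solution \<psi>\<^sub>0 z" and w: "trace_solution \<phi>\<^sub>0 w" and l: "l > 0"
  shows "A4 (\<lambda>t. z t - w t) \<le> 72 * l * (A4 z + A4 w) + 36 / l * (strichartz_K * norm (\<psi>\<^sub>0 - \<phi>\<^sub>0)) ^ 4"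
proof -
  note L = trace_solution_L4(1)[OF z] trace_solution_L4(1)[OF w]
  let ?f = "origin_trace \<psi>\<^sub>0" and ?g = "origin_trace \<phi>\<^sub>0"
  let ?D = "(strichartz_K * norm (\<psi>\<^sub>0 - \<phi>\<^sub>0)) ^ 4"
  have F: "L4 (\<lambda>t. ?f t - ?g t)" by (intro L4_diff L4_trace)
  have "A4 (\<lambda>t. ?f t - ?g t) = A4 (origin_trace (\<psi>\<^sub>0 - \<phi>\<^sub>0))"
    by (rule A4_cong_AE) (use trace_diff[of \<psi>\<^sub>0 \<phi>\<^sub>0] in \<open>auto elim: eventually_mono\<close>)
  then have FD: "A4 (\<lambda>t. ?f t - ?g t) \<le> ?D" using L4_trace(2)[of "\<psi>\<^sub>0 - \<phi>\<^sub>0"] by simp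
  have main: "A4 (restr {0..<real n} (\<lambda>t. a t - b t)) \<le> 36 * l * (A4 z + A4 w) + 18 / l * ?D"
    if v: "volterra (real n) f a" "volterra (real n) g b" and ab: "L4 a" "A4 a = A4 z" "L4 b" "A4 b = A4 w"
      and fg: "L4 (\<lambda>t. f t - g t)" "A4 (\<lambda>t. f t - g t) \<le> ?D" "f \<in> borel_measurable borel" "g \<in> borel_measurable borel"
    for a b f g and n :: nat
  proof -
    have "A4 (restr {0..<real n} (\<lambda>t. a t - b t)) \<le> 36 * l * (A4 (restr {0..<real n} a) + A4 (restr {0..<real n} b))
        + 18 / l * A4 (restr {0..<real n} (\<lambda>t. f t - g t))"
      by (rule volterra_stability[OF v L4_restr(1)[OF fg(1)] fg(3,4) l]) simp
    also have "\<dots> \<le> 36 * l * (A4 z + A4 w) + 18 / l * ?D"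
    proof (intro add_mono mult_left_mono)
      show "A4 (restr {0..<real n} a) \<le> A4 z" "A4 (restr {0..<real n} b) \<le> A4 w"
        using L4_restr(2)[OF ab(1), of "{0..<real n}"] L4_restr(2)[OF ab(3), of "{0..<real n}"] ab by simp_all
      show "A4 (restr {0..<real n} (\<lambda>t. f t - g t)) \<le> ?D"
        using L4_restr(2)[OF fg(1), of "{0..<real n}"] fg(2) by simp
    qed (use l in auto)
    finally show ?thesis .
  qed
  have rev_diff: "rev_cnj (\<lambda>t. p t - q t) = (\<lambda>t. rev_cnj p t - rev_cnj q t)" for p q
    by (simp add: rev_cnj_def fun_eq_iff)
  have "A4 (\<lambda>t. z t - w t) \<le> 2 * (36 * l * (A4 z + A4 w) + 18 / l * ?D)"
  proof (rule A4_two_half_lines)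
    show "L4 (\<lambda>t. z t - w t)" by (intro L4_diff L)
    fix n :: nat
    show "A4 (restr {0..<real n} (\<lambda>t. z t - w t)) \<le> 36 * l * (A4 z + A4 w) + 18 / l * ?D"
      by (rule main[of n ?f z ?g w]) (use z w L F FD in \<open>auto simp: trace_solution_def\<close>)
    show "A4 (restr {0..<real n} (rev_cnj (\<lambda>t. z t - w t))) \<le> 36 * l * (A4 z + A4 w) + 18 / l * ?D"
      unfolding rev_diff
      by (rule main[of n "rev_cnj ?f" "rev_cnj z" "rev_cnj ?g" "rev_cnj w"])
         (use z w L F FD in \<open>auto simp: trace_solution_def A4_rev simp flip: rev_diff intro: rev_cnj_measurable\<close>)
  qed
  then show ?thesis by (simp add: algebra_simps)
qed

text \<open>The traces stay bounded in $L^4$, so their differences tend to zero with the distance of the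
  data, and the nonlinearity is locally Lipschitz.\<close>

lemma trace_solution_LIMSEQ:
  assumes zs: "\<And>n. trace_solution (f n) (zs n)" and z: "trace_solution g z" and lim: "f \<longlonglongrightarrow> g"
  shows "(\<lambda>n. n43 (\<lambda>s. cubic (zs n s) - cubic (z s)) ^ 3) \<longlonglongrightarrow> 0"
proof -
  define d where "d n = strichartz_K * norm (f n - g)" for n
  have d0: "d \<longlonglongrightarrow> 0"
  proof -
    have "(\<lambda>n. norm (f n - g)) \<longlonglongrightarrow> 0" using lim by (simp add: tendsto_norm_zero_iff LIM_zero_iff)
    from tendsto_mult_left[OF this, of strichartz_K] show ?thesis by (simp add: d_def[abs_def])
  qed
  obtain B where B: "\<And>n. norm (f n) \<le> B"
    using convergent_imp_Bseq[OF convergentI[OF lim]] unfolding Bseq_def by auto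
  define M where "M = 5184 * (strichartz_K * B) ^ 4 + A4 z"
  have M: "A4 (zs n) + A4 z \<le> M" for n
  proof -
    have "A4 (zs n) \<le> 5184 * (strichartz_K * norm (f n)) ^ 4" by (rule trace_solution_L4(2)[OF zs])
    also have "\<dots> \<le> 5184 * (strichartz_K * B) ^ 4"
      using B[of n] strichartz_K_pos by (intro mult_left_mono power_mono) auto
    finally show ?thesis by (simp add: M_def)
  qed
  \<comment> \<open>The free parameter is taken comparable to the square of the distance of the data.\<close>
  define l where "l n = (d n)\<^sup>2 + inverse (real (Suc n))" for n
  have l: "l n > 0" for n by (simp add: l_def add_nonneg_pos)
  have bound: "A4 (\<lambda>t. zs n t - z t) \<le> 72 * l n * M + 36 * (d n)\<^sup>2" for n
  proof -
    have "(d n) ^ 4 / l n \<le> (d n)\<^sup>2"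
    proof -
      have "(d n) ^ 4 = (d n)\<^sup>2 * (d n)\<^sup>2" by (simp flip: power_add)
      also have "\<dots> \<le> (d n)\<^sup>2 * l n" by (intro mult_left_mono) (auto simp: l_def)
      finally show ?thesis using l[of n] by (simp add: pos_divide_le_eq)
    qed
    then have "36 / l n * (d n) ^ 4 \<le> 36 * (d n)\<^sup>2" by simp
    moreover have "72 * l n * (A4 (zs n) + A4 z) \<le> 72 * l n * M" using M l[of n] by (intro mult_left_mono) auto
    ultimately show ?thesis using trace_solution_stability[OF zs[of n] z l[of n]] unfolding d_def[symmetric] by linarith
  qed
  have "(\<lambda>n. 72 * l n * M + 36 * (d n)\<^sup>2) \<longlonglongrightarrow> 72 * (0\<^sup>2 + 0) * M + 36 * 0\<^sup>2"
    unfolding l_def by (intro tendsto_add tendsto_mult tendsto_power tendsto_const d0 LIMSEQ_inverse_real_of_nat)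
  then have "(\<lambda>n. 72 * l n * M + 36 * (d n)\<^sup>2) \<longlonglongrightarrow> 0" by simp
  from tendsto_mult_left[OF this, of "2 ^ 12 * M\<^sup>2"]
  have lim0: "(\<lambda>n. 2 ^ 12 * M\<^sup>2 * (72 * l n * M + 36 * (d n)\<^sup>2)) \<longlonglongrightarrow> 0" by simp
  have "n43 (\<lambda>s. cubic (zs n s) - cubic (z s)) ^ 3 \<le> 2 ^ 12 * M\<^sup>2 * (72 * l n * M + 36 * (d n)\<^sup>2)" for n
  proof -
    have "n43 (\<lambda>s. cubic (zs n s) - cubic (z s)) ^ 3 \<le> 2 ^ 12 * (A4 (zs n) + A4 z)\<^sup>2 * A4 (\<lambda>t. zs n t - z t)"
      by (rule n43_cubic_diff(2)[OF trace_solution_L4(1)[OF zs] trace_solution_L4(1)[OF z]])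
    also have "\<dots> \<le> 2 ^ 12 * M\<^sup>2 * (72 * l n * M + 36 * (d n)\<^sup>2)"
      by (intro mult_mono bound mult_left_mono power_mono M) auto
    finally show ?thesis .
  qed
  then show ?thesis
    by (intro tendsto_sandwich[OF _ _ tendsto_const lim0] always_eventually allI) auto
qed

text \<open>The difference of two solutions is again a free evolution with a source, so the linear estimates
  apply to it.\<close>

lemma flow_diff:
  assumes "loc_admissible c" "loc_admissible d"
  shows "flow \<psi>\<^sub>0 c t - flow \<phi>\<^sub>0 d t = flow (\<psi>\<^sub>0 - \<phi>\<^sub>0) (\<lambda>s. c s - d s) t"
  unfolding duhamel_diff[OF assms] by (simp add: l2_scaleC_diff algebra_simps flip: schroedinger_diff)

text \<open>Both norms are controlled, uniformly in time, by the distance of the data and the $L^{4/3}$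
  distance of the nonlinearities.\<close>

lemma continuous_dependence:
  assumes \<psi>s: "\<And>n. solution UNIV (\<psi>s n)" and \<psi>: "solution UNIV \<psi>" and lim: "(\<lambda>n. \<psi>s n 0) \<longlonglongrightarrow> \<psi> 0" and T: "T > 0"
  shows "(\<lambda>n. CL2_norm {-T..T} (\<lambda>t. \<psi>s n t - \<psi> t)) \<longlonglongrightarrow> 0"
    and "(\<lambda>n. L4Cx_norm {-T..T} (\<lambda>t. \<psi>s n t - \<psi> t)) \<longlonglongrightarrow> 0"
proof -
  obtain z where z: "trace_solution (\<psi> 0) z" "\<And>t. \<psi> t = flow (\<psi> 0) (\<lambda>s. cubic (z s)) t"
    using solution_imp_trace_solution[OF \<psi>] by metis
  have "\<exists>z. trace_solution (\<psi>s n 0) z \<and> (\<forall>t. \<psi>s n t = flow (\<psi>s n 0) (\<lambda>s. cubic (z s)) t)" for n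
    using solution_imp_trace_solution[OF \<psi>s[of n]] by metis
  then obtain zs where zs: "\<And>n. trace_solution (\<psi>s n 0) (zs n)" "\<And>n t. \<psi>s n t = flow (\<psi>s n 0) (\<lambda>s. cubic (zs n s)) t"
    by metis
  define h where "h n = (\<lambda>s. cubic (zs n s) - cubic (z s))" for n
  define \<delta> where "\<delta> n = \<psi>s n 0 - \<psi> 0" for n
  have Lh: "L43 (h n)" for n
    unfolding h_def by (rule n43_cubic_diff(1)[OF trace_solution_L4(1)[OF zs(1)] trace_solution_L4(1)[OF z(1)]])
  have diff: "\<psi>s n t - \<psi> t = flow (\<delta> n) (h n) t" for n t
    unfolding zs(2)[of n t] z(2)[of t] h_def \<delta>_def
    by (intro flow_diff loc_admissible_L43 L43_cubic trace_solution_L4(1)[OF zs(1)] trace_solution_L4(1)[OF z(1)])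
  have h0: "(\<lambda>n. n43 (h n) ^ 3) \<longlonglongrightarrow> 0" unfolding h_def by (rule trace_solution_LIMSEQ[OF zs(1) z(1) lim])
  have \<delta>0: "(\<lambda>n. norm (\<delta> n)) \<longlonglongrightarrow> 0" using lim by (simp add: \<delta>_def tendsto_norm_zero_iff LIM_zero_iff)
  have rh: "(\<lambda>n. root 4 (n43 (h n)) ^ 3) \<longlonglongrightarrow> 0"
    using tendsto_real_root[OF h0, of 4] by (simp add: real_root_power)

  define e where "e n = norm (\<delta> n) + strichartz_K * root 4 (n43 (h n)) ^ 3" for n
  have e0: "e \<longlonglongrightarrow> 0"
    using tendsto_add[OF \<delta>0 tendsto_mult_left[OF rh, of strichartz_K]] by (simp add: e_def[abs_def])
  have e: "norm (\<psi>s n t - \<psi> t) \<le> e n" for n t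
    unfolding diff using norm_triangle_ineq4[of "\<delta> n" "l2_scaleC \<i> (duhamel (h n) t)"] norm_duhamel_le[OF Lh, of n t]
    by (simp add: norm_scaleC e_def)
  show "(\<lambda>n. CL2_norm {-T..T} (\<lambda>t. \<psi>s n t - \<psi> t)) \<longlonglongrightarrow> 0"
  proof (rule tendsto_sandwich[OF _ _ tendsto_const e0])
    show "\<forall>\<^sub>F n in sequentially. CL2_norm {-T..T} (\<lambda>t. \<psi>s n t - \<psi> t) \<le> e n"
      unfolding CL2_norm_def using T e by (intro always_eventually allI cSUP_least) auto
    show "\<forall>\<^sub>F n in sequentially. 0 \<le> CL2_norm {-T..T} (\<lambda>t. \<psi>s n t - \<psi> t)"
    proof (intro always_eventually allI)
      fix n
      have "norm (\<psi>s n 0 - \<psi> 0) \<le> CL2_norm {-T..T} (\<lambda>t. \<psi>s n t - \<psi> t)"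
        unfolding CL2_norm_def using T e[of n] by (intro cSUP_upper bdd_aboveI2[of _ _ "e n"]) auto
      then show "0 \<le> CL2_norm {-T..T} (\<lambda>t. \<psi>s n t - \<psi> t)" by (rule order_trans[OF norm_ge_zero])
    qed
  qed

  define b where "b n = 8 * (strichartz_K * norm (\<delta> n)) ^ 4 + 8 * (14 ^ 4 * n43 (h n) ^ 3)" for n
  have "b \<longlonglongrightarrow> 8 * (strichartz_K * 0) ^ 4 + 8 * (14 ^ 4 * 0)"
    unfolding b_def by (intro tendsto_add tendsto_mult tendsto_power tendsto_const \<delta>0 h0)
  from tendsto_real_root[OF this, of 4] have b0: "(\<lambda>n. root 4 (b n)) \<longlonglongrightarrow> 0" by simp
  have b: "(LINT t|lebesgue_on {-T..T}. norm (Cx_rep (\<psi>s n t - \<psi> t)) ^ 4) \<le> b n" for n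
  proof -
    have bn: "b n \<ge> 0" by (simp add: b_def)
    have "ennreal (norm (LINT t|lebesgue_on {-T..T}. norm (Cx_rep (\<psi>s n t - \<psi> t)) ^ 4)) \<le>
        (\<integral>\<^sup>+ t. ennreal (norm (norm (Cx_rep (\<psi>s n t - \<psi> t)) ^ 4)) \<partial>lebesgue_on {-T..T})"
      by (rule ennreal_norm_integral_le)
    also have "\<dots> = (\<integral>\<^sup>+ t. ennreal (norm (Cx_rep (\<psi>s n t - \<psi> t)) ^ 4) * indicator {-T..T} t \<partial>lborel)"
      by (simp add: nn_integral_lebesgue_on)
    also have "\<dots> \<le> (\<integral>\<^sup>+ t. ennreal (norm (Cx_rep (\<psi>s n t - \<psi> t)) ^ 4) \<partial>lborel)"
      by (intro nn_integral_mono) (auto simp: indicator_def)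
    also have "\<dots> \<le> ennreal (b n)" unfolding diff b_def by (rule duhamel_L4_bound[OF Lh])
    finally show ?thesis using bn by (simp add: ennreal_le_iff)
  qed
  show "(\<lambda>n. L4Cx_norm {-T..T} (\<lambda>t. \<psi>s n t - \<psi> t)) \<longlonglongrightarrow> 0"
  proof (rule tendsto_sandwich[OF _ _ tendsto_const b0])
    show "\<forall>\<^sub>F n in sequentially. L4Cx_norm {-T..T} (\<lambda>t. \<psi>s n t - \<psi> t) \<le> root 4 (b n)"
      unfolding L4Cx_norm_def using b by (intro always_eventually allI real_root_le_mono) auto
    show "\<forall>\<^sub>F n in sequentially. 0 \<le> L4Cx_norm {-T..T} (\<lambda>t. \<psi>s n t - \<psi> t)"
      unfolding L4Cx_norm_def by (intro always_eventually allI real_root_ge_zero integral_nonneg_AE) auto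
  qed
qed

section \<open>Scattering\<close>

text \<open>Increments are bounded by the norm of the trace on the remaining half line, which tends to zero.
  The sign \<open>\<sigma>\<close> selects the direction of time.\<close>

lemma duhamel_converges:
  assumes z: "L4 z" and \<sigma>: "\<sigma> = 1 \<or> \<sigma> = -1"
  obtains L where "((\<lambda>t. duhamel (\<lambda>s. cubic (z s)) (\<sigma> * t)) \<longlongrightarrow> L) at_top"
proof -
  let ?F = "\<lambda>t. duhamel (\<lambda>s. cubic (z s)) (\<sigma> * t)"
  define S where "S t = {x. t \<le> \<sigma> * x}" for t
  define r where "r t = strichartz_K * root 4 (A4 (restr (S t) z)) ^ 3" for t
  have S: "S t \<in> sets borel" for t
    unfolding S_def by (intro borel_closed closed_Collect_le continuous_intros)
  have inc: "norm (?F s - ?F t) \<le> r t" if "t \<le> s" for s t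
  proof (cases "\<sigma> = 1")
    case True
    have "{t..<s} \<subseteq> S t" using True by (auto simp: S_def)
    then show ?thesis using norm_duhamel_increment_le[OF z that _ S] True by (simp add: r_def)
  next
    case False
    then have "{- s..<- t} \<subseteq> S t" using \<sigma> by (auto simp: S_def)
    then have "norm (duhamel (\<lambda>s. cubic (z s)) (- t) - duhamel (\<lambda>s. cubic (z s)) (- s)) \<le> r t"
      unfolding r_def by (intro norm_duhamel_increment_le z S) (use that in auto)
    then show ?thesis using False \<sigma> by (auto simp: norm_minus_commute)
  qed
  have r0: "(\<lambda>n. r (X n)) \<longlonglongrightarrow> 0" if X: "filterlim X at_top sequentially" for X :: "nat \<Rightarrow> real"
  proof -
    have A: "(\<lambda>n. A4 (restr (S (X n)) z)) \<longlonglongrightarrow> 0"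
    proof (rule L4_shrinking[OF z S AE_I2])
      fix s
      have "\<forall>\<^sub>F n in sequentially. \<sigma> * s < X n" using X by (simp add: filterlim_at_top_dense)
      then show "\<forall>\<^sub>F n in sequentially. s \<notin> S (X n)" by eventually_elim (simp add: S_def)
    qed
    have "(\<lambda>n. strichartz_K * root 4 (A4 (restr (S (X n)) z)) ^ 3) \<longlonglongrightarrow> strichartz_K * root 4 0 ^ 3"
      by (intro tendsto_mult tendsto_power tendsto_const tendsto_real_root A)
    then show ?thesis by (simp add: r_def)
  qed
  have rn: "(\<lambda>n. r (real n)) \<longlonglongrightarrow> 0" by (rule r0[OF filterlim_real_sequentially])
  have "Cauchy (\<lambda>n. ?F (real n))"
  proof (rule metric_CauchyI)
    fix e :: real assume "e > 0"
    then obtain N where N: "\<And>n. n \<ge> N \<Longrightarrow> r (real n) < e / 2"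
      using order_tendstoD(2)[OF rn, of "e / 2"] by (auto simp: eventually_sequentially)
    have "dist (?F (real m)) (?F (real n)) < e" if "m \<ge> N" "n \<ge> N" for m n
    proof -
      have "dist (?F (real m)) (?F (real N)) < e / 2" "dist (?F (real n)) (?F (real N)) < e / 2"
        using inc[of "real N" "real m"] inc[of "real N" "real n"] N[of N] that by (simp_all add: dist_norm)
      then show ?thesis using dist_triangle_half_l[of "?F (real m)" "?F (real N)" e "?F (real n)"] by (simp add: dist_commute)
    qed
    then show "\<exists>M. \<forall>m\<ge>M. \<forall>n\<ge>M. dist (?F (real m)) (?F (real n)) < e" by blast
  qed
  then obtain L where L: "(\<lambda>n. ?F (real n)) \<longlonglongrightarrow> L" using Cauchy_convergent convergent_def by blast
  have lim: "norm (?F t - L) \<le> r t" for t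
  proof (rule tendsto_le[OF _ tendsto_const tendsto_norm[OF tendsto_diff[OF tendsto_const L]]])
    obtain k where "t \<le> real k" using real_arch_simple by blast
    then show "\<forall>\<^sub>F n in sequentially. norm (?F t - ?F (real n)) \<le> r t"
      by (intro eventually_sequentiallyI[of k]) (use inc in \<open>force simp: norm_minus_commute\<close>)
  qed simp
  have "(?F \<longlongrightarrow> L) at_top"
  proof (rule tendsto_at_topI_sequentially)
    fix X :: "nat \<Rightarrow> real" assume "filterlim X at_top sequentially"
    then have "(\<lambda>n. r (X n)) \<longlonglongrightarrow> 0" by (rule r0)
    then have "(\<lambda>n. ?F (X n) - L) \<longlonglongrightarrow> 0"
      by (rule Lim_null_comparison[rotated]) (intro always_eventually allI lim)
    then show "(\<lambda>n. ?F (X n)) \<longlonglongrightarrow> L" by (simp add: LIM_zero_iff)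
  qed
  then show ?thesis by (rule that)
qed

text \<open>The group is isometric, so scattering is convergence of the Duhamel path.\<close>

lemma norm_flow_asymptotic:
  "norm (flow \<psi>\<^sub>0 c t - schroedinger t (\<psi>\<^sub>0 - l2_scaleC \<i> L)) = norm (duhamel c t - L)"
proof -
  have "flow \<psi>\<^sub>0 c t - schroedinger t (\<psi>\<^sub>0 - l2_scaleC \<i> L) = schroedinger t (l2_scaleC \<i> (L - duhamel c t))"
    by (simp add: l2_scaleC_diff flip: schroedinger_diff)
  then show ?thesis by (simp add: norm_scaleC norm_minus_commute)
qed

lemma scattering:
  assumes "solution UNIV \<psi>"
  shows "\<exists>\<psi>p \<psi>m. ((\<lambda>t. norm (\<psi> t - schroedinger t \<psi>p)) \<longlongrightarrow> 0) at_top \<and>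
          ((\<lambda>t. norm (\<psi> t - schroedinger t \<psi>m)) \<longlongrightarrow> 0) at_bot"
proof -
  obtain z where z: "trace_solution (\<psi> 0) z" "\<And>t. \<psi> t = flow (\<psi> 0) (\<lambda>s. cubic (z s)) t"
    using solution_imp_trace_solution[OF assms] by metis
  note L4 = trace_solution_L4(1)[OF z(1)]
  let ?c = "\<lambda>s. cubic (z s)"
  have n: "norm (\<psi> t - schroedinger t (\<psi> 0 - l2_scaleC \<i> L)) = norm (duhamel ?c t - L)" for t L
    unfolding z(2)[of t] by (rule norm_flow_asymptotic)
  obtain Lp where "((\<lambda>t. duhamel ?c (1 * t)) \<longlongrightarrow> Lp) at_top" using duhamel_converges[OF L4, of 1] by blast
  then have "((\<lambda>t. norm (\<psi> t - schroedinger t (\<psi> 0 - l2_scaleC \<i> Lp))) \<longlongrightarrow> 0) at_top"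
    unfolding n by (simp add: tendsto_norm_zero_iff LIM_zero_iff)
  moreover obtain Lm where "((\<lambda>t. duhamel ?c (-1 * t)) \<longlongrightarrow> Lm) at_top" using duhamel_converges[OF L4, of "-1"] by blast
  then have "((\<lambda>t. norm (\<psi> t - schroedinger t (\<psi> 0 - l2_scaleC \<i> Lm))) \<longlongrightarrow> 0) at_bot"
    unfolding n filterlim_at_bot_mirror by (simp add: tendsto_norm_zero_iff LIM_zero_iff)
  ultimately show ?thesis by blast
qed

lemma spacetime_bound:
  assumes "solution UNIV \<psi>"
  shows "(\<integral>\<^sup>+ t. ennreal (cmod (apply_bcontfun (Cx_rep (\<psi> t)) 0) ^ 4) \<partial>lebesgue) \<le>
    ennreal (5184 * strichartz_K ^ 4 * norm (\<psi> 0) ^ 4)"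
proof -
  obtain z where z: "trace_solution (\<psi> 0) z" "AE t in lborel. apply_bcontfun (Cx_rep (\<psi> t)) 0 = z t"
    using solution_imp_trace_solution[OF assms] by metis
  have "(\<integral>\<^sup>+ t. ennreal (cmod (apply_bcontfun (Cx_rep (\<psi> t)) 0) ^ 4) \<partial>lebesgue) = int4 z"
    unfolding nn_integral_completion by (rule nn_integral_cong_AE, use z(2) in eventually_elim) simp
  also have "\<dots> = ennreal (A4 z)" by (rule ennreal_A4[OF trace_solution_L4(1)[OF z(1)]])
  also have "\<dots> \<le> ennreal (5184 * strichartz_K ^ 4 * norm (\<psi> 0) ^ 4)"
    using trace_solution_L4(2)[OF z(1)] by (intro ennreal_leI) (simp add: power_mult_distrib mult.assoc)
  finally show ?thesis .
qed

theorem theorem1p1: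
  shows "globally_well_posed \<and>
    (\<exists>C>0. \<forall>\<psi>. solution UNIV \<psi> \<longrightarrow>
       (\<integral>\<^sup>+ t. ennreal (cmod (apply_bcontfun (Cx_rep (\<psi> t)) 0) ^ 4) \<partial>lebesgue)
         \<le> ennreal (C * norm (\<psi> 0) ^ 4)) \<and>
    (\<forall>\<psi>. solution UNIV \<psi> \<longrightarrow>
       (\<exists>\<psi>p \<psi>m.
          ((\<lambda>t. norm (\<psi> t - schroedinger t \<psi>p)) \<longlongrightarrow> 0) at_top \<and>
          ((\<lambda>t. norm (\<psi> t - schroedinger t \<psi>m)) \<longlongrightarrow> 0) at_bot))"
proof (intro conjI)
  have "\<exists>!\<psi>. solution UNIV \<psi> \<and> \<psi> 0 = \<psi>\<^sub>0" for \<psi>\<^sub>0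
  proof (rule ex_ex1I)
    obtain z where z: "trace_solution \<psi>\<^sub>0 z" using trace_solution_exists by blast
    show "\<exists>\<psi>. solution UNIV \<psi> \<and> \<psi> 0 = \<psi>\<^sub>0"
      by (rule exI[of _ "flow \<psi>\<^sub>0 (\<lambda>s. cubic (z s))"]) (simp add: trace_solution_imp_solution[OF z])
    show "\<psi> = \<phi>" if "solution UNIV \<psi> \<and> \<psi> 0 = \<psi>\<^sub>0" "solution UNIV \<phi> \<and> \<phi> 0 = \<psi>\<^sub>0" for \<psi> \<phi>
      using that solution_unique by metis
  qed
  then show globally_well_posed
    unfolding globally_well_posed_def using continuous_dependence by blast
  have "0 < 5184 * strichartz_K ^ 4" using strichartz_K_pos by simp
  then show "\<exists>C>0. \<forall>\<psi>. solution UNIV \<psi> \<longrightarrow>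
       (\<integral>\<^sup>+ t. ennreal (cmod (apply_bcontfun (Cx_rep (\<psi> t)) 0) ^ 4) \<partial>lebesgue)
         \<le> ennreal (C * norm (\<psi> 0) ^ 4)"
    using spacetime_bound by blast
qed (use scattering in blast)

end
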